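(* Let $\delta\in(0,1]$ and $\theta\in\big[0,\frac{\delta}{i(\rho)+1}\big)$. Assume that $b\in\mathrm{BMO}^{\log}_{\rho,\theta}(\mathcal X)$ and that $T$ is a $(\delta,\rho)$-Calderón–Zygmund operator satisfying $T1\in\mathrm{BMO}^{\log}_\rho(\mathcal X)$. Then the commutator $[b,T]$ is bounded on $\mathrm{BMO}_\rho(\mathcal X)$.
   Context: **Space.** $(\mathcal X,d,\mu)$ is a space of homogeneous type: $d:\mathcal X\times\mathcal X\to[0,\infty)$ is symmetric, $d(x,y)>0$ iff $x\neq y$, and $d(x,z)\le\kappa(d(x,y)+d(y,z))$ for some constant $\kappa\ge1$; $\mu$ is a regular Borel measure for which there is $C>1$ with $\mu(B(x,2r))\le C\mu(B(x,r))$ for all $x\in\mathcal X$, $r>0$, where $B(x,r)$ is the $d$-ball with center $x$ and radius $r$ (balls have positive finite measure). It is also assumed that there exist $\alpha_0\in(0,1]$ and $C>0$ with $|d(x,z)-d(y,z)|\le C(d(x,z)+d(y,z))^{1-\alpha_0}d(x,y)^{\alpha_0}$ for all $x,y,z$. **Admissible function.** $\rho:\mathcal X\to(0,\infty)$ is a fixed admissible function: there exist $k_0,c_0>0$ such that $\frac1{\rho(x)}\le\frac{c_0}{\rho(y)}\big(1+\frac{d(x,y)}{\rho(y)}\big)^{k_0}$ for all $x,y\in\mathcal X$. Its admissibility index $i(\rho)$ is the infimum of all $k_0>0$ for which this holds with some $c_0=c_0(k_0)>0$. **Hardy space.** For $q\in(1,\infty]$, an $(H^1_\rho,q)$-atom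 related to a ball $B=B(x_0,r)$ with $0<r<\rho(x_0)$ is a measurable function $\mathfrak a$ with $\operatorname{supp}\mathfrak a\subset B$, $\|\mathfrak a\|_{L^q}\le\mu(B)^{1/q-1}$, and, if $0<r<\rho(x_0)/4$, $\int\mathfrak a\,d\mu=0$. $H^1_\rho(\mathcal X)$ is the space of $f\in L^1(\mathcal X)$ of the form $f=\sum_{j\ge1}\lambda_j\mathfrak a_j$ in $L^1$ with $(H^1_\rho,q)$-atoms $\mathfrak a_j$ and $(\lambda_j)\in\ell^1$, with norm the infimum of $\sum|\lambda_j|$ over such decompositions; the space does not depend on $q\in(1,\infty]$, up to equivalent norms. **BMO.** $f_B=\frac1{\mu(B)}\int_Bf\,d\mu$, $\mathrm{MO}(f,B)=\frac1{\mu(B)}\int_B|f-f_B|\,d\mu$. For $\theta\ge0$, $\mathrm{BMO}^{\log}_{\rho,\theta}(\mathcal X)$ is the set of $f\in L^1_{\rm loc}(\mathcal X)$ with $\|f\|_{\mathrm{BMO}^{\log}_{\rho,\theta}}=\sup_{B=B(x_0,r)}\log\big(e+\frac{\rho(x_0)}r\big)\big(1+\frac r{\rho(x_0)}\big)^{-\theta}\mathrm{MO}(f,B)<\infty$; $\mathrm{BMO}^{\log}_\rho:=\mathrm{BMO}^{\log}_{\rho,0}$. $\mathrm{BMO}(\mathcal X)$ is the usual space with $\|f\|_{\mathrm{BMO}}=\sup_B\mathrm{MO}(f,B)$. $\mathrm{BMO}_\rho(\mathcal X)$ is the set of $f\in\mathrm{BMO}(\mathcal X)$ with $\|f\|_{\mathrm{BMO}_\rho}=\|f\|_{\mathrm{BMO}}+\sup|f|_B<\infty$,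 the supremum over balls $B=B(x_0,r)$ with $r\ge\rho(x_0)$; it is the dual of $H^1_\rho(\mathcal X)$. **$(\delta,\rho)$-Calderón–Zygmund operators.** For $\delta\in(0,1]$, a linear operator $T$ bounded on $L^2(\mathcal X)$ with kernel $K(x,y)$ (i.e. $Tf(x)=\int K(x,y)f(y)\,d\mu(y)$ for $x\notin\operatorname{supp}f$, $f$ bounded with bounded support) is a $(\delta,\rho)$-Calderón–Zygmund operator if for each $N>0$ there is $C=C(N)>0$ with $$|K(x,y)|\le\frac{C}{\mu(B(x,d(x,y)))}\Big(1+\frac{d(x,y)}{\rho(x)}\Big)^{-N}\quad\text{for all }x\ne y,$$ and there is $C>0$ with $$|K(x,y)-K(x',y)|+|K(y,x)-K(y,x')|\le\Big[\frac{d(x,x')}{d(x,y)}\Big]^\delta\frac{C}{\mu(B(x,d(x,y)))}$$ whenever $d(x,x')\le\frac1{2\kappa}d(x,y)$. $T^*$ denotes the adjoint of $T$, with kernel $K(y,x)$; $T$ and $T^*$ are bounded from $H^1_\rho(\mathcal X)$ to $L^1(\mathcal X)$. $T1\in\mathrm{BMO}_\rho(\mathcal X)$ is the element of the dual of $H^1_\rho(\mathcal X)$ determined by $\int(T1)\,\mathfrak a\,d\mu=\int T^*\mathfrak a\,d\mu$ for all atoms $\mathfrak a$ of $H^1_\rho(\mathcal X)$. **Commutator.** $[b,T](f)=bTf-T(bf)$ for suitable $f$; on $\mathrm{BMO}_\rho(\mathcal X)$ it is understood through the duality between $H^1_\rho(\mathcal X)$ and $\mathrm{BMO}_\rho(\mathcal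 X)$, as minus the adjoint of $[b,T^*]$. *)

theory Defs
  imports "HOL-Probability.Essential_Supremum"
begin

section \<open>Spaces of homogeneous type\<close>

definition qball :: "('a \<Rightarrow> 'a \<Rightarrow> real) \<Rightarrow> 'a \<Rightarrow> real \<Rightarrow> 'a set" where
  "qball d x r = {y. d x y < r}"

definition qopen :: "('a \<Rightarrow> 'a \<Rightarrow> real) \<Rightarrow> 'a set \<Rightarrow> bool" where
  "qopen d U \<longleftrightarrow> (\<forall>x\<in>U. \<exists>r>0. qball d x r \<subseteq> U)"

definition qtopology :: "('a \<Rightarrow> 'a \<Rightarrow> real) \<Rightarrow> 'a topology" where
  "qtopology d = topology (qopen d)"

lemma istopology_qopen: "istopology (qopen d)"
  unfolding istopology_def
proof (intro conjI allI impI)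
  fix S T assume "qopen d S" "qopen d T"
  show "qopen d (S \<inter> T)"
    unfolding qopen_def
  proof
    fix x assume "x \<in> S \<inter> T"
    then obtain r s where "r > 0" "qball d x r \<subseteq> S" "s > 0" "qball d x s \<subseteq> T"
      using \<open>qopen d S\<close> \<open>qopen d T\<close> unfolding qopen_def by blast
    then have "min r s > 0 \<and> qball d x (min r s) \<subseteq> S \<inter> T"
      unfolding qball_def by auto
    then show "\<exists>r>0. qball d x r \<subseteq> S \<inter> T" by blast
  qed
next
  fix \<K> assume K: "\<forall>S\<in>\<K>. qopen d S"
  show "qopen d (\<Union>\<K>)"
    unfolding qopen_def
  proof
    fix x assume "x \<in> \<Union>\<K>"
    then obtain S where S: "S \<in> \<K>" "x \<in> S" by blast
    then obtain r where "r > 0" "qball d x r \<subseteq> S"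
      using K unfolding qopen_def by blast
    then show "\<exists>r>0. qball d x r \<subseteq> \<Union>\<K>" using S by blast
  qed
qed

lemma openin_qtopology: "openin (qtopology d) U \<longleftrightarrow> qopen d U"
  unfolding qtopology_def by (simp add: topology_inverse' istopology_qopen)

text \<open>The underlying set is the whole type. Regularity is outer regularity by open sets together
  with inner regularity by compact sets, for all Borel sets.\<close>

locale homogeneous_type =
  fixes d :: "'a \<Rightarrow> 'a \<Rightarrow> real" and \<kappa> :: real and M :: "'a measure"
  assumes dist_nonneg: "0 \<le> d x y"
    and dist_sym: "d x y = d y x"
    and dist_pos_iff: "0 < d x y \<longleftrightarrow> x \<noteq> y"
    and kappa_ge_1: "1 \<le> \<kappa>"
    and quasi_triangle: "d x z \<le> \<kappa> * (d x y + d y z)"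
    and space_M: "space M = UNIV"
    and sets_M: "sets M = sigma_sets UNIV {U. openin (qtopology d) U}"
    and outer_regular:
      "A \<in> sets M \<Longrightarrow> emeasure M A = (INF U\<in>{U. openin (qtopology d) U \<and> A \<subseteq> U}. emeasure M U)"
    and inner_regular:
      "A \<in> sets M \<Longrightarrow> emeasure M A = (SUP F\<in>{F. compactin (qtopology d) F \<and> F \<subseteq> A}. emeasure M F)"
    and ball_pos: "0 < r \<Longrightarrow> 0 < emeasure M (qball d x r)"
    and ball_finite: "0 < r \<Longrightarrow> emeasure M (qball d x r) < \<infinity>"
    and doubling:
      "\<exists>C>1. \<forall>x r. 0 < r \<longrightarrow> measure M (qball d x (2 * r)) \<le> C * measure M (qball d x r)"
    and holder_regular:
      "\<exists>\<alpha> C. 0 < \<alpha> \<and> \<alpha> \<le> 1 \<and> 0 < C \<and>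
         (\<forall>x y z. \<bar>d x z - d y z\<bar> \<le> C * (d x z + d y z) powr (1 - \<alpha>) * d x y powr \<alpha>)"

section \<open>Admissible functions\<close>

definition admissible_exponent :: "('a \<Rightarrow> 'a \<Rightarrow> real) \<Rightarrow> ('a \<Rightarrow> real) \<Rightarrow> real \<Rightarrow> bool" where
  "admissible_exponent d \<rho> k \<longleftrightarrow>
     0 < k \<and> (\<exists>c>0. \<forall>x y. 1 / \<rho> x \<le> c / \<rho> y * (1 + d x y / \<rho> y) powr k)"

definition admissible :: "('a \<Rightarrow> 'a \<Rightarrow> real) \<Rightarrow> ('a \<Rightarrow> real) \<Rightarrow> bool" where
  "admissible d \<rho> \<longleftrightarrow> (\<forall>x. 0 < \<rho> x) \<and> (\<exists>k. admissible_exponent d \<rho> k)"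

definition adm_index :: "('a \<Rightarrow> 'a \<Rightarrow> real) \<Rightarrow> ('a \<Rightarrow> real) \<Rightarrow> real" where
  "adm_index d \<rho> = Inf {k. admissible_exponent d \<rho> k}"

section \<open>Function spaces\<close>

text \<open>Elements of the function spaces are complex-valued functions rather than classes modulo null
  sets; identities between them are required almost everywhere. All norms take values in the
  extended nonnegative reals.\<close>

definition Lq_norm :: "'a measure \<Rightarrow> ennreal \<Rightarrow> ('a \<Rightarrow> complex) \<Rightarrow> ennreal" where
  "Lq_norm M q f =
     (if q = \<infinity> then esssup M (\<lambda>x. ennreal (cmod (f x)))
      else if integrable M (\<lambda>x. cmod (f x) powr enn2real q)
      then ennreal ((\<integral>x. cmod (f x) powr enn2real q \<partial>M) powr (1 / enn2real q))
      else \<infinity>)"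

definition Lq :: "'a measure \<Rightarrow> ennreal \<Rightarrow> ('a \<Rightarrow> complex) set" where
  "Lq M q = {f. f \<in> borel_measurable M \<and> Lq_norm M q f < \<infinity>}"

definition bounded_op ::
    "'a measure \<Rightarrow> ('a \<Rightarrow> complex) set \<Rightarrow> (('a \<Rightarrow> complex) \<Rightarrow> ennreal) \<Rightarrow>
     (('a \<Rightarrow> complex) \<Rightarrow> ('a \<Rightarrow> complex)) \<Rightarrow> bool" where
  "bounded_op M V nrm T \<longleftrightarrow>
     (\<forall>f\<in>V. T f \<in> V) \<and>
     (\<forall>f\<in>V. \<forall>g\<in>V. \<forall>c. AE x in M. T (\<lambda>y. f y + c * g y) x = T f x + c * T g x) \<and>
     (\<exists>C\<ge>0. \<forall>f\<in>V. nrm (T f) \<le> ennreal C * nrm f)"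

definition vanishes_off :: "'a measure \<Rightarrow> 'a set \<Rightarrow> ('a \<Rightarrow> complex) \<Rightarrow> bool" where
  "vanishes_off M B f \<longleftrightarrow> (AE x in M. x \<notin> B \<longrightarrow> f x = 0)"

definition bounded_support :: "('a \<Rightarrow> 'a \<Rightarrow> real) \<Rightarrow> 'a measure \<Rightarrow> ('a \<Rightarrow> complex) \<Rightarrow> bool" where
  "bounded_support d M f \<longleftrightarrow> (\<exists>x r. vanishes_off M (qball d x r) f)"

text \<open>The closed support of the class of \<open>f\<close> modulo null sets.\<close>

definition ess_support :: "('a \<Rightarrow> 'a \<Rightarrow> real) \<Rightarrow> 'a measure \<Rightarrow> ('a \<Rightarrow> complex) \<Rightarrow> 'a set" where
  "ess_support d M f = {x. \<forall>r>0. \<not> (AE y in M. y \<in> qball d x r \<longrightarrow> f y = 0)}"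

definition bounded_test_functions :: "('a \<Rightarrow> 'a \<Rightarrow> real) \<Rightarrow> 'a measure \<Rightarrow> ('a \<Rightarrow> complex) set" where
  "bounded_test_functions d M =
     {f. f \<in> borel_measurable M \<and> bounded (range f) \<and> bounded_support d M f}"

subsection \<open>The Hardy space\<close>

text \<open>With \<open>1 / \<infinity> = 0\<close> in the extended nonnegative reals, the size condition also covers
  \<open>q = \<infinity>\<close>. An atom is supported in its (not necessarily closed) ball in the sense that it
  vanishes almost everywhere outside.\<close>

definition H1_atom ::
    "('a \<Rightarrow> 'a \<Rightarrow> real) \<Rightarrow> 'a measure \<Rightarrow> ('a \<Rightarrow> real) \<Rightarrow> ennreal \<Rightarrow> ('a \<Rightarrow> complex) \<Rightarrow> bool" where
  "H1_atom d M \<rho> q a \<longleftrightarrow>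
     a \<in> borel_measurable M \<and>
     (\<exists>x r. 0 < r \<and> r < \<rho> x \<and>
        vanishes_off M (qball d x r) a \<and>
        Lq_norm M q a \<le> ennreal (measure M (qball d x r) powr (enn2real (1 / q) - 1)) \<and>
        (r < \<rho> x / 4 \<longrightarrow> (\<integral>y. a y \<partial>M) = 0))"

definition atomic_decomposition ::
    "('a \<Rightarrow> 'a \<Rightarrow> real) \<Rightarrow> 'a measure \<Rightarrow> ('a \<Rightarrow> real) \<Rightarrow> ennreal \<Rightarrow> ('a \<Rightarrow> complex) \<Rightarrow>
     (nat \<Rightarrow> complex) \<Rightarrow> (nat \<Rightarrow> 'a \<Rightarrow> complex) \<Rightarrow> bool" where
  "atomic_decomposition d M \<rho> q f c a \<longleftrightarrow>
     integrable M f \<and>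
     (\<forall>j. H1_atom d M \<rho> q (a j)) \<and>
     summable (\<lambda>j. cmod (c j)) \<and>
     (\<lambda>n. \<integral>x. cmod (f x - (\<Sum>j<n. c j * a j x)) \<partial>M) \<longlonglongrightarrow> 0"

definition H1 ::
    "('a \<Rightarrow> 'a \<Rightarrow> real) \<Rightarrow> 'a measure \<Rightarrow> ('a \<Rightarrow> real) \<Rightarrow> ennreal \<Rightarrow> ('a \<Rightarrow> complex) set" where
  "H1 d M \<rho> q = {f. \<exists>c a. atomic_decomposition d M \<rho> q f c a}"

definition H1_norm ::
    "('a \<Rightarrow> 'a \<Rightarrow> real) \<Rightarrow> 'a measure \<Rightarrow> ('a \<Rightarrow> real) \<Rightarrow> ennreal \<Rightarrow> ('a \<Rightarrow> complex) \<Rightarrow> ennreal" where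
  "H1_norm d M \<rho> q f =
     (INF (c, a)\<in>{(c, a). atomic_decomposition d M \<rho> q f c a}. ennreal (\<Sum>j. cmod (c j)))"

subsection \<open>Spaces of functions of bounded mean oscillation\<close>

definition average :: "'a measure \<Rightarrow> 'a set \<Rightarrow> ('a \<Rightarrow> 'b::{banach, second_countable_topology}) \<Rightarrow> 'b" where
  "average M B f = (1 / measure M B) *\<^sub>R (LINT x:B|M. f x)"

definition MO :: "'a measure \<Rightarrow> ('a \<Rightarrow> complex) \<Rightarrow> 'a set \<Rightarrow> real" where
  "MO M f B = average M B (\<lambda>x. cmod (f x - average M B f))"

definition L1_loc :: "('a \<Rightarrow> 'a \<Rightarrow> real) \<Rightarrow> 'a measure \<Rightarrow> ('a \<Rightarrow> complex) set" where
  "L1_loc d M = {f. \<forall>x r. 0 < r \<longrightarrow> set_integrable M (qball d x r) f}"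

definition BMO_log_norm ::
    "('a \<Rightarrow> 'a \<Rightarrow> real) \<Rightarrow> 'a measure \<Rightarrow> ('a \<Rightarrow> real) \<Rightarrow> real \<Rightarrow> ('a \<Rightarrow> complex) \<Rightarrow> ennreal" where
  "BMO_log_norm d M \<rho> \<theta> f =
     (SUP x. SUP r\<in>{0<..}.
        ennreal (ln (exp 1 + \<rho> x / r) * (1 + r / \<rho> x) powr (- \<theta>) * MO M f (qball d x r)))"

definition BMO_log ::
    "('a \<Rightarrow> 'a \<Rightarrow> real) \<Rightarrow> 'a measure \<Rightarrow> ('a \<Rightarrow> real) \<Rightarrow> real \<Rightarrow> ('a \<Rightarrow> complex) set" where
  "BMO_log d M \<rho> \<theta> = {f \<in> L1_loc d M. BMO_log_norm d M \<rho> \<theta> f < \<infinity>}"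

definition BMO_norm :: "('a \<Rightarrow> 'a \<Rightarrow> real) \<Rightarrow> 'a measure \<Rightarrow> ('a \<Rightarrow> complex) \<Rightarrow> ennreal" where
  "BMO_norm d M f = (SUP x. SUP r\<in>{0<..}. ennreal (MO M f (qball d x r)))"

definition BMO :: "('a \<Rightarrow> 'a \<Rightarrow> real) \<Rightarrow> 'a measure \<Rightarrow> ('a \<Rightarrow> complex) set" where
  "BMO d M = {f \<in> L1_loc d M. BMO_norm d M f < \<infinity>}"

definition BMO_rho_norm ::
    "('a \<Rightarrow> 'a \<Rightarrow> real) \<Rightarrow> 'a measure \<Rightarrow> ('a \<Rightarrow> real) \<Rightarrow> ('a \<Rightarrow> complex) \<Rightarrow> ennreal" where
  "BMO_rho_norm d M \<rho> f =
     BMO_norm d M f +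
     (SUP x. SUP r\<in>{\<rho> x..}. ennreal (average M (qball d x r) (\<lambda>y. cmod (f y))))"

definition BMO_rho ::
    "('a \<Rightarrow> 'a \<Rightarrow> real) \<Rightarrow> 'a measure \<Rightarrow> ('a \<Rightarrow> real) \<Rightarrow> ('a \<Rightarrow> complex) set" where
  "BMO_rho d M \<rho> = {f \<in> BMO d M. BMO_rho_norm d M \<rho> f < \<infinity>}"

text \<open>The duality pairing of \<open>f \<in> BMO_rho\<close> with \<open>h \<in> H1\<close>: the bounded linear functional on the
  Hardy space whose value at an atom \<open>a\<close> is \<open>\<integral> f a\<close>. The integral of \<open>f h\<close> itself need not
  converge absolutely, so the value at \<open>h\<close> is read off the atomic decompositions of \<open>h\<close>.\<close>

definition pairing ::
    "('a \<Rightarrow> 'a \<Rightarrow> real) \<Rightarrow> 'a measure \<Rightarrow> ('a \<Rightarrow> real) \<Rightarrow> ennreal \<Rightarrow>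
     ('a \<Rightarrow> complex) \<Rightarrow> ('a \<Rightarrow> complex) \<Rightarrow> complex" where
  "pairing d M \<rho> q f h =
     (THE v. \<forall>c a. atomic_decomposition d M \<rho> q h c a \<longrightarrow>
        (\<lambda>j. c j * (\<integral>x. f x * a j x \<partial>M)) sums v)"

section \<open>Calderon--Zygmund operators\<close>

definition CZ_kernel ::
    "('a \<Rightarrow> 'a \<Rightarrow> real) \<Rightarrow> real \<Rightarrow> 'a measure \<Rightarrow> ('a \<Rightarrow> real) \<Rightarrow> real \<Rightarrow>
     ('a \<Rightarrow> 'a \<Rightarrow> complex) \<Rightarrow> bool" where
  "CZ_kernel d \<kappa> M \<rho> \<delta> K \<longleftrightarrow>
     (\<forall>N>0. \<exists>C>0. \<forall>x y. x \<noteq> y \<longrightarrow>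
        cmod (K x y) \<le> C / measure M (qball d x (d x y)) * (1 + d x y / \<rho> x) powr (- N)) \<and>
     (\<exists>C>0. \<forall>x x' y. x \<noteq> y \<and> d x x' \<le> 1 / (2 * \<kappa>) * d x y \<longrightarrow>
        cmod (K x y - K x' y) + cmod (K y x - K y x')
          \<le> (d x x' / d x y) powr \<delta> * (C / measure M (qball d x (d x y))))"

definition CZ_operator ::
    "('a \<Rightarrow> 'a \<Rightarrow> real) \<Rightarrow> real \<Rightarrow> 'a measure \<Rightarrow> ('a \<Rightarrow> real) \<Rightarrow> real \<Rightarrow>
     (('a \<Rightarrow> complex) \<Rightarrow> ('a \<Rightarrow> complex)) \<Rightarrow> bool" where
  "CZ_operator d \<kappa> M \<rho> \<delta> T \<longleftrightarrow>
     bounded_op M (Lq M 2) (Lq_norm M 2) T \<and>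
     (\<exists>K. CZ_kernel d \<kappa> M \<rho> \<delta> K \<and>
        (\<forall>f\<in>bounded_test_functions d M.
           AE x in M. x \<notin> ess_support d M f \<longrightarrow> T f x = (\<integral>y. K x y * f y \<partial>M)))"

text \<open>The adjoint is taken with respect to the bilinear form \<open>\<integral> f g\<close>, without conjugation, so that
  its kernel is \<open>K y x\<close>. It is determined up to null sets.\<close>

definition adjoint_L2 ::
    "'a measure \<Rightarrow> (('a \<Rightarrow> complex) \<Rightarrow> ('a \<Rightarrow> complex)) \<Rightarrow> (('a \<Rightarrow> complex) \<Rightarrow> ('a \<Rightarrow> complex))" where
  "adjoint_L2 M T =
     (SOME T'. bounded_op M (Lq M 2) (Lq_norm M 2) T' \<and>
        (\<forall>f\<in>Lq M 2. \<forall>g\<in>Lq M 2. (\<integral>x. T f x * g x \<partial>M) = (\<integral>x. f x * T' g x \<partial>M)))"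

text \<open>\<open>t\<close> represents \<open>T1\<close>. The test atoms are those with \<open>q = \<infinity>\<close>: they are atoms for every \<open>q\<close>, lie in
  the domain \<open>Lq M 2\<close> of the adjoint, and determine the functional.\<close>

definition represents_T1 ::
    "('a \<Rightarrow> 'a \<Rightarrow> real) \<Rightarrow> 'a measure \<Rightarrow> ('a \<Rightarrow> real) \<Rightarrow>
     (('a \<Rightarrow> complex) \<Rightarrow> ('a \<Rightarrow> complex)) \<Rightarrow> ('a \<Rightarrow> complex) \<Rightarrow> bool" where
  "represents_T1 d M \<rho> T t \<longleftrightarrow>
     t \<in> BMO_rho d M \<rho> \<and>
     (\<forall>a. H1_atom d M \<rho> \<infinity> a \<longrightarrow> (\<integral>x. t x * a x \<partial>M) = (\<integral>x. adjoint_L2 M T a x \<partial>M))"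

section \<open>Commutators\<close>

definition commutator ::
    "('a \<Rightarrow> complex) \<Rightarrow> (('a \<Rightarrow> complex) \<Rightarrow> ('a \<Rightarrow> complex)) \<Rightarrow> ('a \<Rightarrow> complex) \<Rightarrow> 'a \<Rightarrow> complex" where
  "commutator b T f = (\<lambda>x. b x * T f x - T (\<lambda>y. b y * f y) x)"

text \<open>\<open>S\<close> is the bounded operator on the Hardy space given by \<open>[b, T]\<close>. The formula
  \<open>b T f - T (b f)\<close> makes sense for bounded \<open>f\<close> with bounded support, since the functions \<open>b\<close> considered
  here are locally square integrable (John--Nirenberg). These \<open>f\<close> contain the atoms with \<open>q = \<infinity>\<close>, whose
  span is dense, so \<open>S\<close> is determined up to null sets.\<close>

definition H1_commutator ::
    "('a \<Rightarrow> 'a \<Rightarrow> real) \<Rightarrow> 'a measure \<Rightarrow> ('a \<Rightarrow> real) \<Rightarrow> ennreal \<Rightarrow> ('a \<Rightarrow> complex) \<Rightarrow>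
     (('a \<Rightarrow> complex) \<Rightarrow> ('a \<Rightarrow> complex)) \<Rightarrow> (('a \<Rightarrow> complex) \<Rightarrow> ('a \<Rightarrow> complex)) \<Rightarrow> bool" where
  "H1_commutator d M \<rho> q b T S \<longleftrightarrow>
     bounded_op M (H1 d M \<rho> q) (H1_norm d M \<rho> q) S \<and>
     (\<forall>f\<in>bounded_test_functions d M. AE x in M. S f x = commutator b T f x)"

text \<open>\<open>U\<close> is \<open>[b, T]\<close> on \<open>BMO_rho\<close>: minus the adjoint of \<open>[b, T\<^sup>*]\<close> on the Hardy space.\<close>

definition BMO_rho_commutator ::
    "('a \<Rightarrow> 'a \<Rightarrow> real) \<Rightarrow> 'a measure \<Rightarrow> ('a \<Rightarrow> real) \<Rightarrow> ennreal \<Rightarrow> ('a \<Rightarrow> complex) \<Rightarrow>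
     (('a \<Rightarrow> complex) \<Rightarrow> ('a \<Rightarrow> complex)) \<Rightarrow> (('a \<Rightarrow> complex) \<Rightarrow> ('a \<Rightarrow> complex)) \<Rightarrow> bool" where
  "BMO_rho_commutator d M \<rho> q b T U \<longleftrightarrow>
     (\<exists>S. H1_commutator d M \<rho> q b (adjoint_L2 M T) S \<and>
        (\<forall>f\<in>BMO_rho d M \<rho>. U f \<in> BMO_rho d M \<rho> \<and>
           (\<forall>h\<in>H1 d M \<rho> q. pairing d M \<rho> q (U f) h = - pairing d M \<rho> q f (S h))))"

end

theory Submission
 imports Defs
begin

text \<open>Since \<open>BMO_rho\<close> is the dual of the Hardy space, it suffices to bound the commutator of \<open>b\<close> with the
 adjoint \<open>T'\<close> of \<open>T\<close> from atoms to the Hardy space, and to transpose the result. For an atom \<open>a\<close> in a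
 ball \<open>B\<close>, \<open>[b, T'] a = (b - b_B) T' a - T' ((b - b_B) a)\<close>. In both terms \<open>b - b_B\<close> gains the factor
 \<open>1 / log (e + \<rho>/r)\<close>, which compensates the loss incurred when a function without cancellation on a small
 ball is written as a sum of atoms. For the first term this is applied on the dyadic annuli around \<open>B\<close>, where the
 decay of \<open>T' a\<close> beats the growth of the oscillation of \<open>b\<close> because \<open>\<theta> < \<delta> / (i(\<rho>) + 1)\<close>. For the second
 one, \<open>T'\<close> maps the Hardy space to itself because the integrals of \<open>T' a\<close> are pairings of \<open>a\<close> with \<open>T1\<close>, which
 has logarithmically small oscillation. The \<open>L\<^sup>p\<close> forms of these facts (John--Nirenberg and the independence of
 the Hardy space from \<open>q\<close>) come from a Calderon--Zygmund decomposition of atoms, iterated so that the error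
 is halved at each step, and from duality.\<close>

text \<open>A uniform bound on atoms does not by itself give an operator on the Hardy space: two
  atomic decompositions of one function could lead to different sums. Each extension is therefore
  tied to a transposed operator on bounded test functions, and the extended value is recognised by
  its integrals against these, which are pairings blind to the decomposition. The same device puts
  \<open>T' h\<close> into the Hardy space for square integrable \<open>h\<close> such as
  \<open>(b - b_B) a\<close>, which is no bounded atom. The exponents come from Hoelder: on an
  annulus \<open>T' a\<close> is controlled in the square mean and \<open>b - b_B\<close> in the
  fourth power mean, so the product has exponent 4/3, and atoms with an exponent below 2 must be
  decomposed into bounded ones. From one annulus to the next \<open>T' a\<close> falls by
  \<open>2 powr (- \<delta>)\<close>. Once the logarithm is cancelled, the oscillation of
  \<open>b\<close> grows like \<open>2 powr \<tau>\<close> with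
  \<open>\<tau> = \<theta> * (k + 1)\<close>, where \<open>k\<close> is an admissible exponent close
  to the index, times a linear factor from the drift of the averages; hence the need for
  \<open>\<tau> < \<delta>\<close>.\<close>

lemma AE_summable_norm:
 fixes f :: "nat => 'a => 'b::{banach, second_countable_topology}"
 assumes "\<And>i. integrable M (f i)" "summable (\<lambda>i. \<integral>x. norm (f i x) \<partial>M)"
 shows "AE x in M. summable (\<lambda>i. norm (f i x))"
proof -
 have [measurable]: "f i \<in> borel_measurable M" for i using assms(1) by auto
 have "(\<integral>\<^sup>+x. (\<Sum>i. ennreal (norm (f i x))) \<partial>M) = (\<Sum>i. \<integral>\<^sup>+x. ennreal (norm (f i x)) \<partial>M)"
  by (rule nn_integral_suminf) auto
 also have "\<dots> = (\<Sum>i. ennreal (LINT x|M. norm (f i x)))"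
  by (intro suminf_cong nn_integral_eq_integral) (use assms in auto)
 also have "\<dots> = ennreal (\<Sum>i. \<integral>x. norm (f i x) \<partial>M)"
  by (rule suminf_ennreal2) (use assms in auto)
 finally have "(\<integral>\<^sup>+x. (\<Sum>i. ennreal (norm (f i x))) \<partial>M) \<noteq> \<infinity>" by simp
 then have "AE x in M. (\<Sum>i. ennreal (norm (f i x))) \<noteq> \<infinity>"
  by (intro nn_integral_PInf_AE) auto
 then show ?thesis
  by eventually_elim (auto intro!: summable_suminf_not_top)
qed

subsection \<open>Atomic gauges\<close>

text \<open>Nonemptiness lets the zero function be written with zero coefficients, since every slot
  of a decomposition must hold an atom. The bound 1 makes a series with summable coefficients
  converge in the mean and almost everywhere.\<close>

definition L1_atoms :: "'a measure => ('a => complex) set => bool" where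
 "L1_atoms M \<A> \<longleftrightarrow> \<A> \<noteq> {} \<and> (\<forall>a\<in>\<A>. integrable M a \<and> (LINT x|M. cmod (a x)) \<le> 1)"

text \<open>A norm bound is encoded by one decomposition of cost at most \<open>A\<close>, so that
  no infimum has to be approached later. For families satisfying \<open>L1_atoms\<close> and
  summable coefficients, convergence almost everywhere amounts to convergence in the mean.
  Measurability is stated separately because the sum is known only up to a null set and
  \<open>M\<close> need not be complete.\<close>

definition atomic_gauge :: "'a measure => ('a => complex) set => real => ('a => complex) => bool" where
 "atomic_gauge M \<A> A f \<longleftrightarrow> f \<in> borel_measurable M \<and>
   (\<exists>c a. (\<forall>j. a j \<in> \<A>) \<and> summable (\<lambda>j. cmod (c j)) \<and> (\<Sum>j::nat. cmod (c j)) \<le> A \<and>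
    (AE x in M. (\<lambda>j. c j * a j x) sums f x))"

lemma atomic_gauge_measurable: "atomic_gauge M \<A> A f ==> f \<in> borel_measurable M"
 unfolding atomic_gauge_def by blast

lemma atomic_gauge_mono: "atomic_gauge M \<A> A f ==> A \<le> A' ==> atomic_gauge M \<A> A' f"
 unfolding atomic_gauge_def by force

lemma atomic_gauge_AE_cong:
 assumes "atomic_gauge M \<A> A f" "g \<in> borel_measurable M" "AE x in M. f x = g x"
 shows "atomic_gauge M \<A> A g"
proof -
 obtain c a where *: "\<And>j. a j \<in> \<A>" "summable (\<lambda>j. cmod (c j))" "(\<Sum>j::nat. cmod (c j)) \<le> A"
  "AE x in M. (\<lambda>j. c j * a j x) sums f x" using assms(1) unfolding atomic_gauge_def by blast
 have "AE x in M. (\<lambda>j. c j * a j x) sums g x" using *(4) assms(3) by eventually_elim auto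
 with * show ?thesis unfolding atomic_gauge_def using assms(2) by blast
qed

lemma L1_series:
 fixes c :: "nat => complex"
 assumes "L1_atoms M \<A>" "\<And>j. a j \<in> \<A>" "summable (\<lambda>j. cmod (c j))"
 shows "\<And>j. integrable M (\<lambda>x. c j * a j x)"
  and "\<And>j. (LINT x|M. cmod (c j * a j x)) \<le> cmod (c j)"
  and "summable (\<lambda>j. \<integral>x. cmod (c j * a j x) \<partial>M)"
  and "AE x in M. summable (\<lambda>j. cmod (c j * a j x))"
proof -
 show 1: "\<And>j. integrable M (\<lambda>x. c j * a j x)" using assms(1,2) unfolding L1_atoms_def by auto
 show 2: "(LINT x|M. cmod (c j * a j x)) \<le> cmod (c j)" for j
 proof -
  have "(LINT x|M. cmod (c j * a j x)) = cmod (c j) * (LINT x|M. cmod (a j x))" by (simp add: norm_mult)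
  also have "\<dots> \<le> cmod (c j) * 1"
   using assms(1,2) unfolding L1_atoms_def by (intro mult_left_mono) auto
  finally show ?thesis by simp
 qed
 show 3: "summable (\<lambda>j. \<integral>x. cmod (c j * a j x) \<partial>M)"
  by (rule summable_comparison_test'[OF assms(3), of 0]) (use 2 in auto)
 show "AE x in M. summable (\<lambda>j. cmod (c j * a j x))" by (rule AE_summable_norm[OF 1 3])
qed

text \<open>Dominated convergence, with the sum of the norms as an integrable majorant of all
  partial sums and of all remainders.\<close>

lemma integrable_sums:
 fixes f :: "nat => 'a => complex"
 assumes int: "\<And>j. integrable M (f j)" and s: "summable (\<lambda>j. \<integral>x. cmod (f j x) \<partial>M)"
  and m: "g \<in> borel_measurable M" and g: "AE x in M. (\<lambda>j. f j x) sums g x"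
 shows "integrable M g" and "(\<lambda>j. \<integral>x. f j x \<partial>M) sums (LINT x|M. g x)"
  and "(LINT x|M. cmod (g x)) \<le> (\<Sum>j. \<integral>x. cmod (f j x) \<partial>M)"
  and "(\<lambda>n. \<integral>x. cmod (g x - (\<Sum>j<n. f j x)) \<partial>M) \<longlonglongrightarrow> 0"
proof -
 have ae: "AE x in M. summable (\<lambda>j. norm (f j x))" by (rule AE_summable_norm[OF int s])
 have gs: "AE x in M. (\<Sum>j. f j x) = g x" using g by eventually_elim (simp add: sums_iff)
 have [measurable]: "f j \<in> borel_measurable M" for j using int by auto
 note m[measurable]
 have 1: "integrable M (\<lambda>x. \<Sum>j. f j x)" by (rule integrable_suminf[OF int ae s])
 show ig: "integrable M g" by (rule integrable_cong_AE_imp[OF 1 m]) (use gs in auto)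
 have "(\<lambda>j. \<integral>x. f j x \<partial>M) sums (LINT x|M. (\<Sum>j. f j x))" by (rule sums_integral[OF int ae s])
 also have "(LINT x|M. (\<Sum>j. f j x)) = (LINT x|M. g x)" by (rule integral_cong_AE) (use gs in auto)
 finally show "(\<lambda>j. \<integral>x. f j x \<partial>M) sums (LINT x|M. g x)" .
 have isn: "integrable M (\<lambda>x. \<Sum>j. norm (f j x))"
  by (rule integrable_suminf) (use int ae s in auto)
 have sh: "(\<lambda>j. \<integral>x. norm (f j x) \<partial>M) sums (LINT x|M. (\<Sum>j. norm (f j x)))"
  by (rule sums_integral) (use int ae s in auto)
 have le: "AE x in M. cmod (g x) \<le> (\<Sum>j. norm (f j x))"
  using ae gs by eventually_elim (metis summable_norm)
 have "(LINT x|M. cmod (g x)) \<le> (LINT x|M. (\<Sum>j. norm (f j x)))"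
  by (rule integral_mono_AE) (use isn ig le in auto)
 then show "(LINT x|M. cmod (g x)) \<le> (\<Sum>j. \<integral>x. cmod (f j x) \<partial>M)" using sh by (simp add: sums_iff)
 have "(\<lambda>n. \<integral>x. cmod (g x - (\<Sum>j<n. f j x)) \<partial>M) \<longlonglongrightarrow> (LINT x|M. 0)"
 proof (rule integral_dominated_convergence[where w="\<lambda>x. \<Sum>j. norm (f j x)"])
  show "AE x in M. (\<lambda>n. cmod (g x - (\<Sum>j<n. f j x))) \<longlonglongrightarrow> 0"
   using g
  proof eventually_elim
   case (elim x)
   then have "(\<lambda>n. (\<Sum>j<n. f j x)) \<longlonglongrightarrow> g x" by (simp add: sums_def)
   from tendsto_norm_zero[OF LIM_zero[OF this]] show ?case by (simp add: norm_minus_commute)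
  qed
  show "AE x in M. norm (cmod (g x - (\<Sum>j<n. f j x))) \<le> (\<Sum>j. norm (f j x))" for n
   using ae g
  proof eventually_elim
   case (elim x)
   have "g x - (\<Sum>j<n. f j x) = (\<Sum>j. f (j + n) x)"
    using suminf_minus_initial_segment[OF sums_summable[OF elim(2)], of n] sums_unique[OF elim(2)] by simp
   moreover have "cmod (\<Sum>j. f (j + n) x) \<le> (\<Sum>j. norm (f (j + n) x))"
    by (rule summable_norm) (use summable_ignore_initial_segment[OF elim(1), of n] in simp)
   moreover have "(\<Sum>j. norm (f (j + n) x)) \<le> (\<Sum>j. norm (f j x))"
    using suminf_split_initial_segment[OF elim(1), of n] by (simp add: sum_nonneg)
   ultimately show ?case by simp
  qed
 qed (use isn in auto)
 then show "(\<lambda>n. \<integral>x. cmod (g x - (\<Sum>j<n. f j x)) \<partial>M) \<longlonglongrightarrow> 0" by simp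
qed

lemma atomic_gauge_integrable:
 assumes "L1_atoms M \<A>" "atomic_gauge M \<A> A f"
 shows "integrable M f" "(LINT x|M. cmod (f x)) \<le> A"
proof -
 obtain c a where *: "\<And>j. a j \<in> \<A>" "summable (\<lambda>j. cmod (c j))" "(\<Sum>j::nat. cmod (c j)) \<le> A"
  "AE x in M. (\<lambda>j. c j * a j x) sums f x" using assms(2) unfolding atomic_gauge_def by blast
 note L = L1_series[OF assms(1), of a c, OF *(1) *(2)]
 note I = integrable_sums[of M "\<lambda>j x. c j * a j x" f, OF L(1) L(3) atomic_gauge_measurable[OF assms(2)] *(4)]
 show "integrable M f" by (rule I(1))
 have "(\<Sum>j. \<integral>x. cmod (c j * a j x) \<partial>M) \<le> (\<Sum>j. cmod (c j))"
  by (rule suminf_le[OF L(2) L(3) *(2)])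
 then show "(LINT x|M. cmod (f x)) \<le> A" using I(3) *(3) by linarith
qed

lemma atomic_gauge_atom:
 assumes "L1_atoms M \<A>" "a \<in> \<A>" shows "atomic_gauge M \<A> 1 a"
proof -
 have s: "(\<lambda>j. if j = 0 then (1::real) else 0) sums 1" using sums_single[of 0 "\<lambda>_. 1::real"] by simp
 have "a \<in> borel_measurable M" using assms unfolding L1_atoms_def by auto
 moreover have "(\<lambda>j. (if j = 0 then 1 else 0) * a x) sums a x" for x
  using sums_single[of 0 "\<lambda>_. a x"] by (simp add: if_distrib if_distribR cong: if_cong)
 moreover have "(\<lambda>j. cmod (if j = (0::nat) then 1 else 0)) = (\<lambda>j. if j = 0 then (1::real) else 0)" by auto
 ultimately show ?thesis unfolding atomic_gauge_def using assms(2) s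
  by (intro conjI exI[of _ "\<lambda>j. if j = 0 then 1 else 0"] exI[of _ "\<lambda>_. a"]) (auto simp: sums_iff)
qed

lemma atomic_gauge_scale:
 assumes "atomic_gauge M \<A> A f" shows "atomic_gauge M \<A> (cmod z * A) (\<lambda>x. z * f x)"
proof -
 obtain c a where *: "\<And>j. a j \<in> \<A>" "summable (\<lambda>j. cmod (c j))" "(\<Sum>j::nat. cmod (c j)) \<le> A"
  "AE x in M. (\<lambda>j. c j * a j x) sums f x" using assms unfolding atomic_gauge_def by blast
 have "AE x in M. (\<lambda>j. z * c j * a j x) sums (z * f x)"
  using *(4) by eventually_elim (simp add: sums_mult mult.assoc)
 moreover have "summable (\<lambda>j. cmod (z * c j))" using *(2) by (simp add: norm_mult summable_mult)
 moreover have "(\<Sum>j. cmod (z * c j)) \<le> cmod z * A"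
  using *(2,3) by (simp add: norm_mult suminf_mult mult_left_mono)
 ultimately show ?thesis unfolding atomic_gauge_def using *(1) atomic_gauge_measurable[OF assms]
  by (intro conjI exI[of _ "\<lambda>j. z * c j"] exI[of _ a]) auto
qed

lemma atomic_gauge_zero: "\<A> \<noteq> {} ==> atomic_gauge M \<A> 0 (\<lambda>x. 0)"
 unfolding atomic_gauge_def by (auto intro!: exI[of _ "\<lambda>_. 0"])

text \<open>Countable subadditivity, on which all later decompositions rest. The coefficients of the
  decompositions of the \<open>f i\<close> form an absolutely summable double family, so
  \<open>prod_decode\<close> can enumerate them as a single series of the same total cost.\<close>

lemma atomic_gauge_suminf:
 assumes A: "L1_atoms M \<A>" and g: "\<And>i. atomic_gauge M \<A> (N i) (f i)" and N: "summable N" "(\<Sum>i. N i) \<le> B"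
  and m: "h \<in> borel_measurable M" and h: "AE x in M. (\<lambda>i. f i x) sums h x"
 shows "atomic_gauge M \<A> B h"
proof -
 define R where "R i c a \<longleftrightarrow> (\<forall>j. a j \<in> \<A>) \<and> summable (\<lambda>j. cmod (c j)) \<and> (\<Sum>j::nat. cmod (c j)) \<le> N i \<and>
    (AE x in M. (\<lambda>j. c j * a j x) sums f i x)" for i c a
 have "\<exists>c a. R i c a" for i
  using g[of i] unfolding atomic_gauge_def R_def by blast
 then obtain c a where "\<And>i. R i (c i) (a i)" by metis
 then have a: "\<And>i j. a i j \<in> \<A>" and sc: "\<And>i. summable (\<lambda>j. cmod (c i j))"
  and c: "\<And>i. (\<Sum>j::nat. cmod (c i j)) \<le> N i"
  and s: "\<And>i. AE x in M. (\<lambda>j. c i j * a i j x) sums f i x"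
  unfolding R_def by auto
 define c' where "c' n = c (fst (prod_decode n)) (snd (prod_decode n))" for n
 define a' where "a' n = a (fst (prod_decode n)) (snd (prod_decode n))" for n
 have bij: "bij prod_decode" by (rule bij_prod_decode)
 have inner: "((\<lambda>j. cmod (c i j)) has_sum (\<Sum>j. cmod (c i j))) UNIV" for i
  using sc by (intro norm_summable_imp_has_sum) (auto simp: summable_sums)
 have N0: "0 \<le> (\<Sum>j. cmod (c i j))" for i by (rule suminf_nonneg[OF sc]) auto
 have sN: "summable (\<lambda>i. (\<Sum>j. cmod (c i j)))"
  by (rule summable_comparison_test'[OF N(1), of 0]) (use c N0 in auto)
 have outer: "((\<lambda>i. (\<Sum>j. cmod (c i j))) has_sum (\<Sum>i. \<Sum>j. cmod (c i j))) UNIV"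
  by (rule norm_summable_imp_has_sum) (use sN N0 in \<open>auto simp: summable_sums\<close>)
 have abs: "(\<lambda>(i,j). cmod (c i j)) summable_on (UNIV \<times> UNIV)"
 proof (rule summable_on_SigmaI[where g="\<lambda>i. \<Sum>j. cmod (c i j)"])
  show "((\<lambda>y. case (x, y) of (i, j) => cmod (c i j)) has_sum (\<Sum>j. cmod (c x j))) UNIV" for x
   using inner by auto
  show "(\<lambda>i. \<Sum>j. cmod (c i j)) summable_on UNIV" using outer by (auto simp: summable_on_def)
 qed auto
 have hs: "((\<lambda>(i,j). cmod (c i j)) has_sum (\<Sum>i. \<Sum>j. cmod (c i j))) (UNIV \<times> UNIV)"
  by (rule has_sum_SigmaI[where g="\<lambda>i. \<Sum>j. cmod (c i j)"]) (use inner outer abs in auto)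
 have "((\<lambda>n. (\<lambda>(i,j). cmod (c i j)) (prod_decode n)) has_sum (\<Sum>i. \<Sum>j. cmod (c i j))) UNIV"
  using has_sum_reindex_bij_betw[of prod_decode UNIV "UNIV \<times> UNIV" "\<lambda>(i,j). cmod (c i j)"] hs bij
  by simp
 then have c's: "(\<lambda>n. cmod (c' n)) sums (\<Sum>i. \<Sum>j. cmod (c i j))"
  by (intro has_sum_imp_sums) (simp add: c'_def case_prod_unfold)
 have c'le: "(\<Sum>n. cmod (c' n)) \<le> B"
  using c's suminf_le[OF c sN N(1)] N(2) by (simp add: sums_iff)
 have a': "a' n \<in> \<A>" for n unfolding a'_def by (rule a)
 have sc': "summable (\<lambda>n. cmod (c' n))" using c's by (simp add: sums_iff)
 have "AE x in M. summable (\<lambda>j. cmod (c' j * a' j x))" by (rule L1_series(4)[of M \<A> a' c', OF A a' sc'])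
 moreover have "AE x in M. \<forall>i. (\<lambda>j. c i j * a i j x) sums f i x" by (subst AE_all_countable) (use s in auto)
 ultimately have "AE x in M. (\<lambda>j. c' j * a' j x) sums h x" using h
 proof eventually_elim
  case (elim x)
  \<comment> \<open>At a point where the enumerated series converges absolutely, the double family
    may be summed by rows; the rows give the \<open>f i x\<close>, so the enumerated series has the
    sum \<open>h x\<close>.\<close>
  define F where "F = (\<lambda>(i,j). c i j * a i j x)"
  have F': "F (prod_decode n) = c' n * a' n x" for n
   by (simp add: F_def c'_def a'_def case_prod_unfold)
  have "(\<lambda>n. norm (F (prod_decode n))) summable_on UNIV"
   by (rule norm_summable_imp_summable_on) (use elim(1) F' in simp)
  then have FS: "(\<lambda>p. norm (F p)) summable_on (UNIV \<times> UNIV)"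
   using summable_on_reindex_bij_betw[of prod_decode UNIV "UNIV \<times> UNIV" "\<lambda>p. norm (F p)"] bij by simp
  then obtain v where v: "(F has_sum v) (UNIV \<times> UNIV)"
   using abs_summable_summable[OF FS] unfolding summable_on_def by blast
  have "(\<lambda>p. norm (F p)) summable_on (Pair i ` UNIV)" for i
   by (rule summable_on_subset_banach[OF FS]) auto
  then have "(\<lambda>j. norm (F (i, j))) summable_on UNIV" for i
   using summable_on_reindex[of "Pair i" UNIV "\<lambda>p. norm (F p)"] by (simp add: o_def inj_on_def)
  then have in2: "((\<lambda>j. F (i, j)) has_sum f i x) UNIV" for i
  proof -
   obtain w where w: "((\<lambda>j. F (i, j)) has_sum w) UNIV"
    using abs_summable_summable[OF \<open>(\<lambda>j. norm (F (i, j))) summable_on UNIV\<close>]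
    unfolding summable_on_def by blast
   then have "(\<lambda>j. F (i,j)) sums w" by (rule has_sum_imp_sums)
   moreover have "(\<lambda>j. F (i,j)) sums f i x" using elim(2) unfolding F_def by simp
   ultimately have "w = f i x" by (rule sums_unique2)
   then show ?thesis using w by simp
  qed
  have "((\<lambda>i. f i x) has_sum v) UNIV"
   by (rule has_sum_SigmaD[OF v]) (use in2 in auto)
  then have "v = h x" by (rule sums_unique2[OF has_sum_imp_sums elim(3)])
  then have "((\<lambda>n. F (prod_decode n)) has_sum h x) UNIV"
   using has_sum_reindex_bij_betw[of prod_decode UNIV "UNIV \<times> UNIV" F] v bij by simp
  from has_sum_imp_sums[OF this] show ?case using F' by simp
 qed
 then show ?thesis unfolding atomic_gauge_def using m a' sc' c'le by blast
qed

lemma atomic_gauge_add: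
 assumes A: "L1_atoms M \<A>" and "atomic_gauge M \<A> X f" "atomic_gauge M \<A> Y g"
 shows "atomic_gauge M \<A> (X + Y) (\<lambda>x. f x + g x)"
proof (rule atomic_gauge_suminf[OF A, of "\<lambda>i. if i = 0 then X else if i = 1 then Y else 0"
   "\<lambda>i x. if i = 0 then f x else if i = 1 then g x else 0"])
 have z: "atomic_gauge M \<A> 0 (\<lambda>x. 0)" using A atomic_gauge_zero unfolding L1_atoms_def by blast
 show "atomic_gauge M \<A> (if i = 0 then X else if i = 1 then Y else 0)
     (\<lambda>x. if i = 0 then f x else if i = 1 then g x else 0)" for i::nat
  using assms(2,3) z by auto
 have e: "sum h {0..<2} = h 0 + h 1" for h :: "nat => 'c::comm_monoid_add" by (simp add: numeral_2_eq_2)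
 have "(\<lambda>i::nat. if i = 0 then X else if i = 1 then Y else 0) sums (\<Sum>i\<in>{0..<2::nat}. if i = 0 then X else if i = 1 then Y else 0)"
  by (rule sums_finite) auto
 then show "summable (\<lambda>i::nat. if i = 0 then X else if i = 1 then Y else 0)"
  "(\<Sum>i::nat. if i = 0 then X else if i = 1 then Y else 0) \<le> X + Y" by (auto simp: sums_iff e)
 have "(\<lambda>i::nat. if i = 0 then f x else if i = 1 then g x else 0) sums (\<Sum>i\<in>{0..<2::nat}. if i = 0 then f x else if i = 1 then g x else 0)" for x
  by (rule sums_finite) auto
 then show "AE x in M. (\<lambda>i::nat. if i = 0 then f x else if i = 1 then g x else 0) sums (f x + g x)" by (simp add: e)
 show "(\<lambda>x. f x + g x) \<in> borel_measurable M" using assms(2,3) atomic_gauge_measurable by measurable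
qed

lemma atomic_gauge_diff:
 assumes A: "L1_atoms M \<A>" and "atomic_gauge M \<A> X f" "atomic_gauge M \<A> Y g"
 shows "atomic_gauge M \<A> (X + Y) (\<lambda>x. f x - g x)"
 using atomic_gauge_add[OF A assms(2) atomic_gauge_scale[OF assms(3), of "-1"]] by simp

lemma atomic_gauge_sum:
 assumes A: "L1_atoms M \<A>" and "finite I" "\<And>i. i \<in> I ==> atomic_gauge M \<A> (N i) (f i)"
 shows "atomic_gauge M \<A> (\<Sum>i\<in>I. N i) (\<lambda>x. \<Sum>i\<in>I. f i x)"
 using assms(2,3)
proof (induction I)
 case empty
 then show ?case using A atomic_gauge_zero unfolding L1_atoms_def by auto
next
 case (insert i I)
 then show ?case using atomic_gauge_add[OF A, of "N i" "f i"] by simp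
qed

lemma atomic_gauge_compose:
 assumes A: "L1_atoms M \<A>" and B: "L1_atoms M \<B>" and f: "atomic_gauge M \<A> X f"
  and C: "0 \<le> C" "\<And>a. a \<in> \<A> ==> atomic_gauge M \<B> C a"
 shows "atomic_gauge M \<B> (C * X) f"
proof -
 obtain c a where *: "\<And>j. a j \<in> \<A>" "summable (\<lambda>j. cmod (c j))" "(\<Sum>j::nat. cmod (c j)) \<le> X"
  "AE x in M. (\<lambda>j. c j * a j x) sums f x" using f unfolding atomic_gauge_def by blast
 show ?thesis
 proof (rule atomic_gauge_suminf[OF B, of "\<lambda>j. cmod (c j) * C"])
  show "atomic_gauge M \<B> (cmod (c i) * C) (\<lambda>x. c i * a i x)" for i by (rule atomic_gauge_scale) (use C * in auto)
  show "summable (\<lambda>j. cmod (c j) * C)" using * by (simp add: summable_mult2)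
  show "(\<Sum>j. cmod (c j) * C) \<le> C * X"
   using suminf_mult2[OF *(2), of C] mult_left_mono[OF *(3) C(1)] by (simp add: mult.commute)
 qed (use * atomic_gauge_measurable[OF f] in auto)
qed

text \<open>A Neumann series: replacing the remainder again and again produces remainders of gauge
  \<open>X / 2^n\<close> in the coarse family and corrections of gauge \<open>C * X / 2^n\<close> in
  the fine one, whose costs add up to \<open>2 * C * X\<close>.\<close>

lemma atomic_gauge_iterate:
 assumes A: "L1_atoms M \<A>" and P: "L1_atoms M \<P>" and C: "0 \<le> C"
  and step: "\<And>p. p \<in> \<P> ==> \<exists>g. atomic_gauge M \<A> C g \<and> atomic_gauge M \<P> (1/2) (\<lambda>x. p x - g x)"
  and f: "atomic_gauge M \<P> X f"
 shows "atomic_gauge M \<A> (2 * C * X) f"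
proof -
 \<comment> \<open>The hypothesis concerns single atoms. Applying it to every atom of a
   decomposition and summing carries it over to all functions of finite gauge.\<close>
 have gstep: "\<exists>g. atomic_gauge M \<A> (C * Y) g \<and> atomic_gauge M \<P> (Y / 2) (\<lambda>x. f x - g x)" if f: "atomic_gauge M \<P> Y f" for f Y
 proof -
  obtain c a where *: "\<And>j. a j \<in> \<P>" "summable (\<lambda>j. cmod (c j))" "(\<Sum>j::nat. cmod (c j)) \<le> Y"
   "AE x in M. (\<lambda>j. c j * a j x) sums f x" using f unfolding atomic_gauge_def by blast
  obtain g where g: "\<And>j. atomic_gauge M \<A> C (g j)" "\<And>j. atomic_gauge M \<P> (1/2) (\<lambda>x. a j x - g j x)"
   using step[OF *(1)] by metis
  have gA: "atomic_gauge M \<A> (cmod (c i) * C) (\<lambda>x. c i * g i x)" for i by (rule atomic_gauge_scale) (use g in auto)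
  have gP: "atomic_gauge M \<P> (cmod (c i) * (1/2)) (\<lambda>x. c i * (a i x - g i x))" for i by (rule atomic_gauge_scale) (use g in auto)
  define G where "G x = (\<Sum>j. c j * g j x)" for x
  have [measurable]: "g j \<in> borel_measurable M" for j using g atomic_gauge_measurable by blast
  have [measurable]: "G \<in> borel_measurable M" unfolding G_def by measurable
  have sC: "summable (\<lambda>j. cmod (c j) * C)" using *(2) by (simp add: summable_mult2)
  have "AE x in M. summable (\<lambda>j. norm (c j * g j x))"
  proof (rule AE_summable_norm)
   show "integrable M (\<lambda>x. c i * g i x)" for i using atomic_gauge_integrable(1)[OF A gA] .
   show "summable (\<lambda>i. \<integral>x. cmod (c i * g i x) \<partial>M)"
    by (rule summable_comparison_test'[OF sC, of 0]) (use atomic_gauge_integrable(2)[OF A gA] in auto)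
  qed
  then have Gs: "AE x in M. (\<lambda>j. c j * g j x) sums G x"
   by eventually_elim (auto simp: G_def intro!: summable_sums intro: summable_norm_cancel)
  have "atomic_gauge M \<A> (C * Y) G"
  proof (rule atomic_gauge_suminf[OF A gA sC _ _ Gs])
   show "(\<Sum>j. cmod (c j) * C) \<le> C * Y"
    using suminf_mult2[OF *(2), of C] mult_left_mono[OF *(3) C] by (simp add: mult.commute)
  qed auto
  moreover have "atomic_gauge M \<P> (Y / 2) (\<lambda>x. f x - G x)"
  proof (rule atomic_gauge_suminf[OF P gP])
   show "summable (\<lambda>i. cmod (c i) * (1/2))" using *(2) by (rule summable_mult2)
   show "(\<Sum>i. cmod (c i) * (1/2)) \<le> Y / 2" using *(2,3) by (subst suminf_mult2[symmetric]) auto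
   show "(\<lambda>x. f x - G x) \<in> borel_measurable M" using atomic_gauge_measurable[OF f] by measurable
   show "AE x in M. (\<lambda>i. c i * (a i x - g i x)) sums (f x - G x)"
    using *(4) Gs
   proof eventually_elim
    case (elim x)
    from sums_diff[OF this] show ?case by (simp add: algebra_simps)
   qed
  qed
  ultimately show ?thesis by blast
 qed
 \<comment> \<open>\<open>F n\<close> is the remainder after \<open>n\<close> rounds. The clause on
   \<open>n = 0\<close> pins the starting value, which dependent choice would otherwise leave
   open.\<close>
 have ex: "\<exists>F. \<forall>n. atomic_gauge M \<P> (X / 2^n) (F n) \<and> (\<lambda>(F::'a => complex) n. n = 0 \<longrightarrow> F = f) (F n) n \<and>
    atomic_gauge M \<A> (C * (X / 2^n)) (\<lambda>x. F n x - F (Suc n) x)"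
 proof -
  have "\<exists>F. \<forall>n. (atomic_gauge M \<P> (X / 2^n) (F n) \<and> (n = 0 \<longrightarrow> F n = f)) \<and>
    atomic_gauge M \<A> (C * (X / 2^n)) (\<lambda>x. F n x - F (Suc n) x)"
  proof (rule dependent_nat_choice)
   show "\<exists>x. atomic_gauge M \<P> (X / 2 ^ 0) x \<and> (0 = (0::nat) \<longrightarrow> x = f)" using f by auto
  next
   fix h n assume "atomic_gauge M \<P> (X / 2 ^ n) h \<and> (n = 0 \<longrightarrow> h = f)"
   then obtain g where "atomic_gauge M \<A> (C * (X / 2^n)) g" "atomic_gauge M \<P> (X / 2^n / 2) (\<lambda>x. h x - g x)"
    using gstep by blast
   then show "\<exists>y. (atomic_gauge M \<P> (X / 2 ^ Suc n) y \<and> (Suc n = 0 \<longrightarrow> y = f)) \<and> atomic_gauge M \<A> (C * (X / 2 ^ n)) (\<lambda>x. h x - y x)"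
    by (intro exI[of _ "\<lambda>x. h x - g x"]) (auto simp: field_simps)
  qed
  then show ?thesis by auto
 qed
 then obtain F where F: "\<And>n. atomic_gauge M \<P> (X / 2^n) (F n)" "F 0 = f"
  "\<And>n. atomic_gauge M \<A> (C * (X / 2^n)) (\<lambda>x. F n x - F (Suc n) x)" by auto
 have s2: "(\<lambda>n. X / 2^n) sums (2 * X)"
  using sums_mult[OF geometric_sums[of "1/2::real"], of X] by (simp add: power_one_over field_simps)
 have "AE x in M. summable (\<lambda>n. norm (F n x))"
 proof (rule AE_summable_norm)
  show "integrable M (F n)" for n using atomic_gauge_integrable(1)[OF P F(1)] .
  show "summable (\<lambda>i. \<integral>x. cmod (F i x) \<partial>M)"
   by (rule summable_comparison_test'[of "\<lambda>n. X / 2^n" 0]) (use s2 atomic_gauge_integrable(2)[OF P F(1)] in \<open>auto simp: sums_iff\<close>)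
 qed
 then have S: "AE x in M. (\<lambda>n. F n x - F (Suc n) x) sums f x"
 proof eventually_elim
  case (elim x)
  \<comment> \<open>The integrals of the remainders are summable, so the remainders tend to 0 almost
    everywhere and the corrections telescope to \<open>f\<close>.\<close>
  then have "(\<lambda>n. F n x) \<longlonglongrightarrow> 0" by (rule tendsto_norm_zero_cancel[OF summable_LIMSEQ_zero])
  from telescope_sums'[OF this] show ?case using F(2) by simp
 qed
 have s3: "(\<lambda>n. C * (X / 2^n)) sums (C * (2 * X))" by (rule sums_mult[OF s2])
 show ?thesis
  by (rule atomic_gauge_suminf[OF A F(3) _ _ atomic_gauge_measurable[OF f] S]) (use s3 in \<open>auto simp: sums_iff\<close>)
qed

subsection \<open>Square integrable functions\<close>

definition square_int :: "'a measure => ('a => complex) => bool" where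
 "square_int M f \<longleftrightarrow> f \<in> borel_measurable M \<and> integrable M (\<lambda>x. (cmod (f x))\<^sup>2)"

abbreviation norm2 :: "'a measure => ('a => complex) => real" where
 "norm2 M f \<equiv> sqrt (LINT x|M. (cmod (f x))\<^sup>2)"

lemma square_int_measurable: "square_int M f ==> f \<in> borel_measurable M"
 unfolding square_int_def by blast

lemma Lq_2_iff: "f \<in> Lq M 2 \<longleftrightarrow> square_int M f"
 unfolding Lq_def Lq_norm_def square_int_def
 by (auto simp: powr_numeral infinity_ennreal_def split: if_splits)

lemma Lq_norm_2: "square_int M f ==> Lq_norm M 2 f = ennreal (norm2 M f)"
 unfolding Lq_norm_def square_int_def
 by (auto simp: powr_numeral powr_half_sqrt)

lemma square_int_add:
 assumes "square_int M f" "square_int M g" shows "square_int M (\<lambda>x. f x + g x)"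
 unfolding square_int_def
proof
 note [measurable] = square_int_measurable[OF assms(1)] square_int_measurable[OF assms(2)]
 show "(\<lambda>x. f x + g x) \<in> borel_measurable M" by measurable
 show "integrable M (\<lambda>x. (cmod (f x + g x))\<^sup>2)"
 proof (rule Bochner_Integration.integrable_bound)
  show "integrable M (\<lambda>x. 2 * (cmod (f x))\<^sup>2 + 2 * (cmod (g x))\<^sup>2)"
   using assms unfolding square_int_def by auto
  show "AE x in M. norm ((cmod (f x + g x))\<^sup>2) \<le> norm (2 * (cmod (f x))\<^sup>2 + 2 * (cmod (g x))\<^sup>2)"
  proof (intro AE_I2)
   fix x
   have "(cmod (f x + g x))\<^sup>2 \<le> (cmod (f x) + cmod (g x))\<^sup>2" by (intro power_mono norm_triangle_ineq) auto
   also have "\<dots> \<le> 2 * (cmod (f x))\<^sup>2 + 2 * (cmod (g x))\<^sup>2"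
    using sum_squares_bound[of "cmod (f x)" "cmod (g x)"] by (simp add: power2_sum)
   finally show "norm ((cmod (f x + g x))\<^sup>2) \<le> norm (2 * (cmod (f x))\<^sup>2 + 2 * (cmod (g x))\<^sup>2)" by simp
  qed
 qed measurable
qed

lemma square_int_scale: "square_int M f ==> square_int M (\<lambda>x. c * f x)"
 unfolding square_int_def by (auto simp: norm_mult power_mult_distrib)

lemma square_int_diff: "square_int M f ==> square_int M g ==> square_int M (\<lambda>x. f x - g x)"
 using square_int_add[of M f "\<lambda>x. -1 * g x"] square_int_scale[of M g "-1"] by simp

lemma square_int_bound:
 assumes "square_int M f" "g \<in> borel_measurable M" "AE x in M. cmod (g x) \<le> cmod (f x)"
 shows "square_int M g"
 unfolding square_int_def
proof
 show "integrable M (\<lambda>x. (cmod (g x))\<^sup>2)"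
 proof (rule Bochner_Integration.integrable_bound)
  show "integrable M (\<lambda>x. (cmod (f x))\<^sup>2)" using assms unfolding square_int_def by auto
  show "AE x in M. norm ((cmod (g x))\<^sup>2) \<le> norm ((cmod (f x))\<^sup>2)"
   using assms(3) by eventually_elim (auto intro: power_mono)
 qed (use assms in measurable)
qed (rule assms)

lemma Cauchy_Schwarz_integral:
 assumes "square_int M f" "square_int M g"
 shows "integrable M (\<lambda>x. f x * g x)" and "(LINT x|M. cmod (f x * g x)) \<le> norm2 M f * norm2 M g"
  and "cmod (LINT x|M. f x * g x) \<le> norm2 M f * norm2 M g"
proof -
 note [measurable] = square_int_measurable[OF assms(1)] square_int_measurable[OF assms(2)]
 have if2: "integrable M (\<lambda>x. (cmod (f x))\<^sup>2)" and ig2: "integrable M (\<lambda>x. (cmod (g x))\<^sup>2)"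
  using assms unfolding square_int_def by auto
 show i: "integrable M (\<lambda>x. f x * g x)"
 proof (rule Bochner_Integration.integrable_bound)
  show "integrable M (\<lambda>x. (cmod (f x))\<^sup>2 + (cmod (g x))\<^sup>2)" using if2 ig2 by auto
  show "AE x in M. norm (f x * g x) \<le> norm ((cmod (f x))\<^sup>2 + (cmod (g x))\<^sup>2)"
  proof (intro AE_I2)
   fix x
   have "0 \<le> cmod (f x) * cmod (g x)" by simp
   then show "norm (f x * g x) \<le> norm ((cmod (f x))\<^sup>2 + (cmod (g x))\<^sup>2)"
    using sum_squares_bound[of "cmod (f x)" "cmod (g x)"] by (simp add: norm_mult del: zero_le_mult_iff mult_nonneg_nonneg)
  qed
 qed measurable
 have "(\<integral>\<^sup>+x. ennreal (cmod (f x)) * ennreal (cmod (g x)) \<partial>M)\<^sup>2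
   \<le> (\<integral>\<^sup>+x. (ennreal (cmod (f x)))\<^sup>2 \<partial>M) * (\<integral>\<^sup>+x. (ennreal (cmod (g x)))\<^sup>2 \<partial>M)"
  by (rule Cauchy_Schwarz_nn_integral) auto
 moreover have "(\<integral>\<^sup>+x. ennreal (cmod (f x)) * ennreal (cmod (g x)) \<partial>M) = ennreal (LINT x|M. cmod (f x * g x))"
  using nn_integral_eq_integral[OF integrable_norm[OF i]] by (simp add: norm_mult ennreal_mult)
 moreover have "(\<integral>\<^sup>+x. (ennreal (cmod (f x)))\<^sup>2 \<partial>M) = ennreal (LINT x|M. (cmod (f x))\<^sup>2)"
  using nn_integral_eq_integral[OF if2] by (simp add: ennreal_power)
 moreover have "(\<integral>\<^sup>+x. (ennreal (cmod (g x)))\<^sup>2 \<partial>M) = ennreal (LINT x|M. (cmod (g x))\<^sup>2)"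
  using nn_integral_eq_integral[OF ig2] by (simp add: ennreal_power)
 ultimately have "(LINT x|M. cmod (f x * g x))\<^sup>2 \<le> (LINT x|M. (cmod (f x))\<^sup>2) * (LINT x|M. (cmod (g x))\<^sup>2)"
  by (simp add: ennreal_power ennreal_mult[symmetric])
 then show le: "(LINT x|M. cmod (f x * g x)) \<le> norm2 M f * norm2 M g"
  by (simp add: real_sqrt_mult[symmetric] real_le_rsqrt)
 have "cmod (LINT x|M. f x * g x) \<le> (LINT x|M. cmod (f x * g x))" by (rule integral_norm_bound)
 with le show "cmod (LINT x|M. f x * g x) \<le> norm2 M f * norm2 M g" by linarith
qed

lemma borel_measurable_cnj [measurable (raw)]:
 "f \<in> borel_measurable M ==> (\<lambda>x. cnj (f x)) \<in> borel_measurable M"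
 by (rule borel_measurable_continuous_on[OF continuous_on_cnj[OF continuous_on_id]])

lemma square_int_cnj: "square_int M f ==> square_int M (\<lambda>x. cnj (f x))"
 unfolding square_int_def by auto

text \<open>With \<open>t = 1\<close> and \<open>t = -1\<close> this yields the parallelogram law,
  and with small real \<open>t\<close> the first variation of the quadratic functional minimised
  below.\<close>

lemma norm2_expand:
 assumes f: "square_int M f" and h: "square_int M h"
 shows "(LINT x|M. (cmod (f x + of_real t * h x))\<^sup>2)
   = (LINT x|M. (cmod (f x))\<^sup>2) + 2 * t * Re (LINT x|M. cnj (f x) * h x) + t\<^sup>2 * (LINT x|M. (cmod (h x))\<^sup>2)"
proof -
 have i1: "integrable M (\<lambda>x. (cmod (f x))\<^sup>2)" and i2: "integrable M (\<lambda>x. (cmod (h x))\<^sup>2)"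
  using assms unfolding square_int_def by auto
 have i3: "integrable M (\<lambda>x. cnj (f x) * h x)"
  by (rule Cauchy_Schwarz_integral(1)[OF square_int_cnj[OF f] h])
 then have i4: "integrable M (\<lambda>x. Re (cnj (f x) * h x))" by (rule integrable_Re)
 have "(cmod (a + of_real t * b))\<^sup>2 = (cmod a)\<^sup>2 + 2 * t * Re (cnj a * b) + t\<^sup>2 * (cmod b)\<^sup>2" for a b
  by (simp add: cmod_power2) (simp add: power2_eq_square algebra_simps)
 then have "(LINT x|M. (cmod (f x + of_real t * h x))\<^sup>2)
  = (LINT x|M. ((cmod (f x))\<^sup>2 + 2 * t * Re (cnj (f x) * h x)) + t\<^sup>2 * (cmod (h x))\<^sup>2)" by simp
 also have "\<dots> = (LINT x|M. (cmod (f x))\<^sup>2 + 2 * t * Re (cnj (f x) * h x)) + (LINT x|M. t\<^sup>2 * (cmod (h x))\<^sup>2)"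
  by (rule Bochner_Integration.integral_add) (use i1 i2 i4 in auto)
 also have "(LINT x|M. (cmod (f x))\<^sup>2 + 2 * t * Re (cnj (f x) * h x)) = (LINT x|M. (cmod (f x))\<^sup>2) + (LINT x|M. 2 * t * Re (cnj (f x) * h x))"
  by (rule Bochner_Integration.integral_add) (use i1 i4 in auto)
 also have "(LINT x|M. 2 * t * Re (cnj (f x) * h x)) = 2 * t * (LINT x|M. Re (cnj (f x) * h x))" by (rule integral_mult_right_zero)
 also have "(LINT x|M. Re (cnj (f x) * h x)) = Re (LINT x|M. cnj (f x) * h x)" by (rule integral_Re[OF i3])
 finally show ?thesis by simp
qed

text \<open>The rate \<open>(1/4)^n\<close> leaves room for the weights \<open>2^n\<close>: the
  weighted squares of the increments are still summable in the mean, which gives pointwise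
  convergence without passing to a subsequence.\<close>

lemma L2_complete:
 fixes f :: "nat => 'a => complex"
 assumes f: "\<And>n. square_int M (f n)"
  and c: "\<And>n m. n \<le> m ==> (LINT x|M. (cmod (f m x - f n x))\<^sup>2) \<le> (1/4)^n"
 obtains g where "square_int M g" "\<And>n. (LINT x|M. (cmod (g x - f n x))\<^sup>2) \<le> (1/4)^n"
proof -
 have [measurable]: "f n \<in> borel_measurable M" for n by (rule square_int_measurable[OF f])
 have int: "integrable M (\<lambda>x. (cmod (f m x - f n x))\<^sup>2)" for m n
  using square_int_diff[OF f f] unfolding square_int_def by blast
 have "AE x in M. summable (\<lambda>n. norm (2^n * (cmod (f (Suc n) x - f n x))\<^sup>2))"
 proof (rule AE_summable_norm)
  show "integrable M (\<lambda>x. 2^n * (cmod (f (Suc n) x - f n x))\<^sup>2)" for n using int by simp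
  show "summable (\<lambda>n. \<integral>x. norm (2^n * (cmod (f (Suc n) x - f n x))\<^sup>2) \<partial>M)"
  proof (rule summable_comparison_test'[of "\<lambda>n. (1/2::real)^n" 0])
   fix n
   have "(LINT x|M. norm (2^n * (cmod (f (Suc n) x - f n x))\<^sup>2)) = 2^n * (LINT x|M. (cmod (f (Suc n) x - f n x))\<^sup>2)" by simp
   also have "\<dots> \<le> 2^n * (1/4)^n" by (intro mult_left_mono c) auto
   also have "\<dots> = (1/2)^n" by (simp add: power_mult_distrib[symmetric])
   finally show "norm (LINT x|M. norm (2^n * (cmod (f (Suc n) x - f n x))\<^sup>2)) \<le> (1/2)^n" by simp
  qed (simp add: summable_geometric)
 qed
 then have conv: "AE x in M. convergent (\<lambda>n. f n x)"
 proof eventually_elim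
  case (elim x)
  have "summable (\<lambda>n. f (Suc n) x - f n x)"
  proof (rule summable_norm_cancel, rule summable_comparison_test'[of "\<lambda>n. norm (2^n * (cmod (f (Suc n) x - f n x))\<^sup>2) + (1/2)^n" 0])
   show "summable (\<lambda>n. norm (2^n * (cmod (f (Suc n) x - f n x))\<^sup>2) + (1/2)^n)"
    by (intro summable_add elim summable_geometric) auto
   fix n
   define a where "a = cmod (f (Suc n) x - f n x)"
   \<comment> \<open>Multiplied out, this says \<open>a \<le> 2^n * a^2 + (1/2)^n\<close>, which
     bounds the increments by two summable sequences.\<close>
   have "0 \<le> (2^n * a - 1)\<^sup>2 + 2 ^ n * a" unfolding a_def by simp
   then have "a * 2^n \<le> (2^n * a\<^sup>2 + (1/2)^n) * 2^n"
    by (simp add: power2_eq_square algebra_simps power_mult_distrib[symmetric])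
   then show "norm (norm (f (Suc n) x - f n x)) \<le> norm (2^n * (cmod (f (Suc n) x - f n x))\<^sup>2) + (1/2)^n"
    unfolding a_def by simp
  qed
  then have "convergent (\<lambda>n. \<Sum>i<n. f (Suc i) x - f i x)" using summable_iff_convergent by blast
  then have "convergent (\<lambda>n. f n x - f 0 x)" by (simp add: sum_lessThan_telescope[of "\<lambda>n. f n x" for x])
  then obtain l where "(\<lambda>n. f n x - f 0 x) \<longlonglongrightarrow> l" unfolding convergent_def by blast
  then have "(\<lambda>n. (f n x - f 0 x) + f 0 x) \<longlonglongrightarrow> l + f 0 x" by (intro tendsto_intros)
  then show ?case unfolding convergent_def by auto
 qed
 define g where "g x = lim (\<lambda>n. f n x)" for x
 have [measurable]: "g \<in> borel_measurable M" unfolding g_def by measurable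
 have lim: "AE x in M. (\<lambda>n. f n x) \<longlonglongrightarrow> g x"
  using conv by eventually_elim (simp add: g_def convergent_LIMSEQ_iff)
 \<comment> \<open>Fatou's lemma in the index \<open>m\<close> transfers the Cauchy estimate to the
   limit.\<close>
 have fat: "(\<integral>\<^sup>+x. ennreal ((cmod (g x - f n x))\<^sup>2) \<partial>M) \<le> ennreal ((1/4)^n)" for n
 proof -
  have "(\<integral>\<^sup>+x. ennreal ((cmod (g x - f n x))\<^sup>2) \<partial>M) = (\<integral>\<^sup>+x. liminf (\<lambda>m. ennreal ((cmod (f m x - f n x))\<^sup>2)) \<partial>M)"
  proof (rule nn_integral_cong_AE)
   show "AE x in M. ennreal ((cmod (g x - f n x))\<^sup>2) = liminf (\<lambda>m. ennreal ((cmod (f m x - f n x))\<^sup>2))"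
    using lim
   proof eventually_elim
    case (elim x)
    then have "(\<lambda>m. ennreal ((cmod (f m x - f n x))\<^sup>2)) \<longlonglongrightarrow> ennreal ((cmod (g x - f n x))\<^sup>2)"
     by (intro tendsto_intros)
    from lim_imp_Liminf[OF _ this] show ?case by simp
   qed
  qed
  also have "\<dots> \<le> liminf (\<lambda>m. \<integral>\<^sup>+x. ennreal ((cmod (f m x - f n x))\<^sup>2) \<partial>M)"
   by (rule nn_integral_liminf) measurable
  also have "\<dots> \<le> ennreal ((1/4)^n)"
  proof -
   have "(\<integral>\<^sup>+x. ennreal ((cmod (f m x - f n x))\<^sup>2) \<partial>M) \<le> ennreal ((1/4)^n)" if "n \<le> m" for m
    using nn_integral_eq_integral[OF int[of m n]] c[OF that] by (simp add: ennreal_leI)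
   then have "eventually (\<lambda>m. (\<integral>\<^sup>+x. ennreal ((cmod (f m x - f n x))\<^sup>2) \<partial>M) \<le> ennreal ((1/4)^n)) sequentially"
    using eventually_sequentially by blast
   from Liminf_mono[OF this] have "liminf (\<lambda>m. \<integral>\<^sup>+x. ennreal ((cmod (f m x - f n x))\<^sup>2) \<partial>M) \<le> liminf (\<lambda>m. ennreal ((1/4)^n))" .
   then show ?thesis by (simp add: Liminf_const)
  qed
  finally show ?thesis .
 qed
 have gi: "integrable M (\<lambda>x. (cmod (g x - f n x))\<^sup>2)" for n
 proof (rule integrableI_bounded)
  show "(\<integral>\<^sup>+x. ennreal (norm ((cmod (g x - f n x))\<^sup>2)) \<partial>M) < \<infinity>"
   using fat[of n] by (simp add: order_le_less_trans)
 qed measurable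
 have "square_int M (\<lambda>x. g x - f n x)" for n unfolding square_int_def using gi by auto
 from square_int_add[OF this[of 0] f[of 0]] have "square_int M g" by simp
 moreover have "(LINT x|M. (cmod (g x - f n x))\<^sup>2) \<le> (1/4)^n" for n
  using fat[of n] nn_integral_eq_integral[OF gi[of n]] by (simp add: ennreal_le_iff)
 ultimately show ?thesis by (rule that)
qed

text \<open>The direct method: \<open>J\<close> is bounded below, a minimising sequence is Cauchy by
  the parallelogram law, and the vanishing of the first variation at the limit \<open>g\<close>
  identifies the real part of the functional. Testing with \<open>\<i> * h\<close> recovers the
  imaginary part. The pairing is bilinear, hence the representing function is the conjugate of
  \<open>g\<close>.\<close>

lemma L2_Riesz:
 fixes \<Phi> :: "('a => complex) => complex"
 assumes lin: "\<And>f g c. square_int M f ==> square_int M g ==> \<Phi> (\<lambda>x. f x + c * g x) = \<Phi> f + c * \<Phi> g"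
  and bd: "\<And>f. square_int M f ==> cmod (\<Phi> f) \<le> C * norm2 M f" and C: "0 \<le> C"
 obtains u where "square_int M u" "norm2 M u \<le> C" "\<And>f. square_int M f ==> \<Phi> f = (LINT x|M. f x * u x)"
proof -
 define n2 where "n2 f = (LINT x|M. (cmod (f x))\<^sup>2)" for f :: "'a => complex"
 define J where "J f = n2 f / 2 - Re (\<Phi> f)" for f
 have n20: "0 \<le> n2 f" for f unfolding n2_def by simp
 have J: "- (C\<^sup>2) / 2 \<le> J f" if "square_int M f" for f
 proof -
  have "Re (\<Phi> f) \<le> C * sqrt (n2 f)" using bd[OF that] complex_Re_le_cmod[of "\<Phi> f"] unfolding n2_def by linarith
  moreover have "2 * (C * sqrt (n2 f)) \<le> C\<^sup>2 + (sqrt (n2 f))\<^sup>2" using sum_squares_bound[of C "sqrt (n2 f)"] by simp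
  ultimately show ?thesis unfolding J_def using n20 by simp
 qed
 define I where "I = Inf (J ` Collect (square_int M))"
 have bdd: "bdd_below (J ` Collect (square_int M))" by (rule bdd_belowI2) (use J in auto)
 have ne: "Collect (square_int M) \<noteq> {}" by (auto simp: square_int_def intro!: exI[of _ "\<lambda>_. 0"])
 have I: "I \<le> J f" if "square_int M f" for f unfolding I_def by (rule cInf_lower) (use that bdd in auto)
 have "\<exists>f. square_int M f \<and> J f < I + e" if "e > 0" for e
 proof -
  have "Inf (J ` Collect (square_int M)) < I + e" using that unfolding I_def by simp
  then show ?thesis using cInf_less_iff[OF _ bdd] ne by auto
 qed
 \<comment> \<open>The eighth is chosen for \<open>par\<close>: 4 times two such errors is
   \<open>(1/4)^n\<close>, the rate expected by \<open>L2_complete\<close>.\<close>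
 then have "\<exists>f. square_int M f \<and> J f < I + (1/4)^n / 8" for n :: nat by simp
 then obtain f where f: "\<And>n. square_int M (f n)" and Jf: "\<And>n. J (f n) < I + (1/4)^n / 8" by metis
 \<comment> \<open>The squared distance equals 4 times \<open>J f + J g\<close> minus twice the
   value of \<open>J\<close> at the midpoint, and that value is at least \<open>I\<close>.\<close>
 have par: "n2 (\<lambda>x. f x - g x) \<le> 4 * (J f + J g - 2 * I)" if f: "square_int M f" and g: "square_int M g" for f g
 proof -
  have fm: "square_int M (\<lambda>x. f x / 2 + g x / 2)" using square_int_add[OF square_int_scale[OF f, of "1/2"] square_int_scale[OF g, of "1/2"]] by simp
  have z: "square_int M (\<lambda>_. 0)" by (simp add: square_int_def)
  have "\<Phi> (\<lambda>x. 0) = 0" using bd[OF z] by simp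
  then have "\<Phi> (\<lambda>x. f x / 2) = \<Phi> f / 2" using lin[OF z f, of "1/2"] by simp
  then have "\<Phi> (\<lambda>x. f x / 2 + g x / 2) = \<Phi> f / 2 + \<Phi> g / 2"
   using lin[OF square_int_scale[OF f, of "1/2"] g, of "1/2"] by simp
  then have Re: "Re (\<Phi> (\<lambda>x. f x / 2 + g x / 2)) = Re (\<Phi> f) / 2 + Re (\<Phi> g) / 2" by simp
  have e1: "n2 (\<lambda>x. f x - g x) = n2 f - 2 * Re (LINT x|M. cnj (f x) * g x) + n2 g"
   using norm2_expand[OF f g, of "-1"] unfolding n2_def by simp
  have e2: "n2 (\<lambda>x. f x + g x) = n2 f + 2 * Re (LINT x|M. cnj (f x) * g x) + n2 g"
   using norm2_expand[OF f g, of "1"] unfolding n2_def by simp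
  have e3: "n2 (\<lambda>x. f x / 2 + g x / 2) = n2 (\<lambda>x. f x + g x) / 4"
   unfolding n2_def by (simp add: add_divide_distrib[symmetric] norm_divide power_divide)
  show ?thesis using I[OF fm] e1 e2 e3 Re unfolding J_def by (simp add: field_simps)
 qed
 have cau: "(LINT x|M. (cmod (f m x - f n x))\<^sup>2) \<le> (1/4)^n" if "n \<le> m" for n m
 proof -
  have "(1/4::real)^m \<le> (1/4)^n" by (rule power_decreasing[OF that]) auto
  moreover have "x \<le> e" if "x \<le> 4 * (a + b - 2 * I)" "b < I + e / 8" "a < I + e' / 8" "e' \<le> e" for x a b e e' :: real
   using that by argo
  ultimately show ?thesis using par[OF f[of m] f[of n]] Jf[of n] Jf[of m] unfolding n2_def by blast
 qed
 obtain g where g: "square_int M g" "\<And>n. (LINT x|M. (cmod (g x - f n x))\<^sup>2) \<le> (1/4)^n"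
  by (rule L2_complete[of M f, OF f cau]) blast+
 have q0: "(\<lambda>n. (1/4::real)^n) \<longlonglongrightarrow> 0" by (rule LIMSEQ_power_zero) simp
 have ip: "(\<lambda>n. \<integral>x. cnj (f n x) * h x \<partial>M) \<longlonglongrightarrow> (LINT x|M. cnj (g x) * h x)" if h: "square_int M h" for h
 proof (rule LIM_zero_cancel, rule Lim_null_comparison)
  show "\<forall>\<^sub>F n in sequentially. norm ((LINT x|M. cnj (f n x) * h x) - (LINT x|M. cnj (g x) * h x)) \<le> sqrt ((1/4)^n) * norm2 M h"
  proof (intro always_eventually allI)
   fix n
   have "(LINT x|M. cnj (f n x) * h x) - (LINT x|M. cnj (g x) * h x) = (LINT x|M. cnj (f n x - g x) * h x)"
    by (subst Bochner_Integration.integral_diff[symmetric])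
     (auto intro!: Cauchy_Schwarz_integral square_int_cnj f g h simp: algebra_simps)
   also have "cmod \<dots> \<le> norm2 M (\<lambda>x. cnj (f n x - g x)) * norm2 M h"
    by (intro Cauchy_Schwarz_integral square_int_cnj square_int_diff f g h)
   also have "\<dots> = sqrt (LINT x|M. (cmod (g x - f n x))\<^sup>2) * norm2 M h" by (simp add: norm_minus_commute del: complex_cnj_diff)
   also have "\<dots> \<le> sqrt ((1/4)^n) * norm2 M h" by (intro mult_right_mono real_sqrt_le_mono g) auto
   finally show "norm ((LINT x|M. cnj (f n x) * h x) - (LINT x|M. cnj (g x) * h x)) \<le> sqrt ((1/4)^n) * norm2 M h" .
  qed
  show "(\<lambda>n. sqrt ((1/4)^n) * norm2 M h) \<longlonglongrightarrow> 0"
   using tendsto_mult[OF tendsto_real_sqrt[OF q0] tendsto_const[of "norm2 M h"]] by simp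
 qed
 have re: "Re (\<Phi> h) = Re (LINT x|M. cnj (g x) * h x)" if h: "square_int M h" for h
 proof -
  define D where "D = Re (LINT x|M. cnj (g x) * h x) - Re (\<Phi> h)"
  \<comment> \<open>\<open>I\<close> is at most \<open>J\<close> at \<open>f n + t * h\<close>,
    while \<open>J (f n)\<close> exceeds \<open>I\<close> by a vanishing error; the limit in
    \<open>n\<close> is the variational inequality at \<open>g\<close>.\<close>
  have key: "0 \<le> t * D + t\<^sup>2 / 2 * n2 h" for t
  proof (rule tendsto_le[OF trivial_limit_sequentially])
   show "(\<lambda>n. t * (Re (LINT x|M. cnj (f n x) * h x) - Re (\<Phi> h)) + t\<^sup>2 / 2 * n2 h) \<longlonglongrightarrow> t * D + t\<^sup>2 / 2 * n2 h"
    unfolding D_def by (intro tendsto_intros ip h)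
   show "(\<lambda>n. - ((1/4)^n)) \<longlonglongrightarrow> (0::real)" using tendsto_minus[OF q0] by simp
   show "\<forall>\<^sub>F n in sequentially. - ((1/4)^n) \<le> t * (Re (LINT x|M. cnj (f n x) * h x) - Re (\<Phi> h)) + t\<^sup>2 / 2 * n2 h"
   proof (intro always_eventually allI)
    fix n
    have "I \<le> J (\<lambda>x. f n x + of_real t * h x)" by (intro I square_int_add f square_int_scale h)
    moreover have "\<Phi> (\<lambda>x. f n x + of_real t * h x) = \<Phi> (f n) + of_real t * \<Phi> h" by (rule lin[OF f h])
    moreover define e where "e = (1/4::real)^n"
    moreover have "0 \<le> e" unfolding e_def by simp
    moreover have "J (f n) < I + e / 8" using Jf[of n] unfolding e_def .
    ultimately show "- ((1/4)^n) \<le> t * (Re (LINT x|M. cnj (f n x) * h x) - Re (\<Phi> h)) + t\<^sup>2 / 2 * n2 h"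
     unfolding e_def[symmetric] using norm2_expand[OF f[of n] h, of t] unfolding J_def n2_def by (simp add: field_simps)
   qed
  qed
  have "D = 0"
  proof (rule ccontr)
   assume "D \<noteq> 0"
   \<comment> \<open>This is the minimiser of the quadratic in \<open>t\<close>, with 1 added to the
     denominator to cover functions \<open>h\<close> that vanish almost everywhere.\<close>
   define t where "t = - D / (n2 h + 1)"
   have n1: "n2 h + 1 > 0" using n20[of h] by simp
   have p: "D\<^sup>2 / (n2 h + 1) > 0" using \<open>D \<noteq> 0\<close> n1 by simp
   have e1: "t * D = - (D\<^sup>2 / (n2 h + 1))" unfolding t_def by (simp add: power2_eq_square)
   have e2: "t\<^sup>2 * (n2 h + 1) = D\<^sup>2 / (n2 h + 1)"
    unfolding t_def using n1 by (simp add: power_divide) (simp add: power2_eq_square)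
   have "t\<^sup>2 / 2 * n2 h \<le> t\<^sup>2 / 2 * (n2 h + 1)" by (intro mult_left_mono) auto
   then have "t * D + t\<^sup>2 / 2 * n2 h < 0" using p e1 e2 by argo
   then show False using key[of t] by simp
  qed
  then show ?thesis unfolding D_def by simp
 qed
 have eq: "\<Phi> h = (LINT x|M. h x * cnj (g x))" if h: "square_int M h" for h
 proof -
  have z: "square_int M (\<lambda>_. 0)" by (simp add: square_int_def)
  have "\<Phi> (\<lambda>x. 0) = 0" using bd[OF z] by simp
  then have "\<Phi> (\<lambda>x. \<i> * h x) = \<i> * \<Phi> h" using lin[OF z h, of \<i>] by simp
  moreover have "Re (\<Phi> (\<lambda>x. \<i> * h x)) = Re (LINT x|M. cnj (g x) * (\<i> * h x))" by (rule re[OF square_int_scale[OF h]])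
  moreover have "(LINT x|M. cnj (g x) * (\<i> * h x)) = \<i> * (LINT x|M. cnj (g x) * h x)"
   by (simp add: mult.left_commute)
  ultimately have "Im (\<Phi> h) = Im (LINT x|M. cnj (g x) * h x)" by simp
  then have "\<Phi> h = (LINT x|M. cnj (g x) * h x)" using re[OF h] by (simp add: complex_eq_iff)
  then show ?thesis by (simp add: mult.commute)
 qed
 show ?thesis
 proof (rule that[OF square_int_cnj[OF g(1)] _ eq])
  have "\<Phi> g = (LINT x|M. of_real ((cmod (g x))\<^sup>2))" using eq[OF g(1)] by (simp add: complex_norm_square[symmetric])
  also have "\<dots> = of_real (n2 g)" unfolding n2_def by (rule integral_complex_of_real)
  \<comment> \<open>Testing the representation with \<open>g\<close> itself turns the bound on the
    functional into the bound on the representing function.\<close>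
  finally have "n2 g \<le> C * sqrt (n2 g)" using bd[OF g(1)] n20[of g] unfolding n2_def by simp
  then have le: "sqrt (n2 g) * sqrt (n2 g) \<le> C * sqrt (n2 g)" using n20[of g] by simp
  have "sqrt (n2 g) \<le> C"
  proof (cases "n2 g = 0")
   case False
   then show ?thesis using n20[of g] by (intro mult_right_le_imp_le[OF le]) auto
  qed (use C in simp)
  then show "norm2 M (\<lambda>x. cnj (g x)) \<le> C" unfolding n2_def by simp
 qed
qed

text \<open>Testing with the conjugate sign of \<open>F\<close> on the set \<open>E\<close> where
  \<open>c < cmod (F x)\<close> shows that the integral of \<open>cmod (F x) - c\<close> over
  \<open>E\<close> is at most 0, so \<open>E\<close> is null. With \<open>c = 0\<close> it serves
  for uniqueness, with positive \<open>c\<close> for turning duality estimates into pointwise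
  ones.\<close>

lemma AE_bound_by_testing:
 fixes F :: "'a => complex"
 assumes A: "A \<in> sets M" "emeasure M A < \<infinity>" and F: "set_integrable M A F" "F \<in> borel_measurable M"
  and test: "\<And>g. g \<in> borel_measurable M ==> (\<And>x. cmod (g x) \<le> indicator A x) ==>
    cmod (LINT x|M. F x * g x) \<le> c * (LINT x|M. cmod (g x))"
 shows "AE x in M. x \<in> A \<longrightarrow> cmod (F x) \<le> c"
proof -
 note F(2)[measurable] A(1)[measurable]
 define E where "E = {x \<in> space M. x \<in> A \<and> c < cmod (F x)}"
 have [measurable]: "E \<in> sets M" unfolding E_def by measurable
 have EA: "E \<subseteq> A" unfolding E_def by auto
 have Efin: "emeasure M E < \<infinity>" using emeasure_mono[OF EA A(1)] A(2) by (rule order_le_less_trans)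
 define g where "g x = indicator E x *\<^sub>R cnj (sgn (F x))" for x
 have [measurable]: "g \<in> borel_measurable M" unfolding g_def sgn_div_norm by measurable
 have "cmod (g x) \<le> indicator A x" for x unfolding g_def using EA by (auto simp: indicator_def norm_sgn)
 then have t: "cmod (LINT x|M. F x * g x) \<le> c * (LINT x|M. cmod (g x))" by (intro test) auto
 have Fg: "F x * g x = of_real (indicator E x * cmod (F x))" for x
  unfolding g_def by (auto simp: indicator_def sgn_div_norm scaleR_conv_of_real complex_norm_square[symmetric] power2_eq_square field_simps)
   (metis complex_norm_square mult.commute of_real_mult power2_eq_square)?
 have i1: "integrable M (\<lambda>x. indicator E x * cmod (F x))"
 proof (rule Bochner_Integration.integrable_bound)
  show "integrable M (\<lambda>x. indicator A x *\<^sub>R F x)" using F(1) unfolding set_integrable_def .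
  show "AE x in M. norm (indicator E x * cmod (F x)) \<le> norm (indicator A x *\<^sub>R F x)"
   using EA by (auto simp: indicator_def)
 qed measurable
 have iE: "integrable M (indicat_real E)" using Efin by (simp add: less_top)
 have gE: "AE x in M. cmod (g x) = indicator E x \<or> c < 0" unfolding g_def E_def by (auto simp: indicator_def norm_sgn)
 show ?thesis
 proof (cases "c < 0")
  case False
  then have "(LINT x|M. cmod (g x)) = (LINT x|M. indicator E x)" by (intro integral_cong_AE) (use gE in auto)
  moreover have "cmod (LINT x|M. F x * g x) = (LINT x|M. indicator E x * cmod (F x))"
   unfolding Fg integral_complex_of_real norm_of_real by (intro abs_of_nonneg integral_nonneg_AE) auto
  ultimately have "(LINT x|M. indicator E x * cmod (F x) - c * indicator E x) \<le> 0"
   using t i1 iE by (subst Bochner_Integration.integral_diff) auto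
  moreover have nn: "AE x in M. 0 \<le> indicator E x * cmod (F x) - c * indicator E x" unfolding E_def by (auto simp: indicator_def)
  ultimately have "(LINT x|M. indicator E x * cmod (F x) - c * indicator E x) = 0"
   using integral_nonneg_AE[OF nn] by linarith
  then have "AE x in M. indicator E x * cmod (F x) - c * indicator E x = 0"
   using integral_nonneg_eq_0_iff_AE[OF _ nn] i1 iE by auto
  then show ?thesis
   by (rule AE_mp) (auto simp: E_def indicator_def intro!: AE_I2 split: if_splits)
 next
  case True
  have g1: "(\<lambda>x. indicator A x :: complex) \<in> borel_measurable M" by measurable
  \<comment> \<open>For negative \<open>c\<close> the set \<open>E\<close> is all of
    \<open>A\<close>, and the indicator of \<open>A\<close> as test function forces \<open>A\<close>
    to be null.\<close>
  have "cmod (LINT x|M. F x * indicator A x) \<le> c * (LINT x|M. cmod (indicator A x))"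
   by (rule test[OF g1]) (auto simp: indicator_def)
  moreover have "(LINT x|M. cmod (indicator A x)) = measure M A"
  proof -
   have "cmod (indicator A x) = indicat_real A x" for x by (simp add: indicator_def)
   then show ?thesis using A by simp
  qed
  ultimately have "0 \<le> c * measure M A" by (smt (verit) norm_ge_zero)
  then have "measure M A = 0" using True by (simp add: zero_le_mult_iff measure_le_0_iff)
  then have "emeasure M A = 0" using A(2) by (simp add: emeasure_eq_ennreal_measure)
  then have "AE x in M. x \<notin> A" using A(1) by (simp add: AE_iff_null_sets[symmetric] null_sets_def AE_not_in)
  then show ?thesis by auto
 qed
qed

subsection \<open>Spaces of homogeneous type: balls and coverings\<close>

context homogeneous_type
begin

abbreviation B :: "'a => real => 'a set" where "B \<equiv> qball d"
abbreviation mu :: "'a => real => real" where "mu x r \<equiv> measure M (qball d x r)"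

lemma mem_B [simp]: "y \<in> B x r \<longleftrightarrow> d x y < r" by (simp add: qball_def)

lemma d_self [simp]: "d x x = 0" using dist_nonneg[of x x] dist_pos_iff[of x x] by auto

lemma d_nonneg [simp]: "0 \<le> d x y" by (rule dist_nonneg)

lemma kappa_pos: "0 < \<kappa>" using kappa_ge_1 by simp

lemma triangle_less: "d x y < r ==> d y z < s ==> d x z < \<kappa> * (r + s)"
 using quasi_triangle[of x z y] kappa_pos by (smt (verit) mult_le_cancel_left_pos)

lemma triangle_le: "d x y \<le> r ==> d y z \<le> s ==> d x z \<le> \<kappa> * (r + s)"
 using quasi_triangle[of x z y] kappa_pos by (smt (verit) mult_le_cancel_left_pos)

lemma B_mono: "r \<le> s ==> B x r \<subseteq> B x s" by auto

lemma B_subset: "d x y \<le> D ==> \<kappa> * (D + r) \<le> s ==> B y r \<subseteq> B x s"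
proof
 fix z assume "d x y \<le> D" "\<kappa> * (D + r) \<le> s" "z \<in> B y r"
 moreover from this have "\<kappa> * (d x y + d y z) < \<kappa> * (D + r)" using kappa_pos by simp
 ultimately show "z \<in> B x s" using quasi_triangle[of x z y] by simp
qed

text \<open>Balls of a general quasi-metric need not be open. The Hoelder regularity of
  \<open>d\<close> makes \<open>d x\<close> continuous, and this is what puts the balls into the
  Borel sets.\<close>

lemma qopen_ball: "qopen d (B x r)"
 unfolding qopen_def
proof
 fix y assume y: "y \<in> B x r"
 obtain \<alpha> C where \<alpha>: "0 < \<alpha>" "\<alpha> \<le> 1" "0 < C"
  and H: "\<And>x y z. \<bar>d x z - d y z\<bar> \<le> C * (d x z + d y z) powr (1 - \<alpha>) * d x y powr \<alpha>"
  using holder_regular by blast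
 define D where "D = \<kappa> * (1 + d y x) + d y x + 1"
 have D: "0 < D" unfolding D_def using kappa_pos by (intro add_nonneg_pos add_nonneg_nonneg mult_nonneg_nonneg) auto
 define \<epsilon> where "\<epsilon> = r - d x y"
 have e: "\<epsilon> > 0" using y unfolding \<epsilon>_def by simp
 \<comment> \<open>For \<open>d z y < s\<close> the sum of the two distances to \<open>x\<close>
   stays below \<open>D\<close>, thanks to the cap 1, and the second term makes the Hoelder bound
   equal to half of \<open>\<epsilon>\<close>.\<close>
 define s where "s = min 1 ((\<epsilon> / (2 * C * D powr (1 - \<alpha>))) powr (1 / \<alpha>))"
 have s: "0 < s" unfolding s_def using e \<alpha> D by simp
 have "B y s \<subseteq> B x r"
 proof
  fix z assume z: "z \<in> B y s"
  then have zy: "d z y < s" by (simp add: dist_sym)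
  have "d z x \<le> \<kappa> * (1 + d y x)" by (rule triangle_le[of z y]) (use zy s_def in auto)
  then have le: "d z x + d y x \<le> D" unfolding D_def by simp
  have "\<bar>d z x - d y x\<bar> \<le> C * (d z x + d y x) powr (1 - \<alpha>) * d z y powr \<alpha>" by (rule H)
  also have "\<dots> \<le> C * D powr (1 - \<alpha>) * ((\<epsilon> / (2 * C * D powr (1 - \<alpha>))) powr (1 / \<alpha>)) powr \<alpha>"
   using le \<alpha> zy unfolding s_def by (intro mult_mono mult_left_mono powr_mono2) auto
  also have "\<dots> = C * D powr (1 - \<alpha>) * (\<epsilon> / (2 * C * D powr (1 - \<alpha>)))" using \<alpha> e D by (simp add: powr_powr)
  also have "\<dots> = \<epsilon> / 2" using \<alpha> D by (simp add: field_simps)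
  finally have "d z x < d y x + \<epsilon>" using e by linarith
  then show "z \<in> B x r" unfolding \<epsilon>_def by (simp add: dist_sym)
 qed
 then show "\<exists>s>0. B y s \<subseteq> B x r" using s by blast
qed

lemma qopen_sets: "qopen d U ==> U \<in> sets M"
 unfolding sets_M openin_qtopology by (rule sigma_sets.Basic) auto

lemma B_sets [measurable]: "B x r \<in> sets M" by (rule qopen_sets[OF qopen_ball])

lemma measurable_d [measurable]: "d x \<in> borel_measurable M"
proof -
 have "{y \<in> space M. d x y < a} \<in> sets M" for a
  using B_sets[of x a] by (simp add: space_M qball_def)
 then show ?thesis by (simp add: borel_measurable_iff_less)
qed

text \<open>Extended by 0 outside the open set \<open>U\<close>, the function has preimages that are
  open sets, joined with the complement of \<open>U\<close> if they are to contain the value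
  0.\<close>

lemma measurable_if_locally_continuous:
 fixes f :: "'a => complex"
 assumes U: "qopen d U"
  and c: "\<And>y e. y \<in> U ==> 0 < e ==> \<exists>r>0. \<forall>z\<in>B y r. cmod (f z - f y) < e"
 shows "(\<lambda>z. indicator U z *\<^sub>R f z) \<in> borel_measurable M"
proof (rule borel_measurableI)
 fix S :: "complex set" assume S: "open S"
 have "qopen d (U \<inter> f -` S)"
  unfolding qopen_def
 proof
  fix y assume y: "y \<in> U \<inter> f -` S"
  then obtain e where e: "0 < e" "\<And>w. dist w (f y) < e ==> w \<in> S"
   using S unfolding open_dist by auto
  from c[of y e] y e(1) obtain r where r: "r > 0" "\<forall>z\<in>B y r. cmod (f z - f y) < e" by blast
  from U y obtain s where s: "s > 0" "B y s \<subseteq> U" unfolding qopen_def by blast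
  have "B y (min r s) \<subseteq> U \<inter> f -` S" using r(2) s(2) e(2) by (auto simp: dist_norm subset_iff)
  then show "\<exists>r>0. B y r \<subseteq> U \<inter> f -` S" using r s by (intro exI[of _ "min r s"]) auto
 qed
 then have 1: "U \<inter> f -` S \<in> sets M" by (rule qopen_sets)
 have 2: "UNIV - U \<in> sets M" using sets.compl_sets[OF qopen_sets[OF U]] by (simp add: space_M)
 have "(\<lambda>z. indicator U z *\<^sub>R f z) -` S \<inter> space M = (U \<inter> f -` S) \<union> (if 0 \<in> S then UNIV - U else {})"
  by (cases "0 \<in> S") (auto simp: space_M indicator_def of_bool_def split: if_splits)
 then show "(\<lambda>z. indicator U z *\<^sub>R f z) -` S \<inter> space M \<in> sets M" using 1 2 by auto
qed

lemma emeasure_B: "emeasure M (B x r) = ennreal (mu x r)"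
proof (cases "0 < r")
 case True
 then show ?thesis using ball_finite[of r x] by (simp add: emeasure_eq_ennreal_measure less_top[symmetric])
next
 case False
 then have "B x r = {}" using order_trans[OF _ d_nonneg] by (auto simp: qball_def not_less intro: order_trans)
 then show ?thesis by simp
qed

lemma emeasure_B_finite [simp]: "emeasure M (B x r) < top" "emeasure M (B x r) \<noteq> top"
 by (simp_all add: emeasure_B)

lemma mu_pos: "0 < r ==> 0 < mu x r"
 using ball_pos[of r x] by (simp add: emeasure_B)

lemma fmeasurable_sub: "A \<in> sets M ==> A \<subseteq> B x r ==> A \<in> fmeasurable M"
 by (rule fmeasurableI2[of "B x r"]) (auto intro!: fmeasurableI simp: less_top)

lemma measure_sub: "A \<in> sets M ==> A \<subseteq> A' ==> A' \<subseteq> B x r ==> A' \<in> sets M ==> measure M A \<le> measure M A'"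
 by (intro measure_mono_fmeasurable fmeasurable_sub[of A' x r])

lemma mu_mono: "r \<le> s ==> mu x r \<le> mu x s"
 by (rule measure_sub[of _ _ x s]) auto

definition Cd :: real where
 "Cd = (SOME C. C > 1 \<and> (\<forall>x r. 0 < r \<longrightarrow> mu x (2 * r) \<le> C * mu x r))"

lemma Cd: "1 < Cd" "0 < r ==> mu x (2 * r) \<le> Cd * mu x r"
 using someI_ex[OF doubling] unfolding Cd_def by blast+

definition dbl :: "real => real" where "dbl l = Cd ^ nat \<lceil>log 2 l\<rceil>"

lemma dbl_ge_1: "1 \<le> dbl l" unfolding dbl_def using Cd(1) by simp

lemma dbl_pos: "0 < dbl l" using dbl_ge_1[of l] by simp

lemma mu_scale:
 assumes "1 \<le> l" "0 < r" shows "mu x (l * r) \<le> dbl l * mu x r"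
proof -
 have it: "mu x (2^n * r) \<le> Cd^n * mu x r" for n
 proof (induction n)
  case (Suc n)
  have "mu x (2^Suc n * r) \<le> Cd * mu x (2^n * r)" using Cd(2)[of "2^n * r" x] assms by (simp add: mult.assoc)
  also have "\<dots> \<le> Cd * (Cd^n * mu x r)" using Suc Cd(1) by (intro mult_left_mono) auto
  finally show ?case by (simp add: mult.assoc)
 qed simp
 have "l = 2 powr (log 2 l)" using assms by simp
 also have "\<dots> \<le> 2 powr (real (nat \<lceil>log 2 l\<rceil>))" by (intro powr_mono) linarith+
 also have "\<dots> = 2 ^ nat \<lceil>log 2 l\<rceil>" by (simp add: powr_realpow)
 finally have "mu x (l * r) \<le> mu x (2 ^ nat \<lceil>log 2 l\<rceil> * r)" using assms by (intro mu_mono mult_right_mono) auto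
 also have "\<dots> \<le> dbl l * mu x r" unfolding dbl_def by (rule it)
 finally show ?thesis .
qed

lemma mu_compare:
 assumes "d y x \<le> D" "\<kappa> * (D + r) \<le> l * s" "1 \<le> l" "0 < s"
 shows "mu x r \<le> dbl l * mu y s"
proof -
 have "mu x r \<le> mu y (l * s)" by (rule measure_sub[of _ _ y "l * s"]) (use B_subset[OF assms(1,2)] in auto)
 also have "\<dots> \<le> dbl l * mu y s" by (rule mu_scale[OF assms(3,4)])
 finally show ?thesis .
qed

text \<open>Zorn's lemma replaces the greedy selection by decreasing size, since the radii form an
  arbitrary bounded set of reals.\<close>

lemma vitali_maximal:
 assumes t: "\<And>x. x \<in> A ==> 0 < t x \<and> t x \<le> T"
 obtains J where "J \<subseteq> A" "disjoint_family_on (\<lambda>j. B j (t j)) J"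
  "\<And>x. x \<in> A ==> \<exists>j\<in>J. B x (t x) \<inter> B j (t j) \<noteq> {} \<and> t x \<le> 2 * t j"
proof -
 define mt where "mt x j \<longleftrightarrow> B x (t x) \<inter> B j (t j) \<noteq> {}" for x j
 \<comment> \<open>The second condition keeps the selection honest: a ball may be touched by
   \<open>G\<close> only if some touching member has at least half its radius. It is stable under
   unions of chains because a witness, once present, stays.\<close>
 define \<Omega> where "\<Omega> = {G. G \<subseteq> A \<and> disjoint_family_on (\<lambda>j. B j (t j)) G \<and>
   (\<forall>x\<in>A. (\<exists>j\<in>G. mt x j) \<longrightarrow> (\<exists>j\<in>G. mt x j \<and> t x \<le> 2 * t j))}"
 have "\<exists>G\<in>\<Omega>. \<forall>X\<in>\<Omega>. G \<subseteq> X \<longrightarrow> X = G"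
 proof (rule subset_Zorn')
  fix C assume C: "subset.chain \<Omega> C"
  then have CO: "C \<subseteq> \<Omega>" and ch: "\<And>X Y. X \<in> C ==> Y \<in> C ==> X \<subseteq> Y \<or> Y \<subseteq> X"
   unfolding subset_chain_def by auto
  have "disjoint_family_on (\<lambda>j. B j (t j)) (\<Union>C)"
   unfolding disjoint_family_on_def
  proof (intro ballI impI)
   fix m n assume "m \<in> \<Union>C" "n \<in> \<Union>C" "m \<noteq> n"
   then obtain G where "G \<in> C" "m \<in> G" "n \<in> G" using ch by blast
   then show "B m (t m) \<inter> B n (t n) = {}"
    using CO \<open>m \<noteq> n\<close> unfolding \<Omega>_def disjoint_family_on_def by blast
  qed
  then show "\<Union>C \<in> \<Omega>" using CO unfolding \<Omega>_def by blast
 qed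
 then obtain G where G: "G \<in> \<Omega>" and mx: "\<And>X. X \<in> \<Omega> ==> G \<subseteq> X ==> X = G" by blast
 define W where "W = {x \<in> A. \<forall>j\<in>G. \<not> mt x j}"
 have "W = {}"
 proof (rule ccontr)
  assume W: "W \<noteq> {}"
  define s where "s = Sup (t ` W)"
  have bdd: "bdd_above (t ` W)" by (rule bdd_aboveI2[of _ _ T]) (use t W_def in auto)
  have up: "t x \<le> s" if "x \<in> W" for x unfolding s_def by (rule cSup_upper) (use that bdd in auto)
  obtain w where "w \<in> W" using W by blast
  then have "0 < s" using up[of w] t[of w] unfolding W_def by auto
  then have "s / 2 < s" by simp
  \<comment> \<open>Among the balls untouched by \<open>G\<close> one of nearly maximal radius can
    be added: whatever it newly touches was itself untouched and so has at most twice its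
    radius.\<close>
  then obtain x0 where x0: "x0 \<in> W" "s / 2 < t x0"
   using less_cSup_iff[OF _ bdd, of "s/2"] W unfolding s_def by auto
  have x0A: "x0 \<in> A" using x0 unfolding W_def by simp
  have "x0 \<in> B x0 (t x0)" using t[OF x0A] by simp
  then have mtx: "mt x0 x0" unfolding mt_def by blast
  have "insert x0 G \<in> \<Omega>"
  proof -
   have "disjoint_family_on (\<lambda>j. B j (t j)) (insert x0 G)"
    using G x0(1) unfolding \<Omega>_def W_def mt_def disjoint_family_on_def by (auto simp: Int_commute)
   moreover have "\<exists>j\<in>insert x0 G. mt x j \<and> t x \<le> 2 * t j" if x: "x \<in> A" and m: "\<exists>j\<in>insert x0 G. mt x j" for x
   proof (cases "\<exists>j\<in>G. mt x j")
    case True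
    then show ?thesis using G x unfolding \<Omega>_def by blast
   next
    case False
    then have "x \<in> W" using x unfolding W_def by blast
    from up[OF this] x0(2) have "t x \<le> 2 * t x0" by linarith
    moreover have "mt x x0" using False m by blast
    ultimately show ?thesis by blast
   qed
   ultimately show ?thesis using G x0A unfolding \<Omega>_def by blast
  qed
  then have "x0 \<in> G" using mx[of "insert x0 G"] by blast
  then show False using x0(1) mtx unfolding W_def by blast
 qed
 show ?thesis
 proof (rule that[of G])
  show "G \<subseteq> A" "disjoint_family_on (\<lambda>j. B j (t j)) G" using G unfolding \<Omega>_def by auto
  fix x assume x: "x \<in> A"
  with \<open>W = {}\<close> have "\<exists>j\<in>G. mt x j" unfolding W_def by blast
  then show "\<exists>j\<in>G. B x (t x) \<inter> B j (t j) \<noteq> {} \<and> t x \<le> 2 * t j"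
   using G x unfolding \<Omega>_def mt_def by blast
 qed
qed

text \<open>The enlargement factor of the Vitali covering: when two balls meet and
  \<open>t y \<le> 2 * t j\<close>, their centres are within \<open>3 * \<kappa> * t j\<close>,
  which is at most \<open>V * t j\<close>.\<close>

definition V :: real where "V = 5 * \<kappa>\<^sup>2"

lemma V_ge: "5 \<le> V" "1 \<le> V" "0 < V"
proof -
 have "1 \<le> \<kappa>\<^sup>2" using kappa_ge_1 by (rule one_le_power)
 then show "5 \<le> V" "1 \<le> V" "0 < V" unfolding V_def by linarith+
qed

text \<open>Inside a ball of finite measure only finitely many disjoint balls can have measure above
  \<open>1 / real (Suc n)\<close>, and every ball has positive measure.\<close>

lemma countable_disjoint_balls:
 assumes dis: "disjoint_family_on (\<lambda>j. B j (t j)) J" and sub: "\<And>j. j \<in> J ==> 0 < t j \<and> B j (t j) \<subseteq> B z R"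
 shows "countable J"
proof -
 define Jn where "Jn n = {j \<in> J. mu j (t j) > 1 / real (Suc n)}" for n
 have "finite (Jn n)" for n
 proof (rule conjunct1[OF finite_if_finite_subsets_card_bdd[of "Jn n" "nat \<lfloor>real (Suc n) * mu z R\<rfloor>"]])
  fix F assume F: "F \<subseteq> Jn n" "finite F"
  have "real (card F) * (1 / real (Suc n)) \<le> (\<Sum>j\<in>F. mu j (t j))"
   by (rule sum_bounded_below) (use F in \<open>auto simp: Jn_def less_imp_le\<close>)
  also have "\<dots> = measure M (\<Union>j\<in>F. B j (t j))"
   by (rule measure_finite_Union[symmetric]) (use F dis in \<open>auto simp: Jn_def disjoint_family_on_def subset_iff\<close>)
  also have "\<dots> \<le> mu z R"
   by (rule measure_sub[of _ _ z R]) (use F sub in \<open>auto simp: Jn_def subset_iff intro!: sets.finite_UN\<close>)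
  finally have "real (card F) \<le> real (Suc n) * mu z R" by (simp add: field_simps)
  then show "card F \<le> nat \<lfloor>real (Suc n) * mu z R\<rfloor>" by (simp add: le_nat_floor)
 qed
 then have "countable (\<Union>n. Jn n)" by (intro countable_UN) (auto intro: countable_finite)
 moreover have "J \<subseteq> (\<Union>n. Jn n)"
 proof
  fix j assume j: "j \<in> J"
  then have "0 < mu j (t j)" using sub mu_pos by blast
  then obtain n where "1 / real (Suc n) < mu j (t j)" using nat_approx_posE by metis
  then show "j \<in> (\<Union>n. Jn n)" using j unfolding Jn_def by blast
 qed
 ultimately show ?thesis by (rule countable_subset[rotated])
qed

text \<open>The enlarged balls are required to cover the centres, that is the points of
  \<open>A\<close>. The selected balls are indexed by a set of naturals, finite or not, so that
  later sums are series padded with zeros.\<close>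

lemma vitali_cover:
 assumes t: "\<And>x. x \<in> A ==> 0 < t x \<and> t x \<le> T" and A: "A \<subseteq> B z R"
 obtains I :: "nat set" and x where "\<And>i. i \<in> I ==> x i \<in> A"
  "disjoint_family_on (\<lambda>i. B (x i) (t (x i))) I"
  "A \<subseteq> (\<Union>i\<in>I. B (x i) (V * t (x i)))"
proof -
 obtain J where J: "J \<subseteq> A" "disjoint_family_on (\<lambda>j. B j (t j)) J"
  "\<And>x. x \<in> A ==> \<exists>j\<in>J. B x (t x) \<inter> B j (t j) \<noteq> {} \<and> t x \<le> 2 * t j"
  using vitali_maximal[of A t T] t by blast
 have "countable J"
 proof (rule countable_disjoint_balls[OF J(2)])
  fix j assume "j \<in> J"
  then have j: "j \<in> A" using J by blast
  have "B j (t j) \<subseteq> B z (\<kappa> * (R + T))"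
   by (rule B_subset[of z j R]) (use j A t[OF j] kappa_pos in \<open>auto simp: subset_iff less_imp_le\<close>)
  then show "0 < t j \<and> B j (t j) \<subseteq> B z (\<kappa> * (R + T))" using t[OF j] by blast
 qed
 then have inj: "inj_on (to_nat_on J) J" by (rule inj_on_to_nat_on)
 define I where "I = to_nat_on J ` J"
 define x where "x = the_inv_into J (to_nat_on J)"
 have xJ: "x i \<in> J" if "i \<in> I" for i
  using that inj unfolding I_def x_def by (auto simp: the_inv_into_f_f)
 have xinj: "inj_on x I" unfolding I_def x_def by (rule inj_on_the_inv_into[OF inj])
 have xim: "x ` I = J" unfolding I_def x_def using inj by (force simp: the_inv_into_f_f image_iff)
 show ?thesis
 proof (rule that[of I x])
  show "x i \<in> A" if "i \<in> I" for i using xJ[OF that] J(1) by blast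
  show "disjoint_family_on (\<lambda>i. B (x i) (t (x i))) I"
   unfolding disjoint_family_on_def
  proof (intro ballI impI)
   fix m n assume "m \<in> I" "n \<in> I" "m \<noteq> n"
   then have "x m \<noteq> x n" "x m \<in> J" "x n \<in> J" using xJ xinj by (auto dest: inj_onD)
   then show "B (x m) (t (x m)) \<inter> B (x n) (t (x n)) = {}" using J(2) unfolding disjoint_family_on_def by blast
  qed
  show "A \<subseteq> (\<Union>i\<in>I. B (x i) (V * t (x i)))"
  proof
   fix y assume y: "y \<in> A"
   obtain j where j: "j \<in> J" "B y (t y) \<inter> B j (t j) \<noteq> {}" "t y \<le> 2 * t j" using J(3)[OF y] by blast
   then obtain w where w: "d j w < t j" "d w y < t y" by (auto simp: dist_sym)
   have tj: "0 < t j" using j(1) J(1) t by blast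
   have "d j y < \<kappa> * (t j + t y)" by (rule triangle_less[OF w])
   also have "\<dots> \<le> \<kappa> * (3 * t j)" using j(3) kappa_pos by (intro mult_left_mono) auto
   also have "\<dots> \<le> V * t j"
   proof -
    have "\<kappa> * 3 \<le> \<kappa> * (5 * \<kappa>)" using kappa_ge_1 by (intro mult_left_mono) auto
    then have "\<kappa> * 3 * t j \<le> V * t j" unfolding V_def power2_eq_square using tj by (intro mult_right_mono) auto
    then show ?thesis by (simp add: mult.assoc)
   qed
   finally have "y \<in> B j (V * t j)" by simp
   then show "y \<in> (\<Union>i\<in>I. B (x i) (V * t (x i)))" using j(1) xim by blast
  qed
 qed
qed

lemma disjoint_measures:
 fixes D :: "nat => 'a set"
 assumes dis: "disjoint_family_on D I" and s: "\<And>i. i \<in> I ==> D i \<in> sets M \<and> D i \<subseteq> E"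
  and E: "E \<in> fmeasurable M"
 shows "summable (\<lambda>i. if i \<in> I then measure M (D i) else 0)"
  and "(\<Sum>i. if i \<in> I then measure M (D i) else 0) \<le> measure M E"
  and "(\<Sum>i. if i \<in> I then measure M (D i) else 0) = measure M (\<Union>i\<in>I. D i)"
proof -
 define D' where "D' i = (if i \<in> I then D i else {})" for i
 have 1: "range D' \<subseteq> sets M" "\<And>i. D' i \<in> sets M" unfolding D'_def using s by auto
 have 2: "disjoint_family D'" using dis unfolding D'_def disjoint_family_on_def by auto
 have U: "(\<Union>i. D' i) \<subseteq> E" "(\<Union>i. D' i) = (\<Union>i\<in>I. D i)" unfolding D'_def using s by (auto split: if_splits)
 have 3: "(\<Union>i. D' i) \<in> fmeasurable M"
  using U(1) 1 E by (intro fmeasurableI2[OF E]) auto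
 have "(\<lambda>i. measure M (D' i)) sums measure M (\<Union>i. D' i)"
  by (rule measure_UNION[OF 1(1) 2]) (use 3 in \<open>auto simp: fmeasurable_def less_top\<close>)
 moreover have "(\<lambda>i. measure M (D' i)) = (\<lambda>i. if i \<in> I then measure M (D i) else 0)" unfolding D'_def by auto
 ultimately have S: "(\<lambda>i. if i \<in> I then measure M (D i) else 0) sums measure M (\<Union>i. D' i)" by simp
 then show "summable (\<lambda>i. if i \<in> I then measure M (D i) else 0)" by (simp add: sums_iff)
 show "(\<Sum>i. if i \<in> I then measure M (D i) else 0) = measure M (\<Union>i\<in>I. D i)" using S U(2) by (simp add: sums_iff)
 have "measure M (\<Union>i. D' i) \<le> measure M E" using U(1) 1 E 3 by (intro measure_mono_fmeasurable) auto
 then show "(\<Sum>i. if i \<in> I then measure M (D i) else 0) \<le> measure M E" using S by (simp add: sums_iff)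
qed

text \<open>A weak form of the Lebesgue density theorem, for which the covering lemma and outer regularity
 suffice.\<close>

lemma no_density_null:
 assumes A: "A \<in> sets M" "A \<subseteq> B z R" and \<theta>: "\<theta> < 1" and r0: "0 < r0"
  and dens: "\<And>x t. x \<in> A ==> 0 < t ==> t \<le> r0 ==> measure M (A \<inter> B x t) \<le> \<theta> * mu x t"
 shows "emeasure M A = 0"
proof (rule ccontr)
 assume ne: "emeasure M A \<noteq> 0"
 have Af: "A \<in> fmeasurable M" by (rule fmeasurable_sub[OF A])
 define m where "m = measure M A"
 have em: "emeasure M A = ennreal m" unfolding m_def by (rule emeasure_eq_measure2[OF Af])
 then have m: "0 < m" using ne by (metis ennreal_0 measure_nonneg m_def order_le_less)
 \<comment> \<open>The selected balls lie in \<open>O'\<close> and have a share of at least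
   \<open>1 - \<theta>\<close> outside \<open>A\<close>, so their total measure times
   \<open>1 - \<theta>\<close> stays below \<open>\<epsilon>\<close>. On the other hand their
   enlargements cover \<open>A\<close>. This value of \<open>\<epsilon>\<close> makes the two facts
   contradictory.\<close>
 define \<epsilon> where "\<epsilon> = (1 - \<theta>) * m / dbl V"
 have e: "0 < \<epsilon>" unfolding \<epsilon>_def using \<theta> m dbl_pos by simp
 have "emeasure M A < emeasure M A + ennreal \<epsilon>" using em e m by (simp add: ennreal_less_iff flip: ennreal_plus)
 then obtain O' where O': "qopen d O'" "A \<subseteq> O'" "emeasure M O' < emeasure M A + ennreal \<epsilon>"
  unfolding outer_regular[OF A(1)] INF_less_iff by (auto simp: openin_qtopology)
 have O's: "O' \<in> sets M" by (rule qopen_sets[OF O'(1)])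
 have "emeasure M O' < top" using O'(3) em by (simp add: order_less_trans)
 then have O'f: "O' \<in> fmeasurable M" using O's by (intro fmeasurableI) (auto simp: less_top)
 have mO: "measure M O' < m + \<epsilon>"
  using O'(3) e m unfolding em emeasure_eq_measure2[OF O'f] by (simp flip: ennreal_plus add: ennreal_less_iff)
 have "\<forall>x\<in>A. \<exists>s>0. B x s \<subseteq> O'" using O' unfolding qopen_def by blast
 then obtain s where s: "\<And>x. x \<in> A ==> 0 < s x \<and> B x (s x) \<subseteq> O'" by metis
 define t where "t x = min (s x) r0" for x
 have t: "0 < t x \<and> t x \<le> r0" "B x (t x) \<subseteq> O'" if "x \<in> A" for x
  using s[OF that] r0 B_mono[of "t x" "s x" x] unfolding t_def by auto
 obtain I :: "nat set" and x where I: "\<And>i. i \<in> I ==> x i \<in> A"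
  "disjoint_family_on (\<lambda>i. B (x i) (t (x i))) I" "A \<subseteq> (\<Union>i\<in>I. B (x i) (V * t (x i)))"
  by (rule vitali_cover[of A t r0 z R, OF t(1) A(2)]) blast+
 define b where "b i = (if i \<in> I then mu (x i) (t (x i)) else 0)" for i
 have sb: "summable b" unfolding b_def
  by (rule disjoint_measures(1)[OF I(2) _ O'f]) (use t(2) I(1) in auto)
 have b0: "0 \<le> b i" for i unfolding b_def by simp
 have "m \<le> dbl V * (\<Sum>i. b i)"
 proof -
  define E where "E i = (if i \<in> I then B (x i) (V * t (x i)) else {})" for i
  have Es: "E i \<in> sets M" for i unfolding E_def by auto
  have le: "measure M (E i) \<le> dbl V * b i" for i
   unfolding E_def b_def using mu_scale[OF V_ge(2)] t(1) I(1) by auto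
  have AE': "A \<subseteq> (\<Union>i. E i)" using I(3) unfolding E_def by (auto simp: subset_iff)
  have "emeasure M A \<le> emeasure M (\<Union>i. E i)" using AE' Es by (intro emeasure_mono) auto
  also have "\<dots> \<le> (\<Sum>i. emeasure M (E i))" by (rule emeasure_subadditive_countably) (use Es in auto)
  also have "\<dots> \<le> (\<Sum>i. ennreal (dbl V * b i))"
  proof (intro suminf_le summableI)
   fix i
   have "emeasure M (E i) = ennreal (measure M (E i))" unfolding E_def by (auto simp: emeasure_B)
   then show "emeasure M (E i) \<le> ennreal (dbl V * b i)" using le[of i] by (simp add: ennreal_leI)
  qed
  also have "\<dots> = ennreal (\<Sum>i. dbl V * b i)"
   by (rule suminf_ennreal2) (auto intro!: summable_mult sb mult_nonneg_nonneg less_imp_le[OF dbl_pos] simp: b0)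
  also have "(\<Sum>i. dbl V * b i) = dbl V * (\<Sum>i. b i)" by (rule suminf_mult[OF sb])
  finally have "ennreal m \<le> ennreal (dbl V * (\<Sum>i. b i))" unfolding em .
  moreover have "0 \<le> dbl V * (\<Sum>i. b i)" by (intro mult_nonneg_nonneg suminf_nonneg[OF sb] b0 less_imp_le[OF dbl_pos])
  ultimately show ?thesis by (simp add: ennreal_le_iff)
 qed
 moreover have "(1 - \<theta>) * (\<Sum>i. b i) \<le> measure M (O' - A)"
 proof -
  have OA: "O' - A \<in> fmeasurable M" using O'f A(1) by (rule fmeasurable_Diff)
  have dis: "disjoint_family_on (\<lambda>i. B (x i) (t (x i)) - A) I"
   using I(2) unfolding disjoint_family_on_def by blast
  have sub: "B (x i) (t (x i)) - A \<in> sets M \<and> B (x i) (t (x i)) - A \<subseteq> O' - A" if "i \<in> I" for i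
   using t(2)[OF I(1)[OF that]] A(1) by auto
  note dm = disjoint_measures[OF dis sub OA]
  have "(1 - \<theta>) * b i \<le> (if i \<in> I then measure M (B (x i) (t (x i)) - A) else 0)" for i
  proof (cases "i \<in> I")
   case True
   have "mu (x i) (t (x i)) = measure M (A \<inter> B (x i) (t (x i))) + measure M (B (x i) (t (x i)) - A)"
   proof -
    have "measure M (B (x i) (t (x i)) - A \<inter> B (x i) (t (x i))) = mu (x i) (t (x i)) - measure M (A \<inter> B (x i) (t (x i)))"
     by (rule measurable_measure_Diff) (use fmeasurable_sub[of "B (x i) (t (x i))" "x i" "t (x i)"] A(1) in auto)
    moreover have "B (x i) (t (x i)) - A \<inter> B (x i) (t (x i)) = B (x i) (t (x i)) - A" by blast
    ultimately show ?thesis by simp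
   qed
   then show ?thesis using dens[of "x i" "t (x i)"] t(1)[OF I(1)[OF True]] I(1)[OF True] True
    unfolding b_def by (simp add: algebra_simps)
  qed (simp add: b_def)
  then have "(\<Sum>i. (1 - \<theta>) * b i) \<le> (\<Sum>i. if i \<in> I then measure M (B (x i) (t (x i)) - A) else 0)"
   by (intro suminf_le summable_mult sb dm(1)) auto
  then show ?thesis using dm(2) suminf_mult[OF sb, of "1 - \<theta>"] by linarith
 qed
 moreover have "measure M (O' - A) = measure M O' - m"
  unfolding m_def by (rule measurable_measure_Diff) (use O'f A(1) O'(2) in auto)
 ultimately have "(1 - \<theta>) * (\<Sum>i. b i) < \<epsilon>" "m \<le> dbl V * (\<Sum>i. b i)" using mO by auto
 moreover have "(1 - \<theta>) * m \<le> (1 - \<theta>) * (dbl V * (\<Sum>i. b i))" using calculation(2) \<theta> by (intro mult_left_mono) auto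
 ultimately show False unfolding \<epsilon>_def using dbl_pos[of V] by (simp add: field_simps)
qed

end

subsection \<open>Decomposition of p-atoms\<close>

lemma convex_powr_bound:
 fixes p u :: real
 assumes "1 < p" "0 \<le> u" shows "u \<le> u powr p / p + (1 - 1 / p)"
proof -
 define q where "q = p / (p - 1)"
 have q: "1 < q" "1 / p + 1 / q = 1" unfolding q_def using assms by (auto simp: field_simps)
 have "u * 1 \<le> u powr p / p + 1 powr q / q" using Youngs_inequality[OF assms(1) q(1) q(2) assms(2), of 1] by simp
 also have "1 powr q / q = 1 - 1 / p" using q(2) by simp
 finally show ?thesis by simp
qed

lemma powr_sum_le:
 fixes a b p :: real
 assumes "0 \<le> a" "0 \<le> b" "0 \<le> p" shows "(a + b) powr p \<le> 2 powr p * (a powr p + b powr p)"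
proof -
 have "(a + b) powr p \<le> (2 * max a b) powr p" using assms by (intro powr_mono2) auto
 also have "\<dots> = 2 powr p * (max a b) powr p" using assms by (simp add: powr_mult)
 also have "\<dots> \<le> 2 powr p * (a powr p + b powr p)" by (intro mult_left_mono) (auto simp: max_def)
 finally show ?thesis .
qed

lemma disjoint_sums:
 fixes c :: "nat => 'b::real_normed_vector"
 assumes "disjoint_family D"
 shows "x \<in> D k ==> (\<lambda>i. indicator (D i) x *\<^sub>R c i) sums c k"
  and "x \<notin> (\<Union>i. D i) ==> (\<lambda>i. indicator (D i) x *\<^sub>R c i) sums 0"
proof -
 assume x: "x \<in> D k"
 have "(\<lambda>i. indicator (D i) x *\<^sub>R c i) = (\<lambda>i. if i = k then c i else 0)"
 proof
  fix i
  show "indicator (D i) x *\<^sub>R c i = (if i = k then c i else 0)"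
   using x assms by (cases "i = k") (auto simp: disjoint_family_on_def indicator_def)
 qed
 then show "(\<lambda>i. indicator (D i) x *\<^sub>R c i) sums c k" using sums_single[of k c] by simp
next
 assume "x \<notin> (\<Union>i. D i)"
 then have "(\<lambda>i. indicator (D i) x *\<^sub>R c i) = (\<lambda>i. 0)" by auto
 then show "(\<lambda>i. indicator (D i) x *\<^sub>R c i) sums 0" by simp
qed

text \<open>Hoelder's inequality in a normalised form, obtained by integrating Young's inequality
  for \<open>cmod (f x) / A\<close>. The case \<open>A = 0\<close> is separate: there
  \<open>f\<close> vanishes almost everywhere on \<open>E\<close>.\<close>

lemma holder_mean:
 fixes f :: "'a => complex"
 assumes p: "1 < p" and E: "E \<in> fmeasurable M" and f: "f \<in> borel_measurable M"
  and i: "integrable M (\<lambda>x. indicator E x * cmod (f x) powr p)"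
  and le: "(LINT x|M. indicator E x * cmod (f x) powr p) \<le> A powr p * m"
  and A: "0 \<le> A" and m: "measure M E \<le> m"
 shows "set_integrable M E f" "(LINT x|M. indicator E x * cmod (f x)) \<le> A * m"
proof -
 note f[measurable]
 have [measurable]: "E \<in> sets M" using E by auto
 have iE: "integrable M (indicat_real E)" using E by (auto simp: fmeasurable_def less_top)
 have bnd: "indicator E x * cmod (f x) \<le> a * (indicator E x * cmod (f x) powr p / (a powr p * p) + (1 - 1 / p) * indicator E x)"
  if "0 < a" for a x
 proof -
  have "cmod (f x) / a \<le> (cmod (f x) / a) powr p / p + (1 - 1 / p)" by (rule convex_powr_bound) (use p that in auto)
  also have "(cmod (f x) / a) powr p / p = cmod (f x) powr p / (a powr p * p)" using that by (simp add: powr_divide)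
  finally have "cmod (f x) \<le> a * (cmod (f x) powr p / (a powr p * p) + (1 - 1 / p))" using that by (simp add: field_simps)
  then show ?thesis by (simp add: indicator_def)
 qed
 have ia: "integrable M (\<lambda>x. a * (indicator E x * cmod (f x) powr p / (a powr p * p) + (1 - 1 / p) * indicator E x))" for a
  using i iE by auto
 have int: "integrable M (\<lambda>x. indicator E x * cmod (f x))"
  by (rule Bochner_Integration.integrable_bound[OF ia[of 1]]) (use bnd[of 1] in \<open>auto intro!: AE_I2 intro: order_trans[OF _ abs_ge_self]\<close>)
 then show "set_integrable M E f" unfolding set_integrable_def
  by (subst integrable_norm_iff[symmetric]) auto
 show "(LINT x|M. indicator E x * cmod (f x)) \<le> A * m"
 proof (cases "A = 0")
  case True
  have "0 \<le> (LINT x|M. indicator E x * cmod (f x) powr p)" by (intro integral_nonneg_AE) auto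
  then have "(LINT x|M. indicator E x * cmod (f x) powr p) = 0" using le True by (intro antisym) auto
  then have "AE x in M. indicator E x * cmod (f x) powr p = 0"
   by (subst (asm) integral_nonneg_eq_0_iff_AE[OF i]) auto
  then have "AE x in M. indicator E x * cmod (f x) = 0" by eventually_elim (auto simp: indicator_def)
  then have "(LINT x|M. indicator E x * cmod (f x)) = (LINT x|M. 0)" by (intro integral_cong_AE) auto
  then show ?thesis using True by simp
 next
  case False
  then have A: "0 < A" using A by simp
  have "(LINT x|M. indicator E x * cmod (f x)) \<le> (LINT x|M. A * (indicator E x * cmod (f x) powr p / (A powr p * p) + (1 - 1 / p) * indicator E x))"
   by (rule integral_mono[OF int ia bnd[OF A]])
  also have "\<dots> = A * ((LINT x|M. indicator E x * cmod (f x) powr p) / (A powr p * p) + (1 - 1 / p) * measure M E)"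
   using i iE by (subst integral_mult_right_zero, subst Bochner_Integration.integral_add) auto
  also have "\<dots> \<le> A * (m / p + (1 - 1 / p) * m)"
  proof (intro mult_left_mono add_mono)
   have "(LINT x|M. indicator E x * cmod (f x) powr p) / (A powr p * p) \<le> (A powr p * m) / (A powr p * p)"
    using le p A by (intro divide_right_mono) auto
   then show "(LINT x|M. indicator E x * cmod (f x) powr p) / (A powr p * p) \<le> m / p" using A by simp
  qed (use p m A in auto)
  also have "\<dots> = A * m" by (simp add: algebra_simps)
  finally show ?thesis .
 qed
qed

lemma atomic_gauge_mean_zero:
 assumes A: "L1_atoms M \<A>" and f: "atomic_gauge M \<A> X f" and z: "\<And>a. a \<in> \<A> ==> (LINT x|M. a x) = 0"
 shows "(LINT x|M. f x) = 0"
proof -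
 obtain c a where *: "\<And>j. a j \<in> \<A>" "summable (\<lambda>j. cmod (c j))" "(\<Sum>j::nat. cmod (c j)) \<le> X"
  "AE x in M. (\<lambda>j. c j * a j x) sums f x" using f unfolding atomic_gauge_def by blast
 note L = L1_series[OF A, of a c, OF *(1) *(2)]
 have "(\<lambda>j. \<integral>x. c j * a j x \<partial>M) sums (LINT x|M. f x)"
  using integrable_sums[of M "\<lambda>j x. c j * a j x" f, OF L(1) L(3) atomic_gauge_measurable[OF f] *(4)] by blast
 then have "(\<lambda>j. 0) sums (LINT x|M. f x)" using z[OF *(1)] by simp
 then show ?thesis using sums_unique2 sums_zero by blast
qed

context homogeneous_type
begin

text \<open>A bad ball of a function living on a ball of radius \<open>R\<close> has its centre
  within \<open>2 * \<kappa> * R\<close>; adding a radius of at most \<open>2 * \<kappa> * R\<close>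
  and applying the quasi-triangle inequality gives \<open>\<kappa> * (2 * \<kappa> * R + 2 *
  \<kappa> * R) = \<Lambda> * R\<close>.\<close>

definition \<Lambda> :: real where "\<Lambda> = 4 * \<kappa>\<^sup>2"

lemma Lambda_ge: "4 \<le> \<Lambda>" "0 < \<Lambda>" "1 \<le> \<Lambda>"
proof -
 have "1 \<le> \<kappa>\<^sup>2" using kappa_ge_1 by (rule one_le_power)
 then show "4 \<le> \<Lambda>" "0 < \<Lambda>" "1 \<le> \<Lambda>" unfolding \<Lambda>_def by linarith+
qed

text \<open>Two families of mean zero atoms living near the ball \<open>B x0 R\<close>: bounded ones, and those normalised
 in \<open>L\<^sup>p\<close>. The inclusion of dilated balls in the second family is what survives passing to the small
 balls of a Calderon--Zygmund decomposition.\<close>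

definition local_atoms :: "'a => real => ('a => complex) set" where
 "local_atoms x0 R = {a. a \<in> borel_measurable M \<and> (\<exists>x t. 0 < t \<and> t \<le> \<Lambda> * R \<and> d x0 x < \<Lambda> * R \<and>
   (\<forall>y. cmod (a y) \<le> 1 / mu x t) \<and> (\<forall>y. y \<notin> B x t \<longrightarrow> a y = 0)) \<and> (LINT y|M. a y) = 0}"

definition local_patoms :: "real => 'a => real => ('a => complex) set" where
 "local_patoms p x0 R = {a. a \<in> borel_measurable M \<and> (\<exists>x t. 0 < t \<and> t \<le> R \<and> B x (\<Lambda> * t) \<subseteq> B x0 (\<Lambda> * R) \<and>
   integrable M (\<lambda>y. cmod (a y) powr p) \<and> (LINT y|M. cmod (a y) powr p) \<le> mu x t powr (1 - p) \<and>
   (\<forall>y. y \<notin> B x t \<longrightarrow> a y = 0)) \<and> (LINT y|M. a y) = 0}"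

lemma bounded_integrable:
 fixes a :: "'a => complex"
 assumes "a \<in> borel_measurable M" "\<And>y. cmod (a y) \<le> K" "\<And>y. y \<notin> B x t ==> a y = 0"
 shows "integrable M a" "(LINT y|M. cmod (a y)) \<le> K * mu x t"
proof -
 have i: "integrable M (\<lambda>y. K * indicat_real (B x t) y)" by (simp add: less_top[symmetric])
 have b: "cmod (a y) \<le> K * indicat_real (B x t) y" for y using assms(2,3)[of y] by (auto simp: indicator_def)
 show ia: "integrable M a" by (rule Bochner_Integration.integrable_bound[OF i assms(1)]) (use b in \<open>auto intro: order_trans[OF _ abs_ge_self]\<close>)
 have "(LINT y|M. cmod (a y)) \<le> (LINT y|M. K * indicat_real (B x t) y)" by (rule integral_mono) (use ia i b in auto)
 then show "(LINT y|M. cmod (a y)) \<le> K * mu x t" by simp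
qed

lemma L1_local_atoms: "0 < R ==> L1_atoms M (local_atoms x0 R)"
 unfolding L1_atoms_def
proof (intro conjI ballI)
 assume R: "0 < R"
 have "(\<lambda>_. 0) \<in> local_atoms x0 R" unfolding local_atoms_def using R Lambda_ge
  by (auto intro!: exI[of _ x0] exI[of _ R])
 then show "local_atoms x0 R \<noteq> {}" by blast
 fix a assume "a \<in> local_atoms x0 R"
 then obtain x t where a: "a \<in> borel_measurable M" "0 < t" "\<And>y. cmod (a y) \<le> 1 / mu x t" "\<And>y. y \<notin> B x t ==> a y = 0"
  unfolding local_atoms_def by blast
 show "integrable M a" "(LINT x|M. cmod (a x)) \<le> 1"
  using bounded_integrable[of a "1 / mu x t" x t, OF a(1,3,4)] mu_pos[OF a(2), of x] by auto
qed

lemma L1_local_patoms: assumes "0 < R" "1 < p" shows "L1_atoms M (local_patoms p x0 R)"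
 unfolding L1_atoms_def
proof (intro conjI ballI)
 have "(\<lambda>_. 0) \<in> local_patoms p x0 R" unfolding local_patoms_def using assms
  by (auto intro!: exI[of _ x0] exI[of _ R])
 then show "local_patoms p x0 R \<noteq> {}" by blast
 fix a assume "a \<in> local_patoms p x0 R"
 then obtain x t where a: "a \<in> borel_measurable M" "0 < t" "integrable M (\<lambda>y. cmod (a y) powr p)"
  "(LINT y|M. cmod (a y) powr p) \<le> mu x t powr (1 - p)" "\<And>y. y \<notin> B x t ==> a y = 0"
  unfolding local_patoms_def by blast
 have mp: "0 < mu x t" by (rule mu_pos[OF a(2)])
 have e: "(\<lambda>y. indicator (B x t) y * cmod (a y) powr p) = (\<lambda>y. cmod (a y) powr p)"
  "(\<lambda>y. indicator (B x t) y * cmod (a y)) = (\<lambda>y. cmod (a y))"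
  "(\<lambda>y. indicator (B x t) y *\<^sub>R a y) = a"
  using a(5) by (auto simp: indicator_def fun_eq_iff)
 have "mu x t powr (1 - p) = (1 / mu x t) powr p * mu x t"
  using mp by (simp add: powr_diff powr_divide)
 then have "set_integrable M (B x t) a" "(LINT y|M. indicator (B x t) y * cmod (a y)) \<le> (1 / mu x t) * mu x t"
  using holder_mean[OF assms(2) fmeasurable_sub[OF B_sets subset_refl] a(1), of x t "1 / mu x t" "mu x t"] a(3,4) mp
  unfolding e(1) by auto
 then show "integrable M a" "(LINT x|M. cmod (a x)) \<le> 1" unfolding e(2) set_integrable_def e(3) using mp by auto
qed

lemma sum_disjoint_integrals:
 fixes u :: "'a => real" and D :: "nat => 'a set"
 assumes D: "disjoint_family D" "\<And>i. D i \<in> sets M" and u: "integrable M u" "\<And>y. 0 \<le> u y"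
 shows "(\<Sum>i<n. \<integral>y. indicator (D i) y * u y \<partial>M) \<le> (LINT y|M. u y)"
proof -
 have i: "integrable M (\<lambda>y. indicator (D i) y * u y)" for i
  using integrable_mult_indicator[OF D(2) u(1)] by simp
 have "(\<Sum>i<n. \<integral>y. indicator (D i) y * u y \<partial>M) = (LINT y|M. (\<Sum>i<n. indicator (D i) y * u y))"
  by (rule Bochner_Integration.integral_sum[symmetric]) (use i in auto)
 also have "\<dots> \<le> (LINT y|M. u y)"
 proof (rule integral_mono)
  fix y
  have "(\<Sum>i<n. indicator (D i) y * u y) = indicator (\<Union>i<n. D i) y * u y"
   by (subst indicator_UN_disjoint) (use D in \<open>auto simp: sum_distrib_right disjoint_family_on_def\<close>)
  then show "(\<Sum>i<n. indicator (D i) y * u y) \<le> u y" using u(2)[of y] by (auto simp: indicator_def)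
  show "integrable M (\<lambda>y. \<Sum>i<n. indicator (D i) y * u y)"
   by (rule Bochner_Integration.integrable_sum[OF i])
 qed (rule u)
 finally show ?thesis .
qed

text \<open>One half of Lebesgue differentiation. Where \<open>u\<close> exceeds \<open>l\<close> by
  a fixed factor above 1, the bound on the means keeps the density of that set away from 1 at all
  small scales, so \<open>no_density_null\<close> applies; the factors decrease to 1 along
  \<open>n\<close>.\<close>

lemma AE_le_if_means_le:
 assumes u: "u \<in> borel_measurable M" "integrable M u" "\<And>y. 0 \<le> u y" and l: "0 < l" and r0: "0 < r0"
  and A: "A \<in> sets M" "A \<subseteq> B z R"
  and m: "\<And>x t. x \<in> A ==> 0 < t ==> t \<le> r0 ==> (LINT y|M. indicator (B x t) y * u y) \<le> l * mu x t"
 shows "AE y in M. y \<in> A \<longrightarrow> u y \<le> (l::real)"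
proof -
 note u(1)[measurable] A(1)[measurable]
 define An where "An n = {y \<in> space M. y \<in> A \<and> l * (1 + 1 / real (Suc n)) \<le> u y}" for n
 have [measurable]: "An n \<in> sets M" for n unfolding An_def by measurable
 have "emeasure M (An n) = 0" for n
 proof (rule no_density_null[of _ z R "1 / (1 + 1 / real (Suc n))" r0])
  show "An n \<subseteq> B z R" using A(2) unfolding An_def by auto
  show "1 / (1 + 1 / real (Suc n)) < 1" by (simp add: field_simps)
  fix x t assume x: "x \<in> An n" and t: "0 < t" "t \<le> r0"
  define c where "c = l * (1 + 1 / real (Suc n))"
  have c: "0 < c" unfolding c_def using l by (intro mult_pos_pos add_pos_pos) auto
  have f: "An n \<inter> B x t \<in> fmeasurable M" by (rule fmeasurable_sub[of _ x t]) auto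
  have "c * measure M (An n \<inter> B x t) = (LINT y|M. c * indicator (An n \<inter> B x t) y)" by simp
  also have "\<dots> \<le> (LINT y|M. indicator (B x t) y * u y)"
  proof (rule integral_mono)
   show "integrable M (\<lambda>y. c * indicat_real (An n \<inter> B x t) y)" using f by (auto simp: fmeasurable_def less_top)
   show "integrable M (\<lambda>y. indicator (B x t) y * u y)" using integrable_mult_indicator[OF B_sets u(2)] by simp
   show "c * indicat_real (An n \<inter> B x t) y \<le> indicat_real (B x t) y * u y" for y
    using u(3)[of y] unfolding An_def c_def by (auto simp: indicator_def)
  qed
  also have "\<dots> \<le> l * mu x t" by (rule m) (use x t An_def in auto)
  finally have "(1 + 1 / real (Suc n)) * measure M (An n \<inter> B x t) \<le> mu x t" unfolding c_def using l by (simp add: mult.assoc)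
  then show "measure M (An n \<inter> B x t) \<le> 1 / (1 + 1 / real (Suc n)) * mu x t"
   by (simp add: field_simps)
 qed (use r0 in auto)
 then have "AE y in M. \<forall>n. y \<notin> An n" unfolding AE_all_countable by (auto intro!: AE_not_in null_setsI)
 then show ?thesis
 proof eventually_elim
  case (elim y)
  show ?case
  proof (intro impI, rule ccontr)
   assume y: "y \<in> A" "\<not> u y \<le> l"
   then have "0 < u y / l - 1" using l by simp
   then obtain n where "1 / real (Suc n) < u y / l - 1" using nat_approx_posE by blast
   then have "l * (1 + 1 / real (Suc n)) \<le> u y" using l by (simp add: field_simps)
   then show False using elim y(1) unfolding An_def by (auto simp: space_M)
  qed
 qed
qed

end

section \<open>Calderon--Zygmund decomposition of an atom normalised in
  \<open>L\<^sup>p\<close>\<close>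

context homogeneous_type
begin

text \<open>Doubling read backwards: a ball near \<open>B z R\<close> with radius at least
  \<open>\<eta> * R\<close> would have measure comparable to that of \<open>B z R\<close>, against
  the assumed large ratio.\<close>

lemma bad_ball_small:
 assumes R: "0 < R" and a: "0 < a" "dbl (\<kappa> * (2 * \<kappa> + 1) / \<eta>) \<le> a" and \<eta>: "0 < \<eta>" "\<eta> \<le> 1"
  and t: "0 < t" and x: "d z x \<le> 2 * \<kappa> * R" and lt: "a * mu x t < mu z R"
 shows "t < \<eta> * R"
proof (rule ccontr)
 assume "\<not> t < \<eta> * R"
 then have le: "R \<le> t / \<eta>" using \<eta> by (simp add: field_simps)
 define l where "l = \<kappa> * (2 * \<kappa> + 1) / \<eta>"
 have "1 * 1 \<le> \<kappa> * (2 * \<kappa> + 1)" using kappa_ge_1 by (intro mult_mono) auto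
 then have l: "1 \<le> l" unfolding l_def using \<eta> by (simp add: field_simps)
 have "mu z R \<le> dbl l * mu x t"
 proof (rule mu_compare[OF _ _ l t])
  show "d x z \<le> 2 * \<kappa> * R" using x by (simp add: dist_sym)
  have "\<kappa> * (2 * \<kappa> * R + R) = \<kappa> * (2 * \<kappa> + 1) * R" by (simp add: algebra_simps)
  also have "\<dots> \<le> \<kappa> * (2 * \<kappa> + 1) * (t / \<eta>)" using le kappa_pos by (intro mult_left_mono) auto
  finally show "\<kappa> * (2 * \<kappa> * R + R) \<le> l * t" unfolding l_def by simp
 qed
 also have "\<dots> \<le> a * mu x t" using a unfolding l_def by (intro mult_right_mono) auto
 finally show False using lt by simp
qed

text \<open>A stopping time argument without dyadic cubes. A radius is bad when the mean of
  \<open>cmod (f y) powr p\<close> over the ball exceeds \<open>lam powr p\<close>; from each bad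
  centre a nearly maximal bad radius is taken, and the covering lemma selects disjoint balls. The
  condition on \<open>\<alpha>\<close> forces bad radii to be so small that the enlarged ones still
  lie in the range where a radius can be judged.\<close>

lemma CZ_cover:
 assumes p: "1 < p" and R: "0 < R" and f: "f \<in> borel_measurable M" "integrable M (\<lambda>y. cmod (f y) powr p)"
  and sup: "\<And>y. y \<notin> B z R ==> f y = 0"
  and nrm: "(LINT y|M. cmod (f y) powr p) \<le> mu z R powr (1 - p)"
  and al: "dbl (\<kappa> * (2 * \<kappa> + 1) * (2 * \<kappa> * V)) \<le> \<alpha> powr p" "0 < \<alpha>"
  and lamd: "lam = \<alpha> / mu z R"
 obtains I :: "nat set" and x t where
  "\<And>i. i \<in> I ==> 0 < t i \<and> 2 * \<kappa> * V * t i \<le> R \<and> d z (x i) < 2 * \<kappa> * R"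
  "disjoint_family_on (\<lambda>i. B (x i) (t i)) I"
  "\<And>i. i \<in> I ==> (LINT y|M. indicator (B (x i) (V * t i)) y * cmod (f y) powr p) \<le> lam powr p * mu (x i) (V * t i)"
  "summable (\<lambda>i. if i \<in> I then mu (x i) (t i) else 0)"
  "(\<Sum>i. if i \<in> I then mu (x i) (t i) else 0) \<le> mu z R / \<alpha> powr p"
  "AE y in M. y \<notin> (\<Union>i\<in>I. B (x i) (V * t i)) \<longrightarrow> cmod (f y) \<le> lam"
proof -
 note f(1)[measurable]
 define m where "m = mu z R"
 have m: "0 < m" unfolding m_def by (rule mu_pos[OF R])
 have l0: "0 < lam" unfolding lamd using al m m_def by simp
 define u where "u y = cmod (f y) powr p" for y
 have [measurable]: "u \<in> borel_measurable M" unfolding u_def by measurable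
 have ui: "integrable M u" using f(2) unfolding u_def .
 have u0: "0 \<le> u y" for y unfolding u_def by simp
 have iu: "integrable M (\<lambda>y. indicator E y * u y)" if "E \<in> sets M" for E
  using integrable_mult_indicator[OF that ui] by simp
 define J where "J x t = (LINT y|M. indicator (B x t) y * u y)" for x t
 have lp: "lam powr p = \<alpha> powr p * m powr (- p)" unfolding lamd m_def[symmetric] using al m
  by (simp add: powr_divide powr_minus_divide)
 have Jle: "J x t \<le> m powr (1 - p)" for x t
 proof -
  have "J x t \<le> (LINT y|M. u y)" unfolding J_def
   by (rule integral_mono[OF iu[OF B_sets] ui]) (use u0 in \<open>auto simp: indicator_def\<close>)
  then show ?thesis using nrm unfolding u_def m_def by simp
 qed
 define bt where "bt x t \<longleftrightarrow> 0 < t \<and> t \<le> R \<and> lam powr p * mu x t < J x t" for x t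
 have Vp: "0 < 2 * \<kappa> * V" "1 \<le> 2 * \<kappa> * V"
 proof -
  have "1 * 1 \<le> \<kappa> * V" using kappa_ge_1 V_ge by (intro mult_mono) auto
  then show "0 < 2 * \<kappa> * V" "1 \<le> 2 * \<kappa> * V" by auto
 qed
 have small: "2 * \<kappa> * V * t < R \<and> d z x < 2 * \<kappa> * R" if "bt x t" for x t
 proof -
  have t: "0 < t" "t \<le> R" "lam powr p * mu x t < J x t" using that unfolding bt_def by auto
  have "0 < J x t" using t l0 mu_pos[OF t(1), of x] by (smt (verit) mult_pos_pos powr_gt_zero)
  have "\<exists>y. y \<in> B x t \<and> f y \<noteq> 0"
  proof (rule ccontr)
   assume n: "\<nexists>y. y \<in> B x t \<and> f y \<noteq> 0"
   have e: "indicator (B x t) y * u y = 0" for y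
    using n p unfolding u_def by (cases "y \<in> B x t") (simp_all add: indicator_def)
   have "J x t = 0" unfolding J_def by (simp only: e) simp
   then show False using \<open>0 < J x t\<close> by simp
  qed
  then obtain y where y: "d z y < R" "d y x < t" using sup by (auto simp: dist_sym)
  have "d z x < \<kappa> * (R + t)" by (rule triangle_less[OF y])
  also have "\<dots> \<le> \<kappa> * (R + R)" using t kappa_pos by (intro mult_left_mono) auto
  finally have dzx: "d z x < 2 * \<kappa> * R" by (simp add: algebra_simps)
  have "\<alpha> powr p * m powr (- p) * mu x t < m powr (1 - p)" using t(3) Jle[of x t] unfolding lp by (rule less_le_trans)
  also have "m powr (1 - p) = m * m powr (- p)" using m by (simp add: powr_diff powr_minus_divide)
  finally have "(\<alpha> powr p * mu x t) * m powr (- p) < m * m powr (- p)" by (simp add: ac_simps)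
  then have lt: "\<alpha> powr p * mu x t < mu z R" unfolding m_def by (rule mult_right_less_imp_less) simp
  \<comment> \<open>The target \<open>1 / (2 * \<kappa> * V)\<close> leaves room for the enlargement
    by \<open>V\<close> and for one further factor \<open>2 * \<kappa>\<close>, which keeps the
    dilated balls nested in the next step of the decomposition.\<close>
  have "t < 1 / (2 * \<kappa> * V) * R"
  proof (rule bad_ball_small[OF R _ _ _ _ t(1) _ lt])
   show "dbl (\<kappa> * (2 * \<kappa> + 1) / (1 / (2 * \<kappa> * V))) \<le> \<alpha> powr p" using al by simp
   show "1 / (2 * \<kappa> * V) \<le> 1" using Vp by (simp add: divide_le_eq)
   show "0 < 1 / (2 * \<kappa> * V)" using Vp by simp
   show "d z x \<le> 2 * \<kappa> * R" using dzx by simp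
   show "0 < \<alpha> powr p" using al by simp
  qed
  then show ?thesis using dzx Vp by (simp add: field_simps)
 qed
 define A where "A = {x. \<exists>t. bt x t}"
 \<comment> \<open>A bad radius above half the supremum: multiplied by \<open>V\<close>, which is at
   least 5, it passes the supremum and is no longer bad. This gives the upper bound for the mean on
   the enlarged ball.\<close>
 have "\<exists>t. bt x t \<and> \<not> bt x (V * t)" if x: "x \<in> A" for x
 proof -
  have ne: "{t. bt x t} \<noteq> {}" using x unfolding A_def by blast
  have bdd: "bdd_above {t. bt x t}" by (rule bdd_aboveI[of _ R]) (auto simp: bt_def)
  define s where "s = Sup {t. bt x t}"
  obtain t0 where "bt x t0" using x unfolding A_def by blast
  then have "0 < s" using cSup_upper[OF _ bdd, of t0] unfolding s_def bt_def by auto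
  then have "s / 2 < s" by simp
  then obtain t where t: "bt x t" "s / 2 < t" using less_cSup_iff[OF ne bdd, of "s/2"] unfolding s_def by auto
  have "\<not> bt x (V * t)"
  proof
   assume "bt x (V * t)"
   then have "V * t \<le> s" unfolding s_def by (intro cSup_upper[OF _ bdd]) auto
   moreover have "5 * t \<le> V * t" using V_ge t(1) unfolding bt_def by (intro mult_right_mono) auto
   ultimately show False using t(2) \<open>0 < s\<close> by linarith
  qed
  then show ?thesis using t(1) by blast
 qed
 then obtain T where T: "\<And>x. x \<in> A ==> bt x (T x) \<and> \<not> bt x (V * T x)" by metis
 have TR: "0 < T x \<and> T x \<le> R" if "x \<in> A" for x using T[OF that] unfolding bt_def by blast
 have Asub: "A \<subseteq> B z (2 * \<kappa> * R)" using small unfolding A_def by auto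
 obtain I :: "nat set" and x where Ix: "\<And>i. i \<in> I ==> x i \<in> A"
  "disjoint_family_on (\<lambda>i. B (x i) (T (x i))) I" "A \<subseteq> (\<Union>i\<in>I. B (x i) (V * T (x i)))"
  by (rule vitali_cover[of A T R z "2 * \<kappa> * R", OF TR Asub]) blast+
 define t where "t i = T (x i)" for i
 have bt: "bt (x i) (t i)" "\<not> bt (x i) (V * t i)" if "i \<in> I" for i using T[OF Ix(1)[OF that]] unfolding t_def by auto
 have VtR: "V * t i \<le> R" if "i \<in> I" for i
 proof -
  have "1 * (V * t i) \<le> (2 * \<kappa>) * (V * t i)" using bt(1)[OF that] kappa_ge_1 V_ge unfolding bt_def by (intro mult_right_mono) auto
  then show ?thesis using small[OF bt(1)[OF that]] by (simp add: mult.assoc)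
 qed
 have dis: "disjoint_family_on (\<lambda>i. B (x i) (t i)) I" using Ix(2) unfolding t_def .
 define b where "b i = (if i \<in> I then mu (x i) (t i) else 0)" for i
 have sb: "summable b" unfolding b_def
 proof (rule disjoint_measures(1)[OF dis])
  show "B z (\<kappa> * (2 * \<kappa> * R + R)) \<in> fmeasurable M" by (rule fmeasurable_sub[OF _ subset_refl]) simp
  fix i assume i: "i \<in> I"
  have "B (x i) (t i) \<subseteq> B z (\<kappa> * (2 * \<kappa> * R + R))"
   by (rule B_subset[of z "x i" "2 * \<kappa> * R"])
    (use small[OF bt(1)[OF i]] bt(1)[OF i] kappa_pos in \<open>auto simp: bt_def intro!: mult_left_mono\<close>)
  then show "B (x i) (t i) \<in> sets M \<and> B (x i) (t i) \<subseteq> B z (\<kappa> * (2 * \<kappa> * R + R))" by simp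
 qed
 \<comment> \<open>The weak type estimate: on each selected ball the integral of
   \<open>cmod (f y) powr p\<close> is at least \<open>lam powr p\<close> times its measure, and
   disjointness compares the sum with the total integral.\<close>
 have sumb: "(\<Sum>i. b i) \<le> mu z R / \<alpha> powr p"
 proof (rule suminf_le_const[OF sb])
  fix n
  define D where "D i = (if i \<in> I then B (x i) (t i) else {})" for i
  have D: "disjoint_family D" "\<And>i. D i \<in> sets M"
   using dis unfolding D_def disjoint_family_on_def by auto
  have "lam powr p * (\<Sum>i<n. b i) = (\<Sum>i<n. lam powr p * b i)" by (rule sum_distrib_left)
  also have "\<dots> \<le> (\<Sum>i<n. \<integral>y. indicator (D i) y * u y \<partial>M)"
  proof (rule sum_mono)
   fix i
   show "lam powr p * b i \<le> (LINT y|M. indicator (D i) y * u y)"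
    using bt(1)[of i] unfolding D_def b_def bt_def J_def by auto
  qed
  also have "\<dots> \<le> (LINT y|M. u y)" by (rule sum_disjoint_integrals[OF D ui u0])
  also have "\<dots> \<le> m powr (1 - p)" using nrm unfolding u_def m_def .
  also have "\<dots> = m * m powr (- p)" using m by (simp add: powr_diff powr_minus_divide)
  finally have "(\<alpha> powr p * (\<Sum>i<n. b i)) * m powr (- p) \<le> m * m powr (- p)" unfolding lp by (simp add: ac_simps)
  then have "\<alpha> powr p * (\<Sum>i<n. b i) \<le> m" by (rule mult_right_le_imp_le) (use m in simp)
  then show "(\<Sum>i<n. b i) \<le> mu z R / \<alpha> powr p" unfolding m_def[symmetric] using al by (simp add: field_simps)
 qed
 have ae: "AE y in M. y \<notin> (\<Union>i\<in>I. B (x i) (V * t i)) \<longrightarrow> cmod (f y) \<le> lam"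
 proof -
  define N where "N = B z R - (\<Union>i\<in>I. B (x i) (V * t i))"
  have [measurable]: "N \<in> sets M" unfolding N_def by auto
  have "AE y in M. y \<in> N \<longrightarrow> u y \<le> lam powr p"
  proof (rule AE_le_if_means_le[OF _ ui u0 _ R])
   show "N \<subseteq> B z R" unfolding N_def by auto
   fix w s assume w: "w \<in> N" and s: "0 < s" "s \<le> R"
   have "w \<notin> A" using w Ix(3) unfolding N_def t_def by auto
   then have "\<not> bt w s" unfolding A_def by blast
   then show "(LINT y|M. indicator (B w s) y * u y) \<le> lam powr p * mu w s" using s unfolding bt_def J_def by simp
  qed (use l0 in auto)
  then show ?thesis
  proof eventually_elim
   case (elim y)
   show ?case
   proof (intro impI, cases "y \<in> B z R")
    case True
    assume "y \<notin> (\<Union>i\<in>I. B (x i) (V * t i))"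
    then have "y \<in> N" using True unfolding N_def by blast
    then have "cmod (f y) powr p \<le> lam powr p" using elim unfolding u_def by blast
    then show "cmod (f y) \<le> lam" using p l0 powr_less_mono2[of p lam "cmod (f y)"] by (meson less_imp_le not_le zero_less_one order_less_trans)
   next
    case False
    then show "cmod (f y) \<le> lam" using sup l0 by simp
   qed
  qed
 qed
 show ?thesis
 proof (rule that[where I=I and x=x and t=t])
  show "disjoint_family_on (\<lambda>i. B (x i) (t i)) I" by (rule dis)
  show "AE y in M. y \<notin> (\<Union>i\<in>I. B (x i) (V * t i)) \<longrightarrow> cmod (f y) \<le> lam" by (rule ae)
  have be: "b = (\<lambda>i. if i \<in> I then mu (x i) (t i) else 0)" by (rule ext) (simp add: b_def)
  show "summable (\<lambda>i. if i \<in> I then mu (x i) (t i) else 0)" using sb unfolding be .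
  show "(\<Sum>i. if i \<in> I then mu (x i) (t i) else 0) \<le> mu z R / \<alpha> powr p" using sumb unfolding be .
  fix i assume i: "i \<in> I"
  show "0 < t i \<and> 2 * \<kappa> * V * t i \<le> R \<and> d z (x i) < 2 * \<kappa> * R"
   using small[OF bt(1)[OF i]] bt(1)[OF i] unfolding bt_def by auto
  have "\<not> lam powr p * mu (x i) (V * t i) < J (x i) (V * t i)"
   using bt[OF i] VtR[OF i] V_ge(3) unfolding bt_def by auto
  then show "(LINT y|M. indicator (B (x i) (V * t i)) y * cmod (f y) powr p) \<le> lam powr p * mu (x i) (V * t i)"
   unfolding J_def u_def by simp
 qed
qed

text \<open>The function is split into a bounded part \<open>g\<close> and mean zero pieces
  \<open>h i\<close> on the enlarged balls. Raising the level \<open>\<alpha>\<close> makes the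
  pieces cheap, because their total cost is of order \<open>\<alpha> powr (1 - p)\<close>; here
  \<open>1 < p\<close> is essential.\<close>

lemma CZ_step:
 assumes p: "1 < p"
 obtains C where "0 \<le> C"
  "\<And>x0 R a. 0 < R ==> a \<in> local_patoms p x0 R ==>
    \<exists>g. atomic_gauge M (local_atoms x0 R) C g \<and> atomic_gauge M (local_patoms p x0 R) (1/2) (\<lambda>x. a x - g x)"
proof -
 define L where "L = dbl (\<kappa> * (2 * \<kappa> + 1) * (2 * \<kappa> * V))"
 define K where "K = dbl V"
 have K1: "1 \<le> K" unfolding K_def by (rule dbl_ge_1)
 have L1: "1 \<le> L" unfolding L_def by (rule dbl_ge_1)
 \<comment> \<open>The first entry satisfies the smallness condition of \<open>CZ_cover\<close>; the
   second makes the total cost \<open>4 * K\<^sup>2 / \<alpha> powr (p - 1)\<close> of the pieces at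
   most 1/2.\<close>
 define \<alpha> where "\<alpha> = max (L powr (1 / p)) ((8 * K\<^sup>2) powr (1 / (p - 1)))"
 have a0: "0 < \<alpha>" unfolding \<alpha>_def using L1 by (simp add: less_max_iff_disj)
 have aL: "L \<le> \<alpha> powr p"
 proof -
  have "L = (L powr (1 / p)) powr p" using p L1 by (simp add: powr_powr)
  also have "\<dots> \<le> \<alpha> powr p" unfolding \<alpha>_def by (intro powr_mono2) (use p in auto)
  finally show ?thesis .
 qed
 have aK: "8 * K\<^sup>2 \<le> \<alpha> powr (p - 1)"
 proof -
  have "8 * K\<^sup>2 = ((8 * K\<^sup>2) powr (1 / (p - 1))) powr (p - 1)" using p K1 by (simp add: powr_powr)
  also have "\<dots> \<le> \<alpha> powr (p - 1)" unfolding \<alpha>_def by (intro powr_mono2) (use p in auto)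
  finally show ?thesis .
 qed
 define C where "C = K * \<alpha> * dbl \<Lambda>"
 have C0: "0 \<le> C" unfolding C_def using K1 a0 dbl_pos[of \<Lambda>] by auto
 show ?thesis
 proof (rule that[OF C0])
  fix x0 R0 f assume R0: "0 < R0" and fp: "f \<in> local_patoms p x0 R0"
  then obtain z R where f[measurable]: "f \<in> borel_measurable M" and R: "0 < R" "R \<le> R0" "B z (\<Lambda> * R) \<subseteq> B x0 (\<Lambda> * R0)"
   and fi: "integrable M (\<lambda>y. cmod (f y) powr p)" "(LINT y|M. cmod (f y) powr p) \<le> mu z R powr (1 - p)"
   and sup: "\<And>y. y \<notin> B z R ==> f y = 0" and fz: "(LINT y|M. f y) = 0"
   unfolding local_patoms_def by blast
  note LP = L1_local_patoms[OF R0 p, of x0]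
  note LA = L1_local_atoms[OF R0, of x0]
  have fint: "integrable M f" using LP fp unfolding L1_atoms_def by blast
  define m where "m = mu z R"
  have m: "0 < m" unfolding m_def by (rule mu_pos[OF R(1)])
  define lam where "lam = \<alpha> / m"
  have l0: "0 < lam" unfolding lam_def using a0 m by simp
  obtain I :: "nat set" and x t where
   I1: "\<And>i. i \<in> I ==> 0 < t i \<and> 2 * \<kappa> * V * t i \<le> R \<and> d z (x i) < 2 * \<kappa> * R"
   and I2: "disjoint_family_on (\<lambda>i. B (x i) (t i)) I"
   and I3: "\<And>i. i \<in> I ==> (LINT y|M. indicator (B (x i) (V * t i)) y * cmod (f y) powr p) \<le> lam powr p * mu (x i) (V * t i)"
   and I4: "summable (\<lambda>i. if i \<in> I then mu (x i) (t i) else 0)"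
   and I5: "(\<Sum>i. if i \<in> I then mu (x i) (t i) else 0) \<le> mu z R / \<alpha> powr p"
   and I6: "AE y in M. y \<notin> (\<Union>i\<in>I. B (x i) (V * t i)) \<longrightarrow> cmod (f y) \<le> lam"
   by (rule CZ_cover[OF p R(1) f fi(1) sup fi(2) _ a0, of lam]) (use aL in \<open>auto simp: L_def lam_def m_def\<close>)
  define D where "D i = (if i \<in> I then B (x i) (t i) else {})" for i
  define E where "E i = (if i \<in> I then B (x i) (V * t i) else {})" for i
  define Q where "Q = disjointed E"
  have Ds[measurable]: "D i \<in> sets M" for i unfolding D_def by auto
  have Es[measurable]: "E i \<in> sets M" for i unfolding E_def by auto
  have "range Q \<subseteq> sets M" unfolding Q_def by (rule sets.range_disjointed_sets) auto
  then have Qs[measurable]: "Q i \<in> sets M" for i by blast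
  have Ddis: "disjoint_family D" using I2 unfolding D_def disjoint_family_on_def by auto
  have Qdis: "disjoint_family Q" unfolding Q_def by (rule disjoint_family_disjointed)
  have QE: "Q i \<subseteq> E i" for i unfolding Q_def by (rule disjointed_subset)
  have UQ: "(\<Union>i. Q i) = (\<Union>i. E i)" unfolding Q_def by (rule UN_disjointed_eq)
  have UE: "(\<Union>i. E i) = (\<Union>i\<in>I. B (x i) (V * t i))" unfolding E_def by auto
  have DE: "D i \<subseteq> E i" for i
  proof (cases "i \<in> I")
   case True
   have "1 * t i \<le> V * t i" using I1[OF True] V_ge by (intro mult_right_mono) auto
   then show ?thesis unfolding D_def E_def using True by auto
  qed (simp add: D_def)
  have ED: "measure M (E i) \<le> K * measure M (D i)" for i
   unfolding E_def D_def K_def using mu_scale[OF V_ge(2)] I1 by auto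
  have Ef: "E i \<in> fmeasurable M" for i unfolding E_def by (auto intro: fmeasurable_sub)
  have Df: "D i \<in> fmeasurable M" for i unfolding D_def by (auto intro: fmeasurable_sub)
  have Dm: "0 < measure M (D i)" if "i \<in> I" for i unfolding D_def using that I1 mu_pos by auto
  have ifp: "integrable M (\<lambda>y. indicator S y * cmod (f y) powr p)" if "S \<in> sets M" for S
   using integrable_mult_indicator[OF that fi(1)] by simp
  have Ep: "(LINT y|M. indicator (E i) y * cmod (f y) powr p) \<le> lam powr p * measure M (E i)" for i
   unfolding E_def using I3 by auto
  have Qp: "(LINT y|M. indicator (Q i) y * cmod (f y) powr p) \<le> lam powr p * measure M (E i)" for i
  proof (rule order_trans[OF integral_mono Ep])
   show "indicat_real (Q i) y * cmod (f y) powr p \<le> indicat_real (E i) y * cmod (f y) powr p" for y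
    using QE[of i] by (auto simp: indicator_def)
  qed (use ifp in auto)
  have Q1: "(LINT y|M. indicator (E i) y * cmod (f y)) \<le> lam * measure M (E i)" for i
   by (rule holder_mean(2)[OF p Ef f ifp[OF Es] Ep]) (use l0 in auto)
  \<comment> \<open>The integral of \<open>f\<close> over \<open>Q i\<close> is spread over the
    original ball \<open>D i\<close> and not over \<open>Q i\<close>, which may have arbitrarily
    small measure after the enlarged balls have been made disjoint. The \<open>D i\<close> are
    themselves disjoint, so the constants do not pile up in \<open>g\<close>.\<close>
  define c where "c i = (if i \<in> I then (LINT y|M. indicator (Q i) y *\<^sub>R f y) / of_real (measure M (D i)) else 0)" for i
  have iQ: "integrable M (\<lambda>y. indicator (Q i) y *\<^sub>R f y)" for i by (rule integrable_mult_indicator[OF Qs fint])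
  have cle: "cmod (c i) \<le> K * lam" for i
  proof (cases "i \<in> I")
   case True
   have "cmod (LINT y|M. indicator (Q i) y *\<^sub>R f y) \<le> (LINT y|M. cmod (indicator (Q i) y *\<^sub>R f y))"
    by (rule integral_norm_bound)
   also have "\<dots> \<le> (LINT y|M. indicator (E i) y * cmod (f y))"
   proof (rule integral_mono)
    show "integrable M (\<lambda>y. indicat_real (E i) y * cmod (f y))"
     using integrable_mult_indicator[OF Es integrable_norm[OF fint]] by simp
    show "cmod (indicat_real (Q i) y *\<^sub>R f y) \<le> indicat_real (E i) y * cmod (f y)" for y
     using QE[of i] by (auto simp: indicator_def)
   qed (rule integrable_norm[OF iQ])
   also have "\<dots> \<le> lam * (K * measure M (D i))" using Q1[of i] ED[of i] l0 by (meson mult_left_mono less_imp_le order_trans)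
   finally show ?thesis unfolding c_def using True Dm[OF True] by (simp add: norm_divide divide_le_eq ac_simps)
  qed (use K1 l0 in \<open>simp add: c_def\<close>)
  define h where "h i y = indicator (Q i) y *\<^sub>R f y - indicator (D i) y *\<^sub>R c i" for i y
  have [measurable]: "h i \<in> borel_measurable M" for i unfolding h_def by measurable
  have iD: "integrable M (\<lambda>y. indicator (D i) y *\<^sub>R c i)" for i
   using Df[of i] by (intro integrable_scaleR_left) (auto simp: fmeasurable_def less_top)
  have hint: "(LINT y|M. h i y) = 0" for i
  proof -
   have "(LINT y|M. h i y) = (LINT y|M. indicator (Q i) y *\<^sub>R f y) - (LINT y|M. indicator (D i) y *\<^sub>R c i)"
    unfolding h_def by (rule Bochner_Integration.integral_diff[OF iQ iD])
   also have "(LINT y|M. indicator (D i) y *\<^sub>R c i) = measure M (D i) *\<^sub>R c i"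
    using Df[of i] by (subst integral_scaleR_left) (auto simp: fmeasurable_def less_top)
   also have "(LINT y|M. indicator (Q i) y *\<^sub>R f y) - measure M (D i) *\<^sub>R c i = 0"
   proof (cases "i \<in> I")
    case True
    then show ?thesis using Dm[OF True] by (simp add: c_def scaleR_conv_of_real)
   next
    case False
    then have "Q i = {}" using QE[of i] unfolding E_def by auto
    then show ?thesis using False by (simp add: c_def)
   qed
   finally show ?thesis .
  qed
  have hp: "integrable M (\<lambda>y. cmod (h i y) powr p)"
   "(LINT y|M. cmod (h i y) powr p) \<le> (4 * K * lam) powr p * measure M (E i)" for i
  proof -
   define v where "v y = 2 powr p * (indicator (Q i) y * cmod (f y) powr p + (K * lam) powr p * indicator (D i) y)" for y
   have vi: "integrable M v" unfolding v_def using ifp[OF Qs] Df[of i] by (auto simp: fmeasurable_def less_top)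
   have hv: "cmod (h i y) powr p \<le> v y" for y
   proof -
    have "cmod (h i y) \<le> cmod (indicator (Q i) y *\<^sub>R f y) + cmod (indicator (D i) y *\<^sub>R c i)"
     unfolding h_def by (rule norm_triangle_ineq4)
    also have "\<dots> \<le> indicator (Q i) y * cmod (f y) + indicator (D i) y * (K * lam)"
     using cle[of i] by (auto simp: indicator_def)
    finally have "cmod (h i y) powr p \<le> (indicator (Q i) y * cmod (f y) + indicator (D i) y * (K * lam)) powr p"
     using p by (intro powr_mono2) auto
    also have "\<dots> \<le> 2 powr p * ((indicator (Q i) y * cmod (f y)) powr p + (indicator (D i) y * (K * lam)) powr p)"
     by (rule powr_sum_le) (use p K1 l0 in auto)
    also have "\<dots> = v y" unfolding v_def using p by (auto simp: indicator_def)
    finally show ?thesis .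
   qed
   show hi: "integrable M (\<lambda>y. cmod (h i y) powr p)"
    by (rule Bochner_Integration.integrable_bound[OF vi]) (use hv in \<open>auto intro!: AE_I2 intro: order_trans[OF _ abs_ge_self]\<close>)
   have "(LINT y|M. cmod (h i y) powr p) \<le> (LINT y|M. v y)" by (rule integral_mono[OF hi vi hv])
   also have "(LINT y|M. v y) = 2 powr p * ((LINT y|M. indicator (Q i) y * cmod (f y) powr p) + (K * lam) powr p * measure M (D i))"
    unfolding v_def using ifp[OF Qs] Df[of i]
    by (subst integral_mult_right_zero, subst Bochner_Integration.integral_add) (auto simp: fmeasurable_def less_top)
   also have "\<dots> \<le> 2 powr p * ((K * lam) powr p * measure M (E i) + (K * lam) powr p * measure M (E i))"
   proof (intro mult_left_mono add_mono)
    have "1 * lam \<le> K * lam" using K1 l0 by (intro mult_right_mono) auto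
    then have "lam powr p \<le> (K * lam) powr p" using p l0 by (intro powr_mono2) auto
    then show "(LINT y|M. indicator (Q i) y * cmod (f y) powr p) \<le> (K * lam) powr p * measure M (E i)"
     using Qp[of i] by (meson measure_nonneg mult_right_mono order_trans)
    show "measure M (D i) \<le> measure M (E i)" by (rule measure_mono_fmeasurable[OF DE Ds Ef])
   qed auto
   also have "\<dots> = (2 * 2 powr p) * (K * lam) powr p * measure M (E i)" by (simp add: algebra_simps)
   also have "\<dots> \<le> (4 powr p) * (K * lam) powr p * measure M (E i)"
   proof (intro mult_right_mono)
    have "(2::real) powr 1 \<le> 2 powr p" using p by (intro powr_mono) auto
    then have "2 * 2 powr p \<le> (2 powr p) * (2 powr p :: real)" by simp
    also have "\<dots> = 4 powr p" using powr_mult[of 2 2 p] by simp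
    finally show "2 * 2 powr p \<le> (4::real) powr p" .
   qed auto
   also have "\<dots> = (4 * K * lam) powr p * measure M (E i)" using powr_mult[of 4 "K * lam" p] K1 l0 by (simp add: mult.assoc)
   finally show "(LINT y|M. cmod (h i y) powr p) \<le> (4 * K * lam) powr p * measure M (E i)" .
  qed
  \<comment> \<open>Dividing \<open>h i\<close> by this number normalises it in
    \<open>L\<^sup>p\<close> on the enlarged ball.\<close>
  define N where "N i = 4 * K * lam * measure M (E i)" for i
  have hg: "atomic_gauge M (local_patoms p x0 R0) (N i) (h i)" for i
  proof (cases "i \<in> I")
   case True
   have Em: "0 < measure M (E i)" using Dm[OF True] measure_mono_fmeasurable[OF DE Ds Ef] by (rule less_le_trans)
   have N: "0 < N i" unfolding N_def using Em K1 l0 by simp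
   have "(\<lambda>y. h i y / of_real (N i)) \<in> local_patoms p x0 R0"
    unfolding local_patoms_def
   proof (intro CollectI conjI exI[of _ "x i"] exI[of _ "V * t i"] allI impI)
    have Vt: "0 < V * t i" "2 * \<kappa> * (V * t i) \<le> R" "d z (x i) \<le> 2 * \<kappa> * R" using I1[OF True] V_ge by (auto simp: mult.assoc)
    show "0 < V * t i" by fact
    have "1 * (V * t i) \<le> 2 * \<kappa> * (V * t i)" using Vt(1) kappa_ge_1 by (intro mult_right_mono) auto
    then show "V * t i \<le> R0" using Vt(2) R(2) by linarith
    \<comment> \<open>The inclusion of dilated balls is inherited: the small radius satisfies
      \<open>2 * \<kappa> * V * t i \<le> R\<close>, so the displacement and the dilated radius each
      contribute at most half of \<open>\<Lambda> * R\<close>. This keeps the iteration inside the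
      original ball.\<close>
    have "B (x i) (\<Lambda> * (V * t i)) \<subseteq> B z (\<Lambda> * R)"
    proof (rule B_subset[OF Vt(3)])
     have "\<kappa> * (\<Lambda> * (V * t i)) = 2 * \<kappa>\<^sup>2 * (2 * \<kappa> * (V * t i))" unfolding \<Lambda>_def by (simp add: power2_eq_square)
     also have "\<dots> \<le> 2 * \<kappa>\<^sup>2 * R" by (intro mult_left_mono Vt(2)) auto
     finally show "\<kappa> * (2 * \<kappa> * R + \<Lambda> * (V * t i)) \<le> \<Lambda> * R" unfolding \<Lambda>_def by (simp add: algebra_simps power2_eq_square)
    qed
    then show "B (x i) (\<Lambda> * (V * t i)) \<subseteq> B x0 (\<Lambda> * R0)" using R(3) by blast
    have e: "cmod (h i y / of_real (N i)) powr p = N i powr (- p) * cmod (h i y) powr p" for y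
     using N by (simp add: norm_divide powr_divide powr_minus_divide)
    show "integrable M (\<lambda>y. cmod (h i y / of_real (N i)) powr p)" unfolding e using hp(1) by simp
    have EE: "measure M (E i) = mu (x i) (V * t i)" unfolding E_def using True by simp
    have "(LINT y|M. cmod (h i y / of_real (N i)) powr p) = N i powr (- p) * (LINT y|M. cmod (h i y) powr p)"
     unfolding e by simp
    also have "\<dots> \<le> N i powr (- p) * ((4 * K * lam) powr p * measure M (E i))" by (intro mult_left_mono hp(2)) auto
    also have "\<dots> = measure M (E i) powr (1 - p)"
    proof -
     have "N i powr (- p) = (4 * K * lam) powr (- p) * measure M (E i) powr (- p)" unfolding N_def using K1 l0 Em by (intro powr_mult)
     moreover have "(4 * K * lam) powr (- p) * (4 * K * lam) powr p = 1" using K1 l0 by (simp flip: powr_add)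
     moreover have "measure M (E i) powr (1 - p) = measure M (E i) * measure M (E i) powr (- p)" using Em by (simp add: powr_diff powr_minus_divide)
     ultimately show ?thesis by (simp add: algebra_simps)
    qed
    finally show "(LINT y|M. cmod (h i y / of_real (N i)) powr p) \<le> mu (x i) (V * t i) powr (1 - p)" unfolding EE .
    show "h i y / of_real (N i) = 0" if "y \<notin> B (x i) (V * t i)" for y
    proof -
     have "y \<notin> E i" using that True unfolding E_def by simp
     then have "y \<notin> Q i" "y \<notin> D i" using QE[of i] DE[of i] by auto
     then show ?thesis unfolding h_def by simp
    qed
    show "(LINT y|M. h i y / of_real (N i)) = 0" using hint[of i] by simp
   qed measurable
   from atomic_gauge_scale[OF atomic_gauge_atom[OF LP this], of "of_real (N i)"] show ?thesis using N by simp
  next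
   case False
   then have "h i = (\<lambda>_. 0)" using QE[of i] unfolding h_def D_def E_def by (auto simp: fun_eq_iff)
   moreover have "N i = 0" using False unfolding N_def E_def by simp
   moreover have "local_patoms p x0 R0 \<noteq> {}" using LP unfolding L1_atoms_def by blast
   ultimately show ?thesis using atomic_gauge_zero[of "local_patoms p x0 R0" M] by simp
  qed
  \<comment> \<open>Off the enlarged balls \<open>f\<close> is cut off at height \<open>lam\<close>,
    which changes it on a null set and makes the bound on \<open>g\<close> hold everywhere, as
    bounded atoms require.\<close>
  define g where "g y = indicator (- (\<Union>i. E i)) y *\<^sub>R (if cmod (f y) \<le> lam then f y else 0) + (\<Sum>i. indicator (D i) y *\<^sub>R c i)" for y
  have [measurable]: "(\<Union>i. E i) \<in> sets M" "- (\<Union>i. E i) \<in> sets M"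
   using sets.compl_sets[of "\<Union>i. E i" M] by (auto simp: space_M Compl_eq_Diff_UNIV)
  have gm[measurable]: "g \<in> borel_measurable M" unfolding g_def by measurable
  have wE: "(\<Sum>i. indicator (D i) y *\<^sub>R c i) = c k" if "y \<in> D k" for y k
   using disjoint_sums(1)[OF Ddis that, of c] by (simp add: sums_iff)
  have w0: "(\<Sum>i. indicator (D i) y *\<^sub>R c i) = 0" if "y \<notin> (\<Union>i. D i)" for y
   using disjoint_sums(2)[OF Ddis that, of c] by (simp add: sums_iff)
  have ws: "(\<lambda>i. indicator (D i) y *\<^sub>R c i) sums (\<Sum>i. indicator (D i) y *\<^sub>R c i)" for y
  proof (cases "y \<in> (\<Union>i. D i)")
   case True
   then obtain k where "y \<in> D k" by blast
   from sums_summable[OF disjoint_sums(1)[OF Ddis this, of c]] show ?thesis by (rule summable_sums)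
  next
   case False
   from sums_summable[OF disjoint_sums(2)[OF Ddis this, of c]] show ?thesis by (rule summable_sums)
  qed
  have gle: "cmod (g y) \<le> K * lam" for y
  proof (cases "y \<in> (\<Union>i. D i)")
   case True
   then obtain k where k: "y \<in> D k" by blast
   then have "y \<in> (\<Union>i. E i)" using DE by blast
   then show ?thesis unfolding g_def wE[OF k] using cle[of k] by simp
  next
   case False
   have "1 * lam \<le> K * lam" using K1 l0 by (intro mult_right_mono) auto
   then have lK: "lam \<le> K * lam" by simp
   show ?thesis unfolding g_def w0[OF False] using l0 lK K1 by (auto simp: indicator_def intro: order_trans)
  qed
  have gsup: "g y = 0" if y: "y \<notin> B z (\<Lambda> * R)" for y
  proof -
   have "1 * R \<le> \<Lambda> * R" using Lambda_ge R(1) by (intro mult_right_mono) auto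
   then have "f y = 0" using y by (intro sup) auto
   moreover have "y \<notin> (\<Union>i. D i)"
   proof
    assume "y \<in> (\<Union>i. D i)"
    then obtain i where i: "i \<in> I" "y \<in> B (x i) (t i)" unfolding D_def by (auto split: if_splits)
    have "B (x i) (t i) \<subseteq> B z (\<Lambda> * R)"
    proof (rule B_subset[of z "x i" "2 * \<kappa> * R"])
     have "V * t i * 1 \<le> V * t i * (2 * \<kappa>)" using I1[OF i(1)] kappa_ge_1 V_ge by (intro mult_left_mono) auto
     moreover have "1 * t i \<le> V * t i" using I1[OF i(1)] V_ge by (intro mult_right_mono) auto
     moreover have "V * t i * (2 * \<kappa>) = 2 * \<kappa> * V * t i" by simp
     ultimately have "t i \<le> R" using I1[OF i(1)] by linarith
     then have "\<kappa> * (2 * \<kappa> * R + t i) \<le> \<kappa> * (2 * \<kappa> * R + R)" using kappa_pos by (intro mult_left_mono) auto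
     also have "\<dots> \<le> \<kappa> * (2 * \<kappa> * R + 2 * \<kappa> * R)"
     proof -
      have "1 * R \<le> 2 * \<kappa> * R" using kappa_ge_1 R(1) by (intro mult_right_mono) auto
      then show ?thesis using kappa_pos by (intro mult_left_mono add_left_mono) (auto simp: ac_simps)
     qed
     also have "\<dots> = \<Lambda> * R" unfolding \<Lambda>_def by (simp add: power2_eq_square)
     finally show "\<kappa> * (2 * \<kappa> * R + t i) \<le> \<Lambda> * R" .
    qed (use I1[OF i(1)] in auto)
    then show False using i(2) y by blast
   qed
   ultimately show ?thesis unfolding g_def by (simp add: w0)
  qed
  have hs: "AE y in M. (\<lambda>i. h i y) sums (f y - g y)"
   using I6
  proof eventually_elim
   case (elim y)
   have "(\<lambda>i. indicator (Q i) y *\<^sub>R f y) sums (indicator (\<Union>i. E i) y *\<^sub>R f y)"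
    unfolding UQ[symmetric]
   proof (cases "y \<in> (\<Union>i. Q i)")
    case True
    then obtain k where "y \<in> Q k" by blast
    from disjoint_sums(1)[OF Qdis this, of "\<lambda>_. f y"] True
    show "(\<lambda>i. indicator (Q i) y *\<^sub>R f y) sums (indicator (\<Union>i. Q i) y *\<^sub>R f y)" by simp
   next
    case False
    from disjoint_sums(2)[OF Qdis this, of "\<lambda>_. f y"] False
    show "(\<lambda>i. indicator (Q i) y *\<^sub>R f y) sums (indicator (\<Union>i. Q i) y *\<^sub>R f y)" by simp
   qed
   from sums_diff[OF this ws[of y]]
   have "(\<lambda>i. h i y) sums (indicator (\<Union>i. E i) y *\<^sub>R f y - (\<Sum>i. indicator (D i) y *\<^sub>R c i))" unfolding h_def .
   moreover have "indicator (\<Union>i. E i) y *\<^sub>R f y - (\<Sum>i. indicator (D i) y *\<^sub>R c i) = f y - g y"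
    unfolding g_def using elim unfolding UE[symmetric] by (auto simp: indicator_def)
   ultimately show ?case by simp
  qed
  have gP: "atomic_gauge M (local_patoms p x0 R0) (1/2) (\<lambda>y. f y - g y)"
  proof (rule atomic_gauge_suminf[OF LP hg _ _ _ hs])
   have sD: "summable (\<lambda>i. measure M (D i))" "(\<Sum>i. measure M (D i)) \<le> m / \<alpha> powr p"
    using I4 I5 unfolding m_def D_def by (simp_all add: if_distrib[of "measure M"] cong: if_cong)
   have Nle: "N i \<le> 4 * K\<^sup>2 * lam * measure M (D i)" for i
    unfolding N_def using mult_left_mono[OF ED[of i], of "4 * K * lam"] K1 l0 by (simp add: power2_eq_square ac_simps)
   have N0: "0 \<le> N i" for i unfolding N_def using K1 l0 by simp
   show sN: "summable N"
    by (rule summable_comparison_test'[OF summable_mult[OF sD(1), of "4 * K\<^sup>2 * lam"], of 0]) (use Nle N0 in auto)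
   have "(\<Sum>i. N i) \<le> (\<Sum>i. 4 * K\<^sup>2 * lam * measure M (D i))"
    by (intro suminf_le Nle sN summable_mult sD)
   also have "\<dots> = 4 * K\<^sup>2 * lam * (\<Sum>i. measure M (D i))" by (rule suminf_mult[OF sD(1)])
   also have "\<dots> \<le> 4 * K\<^sup>2 * lam * (m / \<alpha> powr p)" using sD(2) K1 l0 by (intro mult_left_mono) auto
   also have "\<dots> = 4 * K\<^sup>2 / \<alpha> powr (p - 1)" unfolding lam_def using m a0 by (simp add: powr_diff)
   also have "\<dots> \<le> 1 / 2" using aK a0 by (simp add: divide_le_eq)
   finally show "(\<Sum>i. N i) \<le> 1 / 2" .
  qed measurable
  have gint: "integrable M g" by (rule bounded_integrable(1)[OF gm gle gsup])
  \<comment> \<open>The mean of \<open>g\<close> vanishes indirectly: \<open>f\<close> has mean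
    zero, and \<open>f - g\<close> is a convergent sum of mean zero pieces.\<close>
  have "(LINT y|M. f y - g y) = 0"
   by (rule atomic_gauge_mean_zero[OF LP gP]) (simp add: local_patoms_def)
  then have g0: "(LINT y|M. g y) = 0" using fz Bochner_Integration.integral_diff[OF fint gint] by simp
  define m' where "m' = mu z (\<Lambda> * R)"
  have m': "0 < m'" "m' \<le> dbl \<Lambda> * m" unfolding m'_def m_def using Lambda_ge R(1) mu_pos[of "\<Lambda> * R" z] mu_scale[of \<Lambda> R z] by auto
  define k where "k = K * lam * m'"
  have k: "0 < k" "k \<le> C"
  proof -
   show "0 < k" unfolding k_def using K1 l0 m' by simp
   have "k \<le> K * lam * (dbl \<Lambda> * m)" unfolding k_def using K1 l0 m' by (intro mult_left_mono) auto
   then show "k \<le> C" unfolding C_def lam_def using m by simp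
  qed
  have "(\<lambda>y. g y / of_real k) \<in> local_atoms x0 R0"
   unfolding local_atoms_def
  proof (intro CollectI conjI exI[of _ z] exI[of _ "\<Lambda> * R"] allI impI)
   show "0 < \<Lambda> * R" using Lambda_ge R(1) by simp
   then have "z \<in> B z (\<Lambda> * R)" by simp
   from subsetD[OF R(3) this] show "d x0 z < \<Lambda> * R0" by simp
   show "\<Lambda> * R \<le> \<Lambda> * R0" using Lambda_ge R(2) by simp
   show "cmod (g y / of_real k) \<le> 1 / mu z (\<Lambda> * R)" for y
   proof -
    have "cmod (g y / of_real k) = cmod (g y) / k" using k(1) by (simp add: norm_divide)
    also have "\<dots> \<le> (K * lam) / k" using gle[of y] k(1) by (intro divide_right_mono) auto
    also have "\<dots> = 1 / m'" unfolding k_def using K1 l0 m'(1) by simp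
    finally show ?thesis unfolding m'_def .
   qed
   show "g y / of_real k = 0" if "y \<notin> B z (\<Lambda> * R)" for y using gsup[OF that] by simp
   show "(LINT y|M. g y / of_real k) = 0" using g0 by simp
  qed measurable
  from atomic_gauge_scale[OF atomic_gauge_atom[OF LA this], of "of_real k"]
  have "atomic_gauge M (local_atoms x0 R0) k g" using k by simp
  then have "atomic_gauge M (local_atoms x0 R0) C g" using k(2) by (rule atomic_gauge_mono)
  then show "\<exists>g. atomic_gauge M (local_atoms x0 R0) C g \<and> atomic_gauge M (local_patoms p x0 R0) (1/2) (\<lambda>x. f x - g x)"
   using gP by blast
 qed
qed

text \<open>The constant depends on \<open>p\<close> but not on the ball. By duality this uniformity
  becomes the John--Nirenberg inequality.\<close>

lemma local_atomic_decomposition: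
 assumes p: "1 < p"
 obtains C where "0 \<le> C"
  "\<And>x0 R X f. 0 < R ==> atomic_gauge M (local_patoms p x0 R) X f ==> atomic_gauge M (local_atoms x0 R) (C * X) f"
proof -
 obtain C where C: "0 \<le> C" "\<And>x0 R a. 0 < R ==> a \<in> local_patoms p x0 R ==>
    \<exists>g. atomic_gauge M (local_atoms x0 R) C g \<and> atomic_gauge M (local_patoms p x0 R) (1/2) (\<lambda>x. a x - g x)"
  by (rule CZ_step[OF p]) blast
 show ?thesis
 proof (rule that[of "2 * C"])
  fix x0 R X f assume R: "0 < R" and f: "atomic_gauge M (local_patoms p x0 R) X f"
  show "atomic_gauge M (local_atoms x0 R) (2 * C * X) f"
   by (rule atomic_gauge_iterate[OF L1_local_atoms[OF R] L1_local_patoms[OF R p] C(1) C(2)[OF R] f])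
 qed (use C in simp)
qed

end

subsection \<open>Mean oscillation and the John--Nirenberg inequality\<close>

lemma atomic_pairing_sums:
 fixes c :: "nat => complex"
 assumes A: "L1_atoms M \<A>" "\<And>j. a j \<in> \<A>" and c: "summable (\<lambda>j. cmod (c j))"
  and h: "h \<in> borel_measurable M" "AE x in M. (\<lambda>j. c j * a j x) sums h x"
  and f: "f \<in> borel_measurable M" "\<And>x. cmod (f x) \<le> K"
 shows "integrable M (\<lambda>x. f x * h x)" "(\<lambda>j. c j * (LINT x|M. f x * a j x)) sums (LINT x|M. f x * h x)"
proof -
 note [measurable] = f(1) h(1)
 note L = L1_series[OF A(1), of a c, OF A(2) c]
 have K0: "0 \<le> K" using f(2) norm_ge_zero order_trans by blast
 have [measurable]: "a j \<in> borel_measurable M" for j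
  using A(1) A(2)[of j] unfolding L1_atoms_def by (meson borel_measurable_integrable)
 have i: "integrable M (\<lambda>x. f x * (c j * a j x))" for j
 proof (rule Bochner_Integration.integrable_bound)
  show "integrable M (\<lambda>x. of_real K * (c j * a j x))" by (rule integrable_mult_right) (rule L(1))
  show "AE x in M. norm (f x * (c j * a j x)) \<le> norm (of_real K * (c j * a j x))"
   using f(2) K0 by (auto simp: norm_mult intro!: AE_I2 mult_right_mono)
 qed measurable
 have s: "summable (\<lambda>j. \<integral>x. cmod (f x * (c j * a j x)) \<partial>M)"
 proof (rule summable_comparison_test'[OF summable_mult[OF c, of K], of 0])
  fix j
  have "(LINT x|M. cmod (f x * (c j * a j x))) \<le> (LINT x|M. K * cmod (c j * a j x))"
   by (rule integral_mono[OF integrable_norm[OF i] integrable_mult_right[OF integrable_norm[OF L(1)]]])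
    (use f(2) in \<open>auto simp: norm_mult intro!: mult_right_mono\<close>)
  also have "\<dots> \<le> K * cmod (c j)" using L(2)[of j] K0 by (simp add: mult_left_mono)
  finally show "norm (LINT x|M. cmod (f x * (c j * a j x))) \<le> K * cmod (c j)" by simp
 qed
 have ae: "AE x in M. (\<lambda>j. f x * (c j * a j x)) sums (f x * h x)"
  using h(2) by eventually_elim (rule sums_mult)
 note I = integrable_sums[of M "\<lambda>j x. f x * (c j * a j x)" "\<lambda>x. f x * h x", OF i s _ ae]
 show "integrable M (\<lambda>x. f x * h x)" by (rule I(1)) measurable
 have "(\<lambda>j. \<integral>x. f x * (c j * a j x) \<partial>M) sums (LINT x|M. f x * h x)" by (rule I(2)) measurable
 moreover have "(LINT x|M. f x * (c j * a j x)) = c j * (LINT x|M. f x * a j x)" for j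
  by (simp add: mult.left_commute)
 ultimately show "(\<lambda>j. c j * (LINT x|M. f x * a j x)) sums (LINT x|M. f x * h x)" by simp
qed

text \<open>Boundedness of \<open>f\<close> justifies integrating the atomic series term by term,
  whereas the estimate involves the values on atoms alone; it can thus be applied uniformly to
  truncations.\<close>

lemma atomic_pairing_bound:
 assumes A: "L1_atoms M \<A>" and h: "atomic_gauge M \<A> X h"
  and f: "f \<in> borel_measurable M" "\<And>x. cmod (f x) \<le> K"
  and b: "\<And>a. a \<in> \<A> ==> cmod (LINT x|M. f x * a x) \<le> Y" "0 \<le> Y"
 shows "cmod (LINT x|M. f x * h x) \<le> Y * X"
proof -
 obtain c a where *: "\<And>j. a j \<in> \<A>" "summable (\<lambda>j. cmod (c j))" "(\<Sum>j::nat. cmod (c j)) \<le> X"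
  "AE x in M. (\<lambda>j. c j * a j x) sums h x" using h unfolding atomic_gauge_def by blast
 have S: "(\<lambda>j. c j * (LINT x|M. f x * a j x)) sums (LINT x|M. f x * h x)"
  by (rule atomic_pairing_sums(2)[OF A *(1,2) atomic_gauge_measurable[OF h] *(4) f])
 have le: "cmod (c j * (LINT x|M. f x * a j x)) \<le> Y * cmod (c j)" for j
  unfolding norm_mult using mult_left_mono[OF b(1)[OF *(1)[of j]], of "cmod (c j)"] by (simp add: mult.commute)
 have sY: "summable (\<lambda>j. Y * cmod (c j))" by (rule summable_mult[OF *(2)])
 have sn: "summable (\<lambda>j. cmod (c j * (LINT x|M. f x * a j x)))"
  by (rule summable_comparison_test'[OF sY, of 0]) (use le in auto)
 have "cmod (LINT x|M. f x * h x) \<le> (\<Sum>j. cmod (c j * (LINT x|M. f x * a j x)))"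
  using summable_norm[OF sn] S by (simp add: sums_iff)
 also have "\<dots> \<le> (\<Sum>j. Y * cmod (c j))" by (rule suminf_le[OF le sn sY])
 also have "\<dots> = Y * (\<Sum>j. cmod (c j))" by (rule suminf_mult[OF *(2)])
 also have "\<dots> \<le> Y * X" using *(3) b(2) by (rule mult_left_mono)
 finally show ?thesis .
qed

text \<open>Projection onto a disc truncates complex values by a map with Lipschitz constant 1 that
  fixes 0, so mean oscillations at most double and absolute values do not grow.\<close>

definition trunc :: "nat => complex => complex" where
 "trunc n = closest_point (cball 0 (real n))"

lemma trunc_lipschitz: "cmod (trunc n z - trunc n w) \<le> cmod (z - w)"
 using closest_point_lipschitz[of "cball (0::complex) (real n)" z w] unfolding trunc_def by (auto simp: dist_norm)

lemma trunc_eq: "cmod z \<le> real n ==> trunc n z = z"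
 unfolding trunc_def by (rule closest_point_self) simp

lemma trunc_bound: "cmod (trunc n z) \<le> real n" "cmod (trunc n z) \<le> cmod z"
 using closest_point_in_set[of "cball (0::complex) (real n)" z] trunc_lipschitz[of n z 0] trunc_eq[of 0 n]
 by (auto simp: trunc_def)

lemma trunc_measurable [measurable]: "trunc n \<in> borel_measurable borel"
 unfolding trunc_def by (intro borel_measurable_continuous_onI continuous_on_closest_point) auto

lemma trunc_tendsto: "(\<lambda>n. trunc n z) \<longlonglongrightarrow> z"
proof (rule tendsto_eventually)
 obtain N where "cmod z \<le> real N" using real_arch_simple by blast
 then show "\<forall>\<^sub>F n in sequentially. trunc n z = z"
  by (intro eventually_sequentiallyI[of N] trunc_eq) linarith
qed

context homogeneous_type
begin

abbreviation avg :: "'a => real => ('a => complex) => complex" where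
 "avg x r f \<equiv> average M (B x r) f"

lemma L1_loc_integrable: "f \<in> L1_loc d M ==> integrable M (\<lambda>y. indicator (B x r) y *\<^sub>R f y)"
proof (cases "0 < r")
 case False
 then have "B x r = {}" by (auto simp: qball_def not_less intro: order_trans[OF _ d_nonneg])
 then show ?thesis by simp
qed (simp add: L1_loc_def set_integrable_def)

lemma L1_loc_measurable:
 assumes "f \<in> L1_loc d M" shows "f \<in> borel_measurable M"
proof (rule borel_measurable_LIMSEQ_metric)
 fix x0 :: 'a and n :: nat
 show "(\<lambda>y. indicator (B (SOME z. True) (real n)) y *\<^sub>R f y) \<in> borel_measurable M"
  by (rule borel_measurable_integrable[OF L1_loc_integrable[OF assms]])
next
 fix y
 obtain N where N: "d (SOME z. True) y < real N" using reals_Archimedean2 by blast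
 have "\<forall>\<^sub>F n in sequentially. indicator (B (SOME z. True) (real n)) y *\<^sub>R f y = f y"
  by (rule eventually_sequentiallyI[of N]) (use N in \<open>auto simp: indicator_def\<close>)
 then show "(\<lambda>n. indicator (B (SOME z. True) (real n)) y *\<^sub>R f y) \<longlonglongrightarrow> f y" by (rule tendsto_eventually)
qed

lemma L1_locI:
 assumes "\<And>x r. 0 < r ==> integrable M (\<lambda>y. indicator (B x r) y *\<^sub>R f y)"
 shows "f \<in> L1_loc d M"
 using assms by (simp add: L1_loc_def set_integrable_def)

lemma L1_loc_const [simp]: "(\<lambda>_. c) \<in> L1_loc d M"
 by (intro L1_locI integrable_scaleR_left) (simp add: less_top[symmetric])

lemma L1_loc_add: "f \<in> L1_loc d M ==> g \<in> L1_loc d M ==> (\<lambda>y. f y + g y) \<in> L1_loc d M"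
 by (intro L1_locI) (simp add: scaleR_add_right L1_loc_integrable)

lemma L1_loc_scale: "f \<in> L1_loc d M ==> (\<lambda>y. c * f y) \<in> L1_loc d M"
proof (rule L1_locI)
 fix x r assume "f \<in> L1_loc d M"
 from integrable_mult_right[OF L1_loc_integrable[OF this, of x r], of c]
 show "integrable M (\<lambda>y. indicator (B x r) y *\<^sub>R (c * f y))" by simp
qed

lemma L1_loc_diff_const: "f \<in> L1_loc d M ==> (\<lambda>y. f y - c) \<in> L1_loc d M"
 using L1_loc_add[of f "\<lambda>_. -c"] by simp

lemma L1_loc_bound:
 assumes "f \<in> L1_loc d M" "g \<in> borel_measurable M" "\<And>y. cmod (g y) \<le> cmod (f y)"
 shows "g \<in> L1_loc d M"
proof (rule L1_locI)
 fix x r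
 show "integrable M (\<lambda>y. indicator (B x r) y *\<^sub>R g y)"
  by (rule Bochner_Integration.integrable_bound[OF L1_loc_integrable[OF assms(1), of x r]])
   (use assms(2,3) in \<open>auto simp: indicator_def\<close>)
qed

lemma L1_loc_norm:
 assumes "f \<in> L1_loc d M" shows "integrable M (\<lambda>y. indicator (B x r) y * cmod (f y))"
 using integrable_norm[OF L1_loc_integrable[OF assms]] by simp

lemma average_eq: "average M (B x r) f = (1 / mu x r) *\<^sub>R (LINT y|M. indicator (B x r) y *\<^sub>R f y)"
 by (simp add: average_def set_lebesgue_integral_def)

lemma MO_eq: "MO M f (B x r) = (LINT y|M. indicator (B x r) y * cmod (f y - avg x r f)) / mu x r"
 by (simp add: MO_def average_eq)

lemma MO_nonneg: "0 \<le> MO M f (B x r)"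
 unfolding MO_eq by (intro divide_nonneg_nonneg integral_nonneg_AE) auto

lemma MO_integral: "0 < r ==> (LINT y|M. indicator (B x r) y * cmod (f y - avg x r f)) = mu x r * MO M f (B x r)"
 using mu_pos[of r x] by (simp add: MO_eq)

lemma avg_integral: "0 < r ==> (LINT y|M. indicator (B x r) y *\<^sub>R f y) = of_real (mu x r) * avg x r f"
 using mu_pos[of r x] by (simp add: average_eq scaleR_conv_of_real)

lemma int_ball_const: "(LINT y|M. indicator (B x r) y *\<^sub>R (c::complex)) = of_real (mu x r) * c"
 by (subst integral_scaleR_left) (auto simp: scaleR_conv_of_real less_top[symmetric])

lemma avg_sub_const:
 assumes f: "f \<in> L1_loc d M" and r: "0 < r" and sub: "B x r \<subseteq> B z s"
 shows "cmod (avg x r f - c) * mu x r \<le> (LINT y|M. indicator (B z s) y * cmod (f y - c))"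
proof -
 have fc: "(\<lambda>y. f y - c) \<in> L1_loc d M" by (rule L1_loc_diff_const[OF f])
 have "of_real (mu x r) * (avg x r f - c) = (LINT y|M. indicator (B x r) y *\<^sub>R f y) - (LINT y|M. indicator (B x r) y *\<^sub>R c)"
  using avg_integral[OF r, of x f] int_ball_const[of x r c] by (simp add: algebra_simps)
 also have "\<dots> = (LINT y|M. indicator (B x r) y *\<^sub>R (f y - c))"
  using L1_loc_integrable[OF f, of x r] L1_loc_integrable[OF L1_loc_const[of c], of x r]
  by (subst Bochner_Integration.integral_diff[symmetric]) (auto simp: scaleR_diff_right)
 finally have e: "of_real (mu x r) * (avg x r f - c) = (LINT y|M. indicator (B x r) y *\<^sub>R (f y - c))" .
 have "cmod (avg x r f - c) * mu x r = cmod (of_real (mu x r) * (avg x r f - c))" by (simp add: norm_mult mult.commute)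
 also have "\<dots> = cmod (LINT y|M. indicator (B x r) y *\<^sub>R (f y - c))" by (simp only: e)
 also have "\<dots> \<le> (LINT y|M. cmod (indicator (B x r) y *\<^sub>R (f y - c)))" by (rule integral_norm_bound)
 also have "\<dots> \<le> (LINT y|M. indicator (B z s) y * cmod (f y - c))"
  by (rule integral_mono[OF integrable_norm[OF L1_loc_integrable[OF fc]] L1_loc_norm[OF fc]])
   (use sub in \<open>auto simp: indicator_def subset_iff\<close>)
 finally show ?thesis .
qed

lemma avg_compare:
 assumes f: "f \<in> L1_loc d M" and r: "0 < r" and s: "0 < s" and sub: "B x r \<subseteq> B z s"
 shows "cmod (avg x r f - avg z s f) \<le> mu z s / mu x r * MO M f (B z s)"
 using avg_sub_const[OF f r sub, of "avg z s f"] MO_integral[OF s, of z f] mu_pos[OF r, of x]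
 by (simp add: field_simps)

lemma MO_le_const:
 assumes f: "f \<in> L1_loc d M" and r: "0 < r"
 shows "mu x r * MO M f (B x r) \<le> 2 * (LINT y|M. indicator (B x r) y * cmod (f y - c))"
proof -
 define m where "m = avg x r f"
 have fc: "(\<lambda>y. f y - c) \<in> L1_loc d M" for c by (rule L1_loc_diff_const[OF f])
 have iB: "integrable M (\<lambda>y. indicator (B x r) y * cmod (c - m))" by (simp add: less_top[symmetric])
 have "mu x r * MO M f (B x r) = (LINT y|M. indicator (B x r) y * cmod (f y - m))" unfolding m_def by (rule MO_integral[OF r, symmetric])
 also have "\<dots> \<le> (LINT y|M. indicator (B x r) y * cmod (f y - c) + indicator (B x r) y * cmod (c - m))"
 proof (rule integral_mono)
  show "indicator (B x r) y * cmod (f y - m) \<le> indicator (B x r) y * cmod (f y - c) + indicator (B x r) y * cmod (c - m)" for y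
   using norm_triangle_ineq[of "f y - c" "c - m"] by (simp add: indicator_def)
 qed (use L1_loc_norm[OF fc] iB in auto)
 also have "\<dots> = (LINT y|M. indicator (B x r) y * cmod (f y - c)) + mu x r * cmod (c - m)"
  by (subst Bochner_Integration.integral_add[OF L1_loc_norm[OF fc] iB]) simp
 also have "mu x r * cmod (c - m) \<le> (LINT y|M. indicator (B x r) y * cmod (f y - c))"
  using avg_sub_const[OF f r subset_refl, where c=c] unfolding m_def by (simp add: norm_minus_commute mult.commute)
 finally show ?thesis by simp
qed

text \<open>The value of the Lipschitz map at the average is a legitimate comparison constant; the
  factor 2 is the price for returning to the true average.\<close>

lemma MO_lipschitz:
 assumes f: "f \<in> L1_loc d M" and \<phi>: "\<phi> \<in> borel_measurable borel" "\<And>z w. cmod (\<phi> z - \<phi> w) \<le> cmod (z - w)" "\<phi> 0 = 0"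
 shows "(\<lambda>y. \<phi> (f y)) \<in> L1_loc d M" and "0 < r ==> MO M (\<lambda>y. \<phi> (f y)) (B x r) \<le> 2 * MO M f (B x r)"
proof -
 note [measurable] = \<phi>(1) L1_loc_measurable[OF f]
 show L: "(\<lambda>y. \<phi> (f y)) \<in> L1_loc d M"
  by (rule L1_loc_bound[OF f]) (use \<phi>(2)[of _ 0] \<phi>(3) in auto)
 assume r: "0 < r"
 define m where "m = avg x r f"
 have "mu x r * MO M (\<lambda>y. \<phi> (f y)) (B x r) \<le> 2 * (LINT y|M. indicator (B x r) y * cmod (\<phi> (f y) - \<phi> m))"
  by (rule MO_le_const[OF L r])
 also have "\<dots> \<le> 2 * (LINT y|M. indicator (B x r) y * cmod (f y - m))"
  by (intro mult_left_mono integral_mono L1_loc_norm L1_loc_diff_const L f \<phi>(2)) (auto simp: \<phi>(2))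
 also have "\<dots> = mu x r * (2 * MO M f (B x r))" unfolding m_def MO_integral[OF r] by simp
 finally show "MO M (\<lambda>y. \<phi> (f y)) (B x r) \<le> 2 * MO M f (B x r)" using mu_pos[OF r, of x] by simp
qed

lemmas MO_trunc = MO_lipschitz[OF _ trunc_measurable trunc_lipschitz trunc_eq[of 0, simplified]]

lemma L1_loc_pairing:
 assumes f: "f \<in> L1_loc d M" and a: "a \<in> borel_measurable M" "\<And>y. cmod (a y) \<le> K" "\<And>y. y \<notin> B x t ==> a y = 0"
 shows "integrable M (\<lambda>y. f y * a y)" "cmod (LINT y|M. f y * a y) \<le> K * (LINT y|M. indicator (B x t) y * cmod (f y))"
proof -
 note [measurable] = L1_loc_measurable[OF f] a(1)
 have b: "cmod (f y * a y) \<le> K * (indicator (B x t) y * cmod (f y))" for y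
  using mult_left_mono[OF a(2)[of y], of "cmod (f y)"] a(3)[of y] by (simp add: norm_mult indicator_def mult.commute)
 have i: "integrable M (\<lambda>y. K * (indicator (B x t) y * cmod (f y)))" using L1_loc_norm[OF f] by simp
 show fa: "integrable M (\<lambda>y. f y * a y)"
  by (rule Bochner_Integration.integrable_bound[OF i]) (use b in \<open>auto intro!: AE_I2 intro: order_trans[OF _ abs_ge_self]\<close>)
 have "cmod (LINT y|M. f y * a y) \<le> (LINT y|M. cmod (f y * a y))" by (rule integral_norm_bound)
 also have "\<dots> \<le> (LINT y|M. K * (indicator (B x t) y * cmod (f y)))" by (rule integral_mono[OF integrable_norm[OF fa] i b])
 finally show "cmod (LINT y|M. f y * a y) \<le> K * (LINT y|M. indicator (B x t) y * cmod (f y))" by simp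
qed

lemma MO_pairing:
 assumes f: "f \<in> L1_loc d M" and a: "a \<in> borel_measurable M" "\<And>y. cmod (a y) \<le> K" "\<And>y. y \<notin> B x t ==> a y = 0"
  and z: "(LINT y|M. a y) = 0" and t: "0 < t"
 shows "cmod (LINT y|M. f y * a y) \<le> K * (mu x t * MO M f (B x t))"
proof -
 define m where "m = avg x t f"
 have fm: "(\<lambda>y. f y - m) \<in> L1_loc d M" by (rule L1_loc_diff_const[OF f])
 have ia: "integrable M a" by (rule bounded_integrable(1)[OF a])
 have "(LINT y|M. (f y - m) * a y) = (LINT y|M. f y * a y) - (LINT y|M. m * a y)"
  unfolding left_diff_distrib by (rule Bochner_Integration.integral_diff) (use L1_loc_pairing(1)[OF f a] ia in auto)
 then have "(LINT y|M. f y * a y) = (LINT y|M. (f y - m) * a y)" using z by simp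
 then show ?thesis using L1_loc_pairing(2)[of "\<lambda>y. f y - m" a K x t, OF fm a] MO_integral[OF t, of x f] unfolding m_def by simp
qed

text \<open>John--Nirenberg by duality. The deviation of \<open>f\<close> from its average is paired
  with a multiple of an atom in the dual exponent; decomposing that into bounded atoms leaves
  pairings that see only mean oscillations. The outcome is an inequality for \<open>S\<close> with
  \<open>S powr (1 / p)\<close> on the right.\<close>

lemma JN_bounded:
 assumes s: "1 < s"
 obtains C where "0 \<le> C"
  "\<And>x0 R f A K. 0 < R ==> 0 \<le> A ==> f \<in> borel_measurable M ==> (\<And>y. cmod (f y) \<le> K) ==>
    (\<And>x t. d x0 x < \<Lambda> * R ==> 0 < t ==> t \<le> \<Lambda> * R ==> MO M f (B x t) \<le> A) ==>
    (LINT y|M. indicator (B x0 R) y * cmod (f y - avg x0 R f) powr s) \<le> (C * A) powr s * mu x0 R"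
proof -
 define p where "p = s / (s - 1)"
 have p: "1 < p" "(s - 1) * p = s" "1 - 1 / p = 1 / s" unfolding p_def using s by (auto simp: field_simps)
 obtain C where C: "0 \<le> C" "\<And>x0 R X f. 0 < R ==> atomic_gauge M (local_patoms p x0 R) X f ==> atomic_gauge M (local_atoms x0 R) (C * X) f"
  by (rule local_atomic_decomposition[OF p(1)]) blast
 show ?thesis
 proof (rule that[of "4 * C"])
  show "0 \<le> 4 * C" using C by simp
  fix x0 R f A and K :: real
  assume R: "0 < R" and A: "0 \<le> A" and f[measurable]: "f \<in> borel_measurable M" and K: "\<And>y. cmod (f y) \<le> K"
   and mo: "\<And>x t. d x0 x < \<Lambda> * R ==> 0 < t ==> t \<le> \<Lambda> * R ==> MO M f (B x t) \<le> A"
  have fL: "f \<in> L1_loc d M" by (rule L1_loc_bound[OF L1_loc_const[of "of_real K"]]) (use K in \<open>auto intro: order_trans[OF _ abs_ge_self]\<close>)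
  define m where "m = avg x0 R f"
  define F where "F y = f y - m" for y
  have [measurable]: "F \<in> borel_measurable M" unfolding F_def by measurable
  define K' where "K' = K + cmod m"
  have FK: "cmod (F y) \<le> K'" for y unfolding F_def K'_def using norm_triangle_ineq4[of "f y" m] K[of y] by linarith
  define \<nu> where "\<nu> = mu x0 R"
  have nu: "0 < \<nu>" unfolding \<nu>_def by (rule mu_pos[OF R])
  \<comment> \<open>The extremal function of Hoelder's inequality: both \<open>F y * g y\<close> and
    \<open>cmod (g y) powr p\<close> equal \<open>cmod (F y) powr s\<close> on the ball.\<close>
  define g where "g y = indicator (B x0 R) y *\<^sub>R (cnj (sgn (F y)) * of_real (cmod (F y) powr (s - 1)))" for y
  have [measurable]: "g \<in> borel_measurable M" unfolding g_def sgn_div_norm by measurable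
  have ng: "cmod (g y) = indicator (B x0 R) y * cmod (F y) powr (s - 1)" for y
   unfolding g_def by (auto simp: norm_mult norm_sgn)
  have gK: "cmod (g y) \<le> K' powr (s - 1)" for y unfolding ng using FK[of y] s by (auto simp: indicator_def intro!: powr_mono2)
  have gp: "cmod (g y) powr p = indicator (B x0 R) y * cmod (F y) powr s" for y
   unfolding ng using p s by (auto simp: indicator_def powr_powr)
  have Fg: "F y * g y = of_real (indicator (B x0 R) y * cmod (F y) powr s)" for y
  proof -
   have 1: "F y * cnj (sgn (F y)) = of_real (cmod (F y))"
    by (cases "F y = 0") (auto simp: sgn_div_norm scaleR_conv_of_real complex_norm_square[symmetric] power2_eq_square field_simps)
   have 2: "cmod (F y) * cmod (F y) powr (s - 1) = cmod (F y) powr s"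
    by (cases "F y = 0") (auto simp: powr_diff)
   have "F y * g y = indicator (B x0 R) y *\<^sub>R ((F y * cnj (sgn (F y))) * of_real (cmod (F y) powr (s - 1)))"
    unfolding g_def by (simp add: mult.assoc)
   also have "\<dots> = indicator (B x0 R) y *\<^sub>R of_real (cmod (F y) powr s)" unfolding 1 of_real_mult[symmetric] 2 ..
   finally show ?thesis by (simp add: scaleR_conv_of_real)
  qed
  define S where "S = (LINT y|M. indicator (B x0 R) y * cmod (F y) powr s)"
  have iS: "integrable M (\<lambda>y. indicator (B x0 R) y * cmod (F y) powr s)"
  proof (rule Bochner_Integration.integrable_bound)
   show "integrable M (\<lambda>y. K' powr s * indicat_real (B x0 R) y)" by (simp add: less_top[symmetric])
   show "AE y in M. norm (indicator (B x0 R) y * cmod (F y) powr s) \<le> norm (K' powr s * indicat_real (B x0 R) y)"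
    using FK s by (auto simp: indicator_def intro!: AE_I2 powr_mono2)
  qed measurable
  have S0: "0 \<le> S" unfolding S_def by (intro integral_nonneg_AE) auto
  have gsup: "g y = 0" if "y \<notin> B x0 R" for y using that unfolding g_def by simp
  have gint: "integrable M g" by (rule bounded_integrable(1)[OF _ gK gsup]) auto
  define c where "c = (LINT y|M. g y) / of_real \<nu>"
  \<comment> \<open>Subtracting the mean supplies the cancellation of an atom and does not change
    the pairing, because \<open>F\<close> has mean zero on the ball.\<close>
  define G where "G y = g y - indicator (B x0 R) y *\<^sub>R c" for y
  have [measurable]: "G \<in> borel_measurable M" unfolding G_def by measurable
  have ic: "integrable M (\<lambda>y. indicator (B x0 R) y *\<^sub>R c)" by (rule L1_loc_integrable[OF L1_loc_const])
  have Gint: "integrable M G" unfolding G_def using gint ic by simp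
  have G0: "(LINT y|M. G y) = 0"
   unfolding G_def using Bochner_Integration.integral_diff[OF gint ic] int_ball_const[of x0 R c] nu unfolding c_def \<nu>_def by simp
  have Gsup: "G y = 0" if "y \<notin> B x0 R" for y using that gsup unfolding G_def by simp
  have fG: "(LINT y|M. f y * G y) = of_real S"
  proof -
   have i1: "integrable M (\<lambda>y. F y * g y)" unfolding Fg using iS by (rule integrable_of_real)
   have FL: "F \<in> L1_loc d M" unfolding F_def[abs_def] by (rule L1_loc_diff_const[OF fL])
   have i2: "integrable M (\<lambda>y. c * (indicator (B x0 R) y *\<^sub>R F y))" by (intro integrable_mult_right L1_loc_integrable FL)
   have i3: "integrable M (\<lambda>y. m * G y)" using Gint by simp
   have "f y * G y = (F y * g y - c * (indicator (B x0 R) y *\<^sub>R F y)) + m * G y" for y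
    unfolding F_def G_def by (simp add: algebra_simps scaleR_conv_of_real)
   then have "(LINT y|M. f y * G y) = (LINT y|M. (F y * g y - c * (indicator (B x0 R) y *\<^sub>R F y))) + (LINT y|M. m * G y)"
    using Bochner_Integration.integral_add[OF Bochner_Integration.integrable_diff[OF i1 i2] i3] by simp
   also have "\<dots> = (LINT y|M. F y * g y) - c * (LINT y|M. indicator (B x0 R) y *\<^sub>R F y) + m * (LINT y|M. G y)"
    by (simp only: Bochner_Integration.integral_diff[OF i1 i2] integral_mult_right_zero)
   also have "(LINT y|M. indicator (B x0 R) y *\<^sub>R F y) = 0"
   proof -
    have "(LINT y|M. indicator (B x0 R) y *\<^sub>R F y) = (LINT y|M. indicator (B x0 R) y *\<^sub>R f y) - (LINT y|M. indicator (B x0 R) y *\<^sub>R m)"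
     unfolding F_def scaleR_diff_right by (rule Bochner_Integration.integral_diff) (intro L1_loc_integrable fL L1_loc_const)+
    also have "\<dots> = of_real (mu x0 R) * m - of_real (mu x0 R) * m"
     using avg_integral[OF R, of x0 f] int_ball_const[of x0 R m] unfolding m_def by argo
    finally show ?thesis by simp
   qed
   also have "(LINT y|M. F y * g y) = of_real S" unfolding Fg S_def by (rule integral_complex_of_real)
   finally show ?thesis using G0 by simp
  qed
  have "S \<le> (4 * C * A) powr s * \<nu>"
  proof (cases "S = 0")
   case True
   then show ?thesis using nu by simp
  next
   case False
   then have Sp: "0 < S" using S0 by simp
   \<comment> \<open>The \<open>L\<^sup>p\<close> mean of \<open>g\<close> over the ball, which
     dominates the modulus of its mean \<open>c\<close>.\<close>
   define b where "b = (S / \<nu>) powr (1 / p)"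
   have bp: "b powr p * \<nu> = S" unfolding b_def using p Sp nu by (simp add: powr_powr)
   have cb: "cmod c \<le> b"
   proof -
    have e1: "indicator (B x0 R) y * cmod (g y) powr p = indicator (B x0 R) y * cmod (F y) powr s" for y
     unfolding gp by (simp add: indicator_def)
    have e2: "indicator (B x0 R) y * cmod (g y) = cmod (g y)" for y unfolding ng by (simp add: indicator_def)
    have "(LINT y|M. indicator (B x0 R) y * cmod (g y)) \<le> b * \<nu>"
     by (rule holder_mean(2)[OF p(1) fmeasurable_sub[OF B_sets subset_refl]])
      (use iS bp in \<open>auto simp: e1 S_def[symmetric] b_def \<nu>_def\<close>)
    then have "(LINT y|M. cmod (g y)) \<le> b * \<nu>" unfolding e2 .
    then have "cmod (LINT y|M. g y) \<le> b * \<nu>" using integral_norm_bound[of M g] by linarith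
    then show ?thesis unfolding c_def using nu by (simp add: norm_divide divide_le_eq)
   qed
   have iG: "integrable M (\<lambda>y. cmod (G y) powr p)" "(LINT y|M. cmod (G y) powr p) \<le> 4 powr p * S"
   proof -
    define v where "v y = 2 powr p * (indicator (B x0 R) y * cmod (F y) powr s + b powr p * indicator (B x0 R) y)" for y
    have vi: "integrable M v" unfolding v_def using iS by (simp add: less_top[symmetric])
    have le: "cmod (G y) powr p \<le> v y" for y
    proof -
     have "cmod (G y) \<le> cmod (g y) + cmod (indicator (B x0 R) y *\<^sub>R c)" unfolding G_def by (rule norm_triangle_ineq4)
     also have "\<dots> \<le> cmod (g y) + indicator (B x0 R) y * b" using cb by (simp add: indicator_def)
     finally have "cmod (G y) powr p \<le> (cmod (g y) + indicator (B x0 R) y * b) powr p" using p by (intro powr_mono2) auto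
     also have "\<dots> \<le> 2 powr p * (cmod (g y) powr p + (indicator (B x0 R) y * b) powr p)"
      by (rule powr_sum_le) (use p b_def in auto)
     also have "\<dots> = v y" unfolding v_def gp using p by (simp add: indicator_def)
     finally show ?thesis .
    qed
    show i: "integrable M (\<lambda>y. cmod (G y) powr p)"
     by (rule Bochner_Integration.integrable_bound[OF vi]) (use le in \<open>auto intro!: AE_I2 intro: order_trans[OF _ abs_ge_self]\<close>)
    have "(LINT y|M. cmod (G y) powr p) \<le> (LINT y|M. v y)" by (rule integral_mono[OF i vi le])
    also have "\<dots> = 2 powr p * (S + b powr p * \<nu>)"
     unfolding v_def S_def \<nu>_def using iS by (subst integral_mult_right_zero, subst Bochner_Integration.integral_add) (auto simp: less_top[symmetric])
    also have "\<dots> = (2 * 2 powr p) * S" using bp by simp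
    also have "\<dots> \<le> 4 powr p * S"
    proof (intro mult_right_mono)
     have "(2::real) powr 1 \<le> 2 powr p" using p by (intro powr_mono) auto
     then have "2 * 2 powr p \<le> (2 powr p) * (2 powr p :: real)" by simp
     also have "\<dots> = 4 powr p" using powr_mult[of 2 2 p] by simp
     finally show "2 * 2 powr p \<le> (4::real) powr p" .
    qed (use S0 in auto)
    finally show "(LINT y|M. cmod (G y) powr p) \<le> 4 powr p * S" .
   qed
   \<comment> \<open>The \<open>L\<^sup>p\<close> norm of \<open>G\<close> is at most
     \<open>4 * S powr (1 / p)\<close>; the second factor, with \<open>1 / s = 1 - 1 / p\<close>, is
     the normalisation of an atom on a set of measure \<open>\<nu>\<close>.\<close>
   define N where "N = 4 * S powr (1 / p) * \<nu> powr (1 / s)"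
   have N: "0 < N" unfolding N_def using Sp nu by simp
   have Np: "N powr p = 4 powr p * S * \<nu> powr (p - 1)"
   proof -
    have "1 / s * p = p - 1" using p(3) p(1) by (simp add: field_simps)
    then show ?thesis unfolding N_def using p Sp nu by (simp add: powr_mult powr_powr)
   qed
   have "(\<lambda>y. G y / of_real N) \<in> local_patoms p x0 R"
    unfolding local_patoms_def
   proof (intro CollectI conjI exI[of _ x0] exI[of _ R] allI impI)
    have e: "cmod (G y / of_real N) powr p = cmod (G y) powr p / N powr p" for y
     using N by (simp add: norm_divide powr_divide)
    show "integrable M (\<lambda>y. cmod (G y / of_real N) powr p)" unfolding e using iG(1) by simp
    have "(LINT y|M. cmod (G y / of_real N) powr p) = (LINT y|M. cmod (G y) powr p) / N powr p" unfolding e by simp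
    also have "\<dots> \<le> (4 powr p * S) / N powr p" by (intro divide_right_mono iG(2)) simp
    also have "\<dots> = \<nu> powr (1 - p)" unfolding Np using Sp nu by (simp add: powr_diff)
    finally show "(LINT y|M. cmod (G y / of_real N) powr p) \<le> mu x0 R powr (1 - p)" unfolding \<nu>_def .
    show "(LINT y|M. G y / of_real N) = 0" using G0 by simp
   qed (use R Gsup in auto)
   from atomic_gauge_scale[OF atomic_gauge_atom[OF L1_local_patoms[OF R p(1)] this], of "of_real N"]
   have "atomic_gauge M (local_patoms p x0 R) N G" using N by simp
   then have "atomic_gauge M (local_atoms x0 R) (C * N) G" by (rule C(2)[OF R])
   then have "cmod (LINT y|M. f y * G y) \<le> A * (C * N)"
   proof (rule atomic_pairing_bound[OF L1_local_atoms[OF R] _ f K _ A])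
    fix a assume "a \<in> local_atoms x0 R"
    then obtain x t where a: "a \<in> borel_measurable M" "0 < t" "t \<le> \<Lambda> * R" "d x0 x < \<Lambda> * R"
     "\<And>y. cmod (a y) \<le> 1 / mu x t" "\<And>y. y \<notin> B x t ==> a y = 0" "(LINT y|M. a y) = 0"
     unfolding local_atoms_def by blast
    have "cmod (LINT y|M. f y * a y) \<le> 1 / mu x t * (mu x t * MO M f (B x t))"
     by (rule MO_pairing[OF fL a(1,5,6,7,2)])
    also have "\<dots> = MO M f (B x t)" using mu_pos[OF a(2), of x] by simp
    also have "\<dots> \<le> A" by (rule mo[OF a(4,2,3)])
    finally show "cmod (LINT y|M. f y * a y) \<le> A" .
   qed
   then have "S \<le> A * (C * N)" unfolding fG using S0 by simp
   also have "\<dots> = (4 * C * A) * \<nu> powr (1 / s) * S powr (1 / p)" unfolding N_def by simp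
   \<comment> \<open>Division is legitimate because \<open>S\<close> is a finite positive number,
     which is why bounded functions are treated first.\<close>
   finally have "S / S powr (1 / p) \<le> (4 * C * A) * \<nu> powr (1 / s)" using Sp by (simp add: divide_le_eq)
   moreover have "S / S powr (1 / p) = S powr (1 / s)" using Sp p(3) powr_diff[of S 1 "1 / p"] by simp
   ultimately have "(S powr (1 / s)) powr s \<le> ((4 * C * A) * \<nu> powr (1 / s)) powr s"
    using s by (intro powr_mono2) auto
   then show ?thesis using s Sp nu A C(1) by (simp add: powr_powr powr_mult)
  qed
  then show "(LINT y|M. indicator (B x0 R) y * cmod (f y - avg x0 R f) powr s) \<le> (4 * C * A) powr s * mu x0 R"
   unfolding S_def F_def m_def \<nu>_def .
 qed
qed

text \<open>Truncations have at most twice the oscillation, so the bounded case applies to them with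
  one constant, and Fatou's lemma passes to the limit. Integrability of the power is part of the
  conclusion.\<close>

lemma John_Nirenberg:
 assumes s: "1 < s"
 obtains C where "0 \<le> C"
  "\<And>x0 R f A. 0 < R ==> 0 \<le> A ==> f \<in> L1_loc d M ==>
    (\<And>x t. d x0 x < \<Lambda> * R ==> 0 < t ==> t \<le> \<Lambda> * R ==> MO M f (B x t) \<le> A) ==>
    integrable M (\<lambda>y. indicator (B x0 R) y * cmod (f y - avg x0 R f) powr s) \<and>
    (LINT y|M. indicator (B x0 R) y * cmod (f y - avg x0 R f) powr s) \<le> (C * A) powr s * mu x0 R"
proof -
 obtain C where C: "0 \<le> C"
  "\<And>x0 R f A K. 0 < R ==> 0 \<le> A ==> f \<in> borel_measurable M ==> (\<And>y. cmod (f y) \<le> K) ==>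
    (\<And>x t. d x0 x < \<Lambda> * R ==> 0 < t ==> t \<le> \<Lambda> * R ==> MO M f (B x t) \<le> A) ==>
    (LINT y|M. indicator (B x0 R) y * cmod (f y - avg x0 R f) powr s) \<le> (C * A) powr s * mu x0 R"
  by (rule JN_bounded[OF s]) blast
 show ?thesis
 proof (rule that[of "2 * C"])
  show "0 \<le> 2 * C" using C by simp
  fix x0 R f A assume R: "0 < R" and A: "0 \<le> A" and f: "f \<in> L1_loc d M"
   and mo: "\<And>x t. d x0 x < \<Lambda> * R ==> 0 < t ==> t \<le> \<Lambda> * R ==> MO M f (B x t) \<le> A"
  note [measurable] = L1_loc_measurable[OF f]
  define fn where "fn n y = trunc n (f y)" for n y
  have [measurable]: "fn n \<in> borel_measurable M" for n unfolding fn_def by measurable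
  define X where "X = (2 * C * A) powr s * mu x0 R"
  have X0: "0 \<le> X" unfolding X_def by simp
  define u where "u n y = indicator (B x0 R) y * cmod (fn n y - avg x0 R (fn n)) powr s" for n y
  define v where "v y = indicator (B x0 R) y * cmod (f y - avg x0 R f) powr s" for y
  have [measurable]: "u n \<in> borel_measurable M" "v \<in> borel_measurable M" for n unfolding u_def v_def by measurable
  have un: "(LINT y|M. u n y) \<le> X" for n
  proof -
   have "(LINT y|M. u n y) \<le> (C * (2 * A)) powr s * mu x0 R" unfolding u_def
   proof (rule C(2)[OF R _ _ , of _ _ "real n"])
    show "cmod (fn n y) \<le> real n" for y unfolding fn_def by (rule trunc_bound)
    fix x t assume xt: "d x0 x < \<Lambda> * R" "0 < t" "t \<le> \<Lambda> * R"
    show "MO M (fn n) (B x t) \<le> 2 * A"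
     using MO_trunc(2)[OF f xt(2), of n x] mo[OF xt] unfolding fn_def by linarith
   qed (use A in auto)
   then show ?thesis unfolding X_def by (simp add: ac_simps)
  qed
  have ui: "integrable M (u n)" for n
  proof (rule Bochner_Integration.integrable_bound)
   define K where "K = real n + cmod (avg x0 R (fn n))"
   show "integrable M (\<lambda>y. K powr s * indicat_real (B x0 R) y)" by (simp add: less_top[symmetric])
   have "cmod (fn n y - avg x0 R (fn n)) \<le> K" for y
    unfolding K_def using norm_triangle_ineq4[of "fn n y" "avg x0 R (fn n)"] trunc_bound(1)[of n "f y"] unfolding fn_def by linarith
   then show "AE y in M. norm (u n y) \<le> norm (K powr s * indicat_real (B x0 R) y)"
    unfolding u_def using s by (auto simp: indicator_def intro!: AE_I2 powr_mono2)
  qed measurable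
  have av: "(\<lambda>n. avg x0 R (fn n)) \<longlonglongrightarrow> avg x0 R f"
   unfolding average_eq
  proof (intro tendsto_scaleR tendsto_const integral_dominated_convergence[where w="\<lambda>y. indicator (B x0 R) y * cmod (f y)"])
   show "integrable M (\<lambda>y. indicator (B x0 R) y * cmod (f y))" by (rule L1_loc_norm[OF f])
   show "AE y in M. (\<lambda>n. indicator (B x0 R) y *\<^sub>R fn n y) \<longlonglongrightarrow> indicator (B x0 R) y *\<^sub>R f y"
    unfolding fn_def by (intro AE_I2 tendsto_intros trunc_tendsto)
   show "AE y in M. norm (indicator (B x0 R) y *\<^sub>R fn n y) \<le> indicator (B x0 R) y * cmod (f y)" for n
    unfolding fn_def using trunc_bound(2)[of n] by (auto simp: indicator_def)
  qed measurable
  have lim: "(\<lambda>n. u n y) \<longlonglongrightarrow> v y" for y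
   unfolding u_def v_def
  proof (intro tendsto_mult tendsto_const tendsto_powr')
   show "(\<lambda>n. cmod (fn n y - avg x0 R (fn n))) \<longlonglongrightarrow> cmod (f y - avg x0 R f)"
    unfolding fn_def[of _ y] by (intro tendsto_norm tendsto_diff trunc_tendsto av)
  qed (use s in auto)
  have "(\<integral>\<^sup>+y. ennreal (v y) \<partial>M) = (\<integral>\<^sup>+y. liminf (\<lambda>n. ennreal (u n y)) \<partial>M)"
  proof (rule nn_integral_cong)
   fix y
   have "(\<lambda>n. ennreal (u n y)) \<longlonglongrightarrow> ennreal (v y)" using lim[of y] by (rule tendsto_ennrealI)
   from lim_imp_Liminf[OF _ this] show "ennreal (v y) = liminf (\<lambda>n. ennreal (u n y))" by simp
  qed
  also have "\<dots> \<le> liminf (\<lambda>n. \<integral>\<^sup>+y. ennreal (u n y) \<partial>M)" by (rule nn_integral_liminf) measurable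
  also have "\<dots> \<le> liminf (\<lambda>n. ennreal X)"
  proof (rule Liminf_mono, intro always_eventually allI)
   fix n
   have "(\<integral>\<^sup>+y. ennreal (u n y) \<partial>M) = ennreal (LINT y|M. u n y)"
    by (rule nn_integral_eq_integral[OF ui]) (auto simp: u_def)
   then show "(\<integral>\<^sup>+y. ennreal (u n y) \<partial>M) \<le> ennreal X" using un[of n] by (simp add: ennreal_leI)
  qed
  also have "\<dots> = ennreal X" by (simp add: Liminf_const)
  finally have nn: "(\<integral>\<^sup>+y. ennreal (v y) \<partial>M) \<le> ennreal X" .
  have v0: "0 \<le> v y" for y unfolding v_def by simp
  have vi: "integrable M v"
  proof (rule integrableI_bounded)
   show "(\<integral>\<^sup>+y. ennreal (norm (v y)) \<partial>M) < \<infinity>" using nn v0 by (simp add: order_le_less_trans)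
  qed measurable
  have "ennreal (LINT y|M. v y) \<le> ennreal X" using nn nn_integral_eq_integral[OF vi] v0 by simp
  then have "(LINT y|M. v y) \<le> X" using X0 by (simp add: ennreal_le_iff)
  then show "integrable M (\<lambda>y. indicator (B x0 R) y * cmod (f y - avg x0 R f) powr s) \<and>
    (LINT y|M. indicator (B x0 R) y * cmod (f y - avg x0 R f) powr s) \<le> (2 * C * A) powr s * mu x0 R"
   using vi unfolding v_def X_def by simp
 qed
qed

end

subsection \<open>The Hardy space of an admissible function\<close>

locale admissible_space = homogeneous_type d \<kappa> M
 for d :: "'a => 'a => real" and \<kappa> :: real and M :: "'a measure" +
 fixes \<rho> :: "'a => real"
 assumes admissible_rho: "admissible d \<rho>"
begin

lemma rho_pos [simp]: "0 < \<rho> x"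
 using admissible_rho unfolding admissible_def by blast

lemma rho_nonneg [simp]: "0 \<le> \<rho> x"
 using rho_pos[of x] by (rule less_imp_le)

text \<open>Admissibility is used with the two points exchanged: if \<open>\<rho> x\<close> exceeded
  \<open>R\<close>, the distance would be at most \<open>\<rho> x\<close> and the growth factor at
  most \<open>2 powr k\<close>.\<close>

lemma rho_upper:
 obtains c where "1 \<le> c" "\<And>x y R. d x y \<le> R ==> \<rho> y \<le> R ==> \<rho> x \<le> c * R"
proof -
 obtain k c where k: "0 < k" "0 < c" and ad: "\<And>x y. 1 / \<rho> x \<le> c / \<rho> y * (1 + d x y / \<rho> y) powr k"
  using admissible_rho unfolding admissible_def admissible_exponent_def by blast
 show ?thesis
 proof (rule that[of "max 1 (c * 2 powr k)"])
  fix x y R assume R: "d x y \<le> R" "\<rho> y \<le> R"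
  have R0: "0 < R" using R(2) rho_pos[of y] by linarith
  show "\<rho> x \<le> max 1 (c * 2 powr k) * R"
  proof (cases "\<rho> x \<le> R")
   case True
   have "1 * R \<le> max 1 (c * 2 powr k) * R" using R0 by (intro mult_right_mono) auto
   then show ?thesis using True by linarith
  next
   case False
   have "1 / \<rho> y \<le> c / \<rho> x * (1 + d y x / \<rho> x) powr k" by (rule ad)
   also have "\<dots> \<le> c / \<rho> x * 2 powr k"
    using False R k rho_pos[of x] by (intro mult_left_mono powr_mono2) (auto simp: dist_sym field_simps)
   finally have "\<rho> x \<le> (c * 2 powr k) * \<rho> y" using rho_pos[of x] rho_pos[of y] by (simp add: field_simps)
   also have "\<dots> \<le> max 1 (c * 2 powr k) * R" using R R0 k by (intro mult_mono) auto
   finally show ?thesis .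
  qed
 qed simp
qed

lemma rho_comparable:
 assumes "0 \<le> D"
 obtains c where "1 \<le> c" "\<And>x y. d x y \<le> D * \<rho> y ==> \<rho> y \<le> c * \<rho> x \<and> \<rho> x \<le> c * \<rho> y"
proof -
 obtain k c where k: "0 < k" "0 < c" and ad: "\<And>x y. 1 / \<rho> x \<le> c / \<rho> y * (1 + d x y / \<rho> y) powr k"
  using admissible_rho unfolding admissible_def admissible_exponent_def by blast
 obtain c' where c': "1 \<le> c'" "\<And>x y R. d x y \<le> R ==> \<rho> y \<le> R ==> \<rho> x \<le> c' * R" by (rule rho_upper) blast
 show ?thesis
 proof (rule that[of "max (c * (1 + D) powr k) (c' * (1 + D))"])
  have "1 * 1 \<le> c' * (1 + D)" using c'(1) assms by (intro mult_mono) auto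
  then show "1 \<le> max (c * (1 + D) powr k) (c' * (1 + D))" by simp
  fix x y assume xy: "d x y \<le> D * \<rho> y"
  have "1 / \<rho> x \<le> c / \<rho> y * (1 + d x y / \<rho> y) powr k" by (rule ad)
  also have "\<dots> \<le> c / \<rho> y * (1 + D) powr k"
   using xy k rho_pos[of y] by (intro mult_left_mono powr_mono2) (auto simp: field_simps)
  finally have "\<rho> y \<le> (c * (1 + D) powr k) * \<rho> x" using rho_pos[of x] rho_pos[of y] by (simp add: field_simps)
  also have "\<dots> \<le> max (c * (1 + D) powr k) (c' * (1 + D)) * \<rho> x" by (intro mult_right_mono) (auto simp: less_imp_le)
  finally have 1: "\<rho> y \<le> max (c * (1 + D) powr k) (c' * (1 + D)) * \<rho> x" .
  have "\<rho> x \<le> c' * ((1 + D) * \<rho> y)"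
   by (rule c'(2)[of x y]) (use xy assms rho_nonneg[of y] in \<open>simp_all add: distrib_right add_increasing\<close>)
  also have "\<dots> \<le> max (c * (1 + D) powr k) (c' * (1 + D)) * \<rho> y"
   unfolding mult.assoc[symmetric] by (intro mult_right_mono) (auto simp: less_imp_le)
  finally show "\<rho> y \<le> max (c * (1 + D) powr k) (c' * (1 + D)) * \<rho> x \<and> \<rho> x \<le> max (c * (1 + D) powr k) (c' * (1 + D)) * \<rho> y"
   using 1 by blast
 qed
qed

text \<open>Bounded atoms with conditions at every point instead of almost every point. An atom with
  \<open>q = \<infinity>\<close> agrees almost everywhere with one of these.\<close>

definition rho_atoms :: "('a => complex) set" where
 "rho_atoms = {a. a \<in> borel_measurable M \<and> (\<exists>x r. 0 < r \<and> r < \<rho> x \<and> (\<forall>y. cmod (a y) \<le> 1 / mu x r) \<and>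
   (\<forall>y. y \<notin> B x r \<longrightarrow> a y = 0) \<and> (r < \<rho> x / 4 \<longrightarrow> (LINT y|M. a y) = 0))}"

abbreviation HA :: "real => ('a => complex) => bool" where
 "HA \<equiv> atomic_gauge M rho_atoms"

lemma L1_rho_atoms: "L1_atoms M rho_atoms"
 unfolding L1_atoms_def
proof (intro conjI ballI)
 fix x0 :: 'a
 have "(\<lambda>_. 0) \<in> rho_atoms" unfolding rho_atoms_def
  by (auto intro!: exI[of _ x0] exI[of _ "\<rho> x0 / 2"])
 then show "rho_atoms \<noteq> {}" by blast
next
 fix a assume "a \<in> rho_atoms"
 then obtain x r where a: "a \<in> borel_measurable M" "0 < r" "\<And>y. cmod (a y) \<le> 1 / mu x r" "\<And>y. y \<notin> B x r ==> a y = 0"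
  unfolding rho_atoms_def by blast
 show "integrable M a" "(LINT x|M. cmod (a x)) \<le> 1"
  using bounded_integrable[of a "1 / mu x r" x r, OF a(1,3,4)] mu_pos[OF a(2), of x] by auto
qed

text \<open>On a ball with \<open>\<rho> x0 \<le> R\<close> no cancellation is required: the
  function is cut along balls of radius \<open>\<rho> (x i) / 2\<close>, at which scale atoms need
  not have mean zero. The pieces are stated explicitly, not just as a gauge, since they are also
  paired with functions that are only locally integrable.\<close>

lemma large_ball_pieces:
 obtains C where "1 \<le> C"
  "\<And>x0 R f. \<rho> x0 \<le> R ==> f \<in> borel_measurable M ==> (\<And>y. cmod (f y) \<le> 1 / mu x0 R) ==>
    (\<And>y. y \<notin> B x0 R ==> f y = 0) ==>
    \<exists>Q N. disjoint_family Q \<and> (\<forall>i. Q i \<in> sets M) \<and> (\<forall>i::nat. (0::real) \<le> N i) \<and> summable N \<and> (\<Sum>i. N i) \<le> C \<and>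
     (\<forall>i. \<exists>a\<in>rho_atoms. \<forall>y. indicator (Q i) y *\<^sub>R f y = of_real (N i) * a y) \<and>
     (\<forall>y. (\<lambda>i. indicator (Q i) y *\<^sub>R f y) sums f y)"
proof -
 obtain c where c: "1 \<le> c" "\<And>x y R. d x y \<le> R ==> \<rho> y \<le> R ==> \<rho> x \<le> c * R" by (rule rho_upper) blast
 \<comment> \<open>With this choice the enlarged balls have radius \<open>\<rho> (x i) / 2\<close>,
   between a quarter of \<open>\<rho> (x i)\<close> and \<open>\<rho> (x i)\<close>.\<close>
 define \<epsilon> where "\<epsilon> = 1 / (2 * V)"
 have e: "0 < \<epsilon>" "V * \<epsilon> = 1 / 2" unfolding \<epsilon>_def using V_ge by auto
 \<comment> \<open>Since \<open>\<rho>\<close> is at most \<open>c * R\<close> on the ball, all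
   selected small balls lie in the ball of radius \<open>l * R\<close>, whose measure bounds the sum
   of theirs.\<close>
 define l where "l = \<kappa> * (1 + \<epsilon> * c)"
 have "1 * 1 \<le> l" unfolding l_def using e c kappa_ge_1 by (intro mult_mono) auto
 then have l: "1 \<le> l" by simp
 show ?thesis
 proof (rule that[of "dbl V * dbl l"])
  have "1 * 1 \<le> dbl V * dbl l" by (intro mult_mono dbl_ge_1) (auto intro: order_trans[OF zero_le_one dbl_ge_1])
  then show "1 \<le> dbl V * dbl l" by simp
  fix x0 R and f :: "'a => complex"
  assume R: "\<rho> x0 \<le> R" and f[measurable]: "f \<in> borel_measurable M"
   and fb: "\<And>y. cmod (f y) \<le> 1 / mu x0 R" and fs: "\<And>y. y \<notin> B x0 R ==> f y = 0"
  have R0: "0 < R" using R rho_pos[of x0] by linarith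
  define m where "m = mu x0 R"
  have m: "0 < m" unfolding m_def by (rule mu_pos[OF R0])
  have rc: "\<rho> x \<le> c * R" if "x \<in> B x0 R" for x
   by (rule c(2)[of x x0]) (use that R in \<open>auto simp: dist_sym\<close>)
  have TR: "0 < \<epsilon> * \<rho> x \<and> \<epsilon> * \<rho> x \<le> \<epsilon> * (c * R)" if "x \<in> B x0 R" for x
   using rc[OF that] e by (auto intro: mult_left_mono)
  obtain I :: "nat set" and x where Ix: "\<And>i. i \<in> I ==> x i \<in> B x0 R"
   "disjoint_family_on (\<lambda>i. B (x i) (\<epsilon> * \<rho> (x i))) I" "B x0 R \<subseteq> (\<Union>i\<in>I. B (x i) (V * (\<epsilon> * \<rho> (x i))))"
   by (rule vitali_cover[of "B x0 R" "\<lambda>x. \<epsilon> * \<rho> x" "\<epsilon> * (c * R)" x0 R, OF TR subset_refl]) blast+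
  have Ve: "V * (\<epsilon> * r) = r / 2" for r using e(2) by (simp add: mult.assoc[symmetric])
  define E where "E i = (if i \<in> I then B (x i) (\<rho> (x i) / 2) else {})" for i
  define Q where "Q = disjointed E"
  have Es[measurable]: "E i \<in> sets M" for i unfolding E_def by auto
  have "range Q \<subseteq> sets M" unfolding Q_def by (rule sets.range_disjointed_sets) auto
  then have Qs[measurable]: "Q i \<in> sets M" for i by blast
  have Qdis: "disjoint_family Q" unfolding Q_def by (rule disjoint_family_disjointed)
  have QE: "Q i \<subseteq> E i" for i unfolding Q_def by (rule disjointed_subset)
  have UQ: "B x0 R \<subseteq> (\<Union>i. Q i)" using Ix(3) unfolding Q_def UN_disjointed_eq Ve E_def by auto
  define N where "N i = measure M (E i) / m" for i
  define b where "b i = (if i \<in> I then mu (x i) (\<epsilon> * \<rho> (x i)) else 0)" for i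
  have be: "b = (\<lambda>i. if i \<in> I then mu (x i) (\<epsilon> * \<rho> (x i)) else 0)" by (rule ext) (simp add: b_def)
  have bsub: "B (x i) (\<epsilon> * \<rho> (x i)) \<in> sets M \<and> B (x i) (\<epsilon> * \<rho> (x i)) \<subseteq> B x0 (l * R)" if i: "i \<in> I" for i
  proof -
   have "B (x i) (\<epsilon> * \<rho> (x i)) \<subseteq> B x0 (l * R)"
   proof (rule B_subset[of x0 "x i" R])
    have "\<kappa> * (R + \<epsilon> * \<rho> (x i)) \<le> \<kappa> * (R + \<epsilon> * (c * R))"
     by (rule mult_left_mono, rule add_left_mono) (use TR[OF Ix(1)[OF i]] kappa_pos in auto)
    also have "\<dots> = l * R" unfolding l_def by (simp add: algebra_simps)
    finally show "\<kappa> * (R + \<epsilon> * \<rho> (x i)) \<le> l * R" .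
   qed (use Ix(1)[OF i] in auto)
   then show ?thesis by simp
  qed
  note dm = disjoint_measures[OF Ix(2) bsub fmeasurable_sub[OF B_sets subset_refl]]
  have sb: "summable b" unfolding be by (rule dm(1)) auto
  have "(\<Sum>i. b i) \<le> mu x0 (l * R)" unfolding be by (rule dm(2)) auto
  also have "\<dots> \<le> dbl l * m" unfolding m_def by (rule mu_scale[OF l R0])
  finally have sb2: "(\<Sum>i. b i) \<le> dbl l * m" .
  have Nle: "N i \<le> dbl V / m * b i" for i
  proof (cases "i \<in> I")
   case True
   have "mu (x i) (V * (\<epsilon> * \<rho> (x i))) \<le> dbl V * mu (x i) (\<epsilon> * \<rho> (x i))" by (rule mu_scale[OF V_ge(2)]) (use e in simp)
   then show ?thesis unfolding N_def E_def b_def Ve using True m by (simp add: divide_right_mono)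
  qed (simp add: N_def E_def b_def)
  have N0: "0 \<le> N i" for i unfolding N_def using m by simp
  have sN: "summable N"
   by (rule summable_comparison_test'[OF summable_mult[OF sb, of "dbl V / m"], of 0]) (use Nle N0 in auto)
  have sN2: "(\<Sum>i. N i) \<le> dbl V * dbl l"
  proof -
   have "(\<Sum>i. N i) \<le> (\<Sum>i. dbl V / m * b i)" by (intro suminf_le Nle sN summable_mult sb)
   also have "\<dots> = dbl V / m * (\<Sum>i. b i)" by (rule suminf_mult[OF sb])
   also have "\<dots> \<le> dbl V / m * (dbl l * m)" using sb2 dbl_pos[of V] m by (intro mult_left_mono) auto
   finally show ?thesis using m by simp
  qed
  have g: "\<exists>a\<in>rho_atoms. \<forall>y. indicator (Q i) y *\<^sub>R f y = of_real (N i) * a y" for i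
  proof (cases "i \<in> I")
   case True
   have Em: "0 < measure M (E i)" unfolding E_def using True mu_pos[of "\<rho> (x i) / 2" "x i"] by simp
   then have N: "0 < N i" unfolding N_def using m by simp
   have "(\<lambda>y. (indicator (Q i) y *\<^sub>R f y) / of_real (N i)) \<in> rho_atoms"
    unfolding rho_atoms_def
   proof (intro CollectI conjI exI[of _ "x i"] exI[of _ "\<rho> (x i) / 2"] allI impI)
    fix y
    have "cmod ((indicator (Q i) y *\<^sub>R f y) / of_real (N i)) \<le> cmod (f y) / N i"
     using N by (simp add: norm_divide indicator_def)
    also have "\<dots> \<le> (1 / m) / N i" using fb[of y] N unfolding m_def by (intro divide_right_mono) auto
    also have "\<dots> = 1 / mu (x i) (\<rho> (x i) / 2)" unfolding N_def E_def using True m by simp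
    finally show "cmod ((indicator (Q i) y *\<^sub>R f y) / of_real (N i)) \<le> 1 / mu (x i) (\<rho> (x i) / 2)" .
    assume "y \<notin> B (x i) (\<rho> (x i) / 2)"
    then have "y \<notin> Q i" using QE[of i] True unfolding E_def by auto
    then show "(indicator (Q i) y *\<^sub>R f y) / of_real (N i) = 0" by simp
   qed auto
   moreover have "of_real (N i) * ((indicator (Q i) y *\<^sub>R f y) / of_real (N i)) = indicator (Q i) y *\<^sub>R f y" for y
    using N by (cases "y \<in> Q i") auto
   ultimately show ?thesis by (intro bexI[of _ "\<lambda>y. (indicator (Q i) y *\<^sub>R f y) / of_real (N i)"] allI) (simp_all only:)
  next
   case False
   then have "Q i = {}" "N i = 0" using QE[of i] unfolding E_def N_def by auto
   then show ?thesis using L1_rho_atoms unfolding L1_atoms_def by auto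
  qed
  have fsum: "(\<lambda>i. indicator (Q i) y *\<^sub>R f y) sums f y" for y
  proof (cases "y \<in> (\<Union>i. Q i)")
   case True
   then obtain k where "y \<in> Q k" by blast
   from disjoint_sums(1)[OF Qdis this, of "\<lambda>_. f y"] show ?thesis .
  next
   case False
   then have "f y = 0" using UQ by (intro fs) blast
   then show ?thesis by simp
  qed
  show "\<exists>Q N. disjoint_family Q \<and> (\<forall>i. Q i \<in> sets M) \<and> (\<forall>i::nat. (0::real) \<le> N i) \<and> summable N \<and> (\<Sum>i. N i) \<le> dbl V * dbl l \<and>
     (\<forall>i. \<exists>a\<in>rho_atoms. \<forall>y. indicator (Q i) y *\<^sub>R f y = of_real (N i) * a y) \<and>
     (\<forall>y. (\<lambda>i. indicator (Q i) y *\<^sub>R f y) sums f y)"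
   using Qdis Qs N0 sN sN2 g fsum by (intro exI[of _ Q] exI[of _ N]) simp
 qed
qed

text \<open>In the last conclusion \<open>w\<close> is merely locally integrable, so a general
  atomic series could not be integrated against it term by term. The pieces are restrictions of
  \<open>f\<close> to disjoint sets, and for these it is possible.\<close>

lemma large_ball_HA:
 obtains C where "1 \<le> C"
  "\<And>x0 R f. \<rho> x0 \<le> R ==> f \<in> borel_measurable M ==> (\<And>y. cmod (f y) \<le> 1 / mu x0 R) ==>
    (\<And>y. y \<notin> B x0 R ==> f y = 0) ==> HA C f"
  "\<And>x0 R f w A. \<rho> x0 \<le> R ==> f \<in> borel_measurable M ==> (\<And>y. cmod (f y) \<le> 1 / mu x0 R) ==>
    (\<And>y. y \<notin> B x0 R ==> f y = 0) ==> w \<in> L1_loc d M ==> 0 \<le> A ==>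
    (\<And>a. a \<in> rho_atoms ==> cmod (LINT y|M. w y * a y) \<le> A) ==> cmod (LINT y|M. w y * f y) \<le> C * A"
proof -
 obtain C where C: "1 \<le> C"
  "\<And>x0 R f. \<rho> x0 \<le> R ==> f \<in> borel_measurable M ==> (\<And>y. cmod (f y) \<le> 1 / mu x0 R) ==>
    (\<And>y. y \<notin> B x0 R ==> f y = 0) ==>
    \<exists>Q N. disjoint_family Q \<and> (\<forall>i. Q i \<in> sets M) \<and> (\<forall>i::nat. (0::real) \<le> N i) \<and> summable N \<and> (\<Sum>i. N i) \<le> C \<and>
     (\<forall>i. \<exists>a\<in>rho_atoms. \<forall>y. indicator (Q i) y *\<^sub>R f y = of_real (N i) * a y) \<and>
     (\<forall>y. (\<lambda>i. indicator (Q i) y *\<^sub>R f y) sums f y)"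
  by (rule large_ball_pieces) blast
 show ?thesis
 proof (rule that[OF C(1)])
  fix x0 R and f :: "'a => complex"
  assume R: "\<rho> x0 \<le> R" and f[measurable]: "f \<in> borel_measurable M"
   and fb: "\<And>y. cmod (f y) \<le> 1 / mu x0 R" and fs: "\<And>y. y \<notin> B x0 R ==> f y = 0"
  obtain Q N where Q: "disjoint_family Q" "\<And>i. Q i \<in> sets M" "\<And>i::nat. (0::real) \<le> N i" "summable N" "(\<Sum>i. N i) \<le> C"
     and a: "\<forall>i. \<exists>a\<in>rho_atoms. \<forall>y. indicator (Q i) y *\<^sub>R f y = of_real (N i) * a y"
     and s: "\<And>y. (\<lambda>i. indicator (Q i) y *\<^sub>R f y) sums f y"
   using C(2)[OF R f fb fs] by blast
  from bchoice[of UNIV, simplified, OF a[unfolded Bex_def]]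
  obtain a where a: "\<And>i. a i \<in> rho_atoms" "\<And>i y. indicator (Q i) y *\<^sub>R f y = of_real (N i) * a i y" by blast
  show "HA C f"
  proof (rule atomic_gauge_suminf[OF L1_rho_atoms _ Q(4,5) f])
   show "HA (N i) (\<lambda>y. indicator (Q i) y *\<^sub>R f y)" for i
    using atomic_gauge_scale[OF atomic_gauge_atom[OF L1_rho_atoms a(1)[of i]], of "of_real (N i)"] Q(3)[of i]
    unfolding a(2) by simp
  qed (use s in simp)
  fix w A assume w: "w \<in> L1_loc d M" and A: "0 \<le> A"
   and wa: "\<And>a. a \<in> rho_atoms ==> cmod (LINT y|M. w y * a y) \<le> A"
  note [measurable] = L1_loc_measurable[OF w] Q(2)
  have wf: "integrable M (\<lambda>y. w y * f y)" by (rule L1_loc_pairing(1)[OF w f fb fs])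
  define u where "u i y = indicator (Q i) y *\<^sub>R (w y * f y)" for i y
  have ui: "integrable M (u i)" for i unfolding u_def[abs_def] by (rule integrable_mult_indicator[OF Q(2) wf])
  have us: "summable (\<lambda>i. \<integral>y. cmod (u i y) \<partial>M)"
  proof (rule bounded_imp_summable[of _ "\<integral>y. cmod (w y * f y) \<partial>M"])
   fix n
   have "(\<Sum>i<Suc n. \<integral>y. indicator (Q i) y * cmod (w y * f y) \<partial>M) \<le> (LINT y|M. cmod (w y * f y))"
    by (rule sum_disjoint_integrals[OF Q(1,2) integrable_norm[OF wf]]) simp
   then show "(\<Sum>i\<le>n. \<integral>y. cmod (u i y) \<partial>M) \<le> (LINT y|M. cmod (w y * f y))"
    unfolding lessThan_Suc_atMost u_def by simp
  qed simp
  have ae: "AE y in M. (\<lambda>i. u i y) sums (w y * f y)"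
  proof (rule AE_I2)
   fix y show "(\<lambda>i. u i y) sums (w y * f y)" using sums_mult[OF s[of y], of "w y"] unfolding u_def by simp
  qed
  have S: "(\<lambda>i. \<integral>y. u i y \<partial>M) sums (LINT y|M. w y * f y)"
   by (rule integrable_sums(2)[OF ui us borel_measurable_integrable[OF wf] ae])
  have le: "cmod (LINT y|M. u i y) \<le> A * N i" for i
  proof -
   have "u i y = of_real (N i) * (w y * a i y)" for y
    using a(2)[of i y] unfolding u_def by (metis mult.left_commute mult_scaleR_right)
   then have "(LINT y|M. u i y) = of_real (N i) * (LINT y|M. w y * a i y)" by simp
   then have "cmod (LINT y|M. u i y) = N i * cmod (LINT y|M. w y * a i y)" using Q(3)[of i] by (simp add: norm_mult)
   also have "\<dots> \<le> N i * A" by (rule mult_left_mono[OF wa[OF a(1)] Q(3)])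
   finally show ?thesis by (simp add: mult.commute)
  qed
  have sA: "summable (\<lambda>i. A * N i)" by (rule summable_mult[OF Q(4)])
  have sn: "summable (\<lambda>i. cmod (LINT y|M. u i y))"
   by (rule summable_comparison_test'[OF sA, of 0]) (use le in auto)
  have "cmod (LINT y|M. w y * f y) \<le> (\<Sum>i. cmod (LINT y|M. u i y))" using summable_norm[OF sn] S by (simp add: sums_iff)
  also have "\<dots> \<le> (\<Sum>i. A * N i)" by (rule suminf_le[OF le sn sA])
  also have "\<dots> = A * (\<Sum>i. N i)" by (rule suminf_mult[OF Q(4)])
  also have "\<dots> \<le> A * C" using Q(5) A by (rule mult_left_mono)
  finally show "cmod (LINT y|M. w y * f y) \<le> C * A" by (simp add: mult.commute)
 qed
qed

lemma mean_zero_HA: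
 obtains C where "1 \<le> C"
  "\<And>x R f K. 0 < R ==> f \<in> borel_measurable M ==> (\<And>y. cmod (f y) \<le> K / mu x R) ==>
    (\<And>y. y \<notin> B x R ==> f y = 0) ==> \<rho> x \<le> R \<or> (LINT y|M. f y) = 0 ==> 0 < K ==> HA (C * K) f"
proof -
 obtain C where C: "1 \<le> C" "\<And>x0 R f. \<rho> x0 \<le> R ==> f \<in> borel_measurable M ==> (\<And>y. cmod (f y) \<le> 1 / mu x0 R) ==>
    (\<And>y. y \<notin> B x0 R ==> f y = 0) ==> HA C f" by (rule large_ball_HA) blast
 show ?thesis
 proof (rule that[OF C(1)])
  fix x R and f :: "'a => complex" and K :: real
  assume R: "0 < R" and f[measurable]: "f \<in> borel_measurable M" and fb: "\<And>y. cmod (f y) \<le> K / mu x R"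
   and fs: "\<And>y. y \<notin> B x R ==> f y = 0" and z: "\<rho> x \<le> R \<or> (LINT y|M. f y) = 0" and K: "0 < K"
  define g where "g y = f y / of_real K" for y
  have gb: "cmod (g y) \<le> 1 / mu x R" for y
   using fb[of y] K unfolding g_def by (simp add: norm_divide divide_le_eq)
  have [measurable]: "g \<in> borel_measurable M" unfolding g_def by measurable
  have "HA C g"
  proof (cases "\<rho> x \<le> R")
   case True
   show ?thesis by (rule C(2)[OF True _ gb]) (use fs in \<open>auto simp: g_def\<close>)
  next
   case False
   then have "(LINT y|M. g y) = 0" using z unfolding g_def by simp
   moreover have "g y = 0" if "y \<notin> B x R" for y using fs[OF that] unfolding g_def by simp
   ultimately have "g \<in> rho_atoms" unfolding rho_atoms_def using R False gb
    by (auto intro!: exI[of _ x] exI[of _ R])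
   then show ?thesis using atomic_gauge_mono[OF atomic_gauge_atom[OF L1_rho_atoms]] C(1) by blast
  qed
  from atomic_gauge_scale[OF this, of "of_real K"] show "HA (C * K) f" using K unfolding g_def by (simp add: mult.commute)
 qed
qed

section \<open>Normalised indicators of balls and the logarithmic cost of missing
  cancellation\<close>

definition chi :: "'a => real => 'a => complex" where
 "chi x R y = of_real (indicator (B x R) y / mu x R)"

lemma chi_measurable [measurable]: "chi x R \<in> borel_measurable M"
 unfolding chi_def by measurable

lemma chi_integral: "0 < R ==> integrable M (chi x R)" "0 < R ==> (LINT y|M. chi x R y) = 1"
 using mu_pos[of R x] unfolding chi_def integral_complex_of_real by (auto simp: less_top[symmetric])

text \<open>The difference of two normalised indicators of concentric balls has mean zero and, by
  doubling, the size of an atom on the larger ball.\<close>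

lemma chi_diff_HA:
 obtains C where "1 \<le> C" "\<And>x R. 0 < R ==> HA C (\<lambda>y. chi x (2 * R) y - chi x R y)"
proof -
 obtain C where C: "1 \<le> C" "\<And>x R f K. 0 < R ==> f \<in> borel_measurable M ==> (\<And>y. cmod (f y) \<le> K / mu x R) ==>
    (\<And>y. y \<notin> B x R ==> f y = 0) ==> \<rho> x \<le> R \<or> (LINT y|M. f y) = 0 ==> 0 < K ==> HA (C * K) f"
  by (rule mean_zero_HA) blast
 show ?thesis
 proof (rule that[of "C * Cd"])
  show "1 \<le> C * Cd" using C(1) Cd(1) by (metis less_imp_le mult_mono mult_1 zero_le_one order_trans)
  fix x R assume R: "(0::real) < R"
  have m: "0 < mu x R" "0 < mu x (2 * R)" "mu x (2 * R) \<le> Cd * mu x R" "mu x R \<le> mu x (2 * R)"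
   using R mu_pos Cd(2)[OF R, of x] mu_mono[of R "2 * R" x] by auto
  show "HA (C * Cd) (\<lambda>y. chi x (2 * R) y - chi x R y)"
  proof (rule C(2)[of "2 * R" _ Cd x])
   show "cmod (chi x (2 * R) y - chi x R y) \<le> Cd / mu x (2 * R)" for y
   proof -
    define u v where "u = indicat_real (B x (2 * R)) y / mu x (2 * R)" and "v = indicat_real (B x R) y / mu x R"
    have b: "0 \<le> u" "0 \<le> v" "u \<le> 1 / mu x (2 * R)" "v \<le> 1 / mu x R"
     unfolding u_def v_def using m by (auto simp: indicator_def)
    have "1 / mu x (2 * R) \<le> Cd / mu x (2 * R)" using m Cd(1) by (simp add: divide_right_mono)
    moreover have "1 / mu x R \<le> Cd / mu x (2 * R)" using m by (simp add: field_simps)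
    ultimately have "\<bar>u - v\<bar> \<le> Cd / mu x (2 * R)" using b by linarith
    then show ?thesis unfolding chi_def u_def[symmetric] v_def[symmetric] of_real_diff[symmetric] norm_of_real .
   qed
   show "\<rho> x \<le> 2 * R \<or> (LINT y|M. chi x (2 * R) y - chi x R y) = 0"
    using Bochner_Integration.integral_diff[OF chi_integral(1)[of "2 * R" x] chi_integral(1)[of R x]] chi_integral(2)[of "2 * R" x] chi_integral(2)[of R x] R by simp
  qed (use R Cd(1) in \<open>auto simp: chi_def\<close>)
 qed
qed

lemma ln_e_ge_1: "0 \<le> u ==> 1 \<le> ln (exp 1 + u)" for u :: real
 by (subst ln_ge_iff) (auto intro: add_pos_nonneg)

text \<open>This is where the logarithm comes from: the radius is doubled until it reaches
  \<open>\<rho> x\<close>, each doubling costs one mean zero difference, and at that scale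
  cancellation is no longer required. The number of doublings is about
  \<open>log 2 (\<rho> x / R)\<close>.\<close>

lemma chi_HA:
 obtains C where "1 \<le> C" "\<And>x R. 0 < R ==> HA (C * ln (exp 1 + \<rho> x / R)) (chi x R)"
proof -
 obtain C where C: "1 \<le> C" "\<And>x R. 0 < R ==> HA C (\<lambda>y. chi x (2 * R) y - chi x R y)" by (rule chi_diff_HA) blast
 obtain C' where C': "1 \<le> C'" "\<And>x0 R f. \<rho> x0 \<le> R ==> f \<in> borel_measurable M ==> (\<And>y. cmod (f y) \<le> 1 / mu x0 R) ==>
    (\<And>y. y \<notin> B x0 R ==> f y = 0) ==> HA C' f" by (rule large_ball_HA) blast
 define D where "D = max C C'"
 have D: "1 \<le> D" "C \<le> D" "C' \<le> D" unfolding D_def using C(1) by auto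
 show ?thesis
 proof (rule that[of "4 * D"])
  show "1 \<le> 4 * D" using D by simp
  fix x R assume R: "(0::real) < R"
  define L where "L = ln (exp 1 + \<rho> x / R)"
  have L1: "1 \<le> L" unfolding L_def by (rule ln_e_ge_1) (use R rho_pos[of x] in simp)
  define n where "n = nat \<lceil>log 2 (\<rho> x / R)\<rceil>"
  have last: "HA D (chi x (2^n * R))"
  proof (rule atomic_gauge_mono[OF C'(2) D(3)])
   have "\<rho> x / R = 2 powr (log 2 (\<rho> x / R))" using R rho_pos[of x] by simp
   also have "\<dots> \<le> 2 powr (real n)" unfolding n_def by (intro powr_mono) linarith+
   also have "\<dots> = 2 ^ n" by (simp add: powr_realpow)
   finally show "\<rho> x \<le> 2^n * R" using R by (simp add: field_simps)
  qed (auto simp: chi_def indicator_def norm_divide)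
  \<comment> \<open>Induction downwards from the largest radius, \<open>k\<close> counting the
    halvings already made.\<close>
  have tel: "HA (D + real k * D) (chi x (2^(n - k) * R))" if "k \<le> n" for k
   using that
  proof (induction k)
   case (Suc k)
   have e: "n - k = Suc (n - Suc k)" using Suc.prems by simp
   have "HA D (\<lambda>y. chi x (2 * (2^(n - Suc k) * R)) y - chi x (2^(n - Suc k) * R) y)"
    by (rule atomic_gauge_mono[OF C(2) D(2)]) (use R in simp)
   from atomic_gauge_diff[OF L1_rho_atoms Suc.IH this] Suc.prems
   have "HA (D + real k * D + D) (\<lambda>y. chi x (2^(n - k) * R) y - (chi x (2 * (2^(n - Suc k) * R)) y - chi x (2^(n - Suc k) * R) y))" by simp
   then show ?case unfolding e by (simp add: algebra_simps)
  qed (use last in simp)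
  have "HA (D + real n * D) (chi x R)" using tel[of n] by simp
  moreover have "D + real n * D \<le> 4 * D * L"
  proof -
   have "real n \<le> 1 + 2 * L"
   proof (cases "\<rho> x / R \<le> 1")
    case True
    have "0 < \<rho> x / R" using R by simp
     with True have "log 2 (\<rho> x / R) \<le> log 2 1" by (subst log_le_cancel_iff) simp_all
    then have "n = 0" unfolding n_def by simp
    then show ?thesis using L1 by simp
   next
    case False
    then have l0: "0 < log 2 (\<rho> x / R)" by simp
    have "real n \<le> log 2 (\<rho> x / R) + 1" unfolding n_def using l0 by linarith
    also have "log 2 (\<rho> x / R) = ln (\<rho> x / R) / ln 2" by (simp add: log_def)
    \<comment> \<open>As \<open>ln 2\<close> is above 1/2, passing to base 2 at most doubles the
      logarithm.\<close>
    also have "ln (\<rho> x / R) / ln 2 \<le> ln (\<rho> x / R) / (1 / 2)"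
     using False ln_2_less_1 ln2_ge_two_thirds by (intro divide_left_mono) auto
    also have "ln (\<rho> x / R) / (1 / 2) \<le> 2 * L" unfolding L_def using False R
     by (simp add: ln_mono)
    finally show ?thesis by simp
   qed
   then have "1 + real n \<le> 4 * L" using L1 by linarith
   then have "D * (1 + real n) \<le> D * (4 * L)" using D(1) by (intro mult_left_mono) auto
   then show ?thesis by (simp add: algebra_simps)
  qed
  ultimately show "HA (4 * D * ln (exp 1 + \<rho> x / R)) (chi x R)" unfolding L_def[symmetric] by (rule atomic_gauge_mono)
 qed
qed

text \<open>The bound says that the \<open>L\<^sup>p\<close> norm is at most \<open>A\<close> times
  that of a normalised atom on \<open>B x R\<close>, with no cancellation demanded. By Hoelder
  \<open>A\<close> also bounds the integral of the modulus.\<close>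

definition psize :: "real => 'a => real => real => ('a => complex) => bool" where
 "psize p x R A f \<longleftrightarrow> f \<in> borel_measurable M \<and> 0 \<le> A \<and> (\<forall>y. y \<notin> B x R \<longrightarrow> f y = 0) \<and>
   integrable M (\<lambda>y. cmod (f y) powr p) \<and> (LINT y|M. cmod (f y) powr p) \<le> A powr p * mu x R powr (1 - p)"

lemma psize_L1:
 assumes f: "psize p x R A f" and p: "1 < p" and R: "0 < R"
 shows "integrable M f" "(LINT y|M. cmod (f y)) \<le> A"
proof -
 have fs: "\<And>y. y \<notin> B x R ==> f y = 0" and fm: "f \<in> borel_measurable M" and A: "0 \<le> A" using f unfolding psize_def by auto
 have mp: "0 < mu x R" by (rule mu_pos[OF R])
 have e: "(\<lambda>y. indicator (B x R) y * cmod (f y) powr p) = (\<lambda>y. cmod (f y) powr p)"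
  "(\<lambda>y. indicator (B x R) y * cmod (f y)) = (\<lambda>y. cmod (f y))"
  "(\<lambda>y. indicator (B x R) y *\<^sub>R f y) = f"
  using fs by (auto simp: indicator_def fun_eq_iff)
 have e2: "A powr p * mu x R powr (1 - p) = (A / mu x R) powr p * mu x R"
  using mp A by (simp add: powr_diff powr_divide)
 have "set_integrable M (B x R) f" "(LINT y|M. indicator (B x R) y * cmod (f y)) \<le> (A / mu x R) * mu x R"
  using holder_mean[OF p fmeasurable_sub[OF B_sets subset_refl] fm, of x R "A / mu x R" "mu x R"] f mp A
  unfolding e(1) psize_def e2 by auto
 then show "integrable M f" "(LINT y|M. cmod (f y)) \<le> A" unfolding e(2) set_integrable_def e(3) using mp by auto
qed

lemma psize_sub_mean:
 assumes f: "psize p x R A f" and p: "1 < p" and R: "0 < R"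
 shows "psize p x R (4 * A) (\<lambda>y. f y - (LINT y|M. f y) * chi x R y)"
proof -
 note f' = f[unfolded psize_def]
 have [measurable]: "f \<in> borel_measurable M" using f' by blast
 define m where "m = mu x R"
 have m: "0 < m" unfolding m_def by (rule mu_pos[OF R])
 define c where "c = (LINT y|M. f y)"
 have cA: "cmod c \<le> A" unfolding c_def using psize_L1(2)[OF f p R] integral_norm_bound[of M f] by linarith
 have A: "0 \<le> A" using f' by blast
 define v where "v y = 2 powr p * (cmod (f y) powr p + (A / m) powr p * indicator (B x R) y)" for y
 have vi: "integrable M v" unfolding v_def using f' by (auto simp: less_top[symmetric])
 have le: "cmod (f y - c * chi x R y) powr p \<le> v y" for y
 proof -
  have "cmod (f y - c * chi x R y) \<le> cmod (f y) + cmod (c * chi x R y)" by (rule norm_triangle_ineq4)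
  also have "cmod (c * chi x R y) \<le> A / m * indicator (B x R) y"
   using cA m unfolding chi_def m_def[symmetric] by (simp add: norm_mult norm_divide indicator_def divide_right_mono)
  finally have "cmod (f y - c * chi x R y) powr p \<le> (cmod (f y) + A / m * indicator (B x R) y) powr p"
   using p by (intro powr_mono2) auto
  also have "\<dots> \<le> 2 powr p * (cmod (f y) powr p + (A / m * indicator (B x R) y) powr p)"
   by (rule powr_sum_le) (use p A m in auto)
  also have "\<dots> = v y" unfolding v_def using p by (simp add: indicator_def)
  finally show ?thesis .
 qed
 have i: "integrable M (\<lambda>y. cmod (f y - c * chi x R y) powr p)"
  by (rule Bochner_Integration.integrable_bound[OF vi]) (use le in \<open>auto intro!: AE_I2 intro: order_trans[OF _ abs_ge_self]\<close>)
 have "(LINT y|M. cmod (f y - c * chi x R y) powr p) \<le> (LINT y|M. v y)" by (rule integral_mono[OF i vi le])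
 also have "\<dots> = 2 powr p * ((LINT y|M. cmod (f y) powr p) + (A / m) powr p * m)"
  unfolding v_def m_def using f' by (subst integral_mult_right_zero, subst Bochner_Integration.integral_add) (auto simp: less_top[symmetric])
 also have "\<dots> \<le> 2 powr p * (A powr p * m powr (1 - p) + A powr p * m powr (1 - p))"
 proof -
  have "(A / m) powr p * m = A powr p * m powr (1 - p)" using A m by (simp add: powr_divide powr_diff)
  then show ?thesis using f' unfolding m_def by (intro mult_left_mono add_mono) auto
 qed
 also have "\<dots> = (2 * 2 powr p) * (A powr p * m powr (1 - p))" by simp
 also have "\<dots> \<le> 4 powr p * (A powr p * m powr (1 - p))"
 proof (intro mult_right_mono)
  have "(2::real) powr 1 \<le> 2 powr p" using p by (intro powr_mono) auto
  then have "2 * 2 powr p \<le> (2 powr p) * (2 powr p :: real)" by simp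
  also have "\<dots> = 4 powr p" using powr_mult[of 2 2 p] by simp
  finally show "2 * 2 powr p \<le> (4::real) powr p" .
 qed auto
 also have "\<dots> = (4 * A) powr p * m powr (1 - p)" using A by (simp add: powr_mult)
 finally have "(LINT y|M. cmod (f y - c * chi x R y) powr p) \<le> (4 * A) powr p * mu x R powr (1 - p)" unfolding m_def .
 then show ?thesis unfolding psize_def c_def[symmetric] using i A f' by (auto simp: chi_def)
qed

text \<open>With mean zero the local decomposition applies at cost \<open>A\<close>. Otherwise the
  mean is split off as a multiple of \<open>chi x R\<close>, which costs the logarithm.\<close>

lemma psize_HA:
 assumes p: "1 < p"
 obtains C where "1 \<le> C"
  "\<And>x R A f. psize p x R A f ==> 0 < R ==> (LINT y|M. f y) = 0 ==> HA (C * A) f"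
  "\<And>x R A f. psize p x R A f ==> 0 < R ==> HA (C * A * ln (exp 1 + \<rho> x / R)) f"
proof -
 obtain C1 where C1: "0 \<le> C1" "\<And>x0 R X f. 0 < R ==> atomic_gauge M (local_patoms p x0 R) X f ==> atomic_gauge M (local_atoms x0 R) (C1 * X) f"
  by (rule local_atomic_decomposition[OF p]) blast
 obtain C2 where C2: "1 \<le> C2" "\<And>x R f K. 0 < R ==> f \<in> borel_measurable M ==> (\<And>y. cmod (f y) \<le> K / mu x R) ==>
    (\<And>y. y \<notin> B x R ==> f y = 0) ==> \<rho> x \<le> R \<or> (LINT y|M. f y) = 0 ==> 0 < K ==> HA (C2 * K) f"
  by (rule mean_zero_HA) blast
 obtain C3 where C3: "1 \<le> C3" "\<And>x R. 0 < R ==> HA (C3 * ln (exp 1 + \<rho> x / R)) (chi x R)" by (rule chi_HA) blast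
 define C where "C = C2 * C1"
 have C0: "0 \<le> C" unfolding C_def using C1 C2 by simp
 have mz: "HA (C * A) f" if f: "psize p x R A f" and R: "0 < R" and z: "(LINT y|M. f y) = 0" for x R A f
 proof (cases "A = 0")
  case True
  have "AE y in M. cmod (f y) = 0"
  proof (subst integral_nonneg_eq_0_iff_AE[symmetric])
   show "(LINT y|M. cmod (f y)) = 0" using psize_L1(2)[OF f p R] True by (intro antisym) auto
  qed (use psize_L1(1)[OF f p R] in auto)
  then have "AE y in M. 0 = f y" by eventually_elim simp
  moreover have "HA 0 (\<lambda>_. 0)" using L1_rho_atoms atomic_gauge_zero unfolding L1_atoms_def by blast
  ultimately show ?thesis using True f atomic_gauge_AE_cong[of M rho_atoms 0 "\<lambda>_. 0" f] unfolding psize_def by simp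
 next
  case False
  then have A: "0 < A" using f unfolding psize_def by auto
  have fm[measurable]: "f \<in> borel_measurable M" using f unfolding psize_def by blast
  have "(\<lambda>y. f y / of_real A) \<in> local_patoms p x R"
   unfolding local_patoms_def
  proof (intro CollectI conjI exI[of _ x] exI[of _ R] allI impI)
   have e: "cmod (f y / of_real A) powr p = cmod (f y) powr p / A powr p" for y
    using A by (simp add: norm_divide powr_divide)
   show "integrable M (\<lambda>y. cmod (f y / of_real A) powr p)" unfolding e using f unfolding psize_def by simp
   have "(LINT y|M. cmod (f y / of_real A) powr p) = (LINT y|M. cmod (f y) powr p) / A powr p" unfolding e by simp
   also have "\<dots> \<le> (A powr p * mu x R powr (1 - p)) / A powr p"
    using f unfolding psize_def by (intro divide_right_mono) auto
   finally show "(LINT y|M. cmod (f y / of_real A) powr p) \<le> mu x R powr (1 - p)" using A by simp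
   show "(LINT y|M. f y / of_real A) = 0" using z by simp
  qed (use R f in \<open>auto simp: psize_def\<close>)
  from atomic_gauge_scale[OF atomic_gauge_atom[OF L1_local_patoms[OF R p] this], of "of_real A"]
  have "atomic_gauge M (local_patoms p x R) A f" using A by simp
  then have "atomic_gauge M (local_atoms x R) (C1 * A) f" by (rule C1(2)[OF R])
  then have "HA (C2 * (C1 * A)) f"
  proof (rule atomic_gauge_compose[OF L1_local_atoms[OF R] L1_rho_atoms])
   fix a assume "a \<in> local_atoms x R"
   then obtain z t where a: "a \<in> borel_measurable M" "0 < t"
     "\<And>y. cmod (a y) \<le> 1 / mu z t" "\<And>y. y \<notin> B z t ==> a y = 0" "(LINT y|M. a y) = 0"
    unfolding local_atoms_def by blast
   have "HA (C2 * 1) a" by (rule C2(2)[OF a(2,1,3,4)]) (use a(5) in auto)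
   then show "HA C2 a" by simp
  qed (use C2 in auto)
  then show ?thesis unfolding C_def by (simp add: mult.assoc)
 qed
 show ?thesis
 proof (rule that[of "4 * C + C3"])
  show "1 \<le> 4 * C + C3" using C0 C3 by simp
  fix x R A f assume f: "psize p x R A f" and R: "0 < R"
  have A: "0 \<le> A" using f unfolding psize_def by blast
  {
   assume "(LINT y|M. f y) = 0"
   from mz[OF f R this] show "HA ((4 * C + C3) * A) f"
    by (rule atomic_gauge_mono) (use A C0 C3 in \<open>intro mult_right_mono, auto\<close>)
  }
  define L where "L = ln (exp 1 + \<rho> x / R)"
  have L1: "1 \<le> L" unfolding L_def by (rule ln_e_ge_1) (use R rho_pos[of x] in simp)
  define c where "c = (LINT y|M. f y)"
  have cA: "cmod c \<le> A" unfolding c_def using psize_L1(2)[OF f p R] integral_norm_bound[of M f] by linarith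
  have "(LINT y|M. f y - c * chi x R y) = 0"
   using Bochner_Integration.integral_diff[OF psize_L1(1)[OF f p R] integrable_mult_right[OF chi_integral(1)[OF R], of c]]
    chi_integral(2)[OF R, of x] unfolding c_def by simp
  from mz[OF psize_sub_mean[OF f p R, folded c_def] R this]
  have 1: "HA (C * (4 * A)) (\<lambda>y. f y - c * chi x R y)" .
  have "HA (cmod c * (C3 * L)) (\<lambda>y. c * chi x R y)" unfolding L_def by (rule atomic_gauge_scale[OF C3(2)[OF R]])
  from atomic_gauge_add[OF L1_rho_atoms 1 this] have "HA (C * (4 * A) + cmod c * (C3 * L)) f" by simp
  moreover have "C * (4 * A) + cmod c * (C3 * L) \<le> (4 * C + C3) * A * L"
  proof -
   have "C * (4 * A) * 1 \<le> C * (4 * A) * L" using C0 A L1 by (intro mult_left_mono) auto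
   moreover have "cmod c * (C3 * L) \<le> A * (C3 * L)" using cA C3 L1 by (intro mult_right_mono) auto
   ultimately show ?thesis by (simp add: algebra_simps)
  qed
  ultimately show "HA ((4 * C + C3) * A * ln (exp 1 + \<rho> x / R)) f" unfolding L_def by (rule atomic_gauge_mono)
 qed
qed

end

section \<open>Atoms with a general exponent \<open>q\<close> compared with bounded atoms\<close>

context admissible_space
begin

lemma Lq_norm_finite:
 assumes q: "q \<noteq> \<infinity>" and p: "p = enn2real q" "1 < p" and m: "0 < m"
  and le: "Lq_norm M q a \<le> ennreal (m powr (enn2real (1 / q) - 1))"
 shows "integrable M (\<lambda>x. cmod (a x) powr p)" "(LINT x|M. cmod (a x) powr p) \<le> m powr (1 - p)"
proof -
 have qe: "q = ennreal p" unfolding p(1) using q by (simp add: less_top)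
 have e1: "enn2real (1 / q) = 1 / p"
 proof -
  have "1 / q = ennreal (1 / p)" unfolding qe using divide_ennreal[of 1 p] p(2) by simp
  then show ?thesis using p(2) by simp
 qed
 show i: "integrable M (\<lambda>x. cmod (a x) powr p)"
 proof (rule ccontr)
  assume "\<not> integrable M (\<lambda>x. cmod (a x) powr p)"
  then have "Lq_norm M q a = \<infinity>" unfolding Lq_norm_def p(1) using q by simp
  then show False using le by (simp add: top_unique)
 qed
 define I where "I = (LINT x|M. cmod (a x) powr p)"
 have I0: "0 \<le> I" unfolding I_def by (intro integral_nonneg_AE) auto
 have "Lq_norm M q a = ennreal (I powr (1 / p))" unfolding Lq_norm_def I_def using q i unfolding p(1) by simp
 then have "I powr (1 / p) \<le> m powr (1 / p - 1)" using le unfolding e1 by (simp add: ennreal_le_iff)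
 then have "(I powr (1 / p)) powr p \<le> (m powr (1 / p - 1)) powr p" using p(2) by (intro powr_mono2) auto
 moreover have "(1 / p - 1) * p = 1 - p" using p(2) by (simp add: algebra_simps)
 ultimately show "(LINT x|M. cmod (a x) powr p) \<le> m powr (1 - p)" using p(2) I0 unfolding I_def[symmetric] by (simp add: powr_powr)
qed

lemma rho_atom_H1_atom:
 assumes q: "1 < q" and a: "a \<in> rho_atoms"
 shows "H1_atom d M \<rho> q a"
proof -
 obtain x r where am[measurable]: "a \<in> borel_measurable M" and r: "0 < r" "r < \<rho> x"
  and ab: "\<And>y. cmod (a y) \<le> 1 / mu x r" and as: "\<And>y. y \<notin> B x r ==> a y = 0"
  and z: "r < \<rho> x / 4 \<longrightarrow> (LINT y|M. a y) = 0" using a unfolding rho_atoms_def by blast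
 define m where "m = mu x r"
 have m: "0 < m" unfolding m_def by (rule mu_pos[OF r(1)])
 have "Lq_norm M q a \<le> ennreal (m powr (enn2real (1 / q) - 1))"
 proof (cases "q = \<infinity>")
  case True
  have "esssup M (\<lambda>x. ennreal (cmod (a x))) \<le> ennreal (1 / m)"
   by (rule esssup_I) (use ab in \<open>auto simp: m_def intro!: AE_I2 ennreal_leI\<close>)
  then show ?thesis unfolding Lq_norm_def True using m by (simp add: powr_minus_divide)
 next
  case False
  define p where "p = enn2real q"
  have qe: "q = ennreal p" unfolding p_def using False by (simp add: less_top)
  have p: "1 < p" using q unfolding qe by (simp add: ennreal_1[symmetric] ennreal_less_iff del: ennreal_1)
  have e1: "enn2real (1 / q) = 1 / p"
  proof -
   have "1 / q = ennreal (1 / p)" unfolding qe using divide_ennreal[of 1 p] p by simp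
   then show ?thesis using p by simp
  qed
  define v where "v y = m powr (- p) * indicat_real (B x r) y" for y
  have vi: "integrable M v" unfolding v_def by (simp add: less_top[symmetric])
  have le: "cmod (a y) powr p \<le> v y" for y
  proof (cases "y \<in> B x r")
   case True
   have "cmod (a y) powr p \<le> (1 / m) powr p" using ab[of y] p unfolding m_def by (intro powr_mono2) auto
   then show ?thesis unfolding v_def using True m by (simp add: powr_divide powr_minus_divide)
  next
   case False
   then show ?thesis using as[OF False] p unfolding v_def by simp
  qed
  have i: "integrable M (\<lambda>y. cmod (a y) powr p)"
   by (rule Bochner_Integration.integrable_bound[OF vi]) (use le in \<open>auto intro!: AE_I2 intro: order_trans[OF _ abs_ge_self]\<close>)
  have "(LINT y|M. cmod (a y) powr p) \<le> (LINT y|M. v y)" by (rule integral_mono[OF i vi le])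
  also have "\<dots> = m powr (1 - p)" unfolding v_def using m by (simp add: m_def[symmetric] powr_diff powr_minus_divide)
  finally have "(LINT y|M. cmod (a y) powr p) powr (1 / p) \<le> (m powr (1 - p)) powr (1 / p)"
   using p by (intro powr_mono2 integral_nonneg_AE) auto
  also have "\<dots> = m powr (1 / p - 1)"
  proof -
   have "(1 - p) * (1 / p) = 1 / p - 1" using p by (simp add: field_simps)
   then show ?thesis by (simp add: powr_powr)
  qed
  finally show ?thesis unfolding Lq_norm_def e1 using False i unfolding p_def by (simp add: ennreal_leI)
 qed
 then show ?thesis unfolding H1_atom_def m_def vanishes_off_def
  using r z as by (intro conjI am exI[of _ x] exI[of _ r]) auto
qed

text \<open>For \<open>q = \<infinity>\<close> a change on a null set suffices. For finite
  \<open>q\<close> an atom without cancellation has radius at least \<open>\<rho> x / 4\<close>, so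
  the logarithm that it costs is at most \<open>ln (exp 1 + 4)\<close>.\<close>

lemma H1_atom_HA:
 assumes q: "1 < q"
 obtains C where "1 \<le> C" "\<And>a. H1_atom d M \<rho> q a ==> HA C a \<and> integrable M a \<and> (LINT x|M. cmod (a x)) \<le> 1"
proof (cases "q = \<infinity>")
 case True
 show ?thesis
 proof (rule that[of 1])
  fix a assume "H1_atom d M \<rho> q a"
  then obtain x r where am[measurable]: "a \<in> borel_measurable M" and r: "0 < r" "r < \<rho> x"
   and van: "vanishes_off M (B x r) a" and nrm: "Lq_norm M q a \<le> ennreal (mu x r powr (enn2real (1 / q) - 1))"
   and z: "r < \<rho> x / 4 \<longrightarrow> (LINT y|M. a y) = 0" unfolding H1_atom_def by blast
  define m where "m = mu x r"
  have m: "0 < m" unfolding m_def by (rule mu_pos[OF r(1)])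
  have "esssup M (\<lambda>x. ennreal (cmod (a x))) \<le> ennreal (1 / m)"
   using nrm m unfolding Lq_norm_def True m_def[symmetric] by (simp add: powr_minus_divide)
  moreover have "AE y in M. ennreal (cmod (a y)) \<le> esssup M (\<lambda>x. ennreal (cmod (a x)))" by (rule esssup_AE)
  ultimately have "AE y in M. ennreal (cmod (a y)) \<le> ennreal (1 / m)"
   by (elim eventually_mono) (rule order_trans)
  then have ae: "AE y in M. cmod (a y) \<le> 1 / m"
   by eventually_elim (use m in \<open>simp add: ennreal_le_iff\<close>)
  \<comment> \<open>The values violating the essential bound or lying outside the ball are set to 0;
    they occupy a null set.\<close>
  define a' where "a' y = (if y \<in> B x r \<and> cmod (a y) \<le> 1 / m then a y else 0)" for y
  have [measurable]: "a' \<in> borel_measurable M" unfolding a'_def by measurable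
  have eq: "AE y in M. a' y = a y" using ae van unfolding vanishes_off_def a'_def by eventually_elim auto
  have int: "(LINT y|M. a' y) = (LINT y|M. a y)" by (rule integral_cong_AE) (use eq in auto)
  have "cmod (a' y) \<le> 1 / mu x r" "y \<notin> B x r ==> a' y = 0" for y unfolding a'_def m_def[symmetric] using m by auto
  then have "a' \<in> rho_atoms" unfolding rho_atoms_def using r z int
   by (intro CollectI conjI exI[of _ x] exI[of _ r]) auto
  from atomic_gauge_atom[OF L1_rho_atoms this] have "HA 1 a" by (rule atomic_gauge_AE_cong[OF _ am eq])
  then show "HA 1 a \<and> integrable M a \<and> (LINT x|M. cmod (a x)) \<le> 1" using atomic_gauge_integrable[OF L1_rho_atoms] by blast
 qed simp
next
 case False
 define p where "p = enn2real q"
 have qe: "q = ennreal p" unfolding p_def using False by (simp add: less_top)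
 have p: "1 < p" using q unfolding qe by (simp add: ennreal_1[symmetric] ennreal_less_iff del: ennreal_1)
 obtain C where C: "1 \<le> C"
  "\<And>x R A f. psize p x R A f ==> 0 < R ==> (LINT y|M. f y) = 0 ==> HA (C * A) f"
  "\<And>x R A f. psize p x R A f ==> 0 < R ==> HA (C * A * ln (exp 1 + \<rho> x / R)) f" by (rule psize_HA[OF p]) blast
 have L: "1 \<le> ln (exp 1 + (4::real))" by (rule ln_e_ge_1) simp
 show ?thesis
 proof (rule that[of "C * ln (exp 1 + 4)"])
  show "1 \<le> C * ln (exp 1 + 4)" using mult_mono[OF C(1) L] C(1) by simp
  fix a assume "H1_atom d M \<rho> q a"
  then obtain x r where am[measurable]: "a \<in> borel_measurable M" and r: "0 < r" "r < \<rho> x"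
   and van: "vanishes_off M (B x r) a" and nrm: "Lq_norm M q a \<le> ennreal (mu x r powr (enn2real (1 / q) - 1))"
   and z: "r < \<rho> x / 4 \<longrightarrow> (LINT y|M. a y) = 0" unfolding H1_atom_def by blast
  note N = Lq_norm_finite[OF False p_def p mu_pos[OF r(1)] nrm]
  define a' where "a' y = (if y \<in> B x r then a y else 0)" for y
  have [measurable]: "a' \<in> borel_measurable M" unfolding a'_def by measurable
  have eq: "AE y in M. a' y = a y" using van unfolding vanishes_off_def a'_def by eventually_elim auto
  have int: "(LINT y|M. a' y) = (LINT y|M. a y)" by (rule integral_cong_AE) (use eq in auto)
  have eqp: "AE y in M. cmod (a' y) powr p = cmod (a y) powr p" using eq by eventually_elim simp
  have ps: "psize p x r 1 a'"
   unfolding psize_def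
  proof (intro conjI allI impI)
   show "integrable M (\<lambda>y. cmod (a' y) powr p)" by (rule integrable_cong_AE_imp[OF N(1)]) (use eqp in auto)
   have "(LINT y|M. cmod (a' y) powr p) = (LINT y|M. cmod (a y) powr p)" by (rule integral_cong_AE) (use eqp in auto)
   then show "(LINT y|M. cmod (a' y) powr p) \<le> 1 powr p * mu x r powr (1 - p)" using N(2) by simp
  qed (auto simp: a'_def)
  have "HA (C * ln (exp 1 + 4)) a'"
  proof (cases "r < \<rho> x / 4")
   case True
   then have "HA (C * 1) a'" using C(2)[OF ps r(1)] z int by simp
   then show ?thesis using C(1) L by (elim atomic_gauge_mono) (simp add: mult_left_mono)
  next
   case False
   have "HA (C * 1 * ln (exp 1 + \<rho> x / r)) a'" by (rule C(3)[OF ps r(1)])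
   moreover have "ln (exp 1 + \<rho> x / r) \<le> ln (exp 1 + 4)"
    using False r by (subst ln_le_cancel_iff) (auto simp: field_simps intro!: add_pos_pos divide_pos_pos)
   ultimately show ?thesis using C(1) by (elim atomic_gauge_mono) (simp add: mult_left_mono)
  qed
  then have 1: "HA (C * ln (exp 1 + 4)) a" by (rule atomic_gauge_AE_cong[OF _ am eq])
  note P = psize_L1[OF ps p r(1)]
  have "integrable M a" by (rule integrable_cong_AE_imp[OF P(1) am]) (use eq in \<open>auto simp: eq_commute\<close>)
  moreover have "(LINT y|M. cmod (a y)) = (LINT y|M. cmod (a' y))"
  proof (rule integral_cong_AE)
   show "AE y in M. cmod (a y) = cmod (a' y)" using eq by eventually_elim simp
  qed auto
  ultimately show "HA (C * ln (exp 1 + 4)) a \<and> integrable M a \<and> (LINT x|M. cmod (a x)) \<le> 1" using 1 P(2) by simp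
 qed
qed

definition q_atoms :: "ennreal => ('a => complex) set" where
 "q_atoms q = {a. H1_atom d M \<rho> q a}"

lemma L1_q_atoms:
 assumes "1 < q" shows "L1_atoms M (q_atoms q)"
proof -
 obtain C where C: "1 \<le> C" "\<And>a. H1_atom d M \<rho> q a ==> HA C a \<and> integrable M a \<and> (LINT x|M. cmod (a x)) \<le> 1"
  by (rule H1_atom_HA[OF assms]) blast
 have "rho_atoms \<noteq> {}" using L1_rho_atoms unfolding L1_atoms_def by blast
 then show ?thesis unfolding L1_atoms_def q_atoms_def using C(2) rho_atom_H1_atom[OF assms] by blast
qed

text \<open>The coefficients are summable, so the series converges almost everywhere and in the mean
  to some \<open>g\<close>; uniqueness of limits in the mean identifies \<open>g\<close> with
  \<open>f\<close>.\<close>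

lemma atomic_decomposition_AE:
 assumes q: "1 < q" and D: "atomic_decomposition d M \<rho> q f c a"
 shows "AE x in M. (\<lambda>j. c j * a j x) sums f x"
proof -
 have f: "integrable M f" and aj: "\<And>j. a j \<in> q_atoms q" and c: "summable (\<lambda>j. cmod (c j))"
  and lim: "(\<lambda>n. \<integral>x. cmod (f x - (\<Sum>j<n. c j * a j x)) \<partial>M) \<longlonglongrightarrow> 0"
  using D unfolding atomic_decomposition_def q_atoms_def by auto
 note L = L1_series[OF L1_q_atoms[OF q], of a c, OF aj c]
 have [measurable]: "a j \<in> borel_measurable M" for j using aj[of j] unfolding q_atoms_def H1_atom_def by blast
 define g where "g x = (\<Sum>j. c j * a j x)" for x
 have gm[measurable]: "g \<in> borel_measurable M" unfolding g_def by measurable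
 have gs: "AE x in M. (\<lambda>j. c j * a j x) sums g x"
  using L(4) by eventually_elim (auto simp: g_def intro: summable_sums summable_norm_cancel)
 note I = integrable_sums[of M "\<lambda>j x. c j * a j x" g, OF L(1) L(3) gm gs]
 have "(LINT x|M. cmod (f x - g x)) \<le> 0"
 proof (rule LIMSEQ_le_const)
  show "(\<lambda>n. (LINT x|M. cmod (f x - (\<Sum>j<n. c j * a j x))) + (LINT x|M. cmod (g x - (\<Sum>j<n. c j * a j x)))) \<longlonglongrightarrow> 0"
   using tendsto_add[OF lim I(4)] by simp
  have "(LINT x|M. cmod (f x - g x)) \<le> (LINT x|M. cmod (f x - (\<Sum>j<n. c j * a j x))) + (LINT x|M. cmod (g x - (\<Sum>j<n. c j * a j x)))" for n
  proof -
   have iS: "integrable M (\<lambda>x. \<Sum>j<n. c j * a j x)" by (rule Bochner_Integration.integrable_sum) (rule L(1))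
   have i1: "integrable M (\<lambda>x. cmod (f x - (\<Sum>j<n. c j * a j x)))" "integrable M (\<lambda>x. cmod (g x - (\<Sum>j<n. c j * a j x)))"
    using f I(1) iS by auto
   have "(LINT x|M. cmod (f x - g x)) \<le> (LINT x|M. cmod (f x - (\<Sum>j<n. c j * a j x)) + cmod (g x - (\<Sum>j<n. c j * a j x)))"
   proof (rule integral_mono)
    fix x
    show "cmod (f x - g x) \<le> cmod (f x - (\<Sum>j<n. c j * a j x)) + cmod (g x - (\<Sum>j<n. c j * a j x))"
     using norm_triangle_ineq4[of "f x - (\<Sum>j<n. c j * a j x)" "g x - (\<Sum>j<n. c j * a j x)"] by simp
   qed (use f I(1) i1 in auto)
   also have "\<dots> = (LINT x|M. cmod (f x - (\<Sum>j<n. c j * a j x))) + (LINT x|M. cmod (g x - (\<Sum>j<n. c j * a j x)))"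
    by (rule Bochner_Integration.integral_add[OF i1])
   finally show ?thesis .
  qed
  then show "\<exists>N. \<forall>n\<ge>N. (LINT x|M. cmod (f x - g x)) \<le> (LINT x|M. cmod (f x - (\<Sum>j<n. c j * a j x))) + (LINT x|M. cmod (g x - (\<Sum>j<n. c j * a j x)))" by blast
 qed
 then have "(LINT x|M. cmod (f x - g x)) = 0" by (intro antisym) auto
 then have "AE x in M. cmod (f x - g x) = 0"
  by (subst (asm) integral_nonneg_eq_0_iff_AE) (use f I(1) in auto)
 then show ?thesis using gs by eventually_elim simp
qed

lemma atomic_decompositionI:
 assumes q: "1 < q" and f: "f \<in> borel_measurable M" and a: "\<And>j. a j \<in> q_atoms q" and c: "summable (\<lambda>j. cmod (c j))"
  and ae: "AE x in M. (\<lambda>j. c j * a j x) sums f x"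
 shows "atomic_decomposition d M \<rho> q f c a"
proof -
 note L = L1_series[OF L1_q_atoms[OF q], of a c, OF a c]
 note I = integrable_sums[of M "\<lambda>j x. c j * a j x" f, OF L(1) L(3) f ae]
 show ?thesis unfolding atomic_decomposition_def using I(1,4) a c unfolding q_atoms_def by auto
qed

lemma HA_H1:
 assumes q: "1 < q" and f: "HA A f"
 shows "f \<in> H1 d M \<rho> q" "H1_norm d M \<rho> q f \<le> ennreal A"
proof -
 obtain c a where *: "\<And>j. a j \<in> rho_atoms" "summable (\<lambda>j. cmod (c j))" "(\<Sum>j::nat. cmod (c j)) \<le> A"
  "AE x in M. (\<lambda>j. c j * a j x) sums f x" using f unfolding atomic_gauge_def by blast
 have D: "atomic_decomposition d M \<rho> q f c a"
  by (rule atomic_decompositionI[OF q atomic_gauge_measurable[OF f] _ *(2,4)])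
   (use *(1) rho_atom_H1_atom[OF q] in \<open>auto simp: q_atoms_def\<close>)
 then show "f \<in> H1 d M \<rho> q" unfolding H1_def by blast
 have "H1_norm d M \<rho> q f \<le> ennreal (\<Sum>j. cmod (c j))"
  unfolding H1_norm_def by (rule INF_lower2[of "(c, a)"]) (use D in auto)
 also have "\<dots> \<le> ennreal A" using *(3) by (rule ennreal_leI)
 finally show "H1_norm d M \<rho> q f \<le> ennreal A" .
qed

lemma H1_HA:
 assumes q: "1 < q"
 obtains C where "1 \<le> C" "\<And>f c a. atomic_decomposition d M \<rho> q f c a ==> HA (C * (\<Sum>j. cmod (c j))) f"
proof -
 obtain C where C: "1 \<le> C" "\<And>a. H1_atom d M \<rho> q a ==> HA C a \<and> integrable M a \<and> (LINT x|M. cmod (a x)) \<le> 1"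
  by (rule H1_atom_HA[OF q]) blast
 show ?thesis
 proof (rule that[OF C(1)])
  fix f c a assume D: "atomic_decomposition d M \<rho> q f c a"
  then have "atomic_gauge M (q_atoms q) (\<Sum>j. cmod (c j)) f"
   unfolding atomic_gauge_def using atomic_decomposition_AE[OF q D]
   by (intro conjI exI[of _ c] exI[of _ a]) (auto simp: atomic_decomposition_def q_atoms_def)
  then show "HA (C * (\<Sum>j. cmod (c j))) f"
   by (rule atomic_gauge_compose[OF L1_q_atoms[OF q] L1_rho_atoms]) (use C in \<open>auto simp: q_atoms_def\<close>)
 qed
qed

subsection \<open>The dual space\<close>

text \<open>A real number bounding both parts of the norm of \<open>BMO_rho\<close> at once, whence
  the factor 2 when the two are added.\<close>

definition bmo :: "real => ('a => complex) => bool" where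
 "bmo N f \<longleftrightarrow> f \<in> L1_loc d M \<and> 0 \<le> N \<and> (\<forall>x r. 0 < r \<longrightarrow> MO M f (B x r) \<le> N) \<and>
   (\<forall>x r. \<rho> x \<le> r \<longrightarrow> average M (B x r) (\<lambda>y. cmod (f y)) \<le> N)"

lemma bmo_BMO_rho:
 assumes "bmo N f" shows "f \<in> BMO_rho d M \<rho>" "BMO_rho_norm d M \<rho> f \<le> ennreal (2 * N)"
proof -
 have N: "0 \<le> N" using assms unfolding bmo_def by blast
 have 1: "BMO_norm d M f \<le> ennreal N" unfolding BMO_norm_def
  using assms unfolding bmo_def by (intro SUP_least ennreal_leI) auto
 have 2: "(SUP x. SUP r\<in>{\<rho> x..}. ennreal (average M (B x r) (\<lambda>y. cmod (f y)))) \<le> ennreal N"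
  using assms unfolding bmo_def by (intro SUP_least ennreal_leI) auto
 show 3: "BMO_rho_norm d M \<rho> f \<le> ennreal (2 * N)"
  using add_mono[OF 1 2] N unfolding BMO_rho_norm_def by (simp flip: ennreal_plus)
 show "f \<in> BMO_rho d M \<rho>" unfolding BMO_rho_def BMO_def
  using assms order_le_less_trans[OF 1 ennreal_less_top] order_le_less_trans[OF 3 ennreal_less_top] unfolding bmo_def by auto
qed

lemma BMO_rho_bmo:
 assumes f: "f \<in> BMO_rho d M \<rho>"
 shows "bmo (enn2real (BMO_rho_norm d M \<rho> f)) f"
proof -
 define N where "N = BMO_rho_norm d M \<rho> f"
 have N: "N < \<infinity>" using f unfolding BMO_rho_def N_def by auto
 have Ne: "N = ennreal (enn2real N)" using N by simp
 have 1: "MO M f (B x r) \<le> enn2real N" if "0 < r" for x r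
 proof -
  have "ennreal (MO M f (B x r)) \<le> BMO_norm d M f"
   unfolding BMO_norm_def using that by (intro SUP_upper2[of x UNIV] SUP_upper2[of r]) auto
  also have "\<dots> \<le> N" unfolding N_def BMO_rho_norm_def by simp
  finally show ?thesis using Ne by (metis enn2real_nonneg ennreal_le_iff)
 qed
 have 2: "average M (B x r) (\<lambda>y. cmod (f y)) \<le> enn2real N" if "\<rho> x \<le> r" for x r
 proof -
  have "ennreal (average M (B x r) (\<lambda>y. cmod (f y))) \<le> (SUP x. SUP r\<in>{\<rho> x..}. ennreal (average M (B x r) (\<lambda>y. cmod (f y))))"
   using that by (intro SUP_upper2[of x UNIV] SUP_upper2[of r]) auto
  also have "\<dots> \<le> N" unfolding N_def BMO_rho_norm_def by simp
  finally show ?thesis using Ne by (metis enn2real_nonneg ennreal_le_iff)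
 qed
 show ?thesis unfolding bmo_def N_def[symmetric] using 1 2 f unfolding BMO_rho_def BMO_def by auto
qed

lemma average_norm_eq: "average M (B x r) (\<lambda>y. cmod (f y)) = (LINT y|M. indicator (B x r) y * cmod (f y)) / mu x r"
 by (simp add: average_eq)

text \<open>Cancellation reduces the pairing to a mean oscillation. An atom without it has
  \<open>\<rho> x \<le> 4 * r\<close>, and the mean over \<open>B x (\<rho> x)\<close>, which the
  norm controls, is compared with the ball of radius \<open>4 * r\<close>; hence
  \<open>dbl 4\<close>.\<close>

lemma bmo_atom:
 assumes f: "bmo N f" and a: "a \<in> rho_atoms"
 shows "integrable M (\<lambda>y. f y * a y)" "cmod (LINT y|M. f y * a y) \<le> dbl 4 * N"
proof -
 have fL: "f \<in> L1_loc d M" and N: "0 \<le> N" using f unfolding bmo_def by auto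
 obtain x r where am: "a \<in> borel_measurable M" and r: "0 < r" "r < \<rho> x"
  and ab: "\<And>y. cmod (a y) \<le> 1 / mu x r" and as: "\<And>y. y \<notin> B x r ==> a y = 0"
  and z: "r < \<rho> x / 4 \<longrightarrow> (LINT y|M. a y) = 0" using a unfolding rho_atoms_def by blast
 have m: "0 < mu x r" by (rule mu_pos[OF r(1)])
 have d4: "1 * N \<le> dbl 4 * N" using N dbl_ge_1[of 4] by (intro mult_right_mono) auto
 note P = L1_loc_pairing[of f a "1 / mu x r" x r, OF fL am ab as]
 show "integrable M (\<lambda>y. f y * a y)" by (rule P(1))
 show "cmod (LINT y|M. f y * a y) \<le> dbl 4 * N"
 proof (cases "r < \<rho> x / 4")
  case True
  have "cmod (LINT y|M. f y * a y) \<le> 1 / mu x r * (mu x r * MO M f (B x r))"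
   by (rule MO_pairing[OF fL am ab as _ r(1)]) (use z True in auto)
  also have "\<dots> = MO M f (B x r)" using m by simp
  also have "\<dots> \<le> N" using f r(1) unfolding bmo_def by blast
  finally show ?thesis using d4 by linarith
 next
  case False
  have "(LINT y|M. indicator (B x r) y * cmod (f y)) \<le> (LINT y|M. indicator (B x (\<rho> x)) y * cmod (f y))"
   by (rule integral_mono[OF L1_loc_norm[OF fL] L1_loc_norm[OF fL]]) (use r in \<open>auto simp: indicator_def\<close>)
  also have "\<dots> = mu x (\<rho> x) * average M (B x (\<rho> x)) (\<lambda>y. cmod (f y))"
   using mu_pos[OF rho_pos[of x], of x] by (simp add: average_norm_eq)
  also have "\<dots> \<le> mu x (\<rho> x) * N" using f unfolding bmo_def by (intro mult_left_mono) auto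
  also have "\<dots> \<le> mu x (4 * r) * N" using False N by (intro mult_right_mono mu_mono) auto
  also have "\<dots> \<le> (dbl 4 * mu x r) * N" using mu_scale[of 4 r x] r N by (intro mult_right_mono) auto
  finally have "1 / mu x r * (LINT y|M. indicator (B x r) y * cmod (f y)) \<le> dbl 4 * N"
   using m by (simp add: field_simps)
  then show ?thesis using P(2) by linarith
 qed
qed

lemma bmo_trunc:
 assumes f: "bmo N f" shows "bmo (2 * N) (\<lambda>y. trunc n (f y))"
proof -
 have fL: "f \<in> L1_loc d M" and N: "0 \<le> N" using f unfolding bmo_def by auto
 have "MO M (\<lambda>y. trunc n (f y)) (B x r) \<le> 2 * N" if "0 < r" for x r
  using MO_trunc(2)[OF fL that, of n x] f that unfolding bmo_def by (smt (verit))
 moreover have "average M (B x r) (\<lambda>y. cmod (trunc n (f y))) \<le> 2 * N" if r: "\<rho> x \<le> r" for x r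
 proof -
  have "average M (B x r) (\<lambda>y. cmod (trunc n (f y))) \<le> average M (B x r) (\<lambda>y. cmod (f y))"
   unfolding average_norm_eq
   by (intro divide_right_mono integral_mono L1_loc_norm fL MO_trunc(1)[OF fL]) (auto simp: trunc_bound indicator_def)
  also have "\<dots> \<le> N" using f r unfolding bmo_def by blast
  finally show ?thesis using N by linarith
 qed
 ultimately show ?thesis unfolding bmo_def using MO_trunc(1)[OF fL, of n] N by auto
qed

text \<open>The extremal test functions are the conjugate sign of \<open>w\<close> minus its
  average, corrected to mean zero, for the oscillation, and the conjugate sign of \<open>w\<close>
  for means over large balls. On large balls these are not atoms but split into atoms by
  \<open>large_ball_HA\<close>.\<close>

lemma bmo_by_testing:
 obtains C where "1 \<le> C" "\<And>w A. w \<in> L1_loc d M ==> 0 \<le> A ==>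
   (\<And>a. a \<in> rho_atoms ==> cmod (LINT y|M. w y * a y) \<le> A) ==> bmo (C * A) w"
proof -
 obtain C where C: "1 \<le> C"
  "\<And>x0 R f w A. \<rho> x0 \<le> R ==> f \<in> borel_measurable M ==> (\<And>y. cmod (f y) \<le> 1 / mu x0 R) ==>
    (\<And>y. y \<notin> B x0 R ==> f y = 0) ==> w \<in> L1_loc d M ==> 0 \<le> A ==>
    (\<And>a. a \<in> rho_atoms ==> cmod (LINT y|M. w y * a y) \<le> A) ==> cmod (LINT y|M. w y * f y) \<le> C * A"
  by (rule large_ball_HA) blast
 show ?thesis
 proof (rule that[of "2 * C"])
  show "1 \<le> 2 * C" using C(1) by simp
  fix w A assume w: "w \<in> L1_loc d M" and A: "0 \<le> A"
   and wa: "\<And>a. a \<in> rho_atoms ==> cmod (LINT y|M. w y * a y) \<le> A"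
  note [measurable] = L1_loc_measurable[OF w]
  have sg: "z * cnj (sgn z) = of_real (cmod z)" for z
   by (cases "z = 0") (auto simp: sgn_div_norm scaleR_conv_of_real complex_norm_square[symmetric] power2_eq_square field_simps)
  have test: "cmod (LINT y|M. w y * f y) \<le> C * A"
   if r: "0 < r" and f: "f \<in> borel_measurable M" "\<And>y. cmod (f y) \<le> 1 / mu x r" "\<And>y. y \<notin> B x r ==> f y = 0"
    and z: "\<rho> x \<le> r \<or> (LINT y|M. f y) = 0" for x r f
  proof (cases "\<rho> x \<le> r")
   case True
   show ?thesis by (rule C(2)[OF True f w A wa])
  next
   case False
   then have "f \<in> rho_atoms" unfolding rho_atoms_def using r f z by (auto intro!: exI[of _ x] exI[of _ r])
   then have "cmod (LINT y|M. w y * f y) \<le> 1 * A" using wa by simp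
   also have "\<dots> \<le> C * A" using C(1) A by (intro mult_right_mono) auto
   finally show ?thesis .
  qed
  have 1: "MO M w (B x r) \<le> 2 * C * A" if r: "0 < r" for x r
  proof -
   define m where "m = mu x r"
   have m: "0 < m" unfolding m_def by (rule mu_pos[OF r])
   define F where "F y = w y - avg x r w" for y
   define s where "s y = indicator (B x r) y *\<^sub>R cnj (sgn (F y))" for y
   have [measurable]: "s \<in> borel_measurable M" unfolding s_def F_def sgn_div_norm by measurable
   have sb: "cmod (s y) \<le> 1" for y unfolding s_def by (simp add: norm_sgn indicator_def)
   have ss: "y \<notin> B x r ==> s y = 0" for y unfolding s_def by simp
   note bi = bounded_integrable[of s 1 x r, OF _ sb ss]
   define c where "c = (LINT y|M. s y)"
   have cm: "cmod c \<le> m" unfolding c_def m_def using bi(2) by (intro order_trans[OF integral_norm_bound]) simp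
   \<comment> \<open>The sign and its mean are each bounded by 1, so division by
     \<open>2 * m\<close> gives the size of an atom.\<close>
   define f where "f y = (s y - c * chi x r y) / of_real (2 * m)" for y
   have fm: "f \<in> borel_measurable M" unfolding f_def by measurable
   have cc: "cmod (c * chi x r y) \<le> 1" for y
    using cm m unfolding chi_def m_def[symmetric] by (simp add: norm_mult norm_divide indicator_def)
   have fb: "cmod (f y) \<le> 1 / mu x r" for y
   proof -
    have "cmod (s y - c * chi x r y) \<le> 2" using norm_triangle_ineq4[of "s y" "c * chi x r y"] sb[of y] cc[of y] by linarith
    then have "cmod (s y - c * chi x r y) / (2 * m) \<le> 2 / (2 * m)" using m by (intro divide_right_mono) auto
    moreover have "cmod (f y) = cmod (s y - c * chi x r y) / (2 * m)" unfolding f_def norm_divide using m by simp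
    ultimately show ?thesis unfolding m_def by simp
   qed
   have fs: "y \<notin> B x r ==> f y = 0" for y unfolding f_def s_def chi_def by simp
   have i1: "integrable M s" using bi by simp
   have i2: "integrable M (\<lambda>y. c * chi x r y)" using chi_integral(1)[OF r] by simp
   have "(LINT y|M. s y - c * chi x r y) = 0"
    using Bochner_Integration.integral_diff[OF i1 i2] chi_integral(2)[OF r, of x] unfolding c_def by simp
   then have f0: "(LINT y|M. f y) = 0" unfolding f_def by simp
   have le: "cmod (LINT y|M. w y * f y) \<le> C * A" by (rule test[OF r fm fb fs]) (use f0 in auto)
   have Fs: "F y * s y = of_real (indicator (B x r) y * cmod (F y))" for y
    unfolding s_def using sg[of "F y"] by (simp add: indicator_def)
   have FL: "F \<in> L1_loc d M" unfolding F_def[abs_def] by (rule L1_loc_diff_const[OF w])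
   have iw: "integrable M (\<lambda>y. w y * f y)" by (rule L1_loc_pairing(1)[OF w fm fb fs])
   have if': "integrable M f" by (rule bounded_integrable(1)[OF fm fb fs])
   have e1: "(LINT y|M. w y * f y) = (LINT y|M. F y * f y)"
   proof -
    have "(LINT y|M. F y * f y) = (LINT y|M. w y * f y - avg x r w * f y)" unfolding F_def by (simp add: algebra_simps)
    also have "\<dots> = (LINT y|M. w y * f y) - (LINT y|M. avg x r w * f y)"
     by (rule Bochner_Integration.integral_diff[OF iw]) (use if' in simp)
    finally show ?thesis using f0 by simp
   qed
   have F0: "(LINT y|M. indicator (B x r) y *\<^sub>R F y) = 0"
   proof -
    have "(LINT y|M. indicator (B x r) y *\<^sub>R F y) = (LINT y|M. indicator (B x r) y *\<^sub>R w y) - (LINT y|M. indicator (B x r) y *\<^sub>R avg x r w)"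
     unfolding F_def scaleR_diff_right by (rule Bochner_Integration.integral_diff) (intro L1_loc_integrable w L1_loc_const)+
    also have "\<dots> = of_real (mu x r) * avg x r w - of_real (mu x r) * avg x r w"
     using avg_integral[OF r, of x w] int_ball_const[of x r "avg x r w"] by argo
    finally show ?thesis by simp
   qed
   have iFs: "integrable M (\<lambda>y. F y * s y)" by (rule L1_loc_pairing(1)[of F s 1 x r, OF FL _ sb ss]) simp
   have e2: "(LINT y|M. F y * f y) = of_real ((LINT y|M. indicator (B x r) y * cmod (F y)) / (2 * m))"
   proof -
    have "F y * f y = (F y * s y) / of_real (2 * m) - (c / of_real (2 * m * m)) * (indicator (B x r) y *\<^sub>R F y)" for y
     unfolding f_def chi_def m_def[symmetric] using m by (simp add: field_simps scaleR_conv_of_real)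
    then have "(LINT y|M. F y * f y) = (LINT y|M. (F y * s y) / of_real (2 * m) - (c / of_real (2 * m * m)) * (indicator (B x r) y *\<^sub>R F y))" by (simp only:)
    also have "\<dots> = (LINT y|M. (F y * s y) / of_real (2 * m)) - (LINT y|M. (c / of_real (2 * m * m)) * (indicator (B x r) y *\<^sub>R F y))"
     by (rule Bochner_Integration.integral_diff[OF integrable_divide[OF iFs] integrable_mult_right[OF L1_loc_integrable[OF FL]]])
    also have "\<dots> = (LINT y|M. F y * s y) / of_real (2 * m)"
     unfolding integral_mult_right_zero F0 by simp
    also have "(LINT y|M. F y * s y) = of_real (LINT y|M. indicator (B x r) y * cmod (F y))" unfolding Fs by (rule integral_complex_of_real)
    finally show ?thesis by simp
   qed
   have "(LINT y|M. indicator (B x r) y * cmod (F y)) / (2 * m) \<le> C * A"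
    using le unfolding e1 e2 norm_of_real by linarith
   moreover have "(LINT y|M. indicator (B x r) y * cmod (F y)) = m * MO M w (B x r)" unfolding F_def m_def by (rule MO_integral[OF r])
   ultimately show ?thesis using m by simp
  qed
  have 2: "average M (B x r) (\<lambda>y. cmod (w y)) \<le> 2 * C * A" if r: "\<rho> x \<le> r" for x r
  proof -
   have r0: "0 < r" using r rho_pos[of x] by linarith
   define m where "m = mu x r"
   have m: "0 < m" unfolding m_def by (rule mu_pos[OF r0])
   define f where "f y = indicator (B x r) y *\<^sub>R cnj (sgn (w y)) / of_real m" for y
   have fm: "f \<in> borel_measurable M" unfolding f_def sgn_div_norm by measurable
   have "cmod (LINT y|M. w y * f y) \<le> C * A"
    by (rule test[OF r0 fm]) (use r m in \<open>auto simp: f_def m_def[symmetric] norm_divide norm_sgn indicator_def\<close>)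
   moreover have "w y * f y = of_real (indicator (B x r) y * cmod (w y) / m)" for y
    unfolding f_def using sg[of "w y"] by (simp add: indicator_def)
   ultimately have "\<bar>\<integral>y. indicator (B x r) y * cmod (w y) / m \<partial>M\<bar> \<le> C * A"
    by (simp only: integral_complex_of_real norm_of_real)
   moreover have "0 \<le> C * A" using A C(1) by simp
   ultimately show ?thesis unfolding average_norm_eq m_def by simp
  qed
  show "bmo (2 * C * A) w" unfolding bmo_def using 1 2 w A C(1) by auto
 qed
qed

end

lemma atomic_tail:
 assumes "\<And>j. a j \<in> \<A>" "summable (\<lambda>j. cmod (c j))" "h \<in> borel_measurable M"
  and A: "L1_atoms M \<A>" and s: "AE x in M. (\<lambda>j. c j * a j x) sums h x"
 shows "atomic_gauge M \<A> (\<Sum>j. cmod (c (j + n))) (\<lambda>x. h x - (\<Sum>j<n. c j * a j x))"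
proof -
 have [measurable]: "a j \<in> borel_measurable M" for j
  using A assms(1)[of j] unfolding L1_atoms_def by (meson borel_measurable_integrable)
 have "AE x in M. (\<lambda>j. c (j + n) * a (j + n) x) sums (h x - (\<Sum>j<n. c j * a j x))"
  using s by eventually_elim (rule sums_split_initial_segment)
 then show ?thesis unfolding atomic_gauge_def using assms(1,2,3)
  by (intro conjI exI[of _ "\<lambda>j. c (j + n)"] exI[of _ "\<lambda>j. a (j + n)"])
   (auto intro: summable_ignore_initial_segment[where f="\<lambda>j. cmod (c j)"])
qed

section \<open>The duality pairing\<close>

context admissible_space
begin

text \<open>The truncated pairings have a limit that involves \<open>h\<close> alone, while the
  series involves the decomposition; equating them proves independence of the decomposition. The
  family of atoms is left general so that the result covers every exponent \<open>q\<close>.\<close>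

lemma pair_sums:
 assumes f: "bmo N f" and A: "L1_atoms M \<A>" and K: "\<And>a. a \<in> \<A> ==> HA K a" "0 \<le> K"
  and i: "\<And>a. a \<in> \<A> ==> integrable M (\<lambda>x. f x * a x)"
  and a: "\<And>j. a j \<in> \<A>" and c: "summable (\<lambda>j. cmod (c j))" and h: "h \<in> borel_measurable M"
  and s: "AE x in M. (\<lambda>j. c j * a j x) sums h x"
 shows "\<exists>v. (\<lambda>j. c j * (LINT x|M. f x * a j x)) sums v \<and> (\<lambda>n. \<integral>x. trunc n (f x) * h x \<partial>M) \<longlonglongrightarrow> v \<and>
   cmod v \<le> 2 * dbl 4 * N * K * (\<Sum>j. cmod (c j))"
proof -
 have N: "0 \<le> N" and fL: "f \<in> L1_loc d M" using f unfolding bmo_def by auto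
 note [measurable] = L1_loc_measurable[OF fL]
 have am[measurable]: "a j \<in> borel_measurable M" for j using atomic_gauge_measurable[OF K(1)[OF a]] .
 define D where "D = dbl 4 * (2 * N) * K"
 have bd: "cmod (LINT x|M. trunc n (f x) * a j x) \<le> D" for n j
  unfolding D_def
  by (rule atomic_pairing_bound[OF L1_rho_atoms K(1)[OF a], where K="real n"])
   (use bmo_atom(2)[OF bmo_trunc[OF f]] N dbl_pos[of 4] in \<open>auto simp: trunc_bound\<close>)
 have S: "(\<lambda>j. c j * (LINT x|M. trunc n (f x) * a j x)) sums (LINT x|M. trunc n (f x) * h x)" for n
  by (rule atomic_pairing_sums(2)[OF A a c h s, where K="real n"]) (auto simp: trunc_bound)
 have lim: "(\<lambda>n. c k * (LINT x|M. trunc n (f x) * a k x)) \<longlonglongrightarrow> c k * (LINT x|M. f x * a k x)" for k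
 proof (intro tendsto_mult tendsto_const integral_dominated_convergence[where w="\<lambda>x. cmod (f x * a k x)"])
  show "integrable M (\<lambda>x. cmod (f x * a k x))" using i[OF a] by (rule integrable_norm)
  show "AE x in M. (\<lambda>n. trunc n (f x) * a k x) \<longlonglongrightarrow> f x * a k x" by (intro AE_I2 tendsto_intros trunc_tendsto)
  show "AE x in M. norm (trunc n (f x) * a k x) \<le> cmod (f x * a k x)" for n
   by (intro AE_I2) (simp add: norm_mult mult_right_mono trunc_bound)
 qed measurable
 have sD: "summable (\<lambda>j. cmod (c j) * D)" by (rule summable_mult2[OF c])
 have bnd: "cmod (c k * (LINT x|M. trunc n (f x) * a k x)) \<le> cmod (c k) * D" for k n
  unfolding norm_mult by (intro mult_left_mono bd) auto
 \<comment> \<open>Truncations satisfy \<open>bmo (2 * N)\<close> uniformly, so each term is at most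
   \<open>cmod (c k) * D\<close> for all \<open>n\<close>, and Tannery's theorem exchanges limit and
   sum.\<close>
 have T: "eventually (\<lambda>n. summable (\<lambda>k. norm (c k * (LINT x|M. trunc n (f x) * a k x)))) sequentially \<and>
      summable (\<lambda>k. norm (c k * (LINT x|M. f x * a k x))) \<and>
      ((\<lambda>n. suminf (\<lambda>k. c k * (LINT x|M. trunc n (f x) * a k x))) \<longlongrightarrow> suminf (\<lambda>k. c k * (LINT x|M. f x * a k x))) sequentially"
  by (rule tannerys_theorem[OF lim _ sD], rule always_eventually) (use bnd in auto)
 define v where "v = (\<Sum>k. c k * (LINT x|M. f x * a k x))"
 have 1: "(\<lambda>k. c k * (LINT x|M. f x * a k x)) sums v" unfolding v_def
  by (rule summable_sums[OF summable_norm_cancel[OF conjunct1[OF conjunct2[OF T]]]])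
 have 2: "(\<lambda>n. \<integral>x. trunc n (f x) * h x \<partial>M) \<longlonglongrightarrow> v"
  using conjunct2[OF conjunct2[OF T]] unfolding v_def sums_unique[OF S, symmetric] .
 have "cmod (LINT x|M. trunc n (f x) * h x) \<le> D * (\<Sum>j. cmod (c j))" for n
 proof -
  have sn: "summable (\<lambda>k. cmod (c k * (LINT x|M. trunc n (f x) * a k x)))"
   by (rule summable_comparison_test'[OF sD, of 0]) (use bnd in auto)
  have "cmod (LINT x|M. trunc n (f x) * h x) \<le> (\<Sum>k. cmod (c k * (LINT x|M. trunc n (f x) * a k x)))"
   using summable_norm[OF sn] S[of n] by (simp add: sums_iff)
  also have "\<dots> \<le> (\<Sum>k. cmod (c k) * D)" by (rule suminf_le[OF bnd sn sD])
  also have "\<dots> = D * (\<Sum>j. cmod (c j))" using suminf_mult2[OF c, of D] by (simp add: mult.commute)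
  finally show ?thesis .
 qed
 then have "cmod v \<le> D * (\<Sum>j. cmod (c j))"
  by (intro LIMSEQ_le_const2[OF tendsto_norm[OF 2]]) auto
 then show ?thesis using 1 2 unfolding D_def by (intro exI[of _ v]) (simp add: ac_simps)
qed

text \<open>The pairing of \<open>f\<close> and \<open>h\<close>, computed through the truncations of \<open>f\<close> so that it manifestly does
 not depend on a decomposition of \<open>h\<close>.\<close>

definition Lp :: "('a => complex) => ('a => complex) => complex" where
 "Lp f h = lim (\<lambda>n. \<integral>x. trunc n (f x) * h x \<partial>M)"

lemma Lp_sums:
 assumes f: "bmo N f" and a: "\<And>j. a j \<in> rho_atoms" and c: "summable (\<lambda>j. cmod (c j))" and h: "h \<in> borel_measurable M"
  and s: "AE x in M. (\<lambda>j. c j * a j x) sums h x"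
 shows "(\<lambda>j. c j * (LINT x|M. f x * a j x)) sums Lp f h"
proof -
 obtain v where v: "(\<lambda>j. c j * (LINT x|M. f x * a j x)) sums v" "(\<lambda>n. \<integral>x. trunc n (f x) * h x \<partial>M) \<longlonglongrightarrow> v"
  using pair_sums[OF f L1_rho_atoms atomic_gauge_atom[OF L1_rho_atoms] _ bmo_atom(1)[OF f] a c h s] by auto
 then show ?thesis unfolding Lp_def by (simp add: limI)
qed

lemma Lp_HA:
 assumes f: "bmo N f" and h: "HA A h"
 shows "(\<lambda>n. \<integral>x. trunc n (f x) * h x \<partial>M) \<longlonglongrightarrow> Lp f h" "cmod (Lp f h) \<le> 2 * dbl 4 * N * A"
proof -
 obtain c a where *: "\<And>j. a j \<in> rho_atoms" "summable (\<lambda>j. cmod (c j))" "(\<Sum>j::nat. cmod (c j)) \<le> A"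
  "AE x in M. (\<lambda>j. c j * a j x) sums h x" using h unfolding atomic_gauge_def by blast
 have N: "0 \<le> N" using f unfolding bmo_def by auto
 obtain v where v: "(\<lambda>n. \<integral>x. trunc n (f x) * h x \<partial>M) \<longlonglongrightarrow> v" "cmod v \<le> 2 * dbl 4 * N * 1 * (\<Sum>j. cmod (c j))"
  using pair_sums[OF f L1_rho_atoms atomic_gauge_atom[OF L1_rho_atoms] _ bmo_atom(1)[OF f] *(1,2) atomic_gauge_measurable[OF h] *(4)] by auto
 have e: "Lp f h = v" unfolding Lp_def by (rule limI[OF v(1)])
 show "(\<lambda>n. \<integral>x. trunc n (f x) * h x \<partial>M) \<longlonglongrightarrow> Lp f h" using v(1) e by simp
 have "2 * dbl 4 * N * 1 * (\<Sum>j. cmod (c j)) \<le> 2 * dbl 4 * N * 1 * A"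
  using *(3) N dbl_pos[of 4] by (intro mult_left_mono) auto
 then show "cmod (Lp f h) \<le> 2 * dbl 4 * N * A" using v(2) e by simp
qed

lemma Lp_integral:
 assumes f: "bmo N f" and h: "HA A h" and i: "integrable M (\<lambda>x. f x * h x)"
 shows "Lp f h = (LINT x|M. f x * h x)"
proof -
 have "f \<in> L1_loc d M" using f unfolding bmo_def by auto
 note [measurable] = L1_loc_measurable[OF this] atomic_gauge_measurable[OF h]
 have "(\<lambda>n. \<integral>x. trunc n (f x) * h x \<partial>M) \<longlonglongrightarrow> (LINT x|M. f x * h x)"
 proof (rule integral_dominated_convergence[where w="\<lambda>x. cmod (f x * h x)"])
  show "integrable M (\<lambda>x. cmod (f x * h x))" using i by (rule integrable_norm)
  show "AE x in M. (\<lambda>n. trunc n (f x) * h x) \<longlonglongrightarrow> f x * h x" by (intro AE_I2 tendsto_intros trunc_tendsto)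
  show "AE x in M. norm (trunc n (f x) * h x) \<le> cmod (f x * h x)" for n
   by (intro AE_I2) (simp add: norm_mult mult_right_mono trunc_bound)
 qed measurable
 then show ?thesis using Lp_HA(1)[OF f h] LIMSEQ_unique by blast
qed

lemma Lp_AE_cong:
 assumes "f \<in> borel_measurable M" "h \<in> borel_measurable M" "g \<in> borel_measurable M" "AE x in M. h x = g x"
 shows "Lp f h = Lp f g"
proof -
 note [measurable] = assms(1-3)
 have "(LINT x|M. trunc n (f x) * h x) = (LINT x|M. trunc n (f x) * g x)" for n
 proof (rule integral_cong_AE)
  show "AE x in M. trunc n (f x) * h x = trunc n (f x) * g x" using assms(4) by eventually_elim simp
 qed measurable
 then show ?thesis unfolding Lp_def by simp
qed

lemma Lp_add:
 assumes f: "bmo N f" and h: "HA A h" and g: "HA A' g"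
 shows "Lp f (\<lambda>x. h x + c * g x) = Lp f h + c * Lp f g"
proof -
 have "f \<in> L1_loc d M" using f unfolding bmo_def by auto
 note [measurable] = L1_loc_measurable[OF this] atomic_gauge_measurable[OF h] atomic_gauge_measurable[OF g]
 have i: "integrable M (\<lambda>x. trunc n (f x) * k x)" if k: "HA K k" for n k K
 proof (rule Bochner_Integration.integrable_bound)
  note [measurable] = atomic_gauge_measurable[OF k]
  show "integrable M (\<lambda>x. of_real (real n) * k x)" using atomic_gauge_integrable(1)[OF L1_rho_atoms k] by simp
  show "AE x in M. norm (trunc n (f x) * k x) \<le> norm (of_real (real n) * k x)"
   by (intro AE_I2) (simp add: norm_mult mult_right_mono trunc_bound del: of_real_of_nat_eq)
  show "(\<lambda>x. trunc n (f x) * k x) \<in> borel_measurable M" by measurable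
 qed
 have e: "(LINT x|M. trunc n (f x) * (h x + c * g x)) = (LINT x|M. trunc n (f x) * h x) + c * (LINT x|M. trunc n (f x) * g x)" for n
 proof -
  have "(LINT x|M. trunc n (f x) * (h x + c * g x)) = (LINT x|M. trunc n (f x) * h x + c * (trunc n (f x) * g x))"
   by (simp add: algebra_simps)
  also have "\<dots> = (LINT x|M. trunc n (f x) * h x) + (LINT x|M. c * (trunc n (f x) * g x))"
   by (rule Bochner_Integration.integral_add[OF i[OF h] integrable_mult_right[OF i[OF g]]])
  finally show ?thesis by simp
 qed
 have "(\<lambda>n. \<integral>x. trunc n (f x) * (h x + c * g x) \<partial>M) \<longlonglongrightarrow> Lp f h + c * Lp f g"
  unfolding e by (intro tendsto_intros Lp_HA(1)[OF f h] Lp_HA(1)[OF f g])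
 then show ?thesis unfolding Lp_def[of f "\<lambda>x. h x + c * g x"] by (rule limI)
qed

lemma bmo_add:
 obtains C where "0 \<le> C" "\<And>f g c N N'. bmo N f ==> bmo N' g ==> bmo (C * (N + cmod c * N')) (\<lambda>x. f x + c * g x)"
proof -
 obtain C where C: "1 \<le> C" "\<And>w A. w \<in> L1_loc d M ==> 0 \<le> A ==>
   (\<And>a. a \<in> rho_atoms ==> cmod (LINT y|M. w y * a y) \<le> A) ==> bmo (C * A) w" by (rule bmo_by_testing) blast
 show ?thesis
 proof (rule that[of "C * dbl 4"])
  show "0 \<le> C * dbl 4" using C(1) dbl_pos[of 4] by simp
  fix f g c N N' assume f: "bmo N f" and g: "bmo N' g"
  have "bmo (C * (dbl 4 * (N + cmod c * N'))) (\<lambda>x. f x + c * g x)"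
  proof (rule C(2))
   show "(\<lambda>x. f x + c * g x) \<in> L1_loc d M" using f g unfolding bmo_def by (intro L1_loc_add L1_loc_scale) auto
   show "0 \<le> dbl 4 * (N + cmod c * N')" using f g dbl_pos[of 4] unfolding bmo_def by simp
   fix a assume a: "a \<in> rho_atoms"
   have "(LINT y|M. (f y + c * g y) * a y) = (LINT y|M. f y * a y + c * (g y * a y))" by (simp add: algebra_simps)
   also have "\<dots> = (LINT y|M. f y * a y) + c * (LINT y|M. g y * a y)"
    using bmo_atom(1)[OF f a] bmo_atom(1)[OF g a] by (subst Bochner_Integration.integral_add) auto
   also have "cmod \<dots> \<le> dbl 4 * N + cmod c * (dbl 4 * N')"
    using bmo_atom(2)[OF f a] bmo_atom(2)[OF g a]
    by (intro norm_triangle_le add_mono) (auto simp: norm_mult intro: mult_left_mono)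
   finally show "cmod (LINT y|M. (f y + c * g y) * a y) \<le> dbl 4 * (N + cmod c * N')" by (simp add: algebra_simps)
  qed
  then show "bmo (C * dbl 4 * (N + cmod c * N')) (\<lambda>x. f x + c * g x)" by (simp add: mult.assoc)
 qed
qed

lemma Lp_add_left:
 assumes f: "bmo N f" and g: "bmo N' g" and h: "HA A h"
 shows "Lp (\<lambda>x. f x + z * g x) h = Lp f h + z * Lp g h"
proof -
 obtain c a where *: "\<And>j. a j \<in> rho_atoms" "summable (\<lambda>j. cmod (c j))" "(\<Sum>j::nat. cmod (c j)) \<le> A"
  "AE x in M. (\<lambda>j. c j * a j x) sums h x" using h unfolding atomic_gauge_def by blast
 note hm = atomic_gauge_measurable[OF h]
 obtain C where C: "\<And>f g c N N'. bmo N f ==> bmo N' g ==> bmo (C * (N + cmod c * N')) (\<lambda>x. f x + c * g x)"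
  by (rule bmo_add) blast
 note 1 = Lp_sums[OF C[OF f g, of z] *(1,2) hm *(4)]
 have e: "c j * (LINT x|M. (f x + z * g x) * a j x) = c j * (LINT x|M. f x * a j x) + z * (c j * (LINT x|M. g x * a j x))" for j
 proof -
  have "(LINT x|M. (f x + z * g x) * a j x) = (LINT x|M. f x * a j x + z * (g x * a j x))" by (simp add: algebra_simps)
  also have "\<dots> = (LINT x|M. f x * a j x) + z * (LINT x|M. g x * a j x)"
   using bmo_atom(1)[OF f *(1)] bmo_atom(1)[OF g *(1)] by (subst Bochner_Integration.integral_add) auto
  finally show ?thesis by (simp add: algebra_simps)
 qed
 have "(\<lambda>j. c j * (LINT x|M. (f x + z * g x) * a j x)) sums (Lp f h + z * Lp g h)"
  unfolding e by (intro sums_add sums_mult Lp_sums[OF f *(1,2) hm *(4)] Lp_sums[OF g *(1,2) hm *(4)])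
 then show ?thesis using 1 sums_unique2 by blast
qed

lemma bmo_powr_integrable:
 assumes f: "bmo N f" and s: "1 < s" and r: "0 < r"
 shows "integrable M (\<lambda>y. indicator (B x r) y * cmod (f y) powr s)"
proof -
 have fL: "f \<in> L1_loc d M" and N: "0 \<le> N" using f unfolding bmo_def by auto
 note [measurable] = L1_loc_measurable[OF fL]
 obtain C where C: "0 \<le> C"
  "\<And>x0 R f A. 0 < R ==> 0 \<le> A ==> f \<in> L1_loc d M ==>
    (\<And>x t. d x0 x < \<Lambda> * R ==> 0 < t ==> t \<le> \<Lambda> * R ==> MO M f (B x t) \<le> A) ==>
    integrable M (\<lambda>y. indicator (B x0 R) y * cmod (f y - avg x0 R f) powr s) \<and>
    (LINT y|M. indicator (B x0 R) y * cmod (f y - avg x0 R f) powr s) \<le> (C * A) powr s * mu x0 R"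
  by (rule John_Nirenberg[OF s]) blast
 have i: "integrable M (\<lambda>y. indicator (B x r) y * cmod (f y - avg x r f) powr s)"
  by (rule conjunct1[OF C(2)[OF r N fL]]) (use f in \<open>auto simp: bmo_def\<close>)
 show ?thesis
 proof (rule Bochner_Integration.integrable_bound)
  show "integrable M (\<lambda>y. 2 powr s * (indicator (B x r) y * cmod (f y - avg x r f) powr s + cmod (avg x r f) powr s * indicator (B x r) y))"
   using i by (simp add: less_top[symmetric])
  show "AE y in M. norm (indicator (B x r) y * cmod (f y) powr s)
    \<le> norm (2 powr s * (indicator (B x r) y * cmod (f y - avg x r f) powr s + cmod (avg x r f) powr s * indicator (B x r) y))"
  proof (rule AE_I2)
   fix y
   have "cmod (f y) \<le> cmod (f y - avg x r f) + cmod (avg x r f)" using norm_triangle_ineq[of "f y - avg x r f" "avg x r f"] by simp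
   then have "cmod (f y) powr s \<le> (cmod (f y - avg x r f) + cmod (avg x r f)) powr s" using s by (intro powr_mono2) auto
   also have "\<dots> \<le> 2 powr s * (cmod (f y - avg x r f) powr s + cmod (avg x r f) powr s)" by (rule powr_sum_le) (use s in auto)
   finally show "norm (indicator (B x r) y * cmod (f y) powr s)
    \<le> norm (2 powr s * (indicator (B x r) y * cmod (f y - avg x r f) powr s + cmod (avg x r f) powr s * indicator (B x r) y))"
    by (auto simp: indicator_def)
  qed
 qed measurable
qed

text \<open>By John--Nirenberg \<open>f\<close> is locally in \<open>L\<^sup>s\<close> for the
  exponent \<open>s\<close> dual to \<open>q\<close>, so Young's inequality applies to the product;
  for \<open>q = \<infinity>\<close> local integrability is enough.\<close>

lemma bmo_q_atom_integrable:
 assumes q: "1 < q" and f: "bmo N f" and a: "H1_atom d M \<rho> q a"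
 shows "integrable M (\<lambda>y. f y * a y)"
proof -
 have fL: "f \<in> L1_loc d M" using f unfolding bmo_def by auto
 obtain x r where am: "a \<in> borel_measurable M" and r: "0 < r" "r < \<rho> x"
  and van: "vanishes_off M (B x r) a" and nrm: "Lq_norm M q a \<le> ennreal (mu x r powr (enn2real (1 / q) - 1))"
  using a unfolding H1_atom_def by blast
 note [measurable] = L1_loc_measurable[OF fL] am
 have m: "0 < mu x r" by (rule mu_pos[OF r(1)])
 show ?thesis
 proof (cases "q = \<infinity>")
  case True
  have "esssup M (\<lambda>x. ennreal (cmod (a x))) \<le> ennreal (1 / mu x r)"
   using nrm m unfolding Lq_norm_def True by (simp add: powr_minus_divide)
  moreover have "AE y in M. ennreal (cmod (a y)) \<le> esssup M (\<lambda>x. ennreal (cmod (a x)))" by (rule esssup_AE)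
  ultimately have "AE y in M. ennreal (cmod (a y)) \<le> ennreal (1 / mu x r)"
   by (elim eventually_mono) (rule order_trans)
  then have ae: "AE y in M. cmod (a y) \<le> 1 / mu x r"
   by eventually_elim (use m in \<open>simp add: ennreal_le_iff\<close>)
  show ?thesis
  proof (rule Bochner_Integration.integrable_bound)
   show "integrable M (\<lambda>y. 1 / mu x r * (indicator (B x r) y * cmod (f y)))" using L1_loc_norm[OF fL] by simp
   show "AE y in M. norm (f y * a y) \<le> norm (1 / mu x r * (indicator (B x r) y * cmod (f y)))"
    using ae van unfolding vanishes_off_def
   proof eventually_elim
    case (elim y)
    have "cmod (f y) * cmod (a y) \<le> cmod (f y) * (1 / mu x r)" using elim by (intro mult_left_mono) auto
    then show ?case using elim m by (cases "y \<in> B x r") (simp_all add: norm_mult mult.commute)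
   qed
  qed measurable
 next
  case False
  define p where "p = enn2real q"
  have qe: "q = ennreal p" unfolding p_def using False by (simp add: less_top)
  have p: "1 < p" using q unfolding qe by (simp add: ennreal_1[symmetric] ennreal_less_iff del: ennreal_1)
  define s where "s = p / (p - 1)"
  have s: "1 < s" "1 / p + 1 / s = 1" unfolding s_def using p by (auto simp: field_simps)
  note N = Lq_norm_finite[OF False p_def p m nrm]
  show ?thesis
  proof (rule Bochner_Integration.integrable_bound)
   show "integrable M (\<lambda>y. cmod (a y) powr p + indicator (B x r) y * cmod (f y) powr s)"
    using N(1) bmo_powr_integrable[OF f s(1) r(1), of x] by simp
   show "AE y in M. norm (f y * a y) \<le> norm (cmod (a y) powr p + indicator (B x r) y * cmod (f y) powr s)"
    using van unfolding vanishes_off_def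
   proof eventually_elim
    case (elim y)
    show ?case
    proof (cases "y \<in> B x r")
     case True
     have "cmod (a y) * cmod (f y) \<le> cmod (a y) powr p / p + cmod (f y) powr s / s"
      by (rule Youngs_inequality[OF p s]) auto
     also have "\<dots> \<le> cmod (a y) powr p / 1 + cmod (f y) powr s / 1"
      using p s by (intro add_mono divide_left_mono) auto
     finally show ?thesis using True by (simp add: norm_mult mult.commute)
    next
     case False
     then show ?thesis using elim by simp
    qed
   qed
  qed measurable
 qed
qed

text \<open>Every decomposition of \<open>h\<close> sums to \<open>Lp f h\<close> and at least one
  exists, so the definite description in \<open>pairing\<close> is well defined.\<close>

lemma pairing_eq_Lp:
 assumes q: "1 < q" and f: "bmo N f" and h: "h \<in> H1 d M \<rho> q"
 shows "pairing d M \<rho> q f h = Lp f h"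
proof -
 obtain C where C: "1 \<le> C" "\<And>a. H1_atom d M \<rho> q a ==> HA C a \<and> integrable M a \<and> (LINT x|M. cmod (a x)) \<le> 1"
  by (rule H1_atom_HA[OF q]) blast
 have S: "(\<lambda>j. c j * (LINT x|M. f x * a j x)) sums Lp f h" if D: "atomic_decomposition d M \<rho> q h c a" for c a
 proof -
  have a: "a j \<in> q_atoms q" and c: "summable (\<lambda>j. cmod (c j))" and hm: "h \<in> borel_measurable M" for j
   using D unfolding atomic_decomposition_def q_atoms_def by auto
  have "\<exists>v. (\<lambda>j. c j * (LINT x|M. f x * a j x)) sums v \<and> (\<lambda>n. \<integral>x. trunc n (f x) * h x \<partial>M) \<longlonglongrightarrow> v \<and>
   cmod v \<le> 2 * dbl 4 * N * C * (\<Sum>j. cmod (c j))"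
   by (rule pair_sums[OF f L1_q_atoms[OF q] _ _ _ a c hm atomic_decomposition_AE[OF q D]])
    (use C bmo_q_atom_integrable[OF q f] in \<open>auto simp: q_atoms_def\<close>)
  then obtain v where v: "(\<lambda>j. c j * (LINT x|M. f x * a j x)) sums v" "(\<lambda>n. \<integral>x. trunc n (f x) * h x \<partial>M) \<longlonglongrightarrow> v" by blast
  from limI[OF v(2)] show ?thesis unfolding Lp_def using v(1) by simp
 qed
 obtain c a where D: "atomic_decomposition d M \<rho> q h c a" using h unfolding H1_def by blast
 show ?thesis unfolding pairing_def
 proof (rule the_equality)
  show "\<forall>c a. atomic_decomposition d M \<rho> q h c a \<longrightarrow> (\<lambda>j. c j * (LINT x|M. f x * a j x)) sums Lp f h" using S by blast
  fix v assume "\<forall>c a. atomic_decomposition d M \<rho> q h c a \<longrightarrow> (\<lambda>j. c j * (LINT x|M. f x * a j x)) sums v"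
  then have "(\<lambda>j. c j * (LINT x|M. f x * a j x)) sums v" using D by blast
  then show "v = Lp f h" using S[OF D] sums_unique2 by blast
 qed
qed

end

section \<open>Test functions, extension from atoms to the Hardy space, and representation of
  functionals\<close>

context admissible_space
begin

abbreviation tests :: "('a => complex) set" where "tests \<equiv> bounded_test_functions d M"

lemma testE:
 assumes "g \<in> tests"
 obtains K x r where "g \<in> borel_measurable M" "0 < K" "\<And>y. cmod (g y) \<le> K" "0 < r" "\<rho> x \<le> r"
  "AE y in M. y \<notin> B x r \<longrightarrow> g y = 0"
proof -
 have gm: "g \<in> borel_measurable M" and b: "bounded (range g)" and bs: "bounded_support d M g"
  using assms unfolding bounded_test_functions_def by auto
 obtain K where K: "0 < K" "\<And>y. cmod (g y) \<le> K" using b unfolding bounded_pos by auto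
 obtain x r where "vanishes_off M (B x r) g" using bs unfolding bounded_support_def by blast
 \<comment> \<open>Enlarging the radius to at least \<open>\<rho> x\<close> makes a test function a
   function on a large ball, which lies in the Hardy space without cancellation.\<close>
 then have ae: "AE y in M. y \<notin> B x (max r (\<rho> x)) \<longrightarrow> g y = 0"
  unfolding vanishes_off_def by eventually_elim auto
 show ?thesis by (rule that[OF gm K _ _ ae]) (auto simp: less_max_iff_disj)
qed

lemma testI:
 assumes "g \<in> borel_measurable M" "\<And>y. cmod (g y) \<le> K" "\<And>y. y \<notin> B x r ==> g y = 0"
 shows "g \<in> tests"
 unfolding bounded_test_functions_def bounded_support_def vanishes_off_def bounded_iff
 using assms by (intro CollectI conjI exI[of _ K] exI[of _ x] exI[of _ r] AE_I2) auto

lemma test_square_int: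
 assumes "g \<in> tests" shows "square_int M g"
proof -
 obtain K x r where g: "g \<in> borel_measurable M" "0 < K" "\<And>y. cmod (g y) \<le> K" "0 < r"
  "AE y in M. y \<notin> B x r \<longrightarrow> g y = 0" by (rule testE[OF assms]) blast
 have "square_int M (\<lambda>y. of_real (K * indicat_real (B x r) y))"
 proof -
  have "(cmod (of_real (K * indicat_real (B x r) y)))\<^sup>2 = K\<^sup>2 * indicat_real (B x r) y" for y by (simp add: indicator_def)
  then show ?thesis unfolding square_int_def by (simp add: less_top[symmetric])
 qed
 then show ?thesis
  by (rule square_int_bound[OF _ g(1)]) (use g(5) in \<open>eventually_elim, use g(2,3) in \<open>auto simp: indicator_def\<close>\<close>)
qed

lemma rho_atom_test: "a \<in> rho_atoms ==> a \<in> tests"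
 proof -
 assume "a \<in> rho_atoms"
 then obtain x r where a: "a \<in> borel_measurable M" "\<And>y. cmod (a y) \<le> 1 / mu x r" "\<And>y. y \<notin> B x r ==> a y = 0"
  unfolding rho_atoms_def by blast
 show "a \<in> tests" by (rule testI[OF a])
qed

lemma square_int_L1_loc:
 assumes f: "square_int M f" shows "f \<in> L1_loc d M"
proof (rule L1_locI)
 fix x r
 note [measurable] = square_int_measurable[OF f]
 show "integrable M (\<lambda>y. indicator (B x r) y *\<^sub>R f y)"
 proof (rule Bochner_Integration.integrable_bound)
  show "integrable M (\<lambda>y. (cmod (f y))\<^sup>2 + indicat_real (B x r) y)"
   using f unfolding square_int_def by (simp add: less_top[symmetric])
  have "cmod (f y) \<le> (cmod (f y))\<^sup>2 + 1" for y
   using sum_squares_bound[of "cmod (f y)" 1] norm_ge_zero[of "f y"] by (simp del: norm_ge_zero)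
  then show "AE y in M. norm (indicator (B x r) y *\<^sub>R f y) \<le> norm ((cmod (f y))\<^sup>2 + indicat_real (B x r) y)"
   by (auto simp: indicator_def)
 qed measurable
qed

lemma integrable_L1_loc: "integrable M f ==> f \<in> L1_loc d M"
 by (intro L1_locI integrable_mult_indicator) auto

lemma HA_L1_loc: "HA A h ==> h \<in> L1_loc d M"
 using atomic_gauge_integrable(1)[OF L1_rho_atoms] integrable_L1_loc by blast

lemma L1_loc_test:
 assumes f: "f \<in> L1_loc d M" and g: "g \<in> tests"
 shows "integrable M (\<lambda>y. f y * g y)"
proof -
 obtain K x r where g': "g \<in> borel_measurable M" "0 < K" "\<And>y. cmod (g y) \<le> K" "0 < r"
  "AE y in M. y \<notin> B x r \<longrightarrow> g y = 0" by (rule testE[OF g]) blast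
 note [measurable] = L1_loc_measurable[OF f] g'(1)
 have i: "integrable M (\<lambda>y. f y * (indicator (B x r) y *\<^sub>R g y))"
  by (rule L1_loc_pairing(1)[OF f, of _ K x r]) (use g'(2,3) in \<open>auto simp: indicator_def\<close>)
 show ?thesis
  by (rule integrable_cong_AE_imp[OF i]) (use g'(5) in \<open>auto simp: indicator_def\<close>)
qed

lemma test_unique:
 assumes k: "k \<in> L1_loc d M" "k' \<in> L1_loc d M"
  and eq: "\<And>g. g \<in> tests ==> (LINT y|M. k y * g y) = (LINT y|M. k' y * g y)"
 shows "AE y in M. k y = k' y"
proof -
 fix z
 have F: "(\<lambda>y. k y - k' y) \<in> L1_loc d M" using L1_loc_add[OF k(1) L1_loc_scale[OF k(2), of "-1"]] by simp
 have "AE y in M. y \<in> B z (real n) \<longrightarrow> cmod (k y - k' y) \<le> 0" for n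
 proof (rule AE_bound_by_testing)
  show "set_integrable M (B z (real n)) (\<lambda>y. k y - k' y)"
   unfolding set_integrable_def by (rule L1_loc_integrable[OF F])
  fix g :: "'a => complex" assume g: "g \<in> borel_measurable M" "\<And>x. cmod (g x) \<le> indicator (B z (real n)) x"
  have "g \<in> tests"
  proof (rule testI[OF g(1), of 1 z "real n"])
   show "cmod (g y) \<le> 1" for y using order_trans[OF g(2)[of y], of 1] by (simp add: indicator_def)
   show "g y = 0" if "y \<notin> B z (real n)" for y using g(2)[of y] that by (simp add: indicator_def)
  qed
  then have "(LINT x|M. (k x - k' x) * g x) = 0"
   using eq Bochner_Integration.integral_diff[OF L1_loc_test[OF k(1)] L1_loc_test[OF k(2)], of g g]
   by (simp add: left_diff_distrib)
  then show "cmod (LINT x|M. (k x - k' x) * g x) \<le> 0 * (LINT x|M. cmod (g x))" by simp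
 qed (use L1_loc_measurable[OF F] in auto)
 then have "AE y in M. \<forall>n::nat. y \<in> B z (real n) \<longrightarrow> cmod (k y - k' y) \<le> 0" by (subst AE_all_countable) blast
 then show ?thesis
 proof eventually_elim
  case (elim y)
  obtain n :: nat where "d z y < real n" using reals_Archimedean2 by blast
  then show ?case using elim by auto
 qed
qed

lemma test_HA: assumes g: "g \<in> tests" shows "\<exists>A. HA A g"
proof -
 obtain C where C: "1 \<le> C"
  "\<And>x R f K. 0 < R ==> f \<in> borel_measurable M ==> (\<And>y. cmod (f y) \<le> K / mu x R) ==>
    (\<And>y. y \<notin> B x R ==> f y = 0) ==> \<rho> x \<le> R \<or> (LINT y|M. f y) = 0 ==> 0 < K ==> HA (C * K) f"
  by (rule mean_zero_HA) blast
 obtain K x r where g': "g \<in> borel_measurable M" "0 < K" "\<And>y. cmod (g y) \<le> K" "0 < r" "\<rho> x \<le> r"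
  "AE y in M. y \<notin> B x r \<longrightarrow> g y = 0" by (rule testE[OF g]) blast
 note [measurable] = g'(1)
 have m: "0 < mu x r" by (rule mu_pos[OF g'(4)])
 have "HA (C * (K * mu x r)) (\<lambda>y. indicator (B x r) y *\<^sub>R g y)"
  by (rule C(2)[OF g'(4)]) (use g' m in \<open>auto simp: indicator_def\<close>)
 then have "HA (C * (K * mu x r)) g"
  by (rule atomic_gauge_AE_cong[OF _ g'(1)]) (use g'(6) in \<open>auto simp: indicator_def\<close>)
 then show ?thesis by blast
qed

text \<open>The constant depends on the ball through its measure and the logarithm. That is
  harmless, since it is used to represent a functional on one ball at a time.\<close>

lemma L2_HA:
 assumes R: "0 < R"
 obtains K where "0 \<le> K" "\<And>f. square_int M f ==> (\<And>y. y \<notin> B z R ==> f y = 0) ==> HA (K * norm2 M f) f"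
proof -
 obtain C where C: "1 \<le> C" "\<And>x R A f. psize 2 x R A f ==> 0 < R ==> HA (C * A * ln (exp 1 + \<rho> x / R)) f"
  by (rule psize_HA[of 2]) auto
 have m: "0 < mu z R" by (rule mu_pos[OF R])
 have L: "1 \<le> ln (exp 1 + \<rho> z / R)" by (rule ln_e_ge_1) (use R in simp)
 show ?thesis
 proof (rule that[of "C * sqrt (mu z R) * ln (exp 1 + \<rho> z / R)"])
  show "0 \<le> C * sqrt (mu z R) * ln (exp 1 + \<rho> z / R)" using C(1) L by simp
  fix f assume f: "square_int M f" and s: "\<And>y. y \<notin> B z R ==> f y = 0"
  have "psize 2 z R (norm2 M f * sqrt (mu z R)) f"
   unfolding psize_def
   using f s m unfolding square_int_def
   by (auto simp: powr_numeral power_mult_distrib powr_minus_divide powr_mult)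
  from C(2)[OF this R] show "HA (C * sqrt (mu z R) * ln (exp 1 + \<rho> z / R) * norm2 M f) f" by (simp add: ac_simps)
 qed
qed

text \<open>The bound \<open>C\<close> on atoms alone would not make the extension well defined. The
  transposed operator \<open>Q\<close> does: it maps test functions into \<open>bmo\<close>, and the
  integrals of \<open>S h\<close> against test functions are the pairings \<open>Lp (Q g) h\<close>,
  whatever decomposition was used to form the sum.\<close>

lemma extension:
 assumes C: "0 \<le> C" and P: "\<And>a. a \<in> rho_atoms ==> HA C (P a)"
  and Q: "\<And>g. g \<in> tests ==> Q g \<in> L1_loc d M"
  and dual: "\<And>a g. a \<in> rho_atoms ==> g \<in> tests ==> (LINT y|M. Q g y * a y) = (LINT y|M. P a y * g y)"
 shows "\<And>g. g \<in> tests ==> \<exists>N. bmo N (Q g)"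
  and "\<exists>S. (\<forall>A h. HA A h \<longrightarrow> HA (C * A) (S h) \<and> (\<forall>g\<in>tests. (LINT y|M. S h y * g y) = Lp (Q g) h))"
proof -
 show bm: "\<exists>N. bmo N (Q g)" if g: "g \<in> tests" for g
 proof -
  obtain C' where C': "1 \<le> C'" "\<And>w A. w \<in> L1_loc d M ==> 0 \<le> A ==>
   (\<And>a. a \<in> rho_atoms ==> cmod (LINT y|M. w y * a y) \<le> A) ==> bmo (C' * A) w" by (rule bmo_by_testing) blast
  obtain K where gm: "g \<in> borel_measurable M" and K: "0 < K" "\<And>y. cmod (g y) \<le> K" by (rule testE[OF g]) blast
  have "bmo (C' * (K * C)) (Q g)"
  proof (rule C'(2)[OF Q[OF g]])
   fix a assume a: "a \<in> rho_atoms"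
   note PI = atomic_gauge_integrable[OF L1_rho_atoms P[OF a]]
   have "cmod (LINT y|M. P a y * g y) \<le> (LINT y|M. cmod (P a y * g y))" by (rule integral_norm_bound)
   also have "\<dots> \<le> (LINT y|M. K * cmod (P a y))"
   proof (rule integral_mono)
    show "integrable M (\<lambda>y. cmod (P a y * g y))" by (rule integrable_norm[OF L1_loc_test[OF integrable_L1_loc[OF PI(1)] g]])
    show "integrable M (\<lambda>y. K * cmod (P a y))" using PI(1) by simp
    show "cmod (P a y * g y) \<le> K * cmod (P a y)" for y
     using mult_left_mono[OF K(2)[of y], of "cmod (P a y)"] by (simp add: norm_mult mult.commute)
   qed
   also have "\<dots> \<le> K * C" using PI(2) K(1) by simp
   finally show "cmod (LINT y|M. Q g y * a y) \<le> K * C" unfolding dual[OF a g] .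
  qed (use K C in simp)
  then show ?thesis by blast
 qed
 have ex: "\<exists>k. HA (C * A) k \<and> (\<forall>g\<in>tests. (LINT y|M. k y * g y) = Lp (Q g) h)" if h: "HA A h" for A h
 proof -
  obtain c a where *: "\<And>j. a j \<in> rho_atoms" "summable (\<lambda>j. cmod (c j))" "(\<Sum>j::nat. cmod (c j)) \<le> A"
   "AE x in M. (\<lambda>j. c j * a j x) sums h x" using h unfolding atomic_gauge_def by blast
  have Pm[measurable]: "P (a j) \<in> borel_measurable M" for j by (rule atomic_gauge_measurable[OF P[OF *(1)]])
  define k where "k x = (\<Sum>j. c j * P (a j) x)" for x
  have km[measurable]: "k \<in> borel_measurable M" unfolding k_def by measurable
  have gj: "HA (cmod (c j) * C) (\<lambda>x. c j * P (a j) x)" for j by (rule atomic_gauge_scale[OF P[OF *(1)]])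
  note gI = atomic_gauge_integrable[OF L1_rho_atoms gj]
  have sC: "summable (\<lambda>j. cmod (c j) * C)" by (rule summable_mult2[OF *(2)])
  have "AE x in M. summable (\<lambda>j. norm (c j * P (a j) x))"
   by (rule AE_summable_norm[OF gI(1)], rule summable_comparison_test'[OF sC, of 0]) (use gI(2) in auto)
  then have ks: "AE x in M. (\<lambda>j. c j * P (a j) x) sums k x"
   by eventually_elim (auto simp: k_def intro!: summable_sums intro: summable_norm_cancel)
  have "HA (C * A) k"
  proof (rule atomic_gauge_suminf[OF L1_rho_atoms gj sC _ km ks])
   show "(\<Sum>j. cmod (c j) * C) \<le> C * A"
    using suminf_mult2[OF *(2), of C] mult_left_mono[OF *(3) C] by (simp add: mult.commute)
  qed
  moreover have "(LINT y|M. k y * g y) = Lp (Q g) h" if g: "g \<in> tests" for g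
  proof -
   obtain K where gm[measurable]: "g \<in> borel_measurable M" and K: "0 < K" "\<And>y. cmod (g y) \<le> K" by (rule testE[OF g]) blast
   have i: "integrable M (\<lambda>x. c j * P (a j) x * g x)" for j
    by (rule L1_loc_test[OF integrable_L1_loc[OF gI(1)] g])
   have s: "summable (\<lambda>j. \<integral>x. cmod (c j * P (a j) x * g x) \<partial>M)"
   proof (rule summable_comparison_test'[OF summable_mult[OF sC, of K], of 0])
    fix j
    have "(LINT x|M. cmod (c j * P (a j) x * g x)) \<le> (LINT x|M. K * cmod (c j * P (a j) x))"
    proof (rule integral_mono[OF integrable_norm[OF i]])
     show "integrable M (\<lambda>x. K * cmod (c j * P (a j) x))" using integrable_norm[OF gI(1)] by (rule integrable_mult_right)
     show "cmod (c j * P (a j) x * g x) \<le> K * cmod (c j * P (a j) x)" for x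
      unfolding norm_mult[of "c j * P (a j) x" "g x"] mult.commute[of K] by (rule mult_left_mono[OF K(2)]) simp
    qed
    also have "\<dots> = K * (LINT x|M. cmod (c j * P (a j) x))" by (rule integral_mult_right_zero)
    also have "\<dots> \<le> K * (cmod (c j) * C)" using gI(2)[of j] K(1) by (intro mult_left_mono) auto
    finally show "norm (LINT x|M. cmod (c j * P (a j) x * g x)) \<le> K * (cmod (c j) * C)" by simp
   qed
   have ae: "AE x in M. (\<lambda>j. c j * P (a j) x * g x) sums (k x * g x)"
    using ks by eventually_elim (rule sums_mult2)
   have "(\<lambda>j. \<integral>x. c j * P (a j) x * g x \<partial>M) sums (LINT x|M. k x * g x)"
    by (rule integrable_sums(2)[OF i s _ ae]) measurable
   moreover have "(LINT x|M. c j * P (a j) x * g x) = c j * (LINT x|M. Q g x * a j x)" for j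
    unfolding dual[OF *(1) g] by (simp add: mult.assoc)
   ultimately have 1: "(\<lambda>j. c j * (LINT x|M. Q g x * a j x)) sums (LINT x|M. k x * g x)" by simp
   obtain N where "bmo N (Q g)" using bm[OF g] by blast
   from Lp_sums[OF this *(1,2) atomic_gauge_measurable[OF h] *(4)] 1 show ?thesis using sums_unique2 by blast
  qed
  ultimately show ?thesis by blast
 qed
 \<comment> \<open>The choice refers to \<open>h\<close> only and not to a bound \<open>A\<close>.
   The tested integrals determine the function almost everywhere, so the chosen one inherits the
   bound for every admissible \<open>A\<close>.\<close>
 define S where "S h = (SOME k. (\<exists>A. HA A k) \<and> (\<forall>g\<in>tests. (LINT y|M. k y * g y) = Lp (Q g) h))" for h
 have "HA (C * A) (S h) \<and> (\<forall>g\<in>tests. (LINT y|M. S h y * g y) = Lp (Q g) h)" if h: "HA A h" for A h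
 proof -
  obtain k where k: "HA (C * A) k" "\<And>g. g \<in> tests ==> (LINT y|M. k y * g y) = Lp (Q g) h" using ex[OF h] by blast
  then have Sh: "(\<exists>A. HA A (S h)) \<and> (\<forall>g\<in>tests. (LINT y|M. S h y * g y) = Lp (Q g) h)"
   unfolding S_def by (intro someI_ex[where P="\<lambda>k. (\<exists>A. HA A k) \<and> (\<forall>g\<in>tests. (LINT y|M. k y * g y) = Lp (Q g) h)"]) blast
  then obtain A' where A': "HA A' (S h)" by blast
  have "AE y in M. k y = S h y"
   by (rule test_unique[OF HA_L1_loc[OF k(1)] HA_L1_loc[OF A']]) (use k(2) Sh in simp)
  from atomic_gauge_AE_cong[OF k(1) atomic_gauge_measurable[OF A'] this] show ?thesis using Sh by blast
 qed
 then show "\<exists>S. (\<forall>A h. HA A h \<longrightarrow> HA (C * A) (S h) \<and> (\<forall>g\<in>tests. (LINT y|M. S h y * g y) = Lp (Q g) h))" by blast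
qed

text \<open>The dual of the Hardy space: on each ball the functional is bounded on \<open>L\<^sup>2\<close>, hence represented by
 a function there, and these functions are glued together.\<close>

lemma bmo_dual:
 obtains C where "0 \<le> C"
  "\<And>l D. 0 \<le> D ==> (\<And>h g A A' c. HA A h ==> HA A' g ==> l (\<lambda>x. h x + c * g x) = l h + c * l g) ==>
    (\<And>h A. HA A h ==> cmod (l h) \<le> D * A) ==> \<exists>u. bmo (C * D) u \<and> (\<forall>h A. HA A h \<longrightarrow> Lp u h = l h)"
proof -
 obtain C where C: "1 \<le> C" "\<And>w A. w \<in> L1_loc d M ==> 0 \<le> A ==>
   (\<And>a. a \<in> rho_atoms ==> cmod (LINT y|M. w y * a y) \<le> A) ==> bmo (C * A) w" by (rule bmo_by_testing) blast
 show ?thesis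
 proof (rule that[of C])
  show "0 \<le> C" using C(1) by simp
  fix l :: "('a => complex) => complex" and D :: real assume D: "0 \<le> D"
   and lin: "\<And>h g A A' c. HA A h ==> HA A' g ==> l (\<lambda>x. h x + c * g x) = l h + c * l g"
   and bd: "\<And>h A. HA A h ==> cmod (l h) \<le> D * A"
  define z where "z = (undefined :: 'a)"
  define BB where "BB n = B z (real (Suc n))" for n
  have BBs[measurable]: "BB n \<in> sets M" for n unfolding BB_def by simp
  have ind_sq: "square_int M (\<lambda>x. indicator (BB n) x *\<^sub>R f x)" if f: "square_int M f" for n f
  proof (rule square_int_bound[OF f])
   show "(\<lambda>x. indicator (BB n) x *\<^sub>R f x) \<in> borel_measurable M" using square_int_measurable[OF f] by measurable
  qed (auto simp: indicator_def)
  have ind_n: "norm2 M (\<lambda>x. indicator (BB n) x *\<^sub>R f x) \<le> norm2 M f" if f: "square_int M f" for n f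
   using f ind_sq[OF f, of n] unfolding square_int_def
   by (intro real_sqrt_le_mono integral_mono) (auto simp: indicator_def)
  \<comment> \<open>Restricting to the ball first makes \<open>l\<close> a bounded functional on all
    square integrable functions, as \<open>L2_Riesz\<close> demands.\<close>
  have "\<exists>u. square_int M u \<and> (\<forall>f. square_int M f \<longrightarrow> l (\<lambda>x. indicator (BB n) x *\<^sub>R f x) = (LINT x|M. f x * u x))" for n
  proof -
   obtain K where K: "0 \<le> K" "\<And>f. square_int M f ==> (\<And>y. y \<notin> BB n ==> f y = 0) ==> HA (K * norm2 M f) f"
    unfolding BB_def by (rule L2_HA[of "real (Suc n)" z]) auto
   have H: "HA (K * norm2 M f) (\<lambda>x. indicator (BB n) x *\<^sub>R f x)" if f: "square_int M f" for f
   proof (rule atomic_gauge_mono[OF K(2)[OF ind_sq[OF f, of n]]])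
    show "K * norm2 M (\<lambda>x. indicator (BB n) x *\<^sub>R f x) \<le> K * norm2 M f"
     by (rule mult_left_mono[OF ind_n[OF f] K(1)])
   qed simp
   obtain u where "square_int M u" "norm2 M u \<le> D * K" "\<And>f. square_int M f ==> l (\<lambda>x. indicator (BB n) x *\<^sub>R f x) = (LINT x|M. f x * u x)"
   proof (rule L2_Riesz[of M "\<lambda>f. l (\<lambda>x. indicator (BB n) x *\<^sub>R f x)" "D * K"])
    fix f g c assume f: "square_int M f" and g: "square_int M g"
    have "(\<lambda>x. indicator (BB n) x *\<^sub>R (f x + c * g x)) = (\<lambda>x. indicator (BB n) x *\<^sub>R f x + c * (indicator (BB n) x *\<^sub>R g x))"
     by (auto simp: scaleR_add_right)
    then show "l (\<lambda>x. indicator (BB n) x *\<^sub>R (f x + c * g x)) = l (\<lambda>x. indicator (BB n) x *\<^sub>R f x) + c * l (\<lambda>x. indicator (BB n) x *\<^sub>R g x)"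
     using lin[OF H[OF f] H[OF g], of c] by simp
   next
    fix f assume f: "square_int M f"
    show "cmod (l (\<lambda>x. indicator (BB n) x *\<^sub>R f x)) \<le> D * K * norm2 M f"
     using bd[OF H[OF f]] by (simp add: mult.assoc)
   qed (use D K in auto)
   then show ?thesis by blast
  qed
  then obtain u where u: "\<And>n. square_int M (u n)"
   "\<And>n f. square_int M f ==> l (\<lambda>x. indicator (BB n) x *\<^sub>R f x) = (LINT x|M. f x * u n x)" by metis
  have um[measurable]: "u n \<in> borel_measurable M" for n by (rule square_int_measurable[OF u(1)])
  have cons: "AE x in M. x \<in> BB n \<longrightarrow> u m x = u n x" if nm: "n \<le> m" for n m
  proof -
   have sub: "BB n \<subseteq> BB m" unfolding BB_def using nm by auto
   have F: "square_int M (\<lambda>x. u m x - u n x)" by (rule square_int_diff[OF u(1) u(1)])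
   have "AE x in M. x \<in> BB n \<longrightarrow> cmod (u m x - u n x) \<le> 0"
   proof (rule AE_bound_by_testing)
    show "set_integrable M (BB n) (\<lambda>x. u m x - u n x)"
     unfolding set_integrable_def BB_def by (rule L1_loc_integrable[OF square_int_L1_loc[OF F]])
    fix g :: "'a => complex" assume g: "g \<in> borel_measurable M" "\<And>x. cmod (g x) \<le> indicator (BB n) x"
    have g0: "g y = 0" if "y \<notin> BB n" for y using g(2)[of y] that by (simp add: indicator_def)
    have gt: "g \<in> tests"
    proof (rule testI[OF g(1), of 1 z "real (Suc n)"])
     show "cmod (g y) \<le> 1" for y using order_trans[OF g(2)[of y], of 1] by (simp add: indicator_def)
     show "g y = 0" if "y \<notin> B z (real (Suc n))" for y using g0 that unfolding BB_def by simp
    qed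
    note gs = test_square_int[OF gt]
    have e: "(\<lambda>x. indicator (BB n) x *\<^sub>R g x) = g" "(\<lambda>x. indicator (BB m) x *\<^sub>R g x) = g"
     using g0 sub by (auto simp: fun_eq_iff indicator_def)
    have "(LINT x|M. g x * u m x) = (LINT x|M. g x * u n x)" using u(2)[OF gs, of n] u(2)[OF gs, of m] e by simp
    moreover have "(LINT x|M. g x * u m x - g x * u n x) = (LINT x|M. g x * u m x) - (LINT x|M. g x * u n x)"
     by (rule Bochner_Integration.integral_diff[OF Cauchy_Schwarz_integral(1)[OF gs u(1)] Cauchy_Schwarz_integral(1)[OF gs u(1)]])
    moreover have "(u m x - u n x) * g x = g x * u m x - g x * u n x" for x by (simp add: algebra_simps)
    ultimately show "cmod (LINT x|M. (u m x - u n x) * g x) \<le> 0 * (LINT x|M. cmod (g x))" by simp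
   qed (auto simp: BB_def)
   then show ?thesis by eventually_elim auto
  qed
  \<comment> \<open>The index of the first ball \<open>BB n\<close> containing the point. Gluing
    along this measurable index with countably many values gives a measurable function that agrees
    almost everywhere on \<open>BB n\<close> with \<open>u n\<close>.\<close>
  define \<kappa>' where "\<kappa>' x = nat \<lfloor>d z x\<rfloor>" for x
  have [measurable]: "\<kappa>' \<in> measurable M (count_space UNIV)" unfolding \<kappa>'_def by measurable
  define w where "w x = u (\<kappa>' x) x" for x
  have wm[measurable]: "w \<in> borel_measurable M" unfolding w_def
   by (rule measurable_compose_countable[where f="\<lambda>i x. u i x" and g=\<kappa>']) measurable
  have kB: "x \<in> BB n ==> \<kappa>' x \<le> n" "x \<in> BB (\<kappa>' x)" for x n
  proof -
   assume "x \<in> BB n"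
   then have "d z x < real (Suc n)" unfolding BB_def by simp
   then have "\<lfloor>d z x\<rfloor> \<le> int n" by linarith
   then show "\<kappa>' x \<le> n" unfolding \<kappa>'_def by linarith
  next
   have "d z x < of_int \<lfloor>d z x\<rfloor> + 1" by linarith
   also have "\<dots> = real (Suc (\<kappa>' x))" unfolding \<kappa>'_def by simp
   finally show "x \<in> BB (\<kappa>' x)" unfolding BB_def by simp
  qed
  have "AE x in M. \<forall>m. \<forall>n. n \<le> m \<longrightarrow> x \<in> BB n \<longrightarrow> u m x = u n x"
   unfolding AE_all_countable using cons by auto
  then have wu: "AE x in M. x \<in> BB n \<longrightarrow> w x = u n x" for n
  proof eventually_elim
   case (elim x)
   show ?case
   proof
    assume "x \<in> BB n"
    then show "w x = u n x" unfolding w_def using spec[OF spec[OF elim, of n], of "\<kappa>' x"] kB(1)[of x n] kB(2)[of x] by simp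
   qed
  qed
  have wL: "w \<in> L1_loc d M"
  proof (rule L1_locI)
   fix x r assume r: "(0::real) < r"
   obtain n :: nat where n: "\<kappa> * (d z x + r) \<le> real n" using real_arch_simple by blast
   have sub: "B x r \<subseteq> BB n" unfolding BB_def by (rule B_subset[of z x "d z x"]) (use n in auto)
   show "integrable M (\<lambda>y. indicator (B x r) y *\<^sub>R w y)"
    by (rule integrable_cong_AE_imp[OF L1_loc_integrable[OF square_int_L1_loc[OF u(1)[of n]], of x r]])
     (use wu[of n] sub in \<open>auto simp: indicator_def subset_iff\<close>)
  qed
  have wa: "(LINT y|M. w y * a y) = l a" if a: "a \<in> rho_atoms" for a
  proof -
   obtain x r where am[measurable]: "a \<in> borel_measurable M" and as: "\<And>y. y \<notin> B x r ==> a y = 0" using a unfolding rho_atoms_def by blast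
   obtain n :: nat where n: "\<kappa> * (d z x + r) \<le> real n" using real_arch_simple by blast
   have sub: "B x r \<subseteq> BB n" unfolding BB_def by (rule B_subset[of z x "d z x"]) (use n in auto)
   have e: "(\<lambda>y. indicator (BB n) y *\<^sub>R a y) = a" using as subsetD[OF sub] by (force simp: fun_eq_iff indicator_def)
   have "(LINT y|M. w y * a y) = (LINT y|M. a y * u n y)"
   proof (rule integral_cong_AE)
    show "AE y in M. w y * a y = a y * u n y" using wu[of n]
     by eventually_elim (use as sub in \<open>auto simp: subset_iff mult.commute\<close>)
   qed measurable
   also have "\<dots> = l a" using u(2)[OF test_square_int[OF rho_atom_test[OF a]], of n] e by simp
   finally show ?thesis .
  qed
  have bw: "bmo (C * D) w"
  proof (rule C(2)[OF wL D])
   fix a assume a: "a \<in> rho_atoms"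
   show "cmod (LINT y|M. w y * a y) \<le> D" unfolding wa[OF a] using bd[OF atomic_gauge_atom[OF L1_rho_atoms a]] by simp
  qed
  moreover have "Lp w h = l h" if h: "HA A h" for h A
  proof -
   obtain c a where *: "\<And>j. a j \<in> rho_atoms" "summable (\<lambda>j. cmod (c j))" "(\<Sum>j::nat. cmod (c j)) \<le> A"
    "AE x in M. (\<lambda>j. c j * a j x) sums h x" using h unfolding atomic_gauge_def by blast
   have gs: "HA (\<Sum>j<n. cmod (c j) * 1) (\<lambda>x. \<Sum>j<n. c j * a j x)" for n
    by (rule atomic_gauge_sum[OF L1_rho_atoms]) (simp, rule atomic_gauge_scale[OF atomic_gauge_atom[OF L1_rho_atoms *(1)]])
   have z0: "HA 0 (\<lambda>x. 0)" using L1_rho_atoms atomic_gauge_zero unfolding L1_atoms_def by blast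
   have l0: "l (\<lambda>x. 0) = 0" using bd[OF z0] by simp
   have ls: "l (\<lambda>x. \<Sum>j<n. c j * a j x) = (\<Sum>j<n. c j * l (a j))" for n
   proof (induction n)
    case (Suc n)
    show ?case using lin[OF gs[of n] atomic_gauge_atom[OF L1_rho_atoms *(1)[of n]], of "c n"] Suc by simp
   qed (use l0 in simp)
   have t: "HA (\<Sum>j. cmod (c (j + n))) (\<lambda>x. h x - (\<Sum>j<n. c j * a j x))" for n
    by (rule atomic_tail[OF *(1,2) atomic_gauge_measurable[OF h] L1_rho_atoms *(4)])
   \<comment> \<open>Agreement on atoms extends to \<open>h\<close> because the tail of a
     decomposition has gauge equal to the tail of its coefficients, on which \<open>l\<close> is
     bounded.\<close>
   have le: "cmod (l h - (\<Sum>j<n. c j * l (a j))) \<le> D * (\<Sum>j. cmod (c (j + n)))" for n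
    using bd[OF t[of n]] lin[OF h gs[of n], of "-1"] ls[of n] by simp
   have "(\<lambda>n. l h - (\<Sum>j<n. c j * l (a j))) \<longlonglongrightarrow> 0"
   proof (rule Lim_null_comparison[OF always_eventually[OF allI[OF le]]])
    show "(\<lambda>n. D * (\<Sum>j. cmod (c (j + n)))) \<longlonglongrightarrow> 0"
     using tendsto_mult[OF tendsto_const[of D] suminf_exist_split2[OF *(2)]] by simp
   qed
   then have "(\<lambda>n. l h - (l h - (\<Sum>j<n. c j * l (a j)))) \<longlonglongrightarrow> l h - 0" by (intro tendsto_diff tendsto_const)
   then have "(\<lambda>j. c j * l (a j)) sums l h" unfolding sums_def by simp
   moreover have "(\<lambda>j. c j * l (a j)) sums Lp w h"
    using Lp_sums[OF bw *(1,2) atomic_gauge_measurable[OF h] *(4)] wa[OF *(1)] by simp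
   ultimately show ?thesis using sums_unique2 by blast
  qed
  ultimately show "\<exists>u. bmo (C * D) u \<and> (\<forall>h A. HA A h \<longrightarrow> Lp u h = l h)" by blast
 qed
qed

end

subsection \<open>Calderon--Zygmund operators and their adjoints\<close>

lemma Lq_2: "Lq M 2 = {f. square_int M f}"
 using Lq_2_iff by blast

lemma bounded_op_L2:
 assumes "bounded_op M (Lq M 2) (Lq_norm M 2) T"
 obtains C where "0 \<le> C" "\<And>f. square_int M f ==> square_int M (T f)"
  "\<And>f. square_int M f ==> norm2 M (T f) \<le> C * norm2 M f"
  "\<And>f g c. square_int M f ==> square_int M g ==> AE x in M. T (\<lambda>y. f y + c * g y) x = T f x + c * T g x"
proof -
 have V: "\<And>f. square_int M f ==> square_int M (T f)"
  and lin: "\<And>f g c. square_int M f ==> square_int M g ==> AE x in M. T (\<lambda>y. f y + c * g y) x = T f x + c * T g x"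
  using assms unfolding bounded_op_def Lq_2 by auto
 obtain C where C: "0 \<le> C" "\<And>f. square_int M f ==> Lq_norm M 2 (T f) \<le> ennreal C * Lq_norm M 2 f"
  using assms unfolding bounded_op_def Lq_2 by blast
 have "norm2 M (T f) \<le> C * norm2 M f" if f: "square_int M f" for f
 proof -
  have "ennreal (norm2 M (T f)) \<le> ennreal (C * norm2 M f)"
   using C(2)[OF f] Lq_norm_2[OF f] Lq_norm_2[OF V[OF f]] C(1) by (simp add: ennreal_mult)
  then show ?thesis using C(1) by (simp add: ennreal_le_iff)
 qed
 then show ?thesis using that[OF C(1) V _ lin] by blast
qed

lemma square_int_zero_by_testing:
 assumes u: "square_int M u" and z: "\<And>f. square_int M f ==> (LINT x|M. f x * u x) = 0"
 shows "AE x in M. u x = 0"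
proof -
 have "(LINT x|M. cnj (u x) * u x) = 0" by (rule z[OF square_int_cnj[OF u]])
 moreover have "cnj (u x) * u x = of_real ((cmod (u x))\<^sup>2)" for x using complex_norm_square[of "u x"] by (simp add: mult.commute)
 ultimately have "(LINT x|M. (cmod (u x))\<^sup>2) = 0" by (simp only: integral_complex_of_real of_real_eq_0_iff)
 then have "AE x in M. (cmod (u x))\<^sup>2 = 0"
  by (subst (asm) integral_nonneg_eq_0_iff_AE) (use u in \<open>auto simp: square_int_def\<close>)
 then show ?thesis by eventually_elim simp
qed

text \<open>Riesz representation makes the choice behind \<open>adjoint_L2\<close> meaningful. The
  norm bound is part of \<open>R\<close>, so the chosen representatives carry it; they are chosen
  independently for each \<open>g\<close>, which is why linearity holds almost everywhere and is
  obtained by testing.\<close>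

lemma adjoint_L2_exists:
 assumes T: "bounded_op M (Lq M 2) (Lq_norm M 2) T"
 shows "bounded_op M (Lq M 2) (Lq_norm M 2) (adjoint_L2 M T)"
  and "square_int M f ==> square_int M g ==> (LINT x|M. T f x * g x) = (LINT x|M. f x * adjoint_L2 M T g x)"
proof -
 obtain C where C: "0 \<le> C" "\<And>f. square_int M f ==> square_int M (T f)"
  "\<And>f. square_int M f ==> norm2 M (T f) \<le> C * norm2 M f"
  "\<And>f g c. square_int M f ==> square_int M g ==> AE x in M. T (\<lambda>y. f y + c * g y) x = T f x + c * T g x"
  by (rule bounded_op_L2[OF T]) blast
 define R where "R g u \<longleftrightarrow> square_int M u \<and> norm2 M u \<le> C * norm2 M g \<and>
   (\<forall>f. square_int M f \<longrightarrow> (LINT x|M. T f x * g x) = (LINT x|M. f x * u x))" for g u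
 have ex: "\<exists>u. R g u"
  if g: "square_int M g" for g
 proof -
  obtain u where "square_int M u" "norm2 M u \<le> C * norm2 M g" "\<And>f. square_int M f ==> (LINT x|M. T f x * g x) = (LINT x|M. f x * u x)"
  proof (rule L2_Riesz[of M "\<lambda>f. \<integral>x. T f x * g x \<partial>M" "C * norm2 M g"])
   fix f h c assume f: "square_int M f" and h: "square_int M h"
   have s: "square_int M (T (\<lambda>y. f y + c * h y))" by (intro C(2) square_int_add f square_int_scale h)
   note [measurable] = square_int_measurable[OF s] square_int_measurable[OF C(2)[OF f]] square_int_measurable[OF C(2)[OF h]] square_int_measurable[OF g]
   have "(LINT x|M. T (\<lambda>y. f y + c * h y) x * g x) = (LINT x|M. T f x * g x + c * (T h x * g x))"
   proof (rule integral_cong_AE)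
    show "AE x in M. T (\<lambda>y. f y + c * h y) x * g x = T f x * g x + c * (T h x * g x)"
     using C(4)[OF f h, of c] by eventually_elim (simp add: algebra_simps)
   qed measurable
   also have "\<dots> = (LINT x|M. T f x * g x) + (LINT x|M. c * (T h x * g x))"
    by (rule Bochner_Integration.integral_add) (intro integrable_mult_right Cauchy_Schwarz_integral C(2) f g h)+
   finally show "(LINT x|M. T (\<lambda>y. f y + c * h y) x * g x) = (LINT x|M. T f x * g x) + c * (LINT x|M. T h x * g x)" by simp
  next
   fix f assume f: "square_int M f"
   have "cmod (LINT x|M. T f x * g x) \<le> norm2 M (T f) * norm2 M g" by (rule Cauchy_Schwarz_integral(3)[OF C(2)[OF f] g])
   also have "\<dots> \<le> (C * norm2 M f) * norm2 M g" by (intro mult_right_mono C(3) f) simp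
   finally show "cmod (LINT x|M. T f x * g x) \<le> C * norm2 M g * norm2 M f" by (simp add: ac_simps)
  qed (use C(1) in auto)
  then show ?thesis unfolding R_def by blast
 qed
 define U where "U g = (SOME u. R g u)" for g
 have U: "square_int M (U g) \<and> norm2 M (U g) \<le> C * norm2 M g \<and>
   (\<forall>f. square_int M f \<longrightarrow> (LINT x|M. T f x * g x) = (LINT x|M. f x * U g x))" if "square_int M g" for g
  proof -
  have "R g (U g)" unfolding U_def by (rule someI_ex[OF ex[OF that]])
  then show ?thesis unfolding R_def .
 qed
 have "bounded_op M (Lq M 2) (Lq_norm M 2) U"
  unfolding bounded_op_def Lq_2 Ball_def mem_Collect_eq
 proof (intro conjI allI impI exI[of _ C])
  fix g assume "square_int M g" then show "square_int M (U g)" using U by blast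
 next
  fix g h c assume g: "square_int M g" and h: "square_int M h"
  have gh: "square_int M (\<lambda>y. g y + c * h y)" by (intro square_int_add g square_int_scale h)
  have sd: "square_int M (\<lambda>x. U (\<lambda>y. g y + c * h y) x - (U g x + c * U h x))"
   using U g h gh by (intro square_int_diff square_int_add square_int_scale) auto
  have "AE x in M. U (\<lambda>y. g y + c * h y) x - (U g x + c * U h x) = 0"
  proof (rule square_int_zero_by_testing[OF sd])
   fix f assume f: "square_int M f"
   have i: "integrable M (\<lambda>x. f x * U k x)" "integrable M (\<lambda>x. T f x * k x)" if "square_int M k" for k
    proof -
    have Uk: "square_int M (U k)" using U[OF that] by blast
    show "integrable M (\<lambda>x. f x * U k x)" by (rule Cauchy_Schwarz_integral(1)[OF f Uk])
    show "integrable M (\<lambda>x. T f x * k x)" by (rule Cauchy_Schwarz_integral(1)[OF C(2)[OF f] that])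
   qed
   have "(LINT x|M. f x * (U (\<lambda>y. g y + c * h y) x - (U g x + c * U h x)))
    = (LINT x|M. f x * U (\<lambda>y. g y + c * h y) x - (f x * U g x + c * (f x * U h x)))" by (simp add: algebra_simps)
   also have "\<dots> = (LINT x|M. f x * U (\<lambda>y. g y + c * h y) x) - ((LINT x|M. f x * U g x) + c * (LINT x|M. f x * U h x))"
    using i(1)[OF gh] i(1)[OF g] i(1)[OF h] by simp
   also have "\<dots> = (LINT x|M. T f x * (g x + c * h x)) - ((LINT x|M. T f x * g x) + c * (LINT x|M. T f x * h x))"
    using U f g h gh by simp
   also have "(LINT x|M. T f x * (g x + c * h x)) = (LINT x|M. T f x * g x + c * (T f x * h x))" by (simp add: algebra_simps)
   also have "\<dots> = (LINT x|M. T f x * g x) + c * (LINT x|M. T f x * h x)" using i(2)[OF g] i(2)[OF h] by simp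
   finally show "(LINT x|M. f x * (U (\<lambda>y. g y + c * h y) x - (U g x + c * U h x))) = 0" by simp
  qed
  then show "AE x in M. U (\<lambda>y. g y + c * h y) x = U g x + c * U h x" by eventually_elim simp
 next
  fix g assume g: "square_int M g"
  have "ennreal (norm2 M (U g)) \<le> ennreal (C * norm2 M g)" using U[OF g] by (intro ennreal_leI) auto
  then show "Lq_norm M 2 (U g) \<le> ennreal C * Lq_norm M 2 g"
   using Lq_norm_2[OF g] Lq_norm_2[of M "U g"] U[OF g] C(1) by (simp add: ennreal_mult)
 qed (rule C(1))
 then have ex: "bounded_op M (Lq M 2) (Lq_norm M 2) U \<and>
    (\<forall>f\<in>Lq M 2. \<forall>g\<in>Lq M 2. (LINT x|M. T f x * g x) = (LINT x|M. f x * U g x))"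
  unfolding Lq_2 Ball_def mem_Collect_eq using U by blast
 from someI[of "\<lambda>T'. bounded_op M (Lq M 2) (Lq_norm M 2) T' \<and>
    (\<forall>f\<in>Lq M 2. \<forall>g\<in>Lq M 2. (LINT x|M. T f x * g x) = (LINT x|M. f x * T' g x))", OF ex]
 have A: "bounded_op M (Lq M 2) (Lq_norm M 2) (adjoint_L2 M T) \<and>
    (\<forall>f\<in>Lq M 2. \<forall>g\<in>Lq M 2. (LINT x|M. T f x * g x) = (LINT x|M. f x * adjoint_L2 M T g x))"
  unfolding adjoint_L2_def .
 then show "bounded_op M (Lq M 2) (Lq_norm M 2) (adjoint_L2 M T)" by blast
 show "square_int M f ==> square_int M g ==> (LINT x|M. T f x * g x) = (LINT x|M. f x * adjoint_L2 M T g x)"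
  using A unfolding Lq_2 Ball_def mem_Collect_eq by blast
qed

locale CZ_space = admissible_space d \<kappa> M \<rho>
 for d :: "'a => 'a => real" and \<kappa> :: real and M :: "'a measure" and \<rho> :: "'a => real" +
 fixes \<delta> :: real and T :: "('a => complex) => ('a => complex)"
 assumes delta: "0 < \<delta>" "\<delta> \<le> 1" and CZ: "CZ_operator d \<kappa> M \<rho> \<delta> T"
begin

abbreviation T' :: "('a => complex) => ('a => complex)" where "T' \<equiv> adjoint_L2 M T"

lemma T_bounded: "bounded_op M (Lq M 2) (Lq_norm M 2) T"
 using CZ unfolding CZ_operator_def by blast

lemmas T'_bounded = adjoint_L2_exists(1)[OF T_bounded]
lemmas T'_adjoint = adjoint_L2_exists(2)[OF T_bounded]

lemma T_square_int: "square_int M f ==> square_int M (T f)"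
 using T_bounded unfolding bounded_op_def Lq_2 by blast

lemma T'_square_int: "square_int M f ==> square_int M (T' f)"
 using T'_bounded unfolding bounded_op_def Lq_2 by blast

definition atom_on :: "'a => real => ('a => complex) => bool" where
 "atom_on x r a \<longleftrightarrow> a \<in> borel_measurable M \<and> 0 < r \<and> r < \<rho> x \<and> (\<forall>y. cmod (a y) \<le> 1 / mu x r) \<and>
   (\<forall>y. y \<notin> B x r \<longrightarrow> a y = 0) \<and> (r < \<rho> x / 4 \<longrightarrow> (LINT y|M. a y) = 0)"

lemma rho_atoms_atom_on: "a \<in> rho_atoms \<longleftrightarrow> (\<exists>x r. atom_on x r a)"
 unfolding rho_atoms_def atom_on_def by blast

lemma kernel_regular:
 assumes K: "CZ_kernel d \<kappa> M \<rho> \<delta> K"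
 obtains C where "0 < C" "\<And>x x' y. x \<noteq> y ==> d x x' \<le> 1 / (2 * \<kappa>) * d x y ==>
    cmod (K x y - K x' y) + cmod (K y x - K y x') \<le> (d x x' / d x y) powr \<delta> * (C / mu x (d x y))"
proof -
 have "\<exists>C>0. \<forall>x x' y. x \<noteq> y \<and> d x x' \<le> 1 / (2 * \<kappa>) * d x y \<longrightarrow>
    cmod (K x y - K x' y) + cmod (K y x - K y x')
     \<le> (d x x' / d x y) powr \<delta> * (C / measure M (qball d x (d x y)))"
  using K unfolding CZ_kernel_def by (rule conjunct2)
 then show ?thesis
 proof (elim exE conjE)
  fix C assume C: "0 < C" and *: "\<forall>x x' y. x \<noteq> y \<and> d x x' \<le> 1 / (2 * \<kappa>) * d x y \<longrightarrow>
    cmod (K x y - K x' y) + cmod (K y x - K y x')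
     \<le> (d x x' / d x y) powr \<delta> * (C / measure M (qball d x (d x y)))"
  show ?thesis
  proof (rule that[OF C])
   fix x x' y assume "x \<noteq> y" "d x x' \<le> 1 / (2 * \<kappa>) * d x y"
   then show "cmod (K x y - K x' y) + cmod (K y x - K y x') \<le> (d x x' / d x y) powr \<delta> * (C / mu x (d x y))"
    by (intro *[rule_format] conjI)
  qed
 qed
qed

lemma kernel_size:
 assumes K: "CZ_kernel d \<kappa> M \<rho> \<delta> K" and N: "0 < N"
 obtains C where "0 < C" "\<And>x y. x \<noteq> y ==> cmod (K x y) \<le> C / mu x (d x y) * (1 + d x y / \<rho> x) powr (- N)"
proof -
 have "\<forall>N>0. \<exists>C>0. \<forall>x y. x \<noteq> y \<longrightarrow>
    cmod (K x y) \<le> C / measure M (qball d x (d x y)) * (1 + d x y / \<rho> x) powr (- N)"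
  using K unfolding CZ_kernel_def by (rule conjunct1)
 from this[rule_format, OF N] show ?thesis
 proof (elim exE conjE)
  fix C assume C: "0 < C" and *: "\<forall>x y. x \<noteq> y \<longrightarrow>
    cmod (K x y) \<le> C / measure M (qball d x (d x y)) * (1 + d x y / \<rho> x) powr (- N)"
  show ?thesis by (rule that[OF C]) (rule *[rule_format])
 qed
qed

text \<open>Measurability of the kernel is not among the conditions of \<open>CZ_kernel\<close>, but
  the regularity estimate makes each section locally continuous off the diagonal.\<close>

lemma kernel_section_measurable:
 assumes K: "CZ_kernel d \<kappa> M \<rho> \<delta> K"
 shows "(\<lambda>z. indicator {z. z \<noteq> y} z *\<^sub>R K y z) \<in> borel_measurable M"
proof (rule measurable_if_locally_continuous)
 show "qopen d {z. z \<noteq> y}"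
  unfolding qopen_def
 proof
  fix z assume z: "z \<in> {z. z \<noteq> y}"
  then have "0 < d z y" using dist_pos_iff by blast
  moreover have "B z (d z y) \<subseteq> {z. z \<noteq> y}" by auto
  ultimately show "\<exists>r>0. B z r \<subseteq> {z. z \<noteq> y}" by blast
 qed
 obtain C where C: "0 < C" and reg: "\<And>x x' y. x \<noteq> y ==> d x x' \<le> 1 / (2 * \<kappa>) * d x y ==>
    cmod (K x y - K x' y) + cmod (K y x - K y x') \<le> (d x x' / d x y) powr \<delta> * (C / mu x (d x y))"
  by (rule kernel_regular[OF K]) blast
 fix z and e :: real assume z: "z \<in> {z. z \<noteq> y}" and e: "0 < e"
 have dz: "0 < d z y" using z dist_pos_iff by blast
 define m where "m = mu z (d z y)"
 have m: "0 < m" unfolding m_def by (rule mu_pos[OF dz])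
 \<comment> \<open>With relative displacement \<open>h\<close> the regularity bound equals half of
   \<open>e\<close>.\<close>
 define h where "h = (e * m / (2 * C)) powr (1 / \<delta>)"
 have h: "0 < h" unfolding h_def using e m C by simp
 define r where "r = min (1 / (2 * \<kappa>) * d z y) (h * d z y)"
 have r: "0 < r" unfolding r_def using dz kappa_pos h by simp
 have "cmod (K y z' - K y z) < e" if z': "z' \<in> B z r" for z'
 proof -
  have d1: "d z z' < r" using z' by simp
  have "cmod (K y z - K y z') \<le> (d z z' / d z y) powr \<delta> * (C / m)"
   using reg[of z y z'] z d1 norm_ge_zero[of "K z y - K z' y"] unfolding m_def r_def by (smt (verit) mem_Collect_eq)
  also have "\<dots> \<le> h powr \<delta> * (C / m)"
  proof (intro mult_right_mono powr_mono2)
   show "d z z' / d z y \<le> h" using d1 dz unfolding r_def by (simp add: divide_le_eq)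
  qed (use delta C m in auto)
  also have "\<dots> = e / 2" unfolding h_def using delta e m C by (simp add: powr_powr)
  finally show ?thesis using e by (simp add: norm_minus_commute)
 qed
 then show "\<exists>r>0. \<forall>z'\<in>B z r. cmod (K y z' - K y z) < e" using r by blast
qed

text \<open>The decay of \<open>T' a\<close> away from its ball in dual form: the kernel formula is
  available for \<open>T\<close>, so the test function sits on the annulus and \<open>T g\<close> is
  evaluated on the ball of \<open>a\<close>. An atom with mean zero uses the regularity of the
  kernel; one with radius comparable to \<open>\<rho> x0\<close> uses its decay beyond that
  scale.\<close>

lemma T_off_support:
 obtains C where "0 \<le> C"
  "\<And>x0 r a s g K0. atom_on x0 r a ==> 2 * \<kappa> * r \<le> s ==> g \<in> borel_measurable M ==> (\<And>y. cmod (g y) \<le> K0) ==>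
    (\<And>y. g y \<noteq> 0 ==> s \<le> d x0 y \<and> d x0 y < 2 * s) ==>
    cmod (LINT y|M. T g y * a y) \<le> C * (r / s) powr \<delta> / mu x0 s * (LINT y|M. cmod (g y))"
proof -
 obtain K where K: "CZ_kernel d \<kappa> M \<rho> \<delta> K" and rep: "\<And>f. f \<in> tests ==> AE x in M. x \<notin> ess_support d M f \<longrightarrow> T f x = (LINT y|M. K x y * f y)"
  using CZ unfolding CZ_operator_def by (elim conjE exE) blast
 \<comment> \<open>Decay of order \<open>\<delta>\<close> is requested so that both kinds of atoms
   end with the same factor \<open>(r / s) powr \<delta>\<close>.\<close>
 obtain C1 where C1: "0 < C1" and size: "\<And>x y. x \<noteq> y ==> cmod (K x y) \<le> C1 / mu x (d x y) * (1 + d x y / \<rho> x) powr (- \<delta>)"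
  by (rule kernel_size[OF K delta(1)]) blast
 obtain C2 where C2: "0 < C2" and reg: "\<And>x x' y. x \<noteq> y ==> d x x' \<le> 1 / (2 * \<kappa>) * d x y ==>
    cmod (K x y - K x' y) + cmod (K y x - K y x') \<le> (d x x' / d x y) powr \<delta> * (C2 / mu x (d x y))"
  by (rule kernel_regular[OF K]) blast
 obtain c where c: "1 \<le> c" "\<And>x y. d x y \<le> 1 * \<rho> y ==> \<rho> y \<le> c * \<rho> x \<and> \<rho> x \<le> c * \<rho> y" by (rule rho_comparable[of 1]) auto
 \<comment> \<open>The second entry serves atoms of radius at least \<open>\<rho> x0 / 4\<close>:
   there \<open>\<rho> y \<le> 4 * c * r\<close>, and the distance to the annulus is at least
   \<open>s / (2 * \<kappa>)\<close>, so their ratio is at least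
   \<open>s / (8 * \<kappa> * c * r)\<close>.\<close>
 define C where "C = max C2 (C1 * dbl \<Lambda> * (8 * \<kappa> * c))"
 have C0: "0 \<le> C" unfolding C_def using C2 by simp
 show ?thesis
 proof (rule that[OF C0])
  fix x0 r a s g and K0 :: real
  assume a: "atom_on x0 r a" and s: "2 * \<kappa> * r \<le> s" and g[measurable]: "g \<in> borel_measurable M" and gK: "\<And>y. cmod (g y) \<le> K0"
   and gs: "\<And>y. g y \<noteq> 0 ==> s \<le> d x0 y \<and> d x0 y < 2 * s"
  note a' = a[unfolded atom_on_def]
  have am[measurable]: "a \<in> borel_measurable M" using a' by blast
  have r: "0 < r" "r < \<rho> x0" using a' by auto
  have s0: "0 < s" using s r kappa_pos by (smt (verit) mult_pos_pos)
  have rs: "r \<le> s / (2 * \<kappa>)" using s kappa_pos by (simp add: field_simps)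
  have rs': "r \<le> s" using s r kappa_ge_1 mult_right_mono[of 1 "2 * \<kappa>" r] by linarith
  define m where "m = mu x0 s"
  have m: "0 < m" unfolding m_def by (rule mu_pos[OF s0])
  have g0: "g y = 0" if "y \<notin> B x0 (2 * s)" for y using gs[of y] that by auto
  have gt: "g \<in> tests" by (rule testI[OF g gK g0])
  have gi: "integrable M g" by (rule bounded_integrable(1)[OF g gK g0])
  have far: "s / (2 * \<kappa>) \<le> d y z" if y: "y \<in> B x0 r" and z: "g z \<noteq> 0" for y z
  proof -
   have "s \<le> d x0 z" using gs[OF z] by simp
   also have "\<dots> \<le> \<kappa> * (d x0 y + d y z)" by (rule quasi_triangle)
   also have "\<dots> \<le> \<kappa> * (s / (2 * \<kappa>) + d y z)" using y rs kappa_pos by (intro mult_left_mono) auto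
   also have "\<dots> = s / 2 + \<kappa> * d y z" using kappa_pos by (simp add: algebra_simps)
   finally show ?thesis using kappa_pos by (simp add: field_simps)
  qed
  have sk: "0 < s / (2 * \<kappa>)" using s0 kappa_pos by simp
  have Kb: "cmod (K y z) \<le> C1 * dbl \<Lambda> / m * (1 + d y z / \<rho> y) powr (- \<delta>)" if y: "y \<in> B x0 r" and z: "g z \<noteq> 0" for y z
  proof -
   have dyz: "s / (2 * \<kappa>) \<le> d y z" by (rule far[OF y z])
   then have dp: "0 < d y z" using sk by linarith
   then have yz: "y \<noteq> z" using dist_pos_iff by blast
   have "m \<le> dbl \<Lambda> * mu y (d y z)"
    unfolding m_def
   proof (rule mu_compare[OF _ _ Lambda_ge(3) dp])
    show "d y x0 \<le> s" using y rs' by (simp add: dist_sym)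
    have "\<kappa> * (s + s) = \<Lambda> * (s / (2 * \<kappa>))" unfolding \<Lambda>_def using kappa_pos by (simp add: power2_eq_square)
    also have "\<dots> \<le> \<Lambda> * d y z" using dyz Lambda_ge by (intro mult_left_mono) auto
    finally show "\<kappa> * (s + s) \<le> \<Lambda> * d y z" .
   qed
   then have "1 / mu y (d y z) \<le> dbl \<Lambda> / m" using m mu_pos[OF dp, of y] by (simp add: field_simps)
   then have "C1 * (1 / mu y (d y z)) \<le> C1 * (dbl \<Lambda> / m)" using C1 by (intro mult_left_mono) auto
   then have le: "C1 / mu y (d y z) \<le> C1 * dbl \<Lambda> / m" by simp
   have "cmod (K y z) \<le> C1 / mu y (d y z) * (1 + d y z / \<rho> y) powr (- \<delta>)" by (rule size[OF yz])
   also have "\<dots> \<le> C1 * dbl \<Lambda> / m * (1 + d y z / \<rho> y) powr (- \<delta>)" using le by (rule mult_right_mono) simp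
   finally show ?thesis .
  qed
  have Kb1: "cmod (K y z) \<le> C1 * dbl \<Lambda> / m" if y: "y \<in> B x0 r" and z: "g z \<noteq> 0" for y z
  proof -
   have "(1 + d y z / \<rho> y) powr (- \<delta>) \<le> 1 powr (- \<delta>)" by (rule powr_mono2') (use delta rho_pos[of y] in \<open>auto intro: divide_nonneg_pos\<close>)
   then have "C1 * dbl \<Lambda> / m * (1 + d y z / \<rho> y) powr (- \<delta>) \<le> C1 * dbl \<Lambda> / m * 1"
    using C1 dbl_pos[of \<Lambda>] m by (intro mult_left_mono) auto
   then show ?thesis using Kb[OF y z] by linarith
  qed
  have Kgm: "(\<lambda>z. K y z * g z) \<in> borel_measurable M" if y: "y \<in> B x0 r" for y
  proof -
   have "K y z * g z = (indicator {z. z \<noteq> y} z *\<^sub>R K y z) * g z" for z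
    using far[OF y, of z] sk by (cases "g z = 0") (auto simp: indicator_def)
   then have "(\<lambda>z. K y z * g z) = (\<lambda>z. (indicator {z. z \<noteq> y} z *\<^sub>R K y z) * g z)" by (rule ext)
   then show ?thesis using borel_measurable_times[OF kernel_section_measurable[OF K] g] by (simp only:)
  qed
  have Kgi: "integrable M (\<lambda>z. K y z * g z)" if y: "y \<in> B x0 r" for y
  proof (rule Bochner_Integration.integrable_bound[OF _ Kgm[OF y]])
   show "integrable M (\<lambda>z. of_real (C1 * dbl \<Lambda> / m) * g z)" using gi by simp
   show "AE z in M. norm (K y z * g z) \<le> norm (of_real (C1 * dbl \<Lambda> / m) * g z)"
   proof (rule AE_I2)
    fix z show "norm (K y z * g z) \<le> norm (of_real (C1 * dbl \<Lambda> / m) * g z)"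
     proof (cases "g z = 0")
     case False
     have "cmod (of_real (C1 * dbl \<Lambda> / m) :: complex) = C1 * dbl \<Lambda> / m"
      using C1 dbl_pos[of \<Lambda>] m by (simp only: norm_of_real abs_of_pos mult_pos_pos divide_pos_pos)
     then show ?thesis unfolding norm_mult using Kb1[OF y False] by (simp only: mult_right_mono norm_ge_zero)
    qed simp
   qed
  qed
  define E where "E = C * (r / s) powr \<delta> / m * (LINT y|M. cmod (g y))"
  \<comment> \<open>Balls are open, so a point of \<open>B x0 r\<close> has a neighbourhood where
    \<open>g\<close> vanishes and lies outside the support of \<open>g\<close>; the kernel formula
    then holds.\<close>
  have rep': "AE y in M. y \<in> B x0 r \<longrightarrow> T g y = (LINT z|M. K y z * g z)"
   using rep[OF gt]
  proof eventually_elim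
   case (elim y)
   show ?case
   proof
    assume y: "y \<in> B x0 r"
    then have "y \<in> B x0 s" using rs' by auto
    then obtain t where t: "0 < t" "B y t \<subseteq> B x0 s" using qopen_ball[of x0 s] unfolding qopen_def by blast
    have "g w = 0" if "w \<in> B y t" for w using subsetD[OF t(2) that] gs[of w] by auto
    then have "AE w in M. w \<in> B y t \<longrightarrow> g w = 0" by simp
    then have "y \<notin> ess_support d M g" unfolding ess_support_def using t(1) by blast
    then show "T g y = (LINT z|M. K y z * g z)" using elim by blast
   qed
  qed
  \<comment> \<open>Both cases in one statement: a constant that the atom does not see, either
    because it is 0 or because the atom has mean zero, and from which \<open>T g\<close> differs by
    at most \<open>E\<close> on the ball.\<close>
  have "\<exists>k. (k = 0 \<or> (LINT y|M. a y) = 0) \<and> (\<forall>y\<in>B x0 r. cmod ((LINT z|M. K y z * g z) - k) \<le> E)"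
  proof (cases "r < \<rho> x0 / 4")
   case True
   define k where "k = (LINT z|M. K x0 z * g z)"
   have x0: "x0 \<in> B x0 r" using r by simp
   have "cmod ((LINT z|M. K y z * g z) - k) \<le> E" if y: "y \<in> B x0 r" for y
   proof -
    define i where "i = (r / s) powr \<delta> * (C2 / m)"
    have le: "cmod (K y z * g z - K x0 z * g z) \<le> i * cmod (g z)" for z
    proof (cases "g z = 0")
     case False
     have sz: "s \<le> d x0 z" using gs[OF False] by simp
     have xz: "x0 \<noteq> z" using sz s0 by auto
     have "d x0 y \<le> 1 / (2 * \<kappa>) * s" using y rs by simp
     also have "\<dots> \<le> 1 / (2 * \<kappa>) * d x0 z" using sz kappa_pos by (intro mult_left_mono) auto
     finally have "cmod (K x0 z - K y z) \<le> (d x0 y / d x0 z) powr \<delta> * (C2 / mu x0 (d x0 z))"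
      using reg[OF xz, of y] norm_ge_zero[of "K z x0 - K z y"] by linarith
     also have "\<dots> \<le> i" unfolding i_def
     proof (intro mult_mono powr_mono2)
      show "d x0 y / d x0 z \<le> r / s" using y sz s0 r by (intro frac_le) auto
      show "C2 / mu x0 (d x0 z) \<le> C2 / m"
       using mu_mono[OF sz, of x0] m C2 unfolding m_def by (intro divide_left_mono) auto
     qed (use delta C2 in auto)
     finally have "cmod (K y z - K x0 z) \<le> i" by (simp add: norm_minus_commute)
     then have "cmod (K y z - K x0 z) * cmod (g z) \<le> i * cmod (g z)" by (rule mult_right_mono) simp
     then show ?thesis by (simp add: left_diff_distrib[symmetric] norm_mult)
    qed simp
    have "(LINT z|M. K y z * g z) - k = (LINT z|M. K y z * g z - K x0 z * g z)"
     unfolding k_def by (rule Bochner_Integration.integral_diff[symmetric, OF Kgi[OF y] Kgi[OF x0]])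
    also have "cmod \<dots> \<le> (LINT z|M. cmod (K y z * g z - K x0 z * g z))" by (rule integral_norm_bound)
    also have "\<dots> \<le> (LINT z|M. i * cmod (g z))"
     by (rule integral_mono) (use Kgi[OF y] Kgi[OF x0] gi le in auto)
    also have "\<dots> = i * (LINT z|M. cmod (g z))" by simp
    also have "\<dots> \<le> (C * (r / s) powr \<delta> / m) * (LINT z|M. cmod (g z))"
    proof (rule mult_right_mono)
     have "C2 * ((r / s) powr \<delta> / m) \<le> C * ((r / s) powr \<delta> / m)" unfolding C_def using m by (intro mult_right_mono) auto
     then show "i \<le> C * (r / s) powr \<delta> / m" unfolding i_def by (simp add: ac_simps)
    qed simp
    finally show ?thesis unfolding E_def .
   qed
   then show ?thesis using True a' by blast
  next
   case False
   have "cmod ((LINT z|M. K y z * g z) - 0) \<le> E" if y: "y \<in> B x0 r" for y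
   proof -
    define i where "i = C1 * dbl \<Lambda> / m * ((8 * \<kappa> * c) * (r / s) powr \<delta>)"
    have "d y x0 \<le> 1 * \<rho> x0" using y r by (simp add: dist_sym)
    from c(2)[OF this] have "\<rho> y \<le> c * \<rho> x0" by blast
    also have "\<dots> \<le> c * (4 * r)" using False c(1) by (intro mult_left_mono) auto
    finally have ry: "\<rho> y \<le> 4 * c * r" by simp
    have le: "cmod (K y z * g z) \<le> i * cmod (g z)" for z
    proof (cases "g z = 0")
     case False
     have dyz: "s / (2 * \<kappa>) \<le> d y z" by (rule far[OF y False])
     have "s / (8 * \<kappa> * c * r) = (s / (2 * \<kappa>)) / (4 * c * r)" by simp
     also have "\<dots> \<le> d y z / \<rho> y" using dyz ry sk rho_pos[of y] r c(1) by (intro frac_le) auto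
     finally have low: "s / (8 * \<kappa> * c * r) \<le> 1 + d y z / \<rho> y" by linarith
     have kc: "1 \<le> 8 * \<kappa> * c" "0 < 8 * \<kappa> * c"
     proof -
      have "1 * 1 \<le> \<kappa> * c" using kappa_ge_1 c(1) by (intro mult_mono) auto
      then show "1 \<le> 8 * \<kappa> * c" "0 < 8 * \<kappa> * c" by auto
     qed
     have "(1 + d y z / \<rho> y) powr (- \<delta>) \<le> (s / (8 * \<kappa> * c * r)) powr (- \<delta>)"
      using low s0 r kc delta by (intro powr_mono2') auto
     also have "\<dots> = ((8 * \<kappa> * c) * (r / s)) powr \<delta>"
      using s0 r kc by (simp add: powr_minus_divide powr_divide powr_mult)
     also have "\<dots> = (8 * \<kappa> * c) powr \<delta> * (r / s) powr \<delta>" using kc r s0 by (intro powr_mult)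
     also have "\<dots> \<le> (8 * \<kappa> * c) * (r / s) powr \<delta>"
     proof (rule mult_right_mono)
      show "(8 * \<kappa> * c) powr \<delta> \<le> 8 * \<kappa> * c" using powr_mono[of \<delta> 1 "8 * \<kappa> * c"] delta kc by simp
     qed simp
     finally have "C1 * dbl \<Lambda> / m * (1 + d y z / \<rho> y) powr (- \<delta>) \<le> i"
      unfolding i_def using C1 dbl_pos[of \<Lambda>] m by (intro mult_left_mono) auto
     then have "cmod (K y z) \<le> i" using Kb[OF y False] by linarith
     then show ?thesis unfolding norm_mult by (rule mult_right_mono) simp
    qed simp
    have "cmod (LINT z|M. K y z * g z) \<le> (LINT z|M. cmod (K y z * g z))" by (rule integral_norm_bound)
    also have "\<dots> \<le> (LINT z|M. i * cmod (g z))"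
     by (rule integral_mono) (use Kgi[OF y] gi le in auto)
    also have "\<dots> = i * (LINT z|M. cmod (g z))" by simp
    also have "\<dots> \<le> (C * (r / s) powr \<delta> / m) * (LINT z|M. cmod (g z))"
    proof (rule mult_right_mono)
     have "(C1 * dbl \<Lambda> * (8 * \<kappa> * c)) * ((r / s) powr \<delta> / m) \<le> C * ((r / s) powr \<delta> / m)" unfolding C_def using m by (intro mult_right_mono) auto
     then show "i \<le> C * (r / s) powr \<delta> / m" unfolding i_def by (simp add: ac_simps)
    qed simp
    finally show ?thesis unfolding E_def by simp
   qed
   then show ?thesis by blast
  qed
  then obtain k where k: "k = 0 \<or> (LINT y|M. a y) = 0" "\<And>y. y \<in> B x0 r ==> cmod ((LINT z|M. K y z * g z) - k) \<le> E" by blast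
  have "x0 \<in> B x0 r" using r by simp
  from order_trans[OF norm_ge_zero k(2)[OF this]] have E0: "0 \<le> E" .
  note asq = a'[THEN conjunct1]
  have ab: "\<And>y. cmod (a y) \<le> 1 / mu x0 r" and as: "\<And>y. y \<notin> B x0 r ==> a y = 0" using a' by auto
  have ai: "integrable M a" "(LINT y|M. cmod (a y)) \<le> 1"
   using bounded_integrable[of a "1 / mu x0 r" x0 r, OF am ab as] mu_pos[OF r(1), of x0] by auto
  have Tg: "T g \<in> L1_loc d M" by (rule square_int_L1_loc[OF T_square_int[OF test_square_int[OF gt]]])
  note [measurable] = L1_loc_measurable[OF Tg]
  have Ti: "integrable M (\<lambda>y. T g y * a y)" by (rule L1_loc_pairing(1)[OF Tg am ab as])
  have "(LINT y|M. T g y * a y) = (LINT y|M. (T g y - k) * a y)"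
   unfolding left_diff_distrib using Bochner_Integration.integral_diff[OF Ti integrable_mult_right[OF ai(1), of k]] k(1) by auto
  also have "cmod \<dots> \<le> (LINT y|M. cmod ((T g y - k) * a y))" by (rule integral_norm_bound)
  also have "\<dots> \<le> (LINT y|M. E * cmod (a y))"
  proof (rule integral_mono_AE)
   have "integrable M (\<lambda>y. (T g y - k) * a y)" unfolding left_diff_distrib using Ti ai(1) by auto
   then show "integrable M (\<lambda>y. cmod ((T g y - k) * a y))" by (rule integrable_norm)
   show "AE y in M. cmod ((T g y - k) * a y) \<le> E * cmod (a y)"
    using rep'
   proof eventually_elim
    case (elim y)
    show ?case
    proof (cases "y \<in> B x0 r")
     case True
     then have "cmod (T g y - k) \<le> E" using elim k(2) by simp
     then show ?thesis unfolding norm_mult by (rule mult_right_mono) simp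
    qed (use as in simp)
   qed
  qed (use ai in auto)
  also have "\<dots> = E * (LINT y|M. cmod (a y))" by simp
  also have "\<dots> \<le> E * 1" using ai(2) E0 by (rule mult_left_mono)
  finally show "cmod (LINT y|M. T g y * a y) \<le> C * (r / s) powr \<delta> / mu x0 s * (LINT y|M. cmod (g y))"
   unfolding E_def m_def by simp
 qed
qed

end

section \<open>Annular estimates for the adjoint on atoms\<close>

context CZ_space
begin

text \<open>The first radius is \<open>2 * \<kappa> * r\<close>, the smallest for which
  \<open>T_off_support\<close> applies outside the ball.\<close>

definition rad :: "real => nat => real" where "rad r k = 2 ^ k * (2 * \<kappa> * r)"

definition ann :: "'a => real => nat => 'a set" where
 "ann x r k = (case k of 0 => B x (rad r 0) | Suc j => B x (rad r (Suc j)) - B x (rad r j))"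

lemma ann_simps: "ann x r 0 = B x (rad r 0)" "ann x r (Suc j) = B x (rad r (Suc j)) - B x (rad r j)"
 by (simp_all add: ann_def)

lemma ann_sets [measurable]: "ann x r k \<in> sets M"
 by (cases k) (auto simp: ann_simps)

lemma rad_pos: "0 < r ==> 0 < rad r k"
 unfolding rad_def using kappa_pos by simp

lemma rad_Suc: "rad r (Suc k) = 2 * rad r k"
 unfolding rad_def by simp

lemma rad_mono: "0 < r ==> j \<le> k ==> rad r j \<le> rad r k"
 unfolding rad_def using kappa_pos by (intro mult_right_mono power_increasing) auto

lemma rad_ge: "0 < r ==> r \<le> rad r k"
proof -
 assume r: "0 < r"
 have "1 * r \<le> 2 * \<kappa> * r" using kappa_ge_1 r by (intro mult_right_mono) auto
 then have "r \<le> rad r 0" unfolding rad_def by simp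
 then show ?thesis using rad_mono[OF r, of 0 k] by simp
qed

lemma ann_sub: "ann x r k \<subseteq> B x (rad r k)"
 by (cases k) (auto simp: ann_simps)

lemma ann_disjoint: assumes r: "0 < r" shows "disjoint_family (ann x r)"
proof -
 have "ann x r j \<inter> ann x r k = {}" if jk: "j < k" for j k
 proof -
  obtain i where i: "k = Suc i" using jk gr0_implies_Suc[of k] by auto
  have "rad r j \<le> rad r i" using jk i by (intro rad_mono r) auto
  then show ?thesis using ann_sub[of x r j] unfolding i ann_simps by auto
 qed
 then have "ann x r j \<inter> ann x r k = {}" if "j \<noteq> k" for j k using that by (cases "j < k") (auto simp: Int_commute not_less le_less)
 then show ?thesis unfolding disjoint_family_on_def by blast
qed

lemma ann_cover: assumes r: "0 < r" shows "\<exists>k. y \<in> ann x r k"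
proof -
 have ex: "\<exists>k. d x y < rad r k"
 proof -
  have "0 < 2 * \<kappa> * r" using r kappa_pos by simp
  then obtain k :: nat where "d x y / (2 * \<kappa> * r) < 2 ^ k" using real_arch_pow[of 2] by auto
  then show ?thesis unfolding rad_def using r kappa_pos by (intro exI[of _ k]) (simp add: divide_less_eq)
 qed
 define k where "k = (LEAST k. d x y < rad r k)"
 have k: "d x y < rad r k" unfolding k_def using ex by (rule LeastI_ex)
 have "y \<in> ann x r k"
 proof (cases k)
  case 0
  then show ?thesis using k by (simp add: ann_simps)
 next
  case (Suc j)
  then have "\<not> d x y < rad r j" using not_less_Least[of j "\<lambda>k. d x y < rad r k"] unfolding k_def by simp
  then show ?thesis using k unfolding Suc by (simp add: ann_simps)
 qed
 then show ?thesis by blast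
qed

lemma ann_sums:
 fixes F :: "'a => complex"
 assumes r: "0 < r" shows "(\<lambda>k. indicator (ann x r k) y *\<^sub>R F y) sums F y"
proof -
 obtain k where "y \<in> ann x r k" using ann_cover[OF r] by blast
 from disjoint_sums(1)[OF ann_disjoint[OF r] this, of "\<lambda>_. F y"] show ?thesis .
qed

text \<open>The factor by which \<open>T' a\<close> shrinks from one annulus to the next.\<close>

definition qd :: real where "qd = 2 powr (- \<delta>)"

lemma qd: "0 < qd" "qd < 1" "1 / 2 \<le> qd"
proof -
 show "0 < qd" unfolding qd_def by simp
 show "qd < 1" unfolding qd_def using delta powr_less_mono[of "- \<delta>" 0 2] by simp
 have "2 powr (-1) \<le> (2::real) powr (- \<delta>)" using delta by (intro powr_mono) auto
 then show "1 / 2 \<le> qd" unfolding qd_def by (simp add: powr_minus_divide)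
qed

lemma atom_on_L2:
 assumes a: "atom_on x r a"
 shows "square_int M a" "norm2 M a \<le> 1 / sqrt (mu x r)" "a \<in> rho_atoms" "a \<in> tests"
proof -
 have am: "a \<in> borel_measurable M" and r: "0 < r" and ab: "\<And>y. cmod (a y) \<le> 1 / mu x r" and as: "\<And>y. y \<notin> B x r ==> a y = 0"
  using a unfolding atom_on_def by auto
 show ar: "a \<in> rho_atoms" using a rho_atoms_atom_on by blast
 show at: "a \<in> tests" by (rule rho_atom_test[OF ar])
 show s: "square_int M a" by (rule test_square_int[OF at])
 have m: "0 < mu x r" by (rule mu_pos[OF r])
 have "(LINT y|M. (cmod (a y))\<^sup>2) \<le> (LINT y|M. (1 / mu x r)\<^sup>2 * indicat_real (B x r) y)"
 proof (rule integral_mono)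
  show "integrable M (\<lambda>y. (cmod (a y))\<^sup>2)" using s unfolding square_int_def by blast
  show "(cmod (a y))\<^sup>2 \<le> (1 / mu x r)\<^sup>2 * indicat_real (B x r) y" for y
  proof (cases "y \<in> B x r")
   case True
   have "(cmod (a y))\<^sup>2 \<le> (1 / mu x r)\<^sup>2" using ab by (intro power_mono) auto
   then show ?thesis using True by simp
  qed (use as in simp)
 qed (simp add: less_top[symmetric])
 also have "\<dots> = 1 / mu x r" using m by (simp add: power2_eq_square)
 finally show "norm2 M a \<le> 1 / sqrt (mu x r)" using real_sqrt_le_mono[of _ "1 / mu x r"] by (simp add: real_sqrt_divide)
qed

text \<open>On the central ball this is boundedness on square integrable functions and doubling; on
  the other annuli the dual estimate \<open>T_off_support\<close> yields a pointwise bound.\<close>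

lemma adjoint_pieces:
 obtains C where "1 \<le> C"
  "\<And>x r a k. atom_on x r a ==> integrable M (\<lambda>y. indicator (ann x r k) y * (cmod (T' a y))\<^sup>2) \<and>
    (LINT y|M. indicator (ann x r k) y * (cmod (T' a y))\<^sup>2) \<le> (C * qd ^ k)\<^sup>2 / mu x (rad r k)"
proof -
 obtain CT where CT: "0 \<le> CT" "\<And>f. square_int M f ==> norm2 M (T' f) \<le> CT * norm2 M f"
  by (rule bounded_op_L2[OF T'_bounded]) blast
 obtain C where C: "0 \<le> C"
  "\<And>x0 r a s g K0. atom_on x0 r a ==> 2 * \<kappa> * r \<le> s ==> g \<in> borel_measurable M ==> (\<And>y. cmod (g y) \<le> K0) ==>
    (\<And>y. g y \<noteq> 0 ==> s \<le> d x0 y \<and> d x0 y < 2 * s) ==>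
    cmod (LINT y|M. T g y * a y) \<le> C * (r / s) powr \<delta> / mu x0 s * (LINT y|M. cmod (g y))"
  by (rule T_off_support) blast
 define K where "K = max 1 (max (2 * C * Cd) (CT * sqrt (dbl (2 * \<kappa>))))"
 show ?thesis
 proof (rule that[of K])
  show "1 \<le> K" unfolding K_def by simp
  fix x r a k assume a: "atom_on x r a"
  have r: "0 < r" using a unfolding atom_on_def by blast
  have m: "0 < mu x (rad r k)" by (rule mu_pos[OF rad_pos[OF r]])
  have F: "square_int M (T' a)" by (rule T'_square_int[OF atom_on_L2(1)[OF a]])
  note [measurable] = square_int_measurable[OF F]
  have F2: "integrable M (\<lambda>y. (cmod (T' a y))\<^sup>2)" using F unfolding square_int_def by blast
  have i: "integrable M (\<lambda>y. indicator (ann x r k) y * (cmod (T' a y))\<^sup>2)"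
   using integrable_mult_indicator[OF ann_sets F2] by simp
  have "(LINT y|M. indicator (ann x r k) y * (cmod (T' a y))\<^sup>2) \<le> (K * qd ^ k)\<^sup>2 / mu x (rad r k)"
  proof (cases k)
   case 0
   have "(LINT y|M. indicator (ann x r k) y * (cmod (T' a y))\<^sup>2) \<le> (LINT y|M. (cmod (T' a y))\<^sup>2)"
    by (rule integral_mono[OF i F2]) (auto simp: indicator_def)
   also have "\<dots> = (norm2 M (T' a))\<^sup>2" by simp
   also have "\<dots> \<le> (CT * (1 / sqrt (mu x r)))\<^sup>2"
   proof (rule power_mono)
    show "norm2 M (T' a) \<le> CT * (1 / sqrt (mu x r))"
     using CT(2)[OF atom_on_L2(1)[OF a]] mult_left_mono[OF atom_on_L2(2)[OF a] CT(1)] by linarith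
   qed simp
   also have "\<dots> = CT\<^sup>2 / mu x r" by (simp add: power_divide)
   also have "\<dots> \<le> CT\<^sup>2 * (dbl (2 * \<kappa>) / mu x (rad r 0))"
   proof -
    have "mu x (rad r 0) \<le> dbl (2 * \<kappa>) * mu x r" unfolding rad_def using mu_scale[of "2 * \<kappa>" r x] kappa_ge_1 r by simp
    then have "1 / mu x r \<le> dbl (2 * \<kappa>) / mu x (rad r 0)"
     using mu_pos[OF r, of x] mu_pos[OF rad_pos[OF r], of x 0] by (simp add: field_simps)
    from mult_left_mono[OF this, of "CT\<^sup>2"] show ?thesis by simp
   qed
   also have "\<dots> = (CT * sqrt (dbl (2 * \<kappa>)))\<^sup>2 / mu x (rad r 0)" using dbl_pos[of "2 * \<kappa>"] by (simp add: power_mult_distrib)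
   also have "\<dots> \<le> K\<^sup>2 / mu x (rad r 0)"
   proof (intro divide_right_mono power_mono)
    show "CT * sqrt (dbl (2 * \<kappa>)) \<le> K" unfolding K_def by simp
    show "0 \<le> CT * sqrt (dbl (2 * \<kappa>))" using CT(1) dbl_pos[of "2 * \<kappa>"] by simp
   qed simp
   finally show ?thesis using 0 by simp
  next
   case (Suc j)
   define s where "s = rad r j"
   have s: "0 < s" "rad r k = 2 * s" unfolding s_def Suc rad_Suc using rad_pos[OF r] by auto
   have sr: "2 * \<kappa> * r \<le> s" using rad_mono[OF r, of 0 j] unfolding s_def rad_def by simp
   have ms: "0 < mu x s" by (rule mu_pos[OF s(1)])
   have annk: "ann x r k = B x (2 * s) - B x s" unfolding Suc ann_simps rad_Suc s_def ..
   have rq: "(r / s) powr \<delta> \<le> qd ^ j"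
   proof -
    have "r / s = 1 / (2 ^ j * (2 * \<kappa>))" unfolding s_def rad_def using r by simp
    also have "\<dots> \<le> 1 / (2 ^ j * 1)" using kappa_ge_1 by (intro divide_left_mono mult_left_mono) auto
    finally have "(r / s) powr \<delta> \<le> (1 / 2 ^ j) powr \<delta>" using r s delta by (intro powr_mono2) auto
    also have "(1 / 2 ^ j) powr \<delta> = (2::real) powr (- (real j * \<delta>))"
     by (simp add: powr_divide powr_minus_divide powr_realpow[symmetric] powr_powr)
    also have "\<dots> = qd ^ j" unfolding qd_def by (simp add: powr_realpow[symmetric] powr_powr mult.commute)
    finally show ?thesis .
   qed
   define c where "c = C * qd ^ j / mu x s"
   have c0: "0 \<le> c" unfolding c_def using C(1) qd(1) by simp
   \<comment> \<open>The adjoint is known only through its pairings, so its size is read off by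
     testing with functions living on the annulus.\<close>
   have "AE y in M. y \<in> ann x r k \<longrightarrow> cmod (T' a y) \<le> c"
   proof (rule AE_bound_by_testing)
    show "emeasure M (ann x r k) < \<infinity>"
     using order_le_less_trans[OF emeasure_mono[OF ann_sub B_sets] emeasure_B_finite(1)] by auto
    show "set_integrable M (ann x r k) (T' a)"
    proof -
     have "integrable M (\<lambda>y. indicator (ann x r k) y *\<^sub>R (indicator (B x (rad r k)) y *\<^sub>R T' a y))"
      by (rule integrable_mult_indicator[OF ann_sets L1_loc_integrable[OF square_int_L1_loc[OF F]]])
     moreover have "indicator (ann x r k) y *\<^sub>R (indicator (B x (rad r k)) y *\<^sub>R T' a y) = indicator (ann x r k) y *\<^sub>R T' a y" for y
      using ann_sub[of x r k] by (auto simp: indicator_def)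
     ultimately show ?thesis unfolding set_integrable_def by (simp only:)
    qed
    fix g :: "'a => complex" assume g: "g \<in> borel_measurable M" "\<And>y. cmod (g y) \<le> indicator (ann x r k) y"
    have g1: "cmod (g y) \<le> 1" for y using order_trans[OF g(2)[of y], of 1] by (simp add: indicator_def)
    have gz: "y \<in> ann x r k" if "g y \<noteq> 0" for y using g(2)[of y] that by (cases "y \<in> ann x r k") auto
    have gs: "s \<le> d x y \<and> d x y < 2 * s" if "g y \<noteq> 0" for y using gz[OF that] unfolding annk by auto
    have gt: "g \<in> tests" by (rule testI[OF g(1) g1, of x "rad r k"]) (use gz ann_sub[of x r k] in blast)
    have "(LINT y|M. T' a y * g y) = (LINT y|M. T g y * a y)"
     using T'_adjoint[OF test_square_int[OF gt] atom_on_L2(1)[OF a]] by (simp add: mult.commute)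
    then have "cmod (LINT y|M. T' a y * g y) \<le> C * (r / s) powr \<delta> / mu x s * (LINT y|M. cmod (g y))"
     using C(2)[OF a sr g(1) g1 gs] by simp
    also have "\<dots> \<le> c * (LINT y|M. cmod (g y))"
     unfolding c_def using rq C(1) ms by (intro mult_right_mono divide_right_mono mult_left_mono) auto
    finally show "cmod (LINT y|M. T' a y * g y) \<le> c * (LINT y|M. cmod (g y))" .
   qed auto
   then have "(LINT y|M. indicator (ann x r k) y * (cmod (T' a y))\<^sup>2) \<le> (LINT y|M. c\<^sup>2 * indicat_real (B x (2 * s)) y)"
   proof (intro integral_mono_AE i)
    assume "AE y in M. y \<in> ann x r k \<longrightarrow> cmod (T' a y) \<le> c"
    then show "AE y in M. indicator (ann x r k) y * (cmod (T' a y))\<^sup>2 \<le> c\<^sup>2 * indicat_real (B x (2 * s)) y"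
    proof eventually_elim
     case (elim y)
     show ?case
     proof (cases "y \<in> ann x r k")
      case True
      have "(cmod (T' a y))\<^sup>2 \<le> c\<^sup>2" using elim True by (intro power_mono) auto
      then show ?thesis using True annk by auto
     qed simp
    qed
   qed (simp add: less_top[symmetric])
   also have "\<dots> = c\<^sup>2 * mu x (2 * s)" by simp
   also have "\<dots> \<le> (K * qd ^ k)\<^sup>2 / mu x (2 * s)"
   proof -
    have m2: "0 < mu x (2 * s)" using s mu_pos[of "2 * s" x] by simp
    have "c * mu x (2 * s) \<le> c * (Cd * mu x s)" using Cd(2)[OF s(1), of x] c0 by (rule mult_left_mono)
    also have "\<dots> = C * Cd * qd ^ j" unfolding c_def using ms by simp
    \<comment> \<open>As \<open>\<delta> \<le> 1\<close>, the factor \<open>2 * qd\<close> is at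
      least 1; it raises the exponent from \<open>j\<close> to \<open>k = Suc j\<close>.\<close>
    also have "\<dots> \<le> C * Cd * qd ^ j * (2 * qd)"
    proof -
     have "C * Cd * qd ^ j * 1 \<le> C * Cd * qd ^ j * (2 * qd)"
      using qd C(1) Cd(1) by (intro mult_left_mono mult_nonneg_nonneg) auto
     then show ?thesis by simp
    qed
    also have "\<dots> = (2 * C * Cd) * qd ^ k" unfolding Suc by simp
    also have "\<dots> \<le> K * qd ^ k" unfolding K_def using qd(1) by (intro mult_right_mono) auto
    finally have "(c * mu x (2 * s))\<^sup>2 \<le> (K * qd ^ k)\<^sup>2" using c0 by (intro power_mono) auto
    then have "c\<^sup>2 * mu x (2 * s) * mu x (2 * s) \<le> (K * qd ^ k)\<^sup>2" by (simp add: power2_eq_square ac_simps)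
    then show ?thesis using m2 by (simp add: le_divide_eq)
   qed
   finally show ?thesis unfolding s(2) .
  qed
  with i show "integrable M (\<lambda>y. indicator (ann x r k) y * (cmod (T' a y))\<^sup>2) \<and>
    (LINT y|M. indicator (ann x r k) y * (cmod (T' a y))\<^sup>2) \<le> (K * qd ^ k)\<^sup>2 / mu x (rad r k)" by blast
 qed
qed

lemma adjoint_psize:
 obtains C where "1 \<le> C"
  "\<And>x r a k. atom_on x r a ==> psize 2 x (rad r k) (C * qd ^ k) (\<lambda>y. indicator (ann x r k) y *\<^sub>R T' a y)"
proof -
 obtain C where C: "1 \<le> C"
  "\<And>x r a k. atom_on x r a ==> integrable M (\<lambda>y. indicator (ann x r k) y * (cmod (T' a y))\<^sup>2) \<and>
    (LINT y|M. indicator (ann x r k) y * (cmod (T' a y))\<^sup>2) \<le> (C * qd ^ k)\<^sup>2 / mu x (rad r k)"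
  by (rule adjoint_pieces) blast
 show ?thesis
 proof (rule that[OF C(1)])
  fix x r a k assume a: "atom_on x r a"
  have r: "0 < r" using a unfolding atom_on_def by blast
  have m: "0 < mu x (rad r k)" by (rule mu_pos[OF rad_pos[OF r]])
  have F: "square_int M (T' a)" by (rule T'_square_int[OF atom_on_L2(1)[OF a]])
  note [measurable] = square_int_measurable[OF F]
  have e: "cmod (indicator (ann x r k) y *\<^sub>R T' a y) powr 2 = indicator (ann x r k) y * (cmod (T' a y))\<^sup>2" for y
   by (simp add: powr_numeral indicator_def)
  show "psize 2 x (rad r k) (C * qd ^ k) (\<lambda>y. indicator (ann x r k) y *\<^sub>R T' a y)"
   unfolding psize_def e
  proof (intro conjI allI impI)
   show "0 \<le> C * qd ^ k" using C(1) qd(1) by simp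
   then have eq: "(C * qd ^ k) powr 2 * mu x (rad r k) powr (1 - 2) = (C * qd ^ k)\<^sup>2 / mu x (rad r k)"
    using m by (simp add: powr_numeral powr_minus_divide)
   show "(LINT y|M. indicator (ann x r k) y * (cmod (T' a y))\<^sup>2) \<le> (C * qd ^ k) powr 2 * mu x (rad r k) powr (1 - 2)"
    unfolding eq using C(2)[OF a, of k] by blast
   fix y assume "y \<notin> B x (rad r k)"
   then show "indicator (ann x r k) y *\<^sub>R T' a y = 0" using ann_sub[of x r k] by (auto simp: indicator_def)
  qed (use C(2)[OF a, of k] in auto)
 qed
qed

text \<open>Summation by parts moves the means of the annular pieces to the smallest ball, where the total
 integral of \<open>T' a\<close> is controlled by the oscillation of \<open>T1\<close>.\<close>

lemma adjoint_HA:
 assumes t: "t \<in> L1_loc d M" and A1: "0 \<le> A1" "\<And>x r. 0 < r ==> ln (exp 1 + \<rho> x / r) * MO M t (B x r) \<le> A1"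
  and tT: "\<And>a. a \<in> rho_atoms ==> (LINT y|M. t y * a y) = (LINT y|M. T' a y)"
 obtains C where "0 \<le> C" "\<And>a. a \<in> rho_atoms ==> HA C (T' a)"
proof -
 obtain C1 where C1: "1 \<le> C1"
  "\<And>x r a k. atom_on x r a ==> psize 2 x (rad r k) (C1 * qd ^ k) (\<lambda>y. indicator (ann x r k) y *\<^sub>R T' a y)"
  by (rule adjoint_psize) blast
 obtain C2 where C2: "1 \<le> C2"
  "\<And>x R A f. psize 2 x R A f ==> 0 < R ==> (LINT y|M. f y) = 0 ==> HA (C2 * A) f"
  by (rule psize_HA[of 2]) auto
 obtain C3 where C3: "1 \<le> C3" "\<And>x R. 0 < R ==> HA (C3 * ln (exp 1 + \<rho> x / R)) (chi x R)" by (rule chi_HA) blast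
 obtain C4 where C4: "1 \<le> C4" "\<And>x R. 0 < R ==> HA C4 (\<lambda>y. chi x (2 * R) y - chi x R y)" by (rule chi_diff_HA) blast
 define D where "D = C1 / (1 - qd)"
 have D: "0 < D" unfolding D_def using C1(1) qd by simp
 define L4 where "L4 = ln (exp 1 + (4::real))"
 have L4: "1 \<le> L4" unfolding L4_def by (rule ln_e_ge_1) simp
 define Q where "Q = max A1 (D * L4)"
 define E where "E = C2 * (4 * C1) + D * C4"
 have E: "0 \<le> E" unfolding E_def using C1 C2 C4 D by simp
 show ?thesis
 proof (rule that[of "E * (1 / (1 - qd)) + C3 * Q"])
  have Q: "0 \<le> Q" unfolding Q_def using A1 by simp
  show "0 \<le> E * (1 / (1 - qd)) + C3 * Q" using E qd C3(1) Q by simp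
  fix a assume ar: "a \<in> rho_atoms"
  then obtain x r where a: "atom_on x r a" using rho_atoms_atom_on by blast
  have r: "0 < r" "r < \<rho> x" using a unfolding atom_on_def by auto
  define F where "F = T' a"
  have F: "square_int M F" unfolding F_def by (rule T'_square_int[OF atom_on_L2(1)[OF a]])
  note Fm[measurable] = square_int_measurable[OF F]
  define Fk where "Fk k y = indicator (ann x r k) y *\<^sub>R F y" for k y
  have ps: "psize 2 x (rad r k) (C1 * qd ^ k) (Fk k)" for k unfolding Fk_def[abs_def] F_def by (rule C1(2)[OF a])
  have Rp: "0 < rad r k" for k by (rule rad_pos[OF r(1)])
  have p2: "(1::real) < 2" by simp
  note Fi = psize_L1[OF ps p2 Rp]
  have sq: "summable (\<lambda>k. C1 * qd ^ k)" "(\<Sum>k. C1 * qd ^ k) = D"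
   using qd suminf_mult[OF summable_geometric[of qd], of C1] suminf_geometric[of qd] unfolding D_def
   by (auto intro!: summable_mult summable_geometric)
  define mk where "mk k = (LINT y|M. Fk k y)" for k
  have mle: "cmod (mk k) \<le> C1 * qd ^ k" for k unfolding mk_def by (rule order_trans[OF integral_norm_bound Fi(2)])
  have smn: "summable (\<lambda>k. cmod (mk k))" by (rule summable_comparison_test'[OF sq(1), of 0]) (use mle in auto)
  then have sm: "summable mk" by (rule summable_norm_cancel)
  \<comment> \<open>The integral of \<open>T' a\<close> from the annulus \<open>k\<close> outwards.
    It decays like \<open>qd ^ k\<close>, and \<open>S 0\<close> is the total integral.\<close>
  define S where "S k = (\<Sum>j. mk (j + k))" for k
  have SS: "S k = mk k + S (Suc k)" for k
   unfolding S_def using suminf_split_head[OF summable_ignore_initial_segment[OF sm, of k]] by simp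
  have Sle: "cmod (S k) \<le> D * qd ^ k" for k
  proof -
   have s1: "summable (\<lambda>j. cmod (mk (j + k)))" by (rule summable_ignore_initial_segment[OF smn])
   have s2: "summable (\<lambda>j. qd ^ k * (C1 * qd ^ j))" by (rule summable_mult[OF sq(1)])
   have "cmod (S k) \<le> (\<Sum>j. cmod (mk (j + k)))" unfolding S_def by (rule summable_norm[OF s1])
   also have "\<dots> \<le> (\<Sum>j. qd ^ k * (C1 * qd ^ j))"
    proof (rule suminf_le[OF _ s1 s2])
    show "cmod (mk (j + k)) \<le> qd ^ k * (C1 * qd ^ j)" for j using mle[of "j + k"] by (simp add: power_add ac_simps)
   qed
   also have "\<dots> = qd ^ k * D" using suminf_mult[OF sq(1), of "qd ^ k"] sq(2) by simp
   finally show ?thesis by (simp add: mult.commute)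
  qed
  have S0: "S 0 = (LINT y|M. F y)"
  proof -
   have "(\<lambda>k. \<integral>y. Fk k y \<partial>M) sums (LINT y|M. F y)"
   proof (rule integrable_sums(2)[OF Fi(1)])
    show "summable (\<lambda>k. \<integral>y. cmod (Fk k y) \<partial>M)"
     by (rule summable_comparison_test'[OF sq(1), of 0]) (use Fi(2) in auto)
    show "AE y in M. (\<lambda>k. Fk k y) sums F y" unfolding Fk_def by (intro AE_I2 ann_sums r)
   qed measurable
   then show ?thesis unfolding S_def mk_def by (simp add: sums_iff)
  qed
  \<comment> \<open>For a mean zero atom the total integral is a pairing with \<open>t\<close>,
    whose oscillation on the ball beats the logarithm; for the remaining atoms
    \<open>\<rho> x / r\<close> is at most 4 and the logarithm is bounded.\<close>
  have S0L: "cmod (S 0) * ln (exp 1 + \<rho> x / rad r 0) \<le> Q"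
  proof -
   have rr: "r \<le> rad r 0" by (rule rad_ge[OF r(1)])
   have "\<rho> x / rad r 0 \<le> \<rho> x / r" using rr r by (intro divide_left_mono) (auto intro: Rp)
   then have Lm: "ln (exp 1 + \<rho> x / rad r 0) \<le> ln (exp 1 + \<rho> x / r)"
    using Rp[of 0] by (subst ln_le_cancel_iff) (auto intro!: add_pos_nonneg divide_nonneg_pos r)
   show ?thesis
   proof (cases "r < \<rho> x / 4")
    case True
    have am: "a \<in> borel_measurable M" and ab: "\<And>y. cmod (a y) \<le> 1 / mu x r" and as: "\<And>y. y \<notin> B x r ==> a y = 0"
     and az: "(LINT y|M. a y) = 0" using a True unfolding atom_on_def by auto
    have "cmod (S 0) = cmod (LINT y|M. t y * a y)" unfolding S0 F_def tT[OF ar] ..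
    also have "\<dots> \<le> 1 / mu x r * (mu x r * MO M t (B x r))" by (rule MO_pairing[OF t am ab as az r(1)])
    also have "\<dots> = MO M t (B x r)" using mu_pos[OF r(1), of x] by simp
    finally have le: "cmod (S 0) \<le> MO M t (B x r)" .
    have "0 \<le> ln (exp 1 + \<rho> x / r)" using ln_e_ge_1[of "\<rho> x / r"] r by simp
    then have "cmod (S 0) * ln (exp 1 + \<rho> x / rad r 0) \<le> MO M t (B x r) * ln (exp 1 + \<rho> x / r)"
     using le Lm MO_nonneg by (meson mult_mono norm_ge_zero order_trans mult_left_mono mult_right_mono)
    also have "\<dots> \<le> A1" using A1(2)[OF r(1), of x] by (simp add: mult.commute)
    finally show ?thesis unfolding Q_def by simp
   next
    case False
    have "\<rho> x / r \<le> 4" using False r by (simp add: divide_le_eq)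
    then have "ln (exp 1 + \<rho> x / r) \<le> L4" unfolding L4_def
     using r by (subst ln_le_cancel_iff) (auto intro!: add_pos_nonneg divide_nonneg_pos)
    then have "ln (exp 1 + \<rho> x / rad r 0) \<le> L4" using Lm by linarith
    then have "cmod (S 0) * ln (exp 1 + \<rho> x / rad r 0) \<le> cmod (S 0) * L4" by (rule mult_left_mono) simp
    also have "\<dots> \<le> D * L4" using Sle[of 0] L4 by (intro mult_right_mono) auto
    finally show ?thesis unfolding Q_def by simp
   qed
  qed
  define X where "X k y = chi x (rad r k) y" for k y
  \<comment> \<open>Each annular piece is freed of its mean. The means return as the tail
    \<open>S k\<close> times the difference of consecutive normalised indicators, which is cheap,
    while the full integral \<open>S 0\<close> stays on the smallest ball. A partial sum differs
    from that of the annular pieces by \<open>S (Suc n) * X n\<close>, which tends to 0.\<close>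
  define G where "G k y = (Fk k y - mk k * X k y) + (if k = 0 then S 0 * X 0 y else S k * (X k y - X (k - 1) y))" for k y
  define N where "N k = E * qd ^ k + (if k = 0 then C3 * Q else 0)" for k
  have g1: "HA (C2 * (4 * (C1 * qd ^ k))) (\<lambda>y. Fk k y - mk k * X k y)" for k
  proof (rule C2(2)[OF _ Rp])
   show "psize 2 x (rad r k) (4 * (C1 * qd ^ k)) (\<lambda>y. Fk k y - mk k * X k y)"
    unfolding mk_def X_def by (rule psize_sub_mean[OF ps p2 Rp])
   show "(LINT y|M. Fk k y - mk k * X k y) = 0"
    using Bochner_Integration.integral_diff[OF Fi(1) integrable_mult_right[OF chi_integral(1)[OF Rp], of "mk k"], of k]
     chi_integral(2)[OF Rp, of x] unfolding X_def mk_def by simp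
  qed
  have gG: "HA (N k) (G k)" for k
  proof (cases k)
   case 0
   have "HA (cmod (S 0) * (C3 * ln (exp 1 + \<rho> x / rad r 0))) (\<lambda>y. S 0 * X 0 y)"
    unfolding X_def by (rule atomic_gauge_scale[OF C3(2)[OF Rp]])
   from atomic_gauge_add[OF L1_rho_atoms g1[of 0] this]
   show ?thesis unfolding 0 G_def[abs_def]
   proof (simp, elim atomic_gauge_mono)
    have "C3 * (cmod (S 0) * ln (exp 1 + \<rho> x / rad r 0)) \<le> C3 * Q" using S0L C3(1) by (intro mult_left_mono) auto
    moreover have "C2 * (4 * C1) \<le> E" unfolding E_def using D C4 by simp
    ultimately show "C2 * (4 * C1) + cmod (S 0) * (C3 * ln (exp 1 + \<rho> x / rad r 0)) \<le> N 0" unfolding N_def by (simp add: ac_simps)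
   qed
  next
   case (Suc j)
   have "HA (cmod (S k) * C4) (\<lambda>y. S k * (X k y - X j y))"
    unfolding X_def Suc rad_Suc by (rule atomic_gauge_scale[OF C4(2)[OF Rp]])
   from atomic_gauge_add[OF L1_rho_atoms g1[of k] this]
   have "HA (C2 * (4 * (C1 * qd ^ k)) + cmod (S k) * C4) (G k)" unfolding Suc G_def[abs_def] by simp
   then show ?thesis
   proof (rule atomic_gauge_mono)
    have "cmod (S k) * C4 \<le> D * qd ^ k * C4" using Sle[of k] C4(1) by (intro mult_right_mono) auto
    then show "C2 * (4 * (C1 * qd ^ k)) + cmod (S k) * C4 \<le> N k" unfolding N_def E_def Suc by (simp add: algebra_simps)
   qed
  qed
  have Nsum: "N sums (E * (1 / (1 - qd)) + C3 * Q)"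
   unfolding N_def using qd by (intro sums_add sums_mult geometric_sums) (use sums_single[of 0 "\<lambda>_. C3 * Q"] in auto)
  have part: "(\<Sum>k<Suc n. G k y) = (\<Sum>k<Suc n. Fk k y) + S (Suc n) * X n y" for n y
  proof (induction n)
   case 0
   show ?case unfolding G_def using SS[of 0] by (simp add: algebra_simps)
  next
   case (Suc n)
   have "G (Suc n) y = Fk (Suc n) y - mk (Suc n) * X (Suc n) y + S (Suc n) * (X (Suc n) y - X n y)" unfolding G_def by simp
   then show ?case unfolding sum.lessThan_Suc[of _ "Suc n"] Suc using SS[of "Suc n"] by (simp add: algebra_simps)
  qed
  have GF: "(\<lambda>k. G k y) sums F y" for y
  proof -
   have X1: "cmod (X n y) \<le> 1 / mu x (rad r 0)" for n
   proof -
    have "mu x (rad r 0) \<le> mu x (rad r n)" by (intro mu_mono rad_mono r) simp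
    then have "1 / mu x (rad r n) \<le> 1 / mu x (rad r 0)" using mu_pos[OF Rp[of 0], of x] by (intro divide_left_mono) (auto intro: mu_pos Rp)
    moreover have "cmod (X n y) \<le> 1 / mu x (rad r n)" unfolding X_def chi_def by (simp add: norm_divide indicator_def)
    ultimately show ?thesis by linarith
   qed
   have z: "(\<lambda>n. S (Suc n) * X n y) \<longlonglongrightarrow> 0"
   proof (rule Lim_null_comparison[OF always_eventually[OF allI]])
    show "norm (S (Suc n) * X n y) \<le> D * qd ^ Suc n * (1 / mu x (rad r 0))" for n
     unfolding norm_mult using Sle[of "Suc n"] X1[of n] by (intro mult_mono) (auto intro: order_trans[OF norm_ge_zero])
    have "(\<lambda>n. qd ^ Suc n) \<longlonglongrightarrow> 0" using LIMSEQ_Suc[OF LIMSEQ_power_zero[of qd]] qd by simp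
    then have "(\<lambda>n. D * qd ^ Suc n * (1 / mu x (rad r 0))) \<longlonglongrightarrow> D * 0 * (1 / mu x (rad r 0))" by (intro tendsto_intros)
    then show "(\<lambda>n. D * qd ^ Suc n * (1 / mu x (rad r 0))) \<longlonglongrightarrow> 0" by simp
   qed
   have "(\<lambda>n. \<Sum>k<n. Fk k y) \<longlonglongrightarrow> F y" using ann_sums[OF r(1), of x y F] unfolding sums_def Fk_def .
   then have "(\<lambda>n. (\<Sum>k<Suc n. Fk k y) + S (Suc n) * X n y) \<longlonglongrightarrow> F y + 0" by (intro tendsto_add z LIMSEQ_Suc)
   then have "(\<lambda>n. \<Sum>k<Suc n. G k y) \<longlonglongrightarrow> F y" unfolding part by simp
   then show ?thesis unfolding sums_def by (rule LIMSEQ_imp_Suc)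
  qed
  show "HA (E * (1 / (1 - qd)) + C3 * Q) (T' a)"
   unfolding F_def[symmetric]
   by (rule atomic_gauge_suminf[OF L1_rho_atoms gG _ _ Fm]) (use Nsum GF in \<open>auto simp: sums_iff\<close>)
 qed
qed

text \<open>\<open>T'\<close> is already defined on \<open>h\<close>, so it has to be matched with
  the extension from atoms: with \<open>T\<close> as transposed operator both give the same
  integrals against test functions.\<close>

lemma adjoint_HA_L2:
 assumes C: "0 \<le> C" "\<And>a. a \<in> rho_atoms ==> HA C (T' a)" and h: "square_int M h" "HA A h"
 shows "HA (C * A) (T' h)"
proof -
 have Q: "T g \<in> L1_loc d M" if "g \<in> tests" for g
  by (rule square_int_L1_loc[OF T_square_int[OF test_square_int[OF that]]])
 have dual: "(LINT y|M. T g y * a y) = (LINT y|M. T' a y * g y)" if a: "square_int M a" and g: "g \<in> tests" for a g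
  using T'_adjoint[OF test_square_int[OF g] a] by (simp add: mult.commute)
 have ext1: "\<exists>N. bmo N (T g)" if "g \<in> tests" for g
  by (rule extension(1)[of C T' T]) (use C Q dual test_square_int rho_atom_test that in auto)
 have ext2: "\<exists>S. (\<forall>A h. HA A h \<longrightarrow> HA (C * A) (S h) \<and> (\<forall>g\<in>tests. (LINT y|M. S h y * g y) = Lp (T g) h))"
  by (rule extension(2)[of C T' T]) (use C Q dual test_square_int rho_atom_test in auto)
 obtain S where S: "HA (C * A) (S h)" "\<And>g. g \<in> tests ==> (LINT y|M. S h y * g y) = Lp (T g) h"
  using ext2 h(2) by blast
 have "AE y in M. S h y = T' h y"
 proof (rule test_unique[OF HA_L1_loc[OF S(1)] square_int_L1_loc[OF T'_square_int[OF h(1)]]])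
  fix g assume g: "g \<in> tests"
  obtain N where N: "bmo N (T g)" using ext1[OF g] by blast
  have "Lp (T g) h = (LINT y|M. T g y * h y)"
   by (rule Lp_integral[OF N h(2) Cauchy_Schwarz_integral(1)[OF T_square_int[OF test_square_int[OF g]] h(1)]])
  then show "(LINT y|M. S h y * g y) = (LINT y|M. T' h y * g y)" using S(2)[OF g] dual[OF h(1) g] by simp
 qed
 then show ?thesis by (rule atomic_gauge_AE_cong[OF S(1) square_int_measurable[OF T'_square_int[OF h(1)]]])
qed

end

subsection \<open>The commutator on atoms\<close>

text \<open>Concavity of the logarithm between \<open>exp 1\<close> and \<open>exp 1 + u\<close>; at
  the first point its value is 1.\<close>

lemma ln_e_scale:
 fixes c u :: real
 assumes "0 \<le> c" "c \<le> 1" "0 \<le> u" shows "c * ln (exp 1 + u) \<le> ln (exp 1 + c * u)"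
proof -
 have "ln (exp 1 + c * u) = ln ((1 - c) * exp 1 + c * (exp 1 + u))" by (simp add: algebra_simps)
 moreover have "(1 - c) * ln (exp 1) + c * ln (exp 1 + u) \<le> ln ((1 - c) * exp 1 + c * (exp 1 + u))"
 proof -
  have "exp 1 + u \<in> {0<..}" "exp (1::real) \<in> {0<..}" using assms by (auto intro: add_pos_nonneg)
  then show ?thesis using concave_onD[OF ln_concave, of c "exp 1" "exp 1 + u"] assms by simp
 qed
 ultimately show ?thesis using assms by simp
qed

section \<open>Oscillation of \<open>b\<close> on a ball and on its dyadic dilates\<close>

context CZ_space
begin

text \<open>The reciprocal of the weight in \<open>BMO_log_norm\<close>, hence the mean oscillation
  that membership permits at this scale, with an exponent \<open>\<tau>\<close> in place of
  \<open>\<theta>\<close>.\<close>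

definition osc_weight :: "real => 'a => real => real" where
 "osc_weight \<tau> x R = (1 + R / \<rho> x) powr \<tau> / ln (exp 1 + \<rho> x / R)"

lemma osc_weight_pos: "0 < R ==> 0 < osc_weight \<tau> x R"
proof -
 assume R: "0 < R"
 have "0 < 1 + R / \<rho> x" using R by (simp add: add_pos_pos)
 moreover have "1 \<le> ln (exp 1 + \<rho> x / R)" by (rule ln_e_ge_1) (use R in simp)
 ultimately show ?thesis unfolding osc_weight_def by simp
qed

lemma osc_weight_mono:
 assumes "0 < R" "R \<le> S" "0 \<le> \<tau>" shows "osc_weight \<tau> x R \<le> osc_weight \<tau> x S"
 unfolding osc_weight_def
proof (rule frac_le)
 show "(1 + R / \<rho> x) powr \<tau> \<le> (1 + S / \<rho> x) powr \<tau>"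
  using assms by (intro powr_mono2) (auto intro!: divide_right_mono add_nonneg_nonneg divide_nonneg_nonneg)
 have "1 \<le> ln (exp 1 + \<rho> x / S)" by (rule ln_e_ge_1) (use assms in simp)
 then show "0 < ln (exp 1 + \<rho> x / S)" by simp
 have "\<rho> x / S \<le> \<rho> x / R" using assms by (intro divide_left_mono) auto
 then show "ln (exp 1 + \<rho> x / S) \<le> ln (exp 1 + \<rho> x / R)"
  using assms by (subst ln_le_cancel_iff) (auto intro!: add_pos_nonneg)
qed simp

text \<open>Passing to the subballs of a large ball costs the factor \<open>k + 1\<close> in the exponent, which is why the
 hypothesis on \<open>\<theta>\<close> involves the admissibility index.\<close>

lemma BMO_log_local:
 assumes \<theta>: "0 \<le> \<theta>" "\<theta> < \<delta> / (adm_index d \<rho> + 1)" and b: "b \<in> BMO_log d M \<rho> \<theta>"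
 obtains C \<tau> where "1 \<le> C" "0 \<le> \<tau>" "\<tau> < \<delta>"
  "\<And>x0 R x t. 0 < R ==> d x0 x < \<Lambda> * R ==> 0 < t ==> t \<le> \<Lambda> * R ==> MO M b (B x t) \<le> C * osc_weight \<tau> x0 R"
proof -
 have ne: "{k. admissible_exponent d \<rho> k} \<noteq> {}" using admissible_rho unfolding admissible_def by auto
 have bdd: "bdd_below {k. admissible_exponent d \<rho> k}" by (rule bdd_belowI[of _ 0]) (auto simp: admissible_exponent_def)
 have i0: "0 \<le> adm_index d \<rho>" unfolding adm_index_def by (rule cInf_greatest[OF ne]) (auto simp: admissible_exponent_def)
 have "\<theta> * (adm_index d \<rho> + 1) < \<delta>" using \<theta>(2) i0 by (simp add: less_divide_eq)
 \<comment> \<open>The index is an infimum that need not be attained; the strict inequality for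
   \<open>\<theta>\<close> leaves room for an admissible exponent slightly above it.\<close>
 have "\<exists>k. admissible_exponent d \<rho> k \<and> \<theta> * (k + 1) < \<delta>"
 proof (cases "\<theta> = 0")
  case True
  then show ?thesis using ne delta by auto
 next
  case False
  then have t: "0 < \<theta>" using \<theta> by simp
  have "adm_index d \<rho> < \<delta> / \<theta> - 1" using \<open>\<theta> * (adm_index d \<rho> + 1) < \<delta>\<close> t by (simp add: less_divide_eq field_simps)
  then obtain k where "admissible_exponent d \<rho> k" "k < \<delta> / \<theta> - 1"
   unfolding adm_index_def using cInf_less_iff[OF ne bdd] by auto
  then show ?thesis using t by (intro exI[of _ k]) (simp add: less_divide_eq field_simps)
 qed
 then obtain k where k: "admissible_exponent d \<rho> k" "\<theta> * (k + 1) < \<delta>" by blast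
 then obtain c where c: "0 < k" "0 < c" and ad: "\<And>x y. 1 / \<rho> x \<le> c / \<rho> y * (1 + d x y / \<rho> y) powr k"
  unfolding admissible_exponent_def by blast
 define A where "A = enn2real (BMO_log_norm d M \<rho> \<theta> b)"
 have fin: "BMO_log_norm d M \<rho> \<theta> b < \<infinity>" using b unfolding BMO_log_def by blast
 have A: "ln (exp 1 + \<rho> x / t) * (1 + t / \<rho> x) powr (- \<theta>) * MO M b (B x t) \<le> A" if t: "0 < t" for x t
 proof -
  have "ennreal (ln (exp 1 + \<rho> x / t) * (1 + t / \<rho> x) powr (- \<theta>) * MO M b (B x t)) \<le> BMO_log_norm d M \<rho> \<theta> b"
   unfolding BMO_log_norm_def using t by (intro SUP_upper2[of x UNIV] SUP_upper2[of t]) auto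
  also have "\<dots> = ennreal A" unfolding A_def using fin by simp
  finally show ?thesis using ennreal_le_iff[of A] unfolding A_def by simp
 qed
 have A0: "0 \<le> A" unfolding A_def by simp
 define \<tau> where "\<tau> = \<theta> * (k + 1)"
 have tau: "0 \<le> \<tau>" unfolding \<tau>_def using \<theta> c by simp
 \<comment> \<open>Bounds \<open>t / \<rho> x\<close> by \<open>c1 * (1 + u) powr (k + 1)\<close>:
   one power of \<open>1 + u\<close> comes from the radius and \<open>k\<close> powers from the
   change of centre. The maximum with 1 makes \<open>c1\<close> large enough to absorb the
   additional 1.\<close>
 define c1 where "c1 = \<Lambda> * max 1 c * \<Lambda> powr k"
 have L1: "1 \<le> \<Lambda> powr k" using Lambda_ge c(1) by (intro ge_one_powr_ge_zero) auto
 have c1: "1 \<le> c1" "\<Lambda> * c * \<Lambda> powr k \<le> c1"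
 proof -
  have "1 * 1 * 1 \<le> \<Lambda> * max 1 c * \<Lambda> powr k" using Lambda_ge L1 by (intro mult_mono) auto
  then show "1 \<le> c1" unfolding c1_def by simp
  show "\<Lambda> * c * \<Lambda> powr k \<le> c1" unfolding c1_def using Lambda_ge L1 by (intro mult_right_mono mult_left_mono) auto
 qed
 \<comment> \<open>For \<open>R \<le> \<rho> x0\<close> the ratio \<open>\<rho> x / t\<close> is at
   least \<open>c2\<close> times \<open>\<rho> x0 / R\<close>; \<open>ln_e_scale\<close> then
   compares the logarithms.\<close>
 define c2 where "c2 = min 1 (1 / (c * (1 + \<Lambda>) powr k * \<Lambda>))"
 have c2: "0 < c2" "c2 \<le> 1" unfolding c2_def using c Lambda_ge by auto
 \<comment> \<open>The second entry handles \<open>R\<close> above \<open>\<rho> x0\<close>, where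
   the logarithm on the left is at most \<open>ln (exp 1 + 1)\<close> and that on the right at least
   1.\<close>
 define l where "l = min c2 (1 / ln (exp 1 + 1))"
 have L11: "1 \<le> ln (exp 1 + (1::real))" by (rule ln_e_ge_1) simp
 have l: "0 < l" "l \<le> c2" "l \<le> 1" unfolding l_def using c2 L11 by auto
 define C where "C = max 1 (A * (2 * c1) powr \<theta> / l)"
 show ?thesis
 proof (rule that[of C \<tau>])
  show "1 \<le> C" unfolding C_def by simp
  show "\<tau> < \<delta>" unfolding \<tau>_def by (rule k(2))
  fix x0 R x t assume R: "0 < R" and x: "d x0 x < \<Lambda> * R" and t: "0 < t" "t \<le> \<Lambda> * R"
  define u where "u = R / \<rho> x0"
  have u: "0 < u" unfolding u_def using R by simp
  have tp: "0 < 1 + t / \<rho> x" using t by (simp add: add_pos_pos)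
  have Lu: "1 + \<Lambda> * u \<le> \<Lambda> * (1 + u)" using Lambda_ge by (simp add: algebra_simps)
  have rx: "1 / \<rho> x \<le> c / \<rho> x0 * (1 + \<Lambda> * u) powr k"
  proof -
   have "1 / \<rho> x \<le> c / \<rho> x0 * (1 + d x x0 / \<rho> x0) powr k" by (rule ad)
   also have "\<dots> \<le> c / \<rho> x0 * (1 + \<Lambda> * u) powr k"
   proof (intro mult_left_mono powr_mono2)
    have "d x x0 / \<rho> x0 \<le> (\<Lambda> * R) / \<rho> x0" using x by (intro divide_right_mono) (auto simp: dist_sym)
    then show "1 + d x x0 / \<rho> x0 \<le> 1 + \<Lambda> * u" unfolding u_def by simp
   qed (use c in \<open>auto intro: add_nonneg_nonneg\<close>)
   finally show ?thesis .
  qed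
  have up: "1 + t / \<rho> x \<le> 2 * c1 * (1 + u) powr (k + 1)"
  proof -
   have "t / \<rho> x = t * (1 / \<rho> x)" by simp
   also have "\<dots> \<le> (\<Lambda> * R) * (c / \<rho> x0 * (1 + \<Lambda> * u) powr k)"
    using t R Lambda_ge rx by (intro mult_mono) auto
   also have "\<dots> = \<Lambda> * c * u * (1 + \<Lambda> * u) powr k" unfolding u_def by simp
   also have "\<dots> \<le> \<Lambda> * c * (1 + u) * (\<Lambda> powr k * (1 + u) powr k)"
   proof (intro mult_mono)
    have "(1 + \<Lambda> * u) powr k \<le> (\<Lambda> * (1 + u)) powr k" using Lu c u Lambda_ge by (intro powr_mono2) auto
    then show "(1 + \<Lambda> * u) powr k \<le> \<Lambda> powr k * (1 + u) powr k" using Lambda_ge u by (simp add: powr_mult)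
   qed (use Lambda_ge c u in auto)
   also have "\<dots> = (\<Lambda> * c * \<Lambda> powr k) * (1 + u) powr (k + 1)" using u by (simp add: powr_add)
   also have "\<dots> \<le> c1 * (1 + u) powr (k + 1)" using c1 by (intro mult_right_mono) auto
   finally have "t / \<rho> x \<le> c1 * (1 + u) powr (k + 1)" .
   moreover have "1 * 1 \<le> c1 * (1 + u) powr (k + 1)" using c1 u c by (intro mult_mono ge_one_powr_ge_zero) auto
   ultimately show ?thesis by simp
  qed
  have lo: "l * ln (exp 1 + \<rho> x0 / R) \<le> ln (exp 1 + \<rho> x / t)"
  proof (cases "R \<le> \<rho> x0")
   case True
   have u1: "u \<le> 1" unfolding u_def using True by simp
   have "1 / \<rho> x \<le> c / \<rho> x0 * (1 + \<Lambda>) powr k"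
   proof (rule order_trans[OF rx], intro mult_left_mono powr_mono2)
    show "1 + \<Lambda> * u \<le> 1 + \<Lambda>" using u1 u Lambda_ge mult_left_mono[of u 1 \<Lambda>] by simp
   qed (use c u Lambda_ge in auto)
   then have r1: "\<rho> x0 \<le> c * (1 + \<Lambda>) powr k * \<rho> x" using rho_pos[of x] rho_pos[of x0] by (simp add: field_simps)
   have "c2 * (\<rho> x0 / R) \<le> 1 / (c * (1 + \<Lambda>) powr k * \<Lambda>) * (\<rho> x0 / R)" unfolding c2_def using R by (intro mult_right_mono) auto
   also have "\<dots> \<le> 1 / (c * (1 + \<Lambda>) powr k * \<Lambda>) * ((c * (1 + \<Lambda>) powr k * \<rho> x) / R)"
    using r1 R c Lambda_ge by (intro mult_left_mono divide_right_mono) auto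
   also have "\<dots> = \<rho> x / (\<Lambda> * R)" using c Lambda_ge by simp
   also have "\<dots> \<le> \<rho> x / t" using t by (intro divide_left_mono) (auto intro: mult_pos_pos simp: R Lambda_ge)
   finally have le: "c2 * (\<rho> x0 / R) \<le> \<rho> x / t" .
   have L0: "0 \<le> ln (exp 1 + \<rho> x0 / R)" using ln_e_ge_1[of "\<rho> x0 / R"] R by simp
   have "l * ln (exp 1 + \<rho> x0 / R) \<le> c2 * ln (exp 1 + \<rho> x0 / R)" using l L0 by (intro mult_right_mono) auto
   also have "\<dots> \<le> ln (exp 1 + c2 * (\<rho> x0 / R))" by (rule ln_e_scale) (use c2 R in auto)
   also have "\<dots> \<le> ln (exp 1 + \<rho> x / t)" using le c2 R by (subst ln_le_cancel_iff) (auto intro!: add_pos_nonneg divide_nonneg_pos t)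
   finally show ?thesis .
  next
   case False
   have "ln (exp 1 + \<rho> x0 / R) \<le> ln (exp 1 + 1)"
    using False R by (subst ln_le_cancel_iff) (auto intro!: add_pos_nonneg)
   then have "l * ln (exp 1 + \<rho> x0 / R) \<le> l * ln (exp 1 + 1)" using l by (intro mult_left_mono) auto
   also have "\<dots> \<le> 1 / ln (exp 1 + 1) * ln (exp 1 + 1)" using L11 unfolding l_def by (intro mult_right_mono) auto
   also have "\<dots> = 1" using L11 by simp
   also have "1 \<le> ln (exp 1 + \<rho> x / t)" by (rule ln_e_ge_1) (use t in simp)
   finally show ?thesis .
  qed
  have Lp': "1 \<le> ln (exp 1 + \<rho> x / t)" "1 \<le> ln (exp 1 + \<rho> x0 / R)" by (rule ln_e_ge_1; use t R in simp)+
  define P where "P = (1 + t / \<rho> x) powr \<theta>"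
  have P: "0 < P" unfolding P_def using tp by simp
  have "ln (exp 1 + \<rho> x / t) * (1 + t / \<rho> x) powr (- \<theta>) * MO M b (B x t) \<le> A" by (rule A[OF t(1)])
  then have "ln (exp 1 + \<rho> x / t) * MO M b (B x t) \<le> A * P"
   unfolding P_def using tp by (simp add: powr_minus_divide divide_le_eq mult.commute mult.left_commute)
  moreover have "(l * ln (exp 1 + \<rho> x0 / R)) * MO M b (B x t) \<le> ln (exp 1 + \<rho> x / t) * MO M b (B x t)"
   by (rule mult_right_mono[OF lo MO_nonneg])
  moreover have "P \<le> (2 * c1) powr \<theta> * (1 + u) powr \<tau>"
  proof -
   have "P \<le> (2 * c1 * (1 + u) powr (k + 1)) powr \<theta>" unfolding P_def using up tp \<theta> by (intro powr_mono2) auto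
   also have "\<dots> = (2 * c1) powr \<theta> * (1 + u) powr \<tau>" unfolding \<tau>_def using c1 u by (simp add: powr_mult powr_powr mult.commute)
   finally show ?thesis .
  qed
  ultimately have "l * ln (exp 1 + \<rho> x0 / R) * MO M b (B x t) \<le> A * ((2 * c1) powr \<theta> * (1 + u) powr \<tau>)"
   using A0 by (meson mult_left_mono order_trans)
  then have "MO M b (B x t) \<le> (A * (2 * c1) powr \<theta> / l) * ((1 + u) powr \<tau> / ln (exp 1 + \<rho> x0 / R))"
   using l Lp' by (simp add: field_simps)
  also have "\<dots> \<le> C * osc_weight \<tau> x0 R"
   unfolding osc_weight_def u_def C_def using Lp' by (intro mult_mono) auto
  finally show "MO M b (B x t) \<le> C * osc_weight \<tau> x0 R" .
 qed (rule tau)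
qed

text \<open>Any exponent above 2 would combine with the square means of \<open>T' a\<close>; 4 is
  convenient. In the last conclusion the average belongs to the original ball while the domain of
  integration grows, and the drift of the averages over \<open>k + 1\<close> enlargements gives the
  linear factor.\<close>

lemma osc_fourth_power:
 assumes b: "b \<in> L1_loc d M" and \<tau>: "0 \<le> \<tau>" and C: "1 \<le> C"
  and mo: "\<And>x0 R x t. 0 < R ==> d x0 x < \<Lambda> * R ==> 0 < t ==> t \<le> \<Lambda> * R ==> MO M b (B x t) \<le> C * osc_weight \<tau> x0 R"
 obtains C' where "1 \<le> C'"
  "\<And>x R. 0 < R ==> integrable M (\<lambda>y. indicator (B x R) y * cmod (b y - avg x R b) powr 4) \<and>
    (LINT y|M. indicator (B x R) y * cmod (b y - avg x R b) powr 4) \<le> (C' * osc_weight \<tau> x R) powr 4 * mu x R"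
  "\<And>x r k. 0 < r ==> integrable M (\<lambda>y. indicator (B x (rad r k)) y * cmod (b y - avg x r b) powr 4) \<and>
    (LINT y|M. indicator (B x (rad r k)) y * cmod (b y - avg x r b) powr 4)
     \<le> (C' * (real k + 1) * osc_weight \<tau> x (rad r k)) powr 4 * mu x (rad r k)"
proof -
 note [measurable] = L1_loc_measurable[OF b]
 obtain J where J: "0 \<le> J"
  "\<And>x0 R f A. 0 < R ==> 0 \<le> A ==> f \<in> L1_loc d M ==>
    (\<And>x t. d x0 x < \<Lambda> * R ==> 0 < t ==> t \<le> \<Lambda> * R ==> MO M f (B x t) \<le> A) ==>
    integrable M (\<lambda>y. indicator (B x0 R) y * cmod (f y - avg x0 R f) powr 4) \<and>
    (LINT y|M. indicator (B x0 R) y * cmod (f y - avg x0 R f) powr 4) \<le> (J * A) powr 4 * mu x0 R"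
  by (rule John_Nirenberg[of 4]) auto
 define K where "K = max (dbl (2 * \<kappa>)) Cd * C"
 have K: "1 \<le> K"
 proof -
  have "1 * 1 \<le> max (dbl (2 * \<kappa>)) Cd * C" using C Cd(1) by (intro mult_mono) auto
  then show ?thesis unfolding K_def by simp
 qed
 define D where "D = max 1 (4 * max (J * C) K)"
 have wp: "0 < osc_weight \<tau> x R" if "0 < R" for x R by (rule osc_weight_pos[OF that])
 have jn: "integrable M (\<lambda>y. indicator (B x R) y * cmod (b y - avg x R b) powr 4) \<and>
    (LINT y|M. indicator (B x R) y * cmod (b y - avg x R b) powr 4) \<le> (J * (C * osc_weight \<tau> x R)) powr 4 * mu x R" if R: "0 < R" for x R
  by (rule J(2)[OF R _ b mo[OF R]]) (use C wp[OF R, of x] in auto)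
 have self: "MO M b (B x R) \<le> C * osc_weight \<tau> x R" if R: "0 < R" for x R
  by (rule mo[OF R _ R]) (use R Lambda_ge mult_right_mono[of 1 \<Lambda> R] in auto)
 \<comment> \<open>Each enlargement moves the average by at most \<open>K\<close> times the weight
   at the larger radius; since the weight increases with the radius, all of them are charged at the
   last one.\<close>
 have avgd: "cmod (avg x (rad r k) b - avg x r b) \<le> K * (real k + 1) * osc_weight \<tau> x (rad r k)" if r: "0 < r" for x r k
 proof (induction k)
  case 0
  have "cmod (avg x r b - avg x (rad r 0) b) \<le> mu x (rad r 0) / mu x r * MO M b (B x (rad r 0))"
   by (rule avg_compare[OF b r rad_pos[OF r] B_mono[OF rad_ge[OF r]]])
  also have "\<dots> \<le> dbl (2 * \<kappa>) * (C * osc_weight \<tau> x (rad r 0))"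
  proof (intro mult_mono self rad_pos r)
   have "mu x (rad r 0) \<le> dbl (2 * \<kappa>) * mu x r" unfolding rad_def using mu_scale[of "2 * \<kappa>" r x] kappa_ge_1 r by simp
   then show "mu x (rad r 0) / mu x r \<le> dbl (2 * \<kappa>)" using mu_pos[OF r, of x] by (simp add: divide_le_eq)
  qed (use dbl_pos[of "2 * \<kappa>"] MO_nonneg in auto)
  also have "\<dots> \<le> K * osc_weight \<tau> x (rad r 0)"
   unfolding K_def mult.assoc[symmetric] using C wp[OF rad_pos[OF r], of x 0] by (intro mult_right_mono) auto
  finally show ?case by (simp add: norm_minus_commute)
 next
  case (Suc k)
  have "cmod (avg x (rad r k) b - avg x (rad r (Suc k)) b) \<le> mu x (rad r (Suc k)) / mu x (rad r k) * MO M b (B x (rad r (Suc k)))"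
   by (rule avg_compare[OF b rad_pos[OF r] rad_pos[OF r] B_mono]) (use rad_mono[OF r, of k "Suc k"] in simp)
  also have "\<dots> \<le> Cd * (C * osc_weight \<tau> x (rad r (Suc k)))"
  proof (intro mult_mono self rad_pos r)
   show "mu x (rad r (Suc k)) / mu x (rad r k) \<le> Cd"
    unfolding rad_Suc using Cd(2)[OF rad_pos[OF r], of x k] mu_pos[OF rad_pos[OF r], of x k] by (simp add: divide_le_eq)
  qed (use Cd(1) MO_nonneg in auto)
  also have "\<dots> \<le> K * osc_weight \<tau> x (rad r (Suc k))"
   unfolding K_def mult.assoc[symmetric] using C wp[OF rad_pos[OF r], of x "Suc k"] by (intro mult_right_mono) auto
  finally have 1: "cmod (avg x (rad r (Suc k)) b - avg x (rad r k) b) \<le> K * osc_weight \<tau> x (rad r (Suc k))" by (simp add: norm_minus_commute)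
  have "K * (real k + 1) * osc_weight \<tau> x (rad r k) \<le> K * (real k + 1) * osc_weight \<tau> x (rad r (Suc k))"
   using K by (intro mult_left_mono osc_weight_mono rad_pos r \<tau> rad_mono) auto
  then have 2: "cmod (avg x (rad r k) b - avg x r b) \<le> K * (real k + 1) * osc_weight \<tau> x (rad r (Suc k))" using Suc.IH by linarith
  have "cmod (avg x (rad r (Suc k)) b - avg x r b) \<le> cmod (avg x (rad r (Suc k)) b - avg x (rad r k) b) + cmod (avg x (rad r k) b - avg x r b)"
   using norm_triangle_ineq[of "avg x (rad r (Suc k)) b - avg x (rad r k) b" "avg x (rad r k) b - avg x r b"] by simp
  then show ?case using 1 2 by (simp add: algebra_simps)
 qed
 show ?thesis
 proof (rule that[of D])
  show "1 \<le> D" unfolding D_def by simp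
  fix x :: 'a
  {
   fix R :: real assume R: "0 < R"
   have "J * C \<le> D" unfolding D_def using J(1) C by (auto simp: max_def)
   then have "(J * (C * osc_weight \<tau> x R)) powr 4 \<le> (D * osc_weight \<tau> x R) powr 4"
    using wp[OF R, of x] J(1) C unfolding mult.assoc[symmetric] by (intro powr_mono2 mult_right_mono) auto
   then have "(J * (C * osc_weight \<tau> x R)) powr 4 * mu x R \<le> (D * osc_weight \<tau> x R) powr 4 * mu x R" by (rule mult_right_mono) simp
   then show "integrable M (\<lambda>y. indicator (B x R) y * cmod (b y - avg x R b) powr 4) \<and>
    (LINT y|M. indicator (B x R) y * cmod (b y - avg x R b) powr 4) \<le> (D * osc_weight \<tau> x R) powr 4 * mu x R"
    using jn[OF R, of x] by linarith
  }
  fix r :: real and k :: nat assume r: "0 < r"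
  define R where "R = rad r k"
  have R: "0 < R" unfolding R_def by (rule rad_pos[OF r])
  define w where "w = (real k + 1) * osc_weight \<tau> x R"
  have w: "0 < w" "osc_weight \<tau> x R \<le> w"
  proof -
   have "1 * osc_weight \<tau> x R \<le> w" unfolding w_def using wp[OF R, of x] by (intro mult_right_mono) auto
   then show "osc_weight \<tau> x R \<le> w" "0 < w" using wp[OF R, of x] by linarith+
  qed
  define e where "e = cmod (avg x R b - avg x r b)"
  have e: "0 \<le> e" "e \<le> K * w" unfolding e_def w_def R_def using avgd[OF r, of x k] by (auto simp: mult.assoc)
  define v where "v y = 2 powr 4 * (indicator (B x R) y * cmod (b y - avg x R b) powr 4 + e powr 4 * indicator (B x R) y)" for y
  have vi: "integrable M v" unfolding v_def using jn[OF R, of x] by (simp add: less_top[symmetric])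
  have le: "indicator (B x R) y * cmod (b y - avg x r b) powr 4 \<le> v y" for y
  proof (cases "y \<in> B x R")
   case True
   have "cmod (b y - avg x r b) \<le> cmod (b y - avg x R b) + e"
    unfolding e_def using norm_triangle_ineq[of "b y - avg x R b" "avg x R b - avg x r b"] by simp
   then have "cmod (b y - avg x r b) powr 4 \<le> (cmod (b y - avg x R b) + e) powr 4" by (intro powr_mono2) auto
   also have "\<dots> \<le> 2 powr 4 * (cmod (b y - avg x R b) powr 4 + e powr 4)" by (rule powr_sum_le) (use e in auto)
   finally show ?thesis using True unfolding v_def by simp
  qed (simp add: v_def)
  have i: "integrable M (\<lambda>y. indicator (B x R) y * cmod (b y - avg x r b) powr 4)"
   by (rule Bochner_Integration.integrable_bound[OF vi]) (use le in \<open>auto intro!: AE_I2 intro: order_trans[OF _ abs_ge_self]\<close>)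
  have "(LINT y|M. indicator (B x R) y * cmod (b y - avg x r b) powr 4) \<le> (LINT y|M. v y)" by (rule integral_mono[OF i vi le])
  also have "\<dots> = 2 powr 4 * ((LINT y|M. indicator (B x R) y * cmod (b y - avg x R b) powr 4) + e powr 4 * mu x R)"
   unfolding v_def using jn[OF R, of x] by (subst integral_mult_right_zero, subst Bochner_Integration.integral_add) (auto simp: less_top[symmetric])
  also have "\<dots> \<le> 2 powr 4 * ((max (J * C) K * w) powr 4 * mu x R + (max (J * C) K * w) powr 4 * mu x R)"
  proof (intro mult_left_mono add_mono)
   have "J * (C * osc_weight \<tau> x R) \<le> max (J * C) K * w"
    unfolding mult.assoc[symmetric] using J(1) C w K wp[OF R, of x] by (intro mult_mono) auto
   then have "(J * (C * osc_weight \<tau> x R)) powr 4 * mu x R \<le> (max (J * C) K * w) powr 4 * mu x R"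
    using J(1) C wp[OF R, of x] by (intro mult_right_mono powr_mono2) auto
   then show "(LINT y|M. indicator (B x R) y * cmod (b y - avg x R b) powr 4) \<le> (max (J * C) K * w) powr 4 * mu x R"
    using jn[OF R, of x] by linarith
   have "e \<le> max (J * C) K * w" by (rule order_trans[OF e(2)]) (use w in \<open>auto intro: mult_right_mono\<close>)
   then show "e powr 4 * mu x R \<le> (max (J * C) K * w) powr 4 * mu x R" using e(1) by (intro mult_right_mono powr_mono2) auto
  qed auto
  also have "\<dots> = 32 * (max (J * C) K * w) powr 4 * mu x R" by simp
  also have "\<dots> \<le> (4 powr 4) * (max (J * C) K * w) powr 4 * mu x R" by (intro mult_right_mono) auto
  also have "\<dots> = (4 * max (J * C) K * w) powr 4 * mu x R"
   using powr_mult[of 4 "max (J * C) K * w" 4] K w by (simp add: mult.assoc max_def)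
  also have "\<dots> \<le> (D * w) powr 4 * mu x R"
   unfolding D_def using K w by (intro mult_right_mono powr_mono2) (auto simp: le_max_iff_disj intro!: mult_nonneg_nonneg)
  finally show "integrable M (\<lambda>y. indicator (B x (rad r k)) y * cmod (b y - avg x r b) powr 4) \<and>
    (LINT y|M. indicator (B x (rad r k)) y * cmod (b y - avg x r b) powr 4)
     \<le> (D * (real k + 1) * osc_weight \<tau> x (rad r k)) powr 4 * mu x (rad r k)"
   using i unfolding w_def R_def by (simp add: mult.assoc)
 qed
qed

end

text \<open>Young's inequality with exponents 3 and 3/2, which reflects
  \<open>3/4 = 1/4 + 1/2\<close> for the product of a fourth power and a square integrable
  function.\<close>

lemma mixed_power_bound:
 fixes u v :: real
 assumes "0 \<le> u" "0 \<le> v" shows "(u * v) powr (4 / 3) \<le> u powr 4 + v\<^sup>2"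
proof -
 have "(u * v) powr (4 / 3) = u powr (4 / 3) * v powr (4 / 3)" using assms by (simp add: powr_mult)
 also have "\<dots> \<le> (u powr (4 / 3)) powr 3 / 3 + (v powr (4 / 3)) powr (3 / 2) / (3 / 2)"
  by (rule Youngs_inequality) auto
 also have "\<dots> = u powr 4 / 3 + v\<^sup>2 / (3 / 2)" using assms by (simp add: powr_powr powr_numeral)
 also have "\<dots> \<le> u powr 4 / 1 + v\<^sup>2 / 1" by (intro add_mono divide_left_mono) auto
 finally show ?thesis by simp
qed

lemma square_le_fourth:
 fixes t :: real
 assumes "0 \<le> t" shows "t\<^sup>2 \<le> t powr 4 + 1"
proof -
 define w where "w = t\<^sup>2"
 have "t powr 4 = w\<^sup>2" unfolding w_def using assms by (simp add: powr_numeral)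
 moreover have "0 \<le> w" unfolding w_def by simp
 moreover have "0 \<le> (w - 1)\<^sup>2" by simp
 ultimately show ?thesis unfolding w_def[symmetric] power2_diff by simp
qed

locale commutator_space = CZ_space d \<kappa> M \<rho> \<delta> T
 for d :: "'a => 'a => real" and \<kappa> :: real and M :: "'a measure" and \<rho> :: "'a => real" and \<delta> :: real
  and T :: "('a => complex) => ('a => complex)" +
 fixes \<theta> :: real and b T1 :: "'a => complex"
 assumes theta: "0 \<le> \<theta>" "\<theta> < \<delta> / (adm_index d \<rho> + 1)"
  and b_BMO: "b \<in> BMO_log d M \<rho> \<theta>"
  and T1_rep: "represents_T1 d M \<rho> T T1"
  and T1_BMO: "T1 \<in> BMO_log d M \<rho> 0"
begin

lemma b_L1_loc: "b \<in> L1_loc d M"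
 using b_BMO unfolding BMO_log_def by blast

lemma b_measurable [measurable]: "b \<in> borel_measurable M"
 by (rule L1_loc_measurable[OF b_L1_loc])

lemma adjoint_atoms_HA:
 obtains C where "0 \<le> C" "\<And>a. a \<in> rho_atoms ==> HA C (T' a)"
proof -
 have L: "T1 \<in> L1_loc d M" and fin: "BMO_log_norm d M \<rho> 0 T1 < \<infinity>" using T1_BMO unfolding BMO_log_def by auto
 define A where "A = enn2real (BMO_log_norm d M \<rho> 0 T1)"
 have A: "ln (exp 1 + \<rho> x / r) * MO M T1 (B x r) \<le> A" if r: "0 < r" for x r
 proof -
  have p: "(1 + r / \<rho> x) powr (- 0) = 1" using r rho_pos[of x] by (simp add: add_pos_pos less_imp_neq[symmetric])
  have "ennreal (ln (exp 1 + \<rho> x / r) * (1 + r / \<rho> x) powr (- 0) * MO M T1 (B x r)) \<le> BMO_log_norm d M \<rho> 0 T1"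
   unfolding BMO_log_norm_def using r by (intro SUP_upper2[of x UNIV] SUP_upper2[of r]) auto
  also have "\<dots> = ennreal A" unfolding A_def using fin by simp
  finally show ?thesis unfolding p using ennreal_le_iff[of A] unfolding A_def by simp
 qed
 have rep: "(LINT y|M. T1 y * a y) = (LINT y|M. T' a y)" if "a \<in> rho_atoms" for a
  using T1_rep rho_atom_H1_atom[of \<infinity>, OF _ that] unfolding represents_T1_def by simp
 show ?thesis
  by (rule adjoint_HA[of T1 A, OF L _ A rep that]) (simp_all add: A_def)
qed

text \<open>On each annulus the oscillation weight of \<open>b\<close> cancels the logarithm that a
  function without mean zero costs, leaving \<open>(1 + R / \<rho> x) powr \<tau>\<close>. That
  grows at most like \<open>(2 powr \<tau>) ^ k\<close> because \<open>r < \<rho> x\<close>, and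
  loses against \<open>qd ^ k\<close>.\<close>

lemma commutator_annuli:
 obtains C s where "0 \<le> C" "0 < s" "s < 1"
  "\<And>x r a k. atom_on x r a ==>
    HA (C * (real (Suc k) * s ^ k)) (\<lambda>y. indicator (ann x r k) y *\<^sub>R ((b y - avg x r b) * T' a y))"
  "\<And>x r a. atom_on x r a ==> square_int M (\<lambda>y. (b y - avg x r b) * a y) \<and> HA C (\<lambda>y. (b y - avg x r b) * a y)"
  "\<And>x R. 0 < R ==> square_int M (\<lambda>y. indicator (B x R) y *\<^sub>R b y)"
proof -
 obtain Cb \<tau> where Cb: "1 \<le> Cb" and \<tau>: "0 \<le> \<tau>" "\<tau> < \<delta>"
  and mo: "\<And>x0 R x t. 0 < R ==> d x0 x < \<Lambda> * R ==> 0 < t ==> t \<le> \<Lambda> * R ==> MO M b (B x t) \<le> Cb * osc_weight \<tau> x0 R"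
  by (rule BMO_log_local[OF theta b_BMO]) blast
 obtain D where D: "1 \<le> D"
  and D1: "\<And>x R. 0 < R ==> integrable M (\<lambda>y. indicator (B x R) y * cmod (b y - avg x R b) powr 4) \<and>
    (LINT y|M. indicator (B x R) y * cmod (b y - avg x R b) powr 4) \<le> (D * osc_weight \<tau> x R) powr 4 * mu x R"
  and D2: "\<And>x r k. 0 < r ==> integrable M (\<lambda>y. indicator (B x (rad r k)) y * cmod (b y - avg x r b) powr 4) \<and>
    (LINT y|M. indicator (B x (rad r k)) y * cmod (b y - avg x r b) powr 4)
     \<le> (D * (real k + 1) * osc_weight \<tau> x (rad r k)) powr 4 * mu x (rad r k)"
  by (rule osc_fourth_power[OF b_L1_loc \<tau>(1) Cb mo]) blast+
 obtain CF where CF: "1 \<le> CF"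
  "\<And>x r a k. atom_on x r a ==> integrable M (\<lambda>y. indicator (ann x r k) y * (cmod (T' a y))\<^sup>2) \<and>
    (LINT y|M. indicator (ann x r k) y * (cmod (T' a y))\<^sup>2) \<le> (CF * qd ^ k)\<^sup>2 / mu x (rad r k)"
  by (rule adjoint_pieces) blast
 obtain C3 where C3: "1 \<le> C3" "\<And>x R A f. psize (4/3) x R A f ==> 0 < R ==> HA (C3 * A * ln (exp 1 + \<rho> x / R)) f"
  by (rule psize_HA[of "4/3"]) auto
 obtain C2 where C2: "1 \<le> C2" "\<And>x R A f. psize 2 x R A f ==> 0 < R ==> HA (C2 * A * ln (exp 1 + \<rho> x / R)) f"
  by (rule psize_HA[of 2]) auto
 \<comment> \<open>Decay of \<open>T' a\<close> against growth of the oscillation: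
   \<open>s = 2 powr (\<tau> - \<delta>)\<close>.\<close>
 define s where "s = qd * 2 powr \<tau>"
 have s: "0 < s" "s < 1"
 proof -
  show "0 < s" unfolding s_def using qd by simp
  have "s = 2 powr (\<tau> - \<delta>)" unfolding s_def qd_def by (simp add: powr_add[symmetric])
  also have "\<dots> < 2 powr 0" using \<tau> by (intro powr_less_mono) auto
  finally show "s < 1" by simp
 qed
 define C where "C = max (C3 * (2 * D * CF) * (3 * \<kappa>)) (C2 * (2 * D) * 2)"
 have ln_w: "osc_weight \<tau> x R * ln (exp 1 + \<rho> x / R) = (1 + R / \<rho> x) powr \<tau>" if R: "0 < R" for x R
 proof -
  have "1 \<le> ln (exp 1 + \<rho> x / R)" by (rule ln_e_ge_1) (use R in simp)
  then show ?thesis unfolding osc_weight_def by simp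
 qed
 show ?thesis
 proof (rule that[of C s])
  show "0 \<le> C" unfolding C_def using C2(1) D by (simp add: le_max_iff_disj)
  show "0 < s" "s < 1" by (fact s)+
  fix x :: 'a
  {
   fix R :: real assume R: "0 < R"
   have "square_int M (\<lambda>y. indicator (B x R) y *\<^sub>R (b y - avg x R b))"
    unfolding square_int_def
   proof
    show "integrable M (\<lambda>y. (cmod (indicator (B x R) y *\<^sub>R (b y - avg x R b)))\<^sup>2)"
    proof (rule Bochner_Integration.integrable_bound)
     show "integrable M (\<lambda>y. indicator (B x R) y * cmod (b y - avg x R b) powr 4 + indicat_real (B x R) y)"
      using D1[OF R, of x] by (simp add: less_top[symmetric])
     show "AE y in M. norm ((cmod (indicator (B x R) y *\<^sub>R (b y - avg x R b)))\<^sup>2)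
      \<le> norm (indicator (B x R) y * cmod (b y - avg x R b) powr 4 + indicat_real (B x R) y)"
      using square_le_fourth[OF norm_ge_zero] by (auto simp: indicator_def)
    qed measurable
   qed measurable
   moreover have "square_int M (\<lambda>y. indicator (B x R) y *\<^sub>R avg x R b)"
   proof (rule test_square_int[OF testI])
    show "cmod (indicator (B x R) y *\<^sub>R avg x R b) \<le> cmod (avg x R b)" for y by (simp add: indicator_def)
    show "y \<notin> B x R ==> indicator (B x R) y *\<^sub>R avg x R b = 0" for y by simp
   qed measurable
   ultimately have "square_int M (\<lambda>y. indicator (B x R) y *\<^sub>R (b y - avg x R b) + indicator (B x R) y *\<^sub>R avg x R b)"
    by (rule square_int_add)
   then show "square_int M (\<lambda>y. indicator (B x R) y *\<^sub>R b y)" by (simp add: scaleR_add_right[symmetric])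
  }
  fix r a assume a: "atom_on x r a"
  have r: "0 < r" "r < \<rho> x" using a unfolding atom_on_def by auto
  define c where "c = avg x r b"
  have F: "square_int M (T' a)" by (rule T'_square_int[OF atom_on_L2(1)[OF a]])
  note [measurable] = square_int_measurable[OF F]
  {
   fix k
   define R where "R = rad r k"
   have R: "0 < R" unfolding R_def by (rule rad_pos[OF r(1)])
   define m where "m = mu x R"
   have m: "0 < m" unfolding m_def by (rule mu_pos[OF R])
   define u0 where "u0 = D * (real k + 1) * osc_weight \<tau> x R"
   have u0: "0 < u0" unfolding u0_def using D osc_weight_pos[OF R, of \<tau> x] by (intro mult_pos_pos) auto
   define f0 where "f0 = CF * qd ^ k / m"
   have f0: "0 < f0" unfolding f0_def using CF(1) qd(1) m by simp
   define G where "G y = indicator (ann x r k) y *\<^sub>R ((b y - c) * T' a y)" for y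
   have [measurable]: "G \<in> borel_measurable M" unfolding G_def by measurable
   \<comment> \<open>The factors are normalised by \<open>u0\<close> and \<open>f0\<close>, the
     bounds for the fourth power mean and the square mean, so that each summand of the majorant
     contributes at most \<open>m\<close> before the common prefactor.\<close>
   define v where "v y = (u0 * f0) powr (4/3) * ((indicator (B x R) y * cmod (b y - c) powr 4) / u0 powr 4
     + (indicator (ann x r k) y * (cmod (T' a y))\<^sup>2) / f0\<^sup>2)" for y
   have i1: "integrable M (\<lambda>y. indicator (B x R) y * cmod (b y - c) powr 4)"
    and l1: "(LINT y|M. indicator (B x R) y * cmod (b y - c) powr 4) \<le> u0 powr 4 * m"
    using D2[OF r(1), of x k] unfolding c_def R_def u0_def m_def by blast+
   have i2: "integrable M (\<lambda>y. indicator (ann x r k) y * (cmod (T' a y))\<^sup>2)"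
    and l2: "(LINT y|M. indicator (ann x r k) y * (cmod (T' a y))\<^sup>2) \<le> f0\<^sup>2 * m"
   proof -
    have "(CF * qd ^ k)\<^sup>2 / m = f0\<^sup>2 * m" unfolding f0_def using m by (simp add: power2_eq_square)
    then show "integrable M (\<lambda>y. indicator (ann x r k) y * (cmod (T' a y))\<^sup>2)"
     "(LINT y|M. indicator (ann x r k) y * (cmod (T' a y))\<^sup>2) \<le> f0\<^sup>2 * m"
     using CF(2)[OF a, of k] unfolding R_def m_def by auto
   qed
   have vi: "integrable M v" unfolding v_def by (intro integrable_mult_right Bochner_Integration.integrable_add integrable_divide i1 i2)
   have le: "cmod (G y) powr (4/3) \<le> v y" for y
   proof (cases "y \<in> ann x r k")
    case True
    then have yB: "y \<in> B x R" using ann_sub[of x r k] unfolding R_def by blast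
    define W where "W = (cmod (b y - c) / u0) * (cmod (T' a y) / f0)"
    have W: "0 \<le> W" unfolding W_def using u0 f0 by simp
    have "cmod (G y) = (u0 * f0) * W"
     unfolding G_def W_def using True u0 f0 by (simp add: norm_mult)
    then have "cmod (G y) powr (4/3) = (u0 * f0) powr (4/3) * W powr (4/3)"
     using u0 f0 W powr_mult[of "u0 * f0" W "4/3"] by simp
    also have "\<dots> \<le> (u0 * f0) powr (4/3) * ((cmod (b y - c) / u0) powr 4 + (cmod (T' a y) / f0)\<^sup>2)"
     unfolding W_def using u0 f0 by (intro mult_left_mono mixed_power_bound) auto
    also have "\<dots> = v y" unfolding v_def using True yB u0 f0 by (simp add: powr_divide power_divide)
    finally show ?thesis .
   next
    case False
    then show ?thesis unfolding G_def v_def by (simp add: indicator_def)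
   qed
   have Gi: "integrable M (\<lambda>y. cmod (G y) powr (4/3))"
    by (rule Bochner_Integration.integrable_bound[OF vi]) (use le in \<open>auto intro!: AE_I2 intro: order_trans[OF _ abs_ge_self]\<close>)
   have "(LINT y|M. cmod (G y) powr (4/3)) \<le> (LINT y|M. v y)" by (rule integral_mono[OF Gi vi le])
   also have "\<dots> = (u0 * f0) powr (4/3) * ((LINT y|M. indicator (B x R) y * cmod (b y - c) powr 4) / u0 powr 4
     + (LINT y|M. indicator (ann x r k) y * (cmod (T' a y))\<^sup>2) / f0\<^sup>2)"
    unfolding v_def integral_mult_right_zero
    by (subst Bochner_Integration.integral_add) (use i1 i2 in auto)
   also have "\<dots> \<le> (u0 * f0) powr (4/3) * ((u0 powr 4 * m) / u0 powr 4 + (f0\<^sup>2 * m) / f0\<^sup>2)"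
    by (intro mult_left_mono add_mono divide_right_mono l1 l2) auto
   also have "\<dots> = 2 * ((u0 * f0) powr (4/3) * m)" using u0 f0 by simp
   also have "\<dots> \<le> 2 powr (4/3) * ((u0 * f0) powr (4/3) * m)"
   proof (rule mult_right_mono)
    have "(2::real) powr 1 \<le> 2 powr (4/3)" by (intro powr_mono) auto
    then show "(2::real) \<le> 2 powr (4/3)" by simp
   qed (use m in simp)
   also have "\<dots> = (2 * u0 * (CF * qd ^ k)) powr (4/3) * m powr (1 - 4/3)"
   proof -
    define w where "w = u0 * (CF * qd ^ k)"
    have w: "0 \<le> w" unfolding w_def using u0 CF(1) qd(1) by simp
    have "u0 * f0 = w / m" unfolding f0_def w_def by simp
    then have "(u0 * f0) powr (4/3) * m = w powr (4/3) * (m powr 1 / m powr (4/3))"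
     using m w by (simp add: powr_divide)
    also have "\<dots> = w powr (4/3) * m powr (1 - 4/3)" by (subst powr_diff) (rule refl)
    finally have "2 powr (4/3) * ((u0 * f0) powr (4/3) * m) = (2 powr (4/3) * w powr (4/3)) * m powr (1 - 4/3)"
     by (simp only: mult.assoc)
    also have "2 powr (4/3) * w powr (4/3) = (2 * w) powr (4/3)" using w by (simp add: powr_mult)
    also have "2 * w = 2 * u0 * (CF * qd ^ k)" unfolding w_def by simp
    finally show ?thesis .
   qed
   finally have Gp: "(LINT y|M. cmod (G y) powr (4/3)) \<le> (2 * u0 * (CF * qd ^ k)) powr (4/3) * m powr (1 - 4/3)" .
   have "psize (4/3) x R (2 * u0 * (CF * qd ^ k)) G"
    unfolding psize_def
   proof (intro conjI allI impI)
    show "0 \<le> 2 * u0 * (CF * qd ^ k)" using u0 CF(1) qd(1) by simp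
    fix y assume "y \<notin> B x R"
    then have "y \<notin> ann x r k" using ann_sub[of x r k] unfolding R_def by blast
    then show "G y = 0" unfolding G_def by simp
   qed (use Gi Gp in \<open>auto simp: m_def\<close>)
   from C3(2)[OF this R] have g: "HA (C3 * (2 * u0 * (CF * qd ^ k)) * ln (exp 1 + \<rho> x / R)) G" .
   have "C3 * (2 * u0 * (CF * qd ^ k)) * ln (exp 1 + \<rho> x / R)
    = C3 * (2 * D * CF) * (real k + 1) * qd ^ k * (osc_weight \<tau> x R * ln (exp 1 + \<rho> x / R))" unfolding u0_def by simp
   also have "\<dots> = C3 * (2 * D * CF) * (real k + 1) * qd ^ k * (1 + R / \<rho> x) powr \<tau>" unfolding ln_w[OF R] ..
   also have "\<dots> \<le> C3 * (2 * D * CF) * (real k + 1) * qd ^ k * (3 * \<kappa> * (2 powr \<tau>) ^ k)"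
   proof (rule mult_left_mono)
    have "R / \<rho> x \<le> R / r" using r R by (intro divide_left_mono) auto
    also have "\<dots> = 2 ^ k * (2 * \<kappa>)" unfolding R_def rad_def using r by simp
    finally have "1 + R / \<rho> x \<le> 1 + 2 ^ k * (2 * \<kappa>)" by simp
    also have "\<dots> \<le> 3 * \<kappa> * 2 ^ k"
    proof -
     have "1 * 1 \<le> \<kappa> * 2 ^ k" using kappa_ge_1 by (intro mult_mono) auto
     then show ?thesis by simp
    qed
    finally have "(1 + R / \<rho> x) powr \<tau> \<le> (3 * \<kappa> * 2 ^ k) powr \<tau>" using \<tau> R by (intro powr_mono2) (auto intro!: add_nonneg_nonneg divide_nonneg_nonneg)
    also have "\<dots> = (3 * \<kappa>) powr \<tau> * (2 powr \<tau>) ^ k"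
    proof -
     have "((2::real) ^ k) powr \<tau> = (2 powr \<tau>) ^ k" by (simp add: powr_realpow[symmetric] powr_powr mult.commute)
     then show ?thesis using kappa_pos powr_mult[of "3 * \<kappa>" "2 ^ k" \<tau>] by simp
    qed
    also have "\<dots> \<le> (3 * \<kappa>) * (2 powr \<tau>) ^ k"
    proof (rule mult_right_mono)
     show "(3 * \<kappa>) powr \<tau> \<le> 3 * \<kappa>" using powr_mono[of \<tau> 1 "3 * \<kappa>"] \<tau> delta kappa_ge_1 by simp
    qed simp
    finally show "(1 + R / \<rho> x) powr \<tau> \<le> 3 * \<kappa> * (2 powr \<tau>) ^ k" .
   qed (use C3(1) D CF(1) qd(1) in auto)
   also have "\<dots> = (C3 * (2 * D * CF) * (3 * \<kappa>)) * (real (Suc k) * s ^ k)" unfolding s_def by (simp add: power_mult_distrib)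
   also have "\<dots> \<le> C * (real (Suc k) * s ^ k)" unfolding C_def using s by (intro mult_right_mono) auto
   finally show "HA (C * (real (Suc k) * s ^ k)) (\<lambda>y. indicator (ann x r k) y *\<^sub>R ((b y - avg x r b) * T' a y))"
    using atomic_gauge_mono[OF g] unfolding G_def[abs_def] c_def by blast
  }
  define h where "h y = (b y - c) * a y" for y
  define m where "m = mu x r"
  have m: "0 < m" unfolding m_def by (rule mu_pos[OF r(1)])
  define u0 where "u0 = D * osc_weight \<tau> x r"
  have u0: "0 < u0" unfolding u0_def using D osc_weight_pos[OF r(1), of \<tau> x] by (intro mult_pos_pos) auto
  have am[measurable]: "a \<in> borel_measurable M" and ab: "\<And>y. cmod (a y) \<le> 1 / m" and as: "\<And>y. y \<notin> B x r ==> a y = 0"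
   using a unfolding atom_on_def m_def by auto
  have [measurable]: "h \<in> borel_measurable M" unfolding h_def by measurable
  define v where "v y = (u0 / m)\<^sup>2 * (indicator (B x r) y + (indicator (B x r) y * cmod (b y - c) powr 4) / u0 powr 4)" for y
  have i1: "integrable M (\<lambda>y. indicator (B x r) y * cmod (b y - c) powr 4)"
   and l1: "(LINT y|M. indicator (B x r) y * cmod (b y - c) powr 4) \<le> u0 powr 4 * m"
   using D1[OF r(1), of x] unfolding c_def u0_def m_def by blast+
  have vi: "integrable M v" unfolding v_def using i1 by (simp add: less_top[symmetric])
  have le: "(cmod (h y))\<^sup>2 \<le> v y" for y
  proof (cases "y \<in> B x r")
   case True
   define z where "z = cmod (b y - c) / u0"
   have z0: "0 \<le> z" unfolding z_def using u0 by simp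
   have "cmod (h y) \<le> cmod (b y - c) * (1 / m)" unfolding h_def norm_mult using ab by (intro mult_left_mono) auto
   also have "\<dots> = (u0 / m) * z" unfolding z_def using u0 by simp
   finally have "(cmod (h y))\<^sup>2 \<le> ((u0 / m) * z)\<^sup>2" by (intro power_mono) auto
   also have "\<dots> = (u0 / m)\<^sup>2 * z\<^sup>2" by (rule power_mult_distrib)
   also have "\<dots> \<le> (u0 / m)\<^sup>2 * (1 + z powr 4)"
   using square_le_fourth[OF z0] by (intro mult_left_mono) auto
   also have "\<dots> = v y" unfolding v_def z_def using True u0 by (simp add: powr_divide)
   finally show ?thesis .
  next
   case False
   then show ?thesis using as unfolding h_def v_def by simp
  qed
  have hi: "integrable M (\<lambda>y. (cmod (h y))\<^sup>2)"
   by (rule Bochner_Integration.integrable_bound[OF vi]) (use le in \<open>auto intro!: AE_I2 intro: order_trans[OF _ abs_ge_self]\<close>)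
  then have hs: "square_int M h" unfolding square_int_def by simp
  have "(LINT y|M. (cmod (h y))\<^sup>2) \<le> (LINT y|M. v y)" by (rule integral_mono[OF hi vi le])
  also have "\<dots> = (u0 / m)\<^sup>2 * (m + (LINT y|M. indicator (B x r) y * cmod (b y - c) powr 4) / u0 powr 4)"
   unfolding v_def integral_mult_right_zero m_def
   by (subst Bochner_Integration.integral_add) (use i1 in \<open>auto simp: less_top[symmetric]\<close>)
  also have "\<dots> \<le> (u0 / m)\<^sup>2 * (m + (u0 powr 4 * m) / u0 powr 4)"
   by (intro mult_left_mono add_left_mono divide_right_mono l1) auto
  also have "\<dots> = 2 * u0\<^sup>2 / m" using u0 m by (simp add: power_divide power2_eq_square)
  also have "\<dots> \<le> (2 * u0)\<^sup>2 / m" using m by (intro divide_right_mono) (auto simp: power_mult_distrib)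
  finally have hp: "(LINT y|M. (cmod (h y))\<^sup>2) \<le> (2 * u0)\<^sup>2 / m" .
  have "psize 2 x r (2 * u0) h"
   unfolding psize_def
  proof (intro conjI allI impI)
   have e: "cmod (h y) powr 2 = (cmod (h y))\<^sup>2" for y by (simp add: powr_numeral)
   show "integrable M (\<lambda>y. cmod (h y) powr 2)" unfolding e by (rule hi)
   have "(2 * u0) powr 2 * mu x r powr (1 - 2) = (2 * u0)\<^sup>2 / m" using u0 m unfolding m_def by (simp add: powr_numeral powr_minus_divide)
   then show "(LINT y|M. cmod (h y) powr 2) \<le> (2 * u0) powr 2 * mu x r powr (1 - 2)" unfolding e using hp by linarith
   show "h y = 0" if "y \<notin> B x r" for y using as[OF that] unfolding h_def by simp
  qed (use u0 in auto)
  from C2(2)[OF this r(1)] have g: "HA (C2 * (2 * u0) * ln (exp 1 + \<rho> x / r)) h" .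
  have "C2 * (2 * u0) * ln (exp 1 + \<rho> x / r) = C2 * (2 * D) * (osc_weight \<tau> x r * ln (exp 1 + \<rho> x / r))" unfolding u0_def by simp
  also have "\<dots> = C2 * (2 * D) * (1 + r / \<rho> x) powr \<tau>" unfolding ln_w[OF r(1)] ..
  also have "\<dots> \<le> C2 * (2 * D) * 2"
  proof (rule mult_left_mono)
   have "r / \<rho> x \<le> 1" using r by simp
   then have "(1 + r / \<rho> x) powr \<tau> \<le> 2 powr \<tau>" using r \<tau> by (intro powr_mono2) (auto intro!: add_nonneg_nonneg)
   also have "\<dots> \<le> 2 powr 1" using \<tau> delta by (intro powr_mono) auto
   finally show "(1 + r / \<rho> x) powr \<tau> \<le> 2" by simp
  qed (use C2(1) D in auto)
  also have "\<dots> \<le> C" unfolding C_def by simp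
  finally have "HA C h" by (rule atomic_gauge_mono[OF g])
  then show "square_int M (\<lambda>y. (b y - avg x r b) * a y) \<and> HA C (\<lambda>y. (b y - avg x r b) * a y)"
   using hs unfolding h_def[abs_def] c_def by blast
 qed
qed

lemma b_ball_square_int: "0 < R ==> square_int M (\<lambda>y. indicator (B x R) y *\<^sub>R b y)"
 by (rule commutator_annuli) blast

lemma b_test_square_int:
 assumes f: "f \<in> tests" shows "square_int M (\<lambda>y. b y * f y)"
proof -
 obtain K x r where fm[measurable]: "f \<in> borel_measurable M" and K: "0 < K" "\<And>y. cmod (f y) \<le> K" and r: "0 < r"
  and ae: "AE y in M. y \<notin> B x r \<longrightarrow> f y = 0" by (rule testE[OF f]) blast
 show ?thesis
 proof (rule square_int_bound[OF square_int_scale[OF b_ball_square_int[OF r, of x], of "of_real K"]])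
  show "AE y in M. cmod (b y * f y) \<le> cmod (of_real K * (indicator (B x r) y *\<^sub>R b y))"
   using ae
  proof eventually_elim
   case (elim y)
   have "cmod (b y) * cmod (f y) \<le> cmod (b y) * K" using K(2) by (rule mult_left_mono) simp
   then show ?case using elim K(1) by (cases "y \<in> B x r") (simp_all add: norm_mult mult.commute)
  qed
 qed measurable
qed

lemma b_times_L1_loc:
 assumes f: "square_int M f" shows "(\<lambda>y. b y * f y) \<in> L1_loc d M"
proof (rule L1_locI)
 fix x r assume r: "(0::real) < r"
 show "integrable M (\<lambda>y. indicator (B x r) y *\<^sub>R (b y * f y))"
  using Cauchy_Schwarz_integral(1)[OF b_ball_square_int[OF r, of x] f] by simp
qed

lemma commutator_measurable:
 assumes f: "f \<in> tests" shows "commutator b T' f \<in> borel_measurable M"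
proof -
 note [measurable] = square_int_measurable[OF T'_square_int[OF test_square_int[OF f]]]
  square_int_measurable[OF T'_square_int[OF b_test_square_int[OF f]]]
 show ?thesis unfolding commutator_def by measurable
qed

lemma commutator_L1_loc:
 assumes f: "f \<in> tests" shows "commutator b T' f \<in> L1_loc d M"
 using L1_loc_add[OF b_times_L1_loc[OF T'_square_int[OF test_square_int[OF f]]]
   L1_loc_scale[OF square_int_L1_loc[OF T'_square_int[OF b_test_square_int[OF f]]], of "-1"]]
 unfolding commutator_def by simp

text \<open>Subtracting the average of \<open>b\<close> leaves the commutator unchanged. The first
  term is summed over the annuli with costs \<open>(k + 1) * s ^ k\<close>; the second needs
  \<open>T'\<close> on a square integrable function of the Hardy space.\<close>

lemma commutator_atoms_HA:
 obtains C where "0 \<le> C" "\<And>a. a \<in> rho_atoms ==> HA C (commutator b T' a)"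
proof -
 obtain CT where CT: "0 \<le> CT" "\<And>a. a \<in> rho_atoms ==> HA CT (T' a)" by (rule adjoint_atoms_HA) blast
 obtain C s where C: "0 \<le> C" and s: "0 < s" "s < 1"
  and g: "\<And>x r a k. atom_on x r a ==>
    HA (C * (real (Suc k) * s ^ k)) (\<lambda>y. indicator (ann x r k) y *\<^sub>R ((b y - avg x r b) * T' a y))"
  and h: "\<And>x r a. atom_on x r a ==> square_int M (\<lambda>y. (b y - avg x r b) * a y) \<and> HA C (\<lambda>y. (b y - avg x r b) * a y)"
  by (rule commutator_annuli) blast
 have sm: "(\<lambda>k. C * (real (Suc k) * s ^ k)) sums (C * (1 / (1 - s)\<^sup>2))"
  by (rule sums_mult[OF geometric_deriv_sums]) (use s in simp)
 show ?thesis
 proof (rule that[of "C * (1 / (1 - s)\<^sup>2) + CT * C"])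
  show "0 \<le> C * (1 / (1 - s)\<^sup>2) + CT * C" using C CT(1) by simp
  fix a assume ar: "a \<in> rho_atoms"
  then obtain x r where a: "atom_on x r a" using rho_atoms_atom_on by blast
  have r: "0 < r" using a unfolding atom_on_def by blast
  define c where "c = avg x r b"
  have F: "square_int M (T' a)" by (rule T'_square_int[OF atom_on_L2(1)[OF a]])
  note [measurable] = square_int_measurable[OF F]
  have 1: "HA (C * (1 / (1 - s)\<^sup>2)) (\<lambda>y. (b y - c) * T' a y)"
  proof (rule atomic_gauge_suminf[OF L1_rho_atoms g[OF a]])
   show "AE y in M. (\<lambda>k. indicator (ann x r k) y *\<^sub>R ((b y - avg x r b) * T' a y)) sums ((b y - c) * T' a y)"
    unfolding c_def by (intro AE_I2 ann_sums r)
  qed (use sm in \<open>auto simp: sums_iff\<close>)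
  define h' where "h' y = (b y - c) * a y" for y
  have hs: "square_int M h'" and hH: "HA C h'" using h[OF a] unfolding h'_def[abs_def] c_def by auto
  have 2: "HA (CT * C) (T' h')" by (rule adjoint_HA_L2[OF CT hs hH])
  have "AE y in M. T' (\<lambda>y. h' y + c * a y) y = T' h' y + c * T' a y"
   using T'_bounded hs atom_on_L2(1)[OF a] unfolding bounded_op_def Lq_2 by blast
  moreover have "(\<lambda>y. h' y + c * a y) = (\<lambda>y. b y * a y)" unfolding h'_def by (simp add: algebra_simps)
  ultimately have "AE y in M. T' (\<lambda>y. b y * a y) y = T' h' y + c * T' a y" by simp
  then have "AE y in M. (b y - c) * T' a y - T' h' y = commutator b T' a y"
   by eventually_elim (simp add: commutator_def algebra_simps)
  then show "HA (C * (1 / (1 - s)\<^sup>2) + CT * C) (commutator b T' a)"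
   by (rule atomic_gauge_AE_cong[OF atomic_gauge_diff[OF L1_rho_atoms 1 2] commutator_measurable[OF rho_atom_test[OF ar]]])
 qed
qed

text \<open>Minus the commutator of \<open>b\<close> with \<open>T\<close> on test functions. It is
  the transpose of the commutator with \<open>T'\<close>, and plays the part of \<open>Q\<close> in
  \<open>extension\<close>.\<close>

definition transposed :: "('a => complex) => 'a => complex" where
 "transposed g = (\<lambda>x. T (\<lambda>y. b y * g y) x - b x * T g x)"

lemma transposed_L1_loc:
 assumes g: "g \<in> tests" shows "transposed g \<in> L1_loc d M"
 using L1_loc_add[OF square_int_L1_loc[OF T_square_int[OF b_test_square_int[OF g]]]
   L1_loc_scale[OF b_times_L1_loc[OF T_square_int[OF test_square_int[OF g]]], of "-1"]]
 unfolding transposed_def by simp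

lemma transposed_dual:
 assumes f: "f \<in> tests" and g: "g \<in> tests"
 shows "(LINT y|M. transposed g y * f y) = (LINT y|M. commutator b T' f y * g y)"
proof -
 note f2 = test_square_int[OF f] and g2 = test_square_int[OF g]
 note bf = b_test_square_int[OF f] and bg = b_test_square_int[OF g]
 have "(LINT y|M. transposed g y * f y) = (LINT y|M. T (\<lambda>y. b y * g y) y * f y - T g y * (b y * f y))"
  unfolding transposed_def by (simp add: algebra_simps)
 also have "\<dots> = (LINT y|M. T (\<lambda>y. b y * g y) y * f y) - (LINT y|M. T g y * (b y * f y))"
  by (rule Bochner_Integration.integral_diff[OF Cauchy_Schwarz_integral(1)[OF T_square_int[OF bg] f2] Cauchy_Schwarz_integral(1)[OF T_square_int[OF g2] bf]])
 also have "\<dots> = (LINT y|M. (b y * g y) * T' f y) - (LINT y|M. g y * T' (\<lambda>y. b y * f y) y)"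
  using T'_adjoint[OF bg f2] T'_adjoint[OF g2 bf] by simp
 also have "\<dots> = (LINT y|M. (b y * g y) * T' f y - g y * T' (\<lambda>y. b y * f y) y)"
  by (rule Bochner_Integration.integral_diff[symmetric, OF Cauchy_Schwarz_integral(1)[OF bg T'_square_int[OF f2]] Cauchy_Schwarz_integral(1)[OF g2 T'_square_int[OF bf]]])
 also have "\<dots> = (LINT y|M. commutator b T' f y * g y)"
  unfolding commutator_def by (simp add: algebra_simps)
 finally show ?thesis .
qed

text \<open>Linearity and agreement with the explicit formula both follow by testing, because
  integrals of \<open>S h\<close> against test functions are pairings, linear in \<open>h\<close>
  and equal to ordinary integrals when \<open>h\<close> is a test function.\<close>

lemma commutator_extension:
 obtains C S where "0 \<le> C" "\<And>A h. HA A h ==> HA (C * A) (S h)"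
  "\<And>A A' h g c. HA A h ==> HA A' g ==> AE x in M. S (\<lambda>y. h y + c * g y) x = S h x + c * S g x"
  "\<And>f. f \<in> tests ==> AE x in M. S f x = commutator b T' f x"
proof -
 obtain C where C: "0 \<le> C" "\<And>a. a \<in> rho_atoms ==> HA C (commutator b T' a)" by (rule commutator_atoms_HA) blast
 have bm: "\<exists>N. bmo N (transposed g)" if "g \<in> tests" for g
  by (rule extension(1)[of C "commutator b T'" transposed])
   (use C transposed_L1_loc transposed_dual rho_atom_test that in auto)
 have "\<exists>S. (\<forall>A h. HA A h \<longrightarrow> HA (C * A) (S h) \<and> (\<forall>g\<in>tests. (LINT y|M. S h y * g y) = Lp (transposed g) h))"
  by (rule extension(2)[of C "commutator b T'" transposed])
   (use C transposed_L1_loc transposed_dual rho_atom_test in auto)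
 then obtain S where S: "\<And>A h. HA A h ==> HA (C * A) (S h)"
  and Sg: "\<And>A h g. HA A h ==> g \<in> tests ==> (LINT y|M. S h y * g y) = Lp (transposed g) h" by blast
 show ?thesis
 proof (rule that[OF C(1) S])
  fix A A' h g c assume h: "HA A h" and g: "HA A' g"
  have hg: "HA (A + cmod c * A') (\<lambda>y. h y + c * g y)"
   by (rule atomic_gauge_add[OF L1_rho_atoms h atomic_gauge_scale[OF g]])
  have SL: "S h \<in> L1_loc d M" "S g \<in> L1_loc d M" using HA_L1_loc[OF S[OF h]] HA_L1_loc[OF S[OF g]] by auto
  show "AE x in M. S (\<lambda>y. h y + c * g y) x = S h x + c * S g x"
  proof (rule test_unique[OF HA_L1_loc[OF S[OF hg]] L1_loc_add[OF SL(1) L1_loc_scale[OF SL(2)]]])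
   fix k assume k: "k \<in> tests"
   obtain N where N: "bmo N (transposed k)" using bm[OF k] by blast
   have "(LINT y|M. (S h y + c * S g y) * k y) = (LINT y|M. S h y * k y + c * (S g y * k y))" by (simp add: algebra_simps)
   also have "\<dots> = (LINT y|M. S h y * k y) + c * (LINT y|M. S g y * k y)"
    using L1_loc_test[OF SL(1) k] L1_loc_test[OF SL(2) k] by simp
   finally show "(LINT y|M. S (\<lambda>y. h y + c * g y) y * k y) = (LINT y|M. (S h y + c * S g y) * k y)"
    using Sg[OF hg k] Sg[OF h k] Sg[OF g k] Lp_add[OF N h g, of c] by simp
  qed
 next
  fix f assume f: "f \<in> tests"
  obtain A where A: "HA A f" using test_HA[OF f] by blast
  show "AE x in M. S f x = commutator b T' f x"
  proof (rule test_unique[OF HA_L1_loc[OF S[OF A]] commutator_L1_loc[OF f]])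
   fix g assume g: "g \<in> tests"
   obtain N where N: "bmo N (transposed g)" using bm[OF g] by blast
   show "(LINT y|M. S f y * g y) = (LINT y|M. commutator b T' f y * g y)"
    using Sg[OF A g] Lp_integral[OF N A L1_loc_test[OF transposed_L1_loc[OF g] f]] transposed_dual[OF f g] by simp
  qed
 qed
qed

text \<open>For fixed \<open>f\<close> the functional sending \<open>h\<close> to
  \<open>- Lp f (S h)\<close> is bounded on the Hardy space, and \<open>U f\<close> is chosen to
  represent it.\<close>

lemma commutator_bounded_on_BMO_rho:
 assumes q: "1 < q"
 shows "\<exists>U. BMO_rho_commutator d M \<rho> q b T U \<and> bounded_op M (BMO_rho d M \<rho>) (BMO_rho_norm d M \<rho>) U"
proof -
 obtain C S where C: "0 \<le> C" and S: "\<And>A h. HA A h ==> HA (C * A) (S h)"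
  and Slin: "\<And>A A' h g c. HA A h ==> HA A' g ==> AE x in M. S (\<lambda>y. h y + c * g y) x = S h x + c * S g x"
  and Stest: "\<And>f. f \<in> tests ==> AE x in M. S f x = commutator b T' f x"
  by (rule commutator_extension) blast
 obtain Cq where Cq: "1 \<le> Cq" "\<And>f c a. atomic_decomposition d M \<rho> q f c a ==> HA (Cq * (\<Sum>j. cmod (c j))) f"
  by (rule H1_HA[OF q]) blast
 have H1: "\<exists>A. HA A f" if "f \<in> H1 d M \<rho> q" for f using that Cq(2) unfolding H1_def by blast
 have HS: "H1_commutator d M \<rho> q b T' S"
  unfolding H1_commutator_def bounded_op_def
 proof (intro conjI ballI allI)
  show "S f \<in> H1 d M \<rho> q" if f: "f \<in> H1 d M \<rho> q" for f
   using H1[OF f] S HA_H1(1)[OF q] by blast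
  show "AE x in M. S (\<lambda>y. f y + c * g y) x = S f x + c * S g x" if f: "f \<in> H1 d M \<rho> q" and g: "g \<in> H1 d M \<rho> q" for f g c
   using H1[OF f] H1[OF g] Slin by blast
  show "AE x in M. S f x = commutator b T' f x" if "f \<in> tests" for f by (rule Stest[OF that])
  \<comment> \<open>The added 1 makes \<open>K\<close> positive, so that the estimate can be divided
    by \<open>K\<close> and compared with each decomposition under the infimum.\<close>
  define K where "K = (C + 1) * Cq"
  have K: "0 < K" unfolding K_def using C Cq(1) by simp
  have "H1_norm d M \<rho> q (S f) \<le> ennreal K * H1_norm d M \<rho> q f" for f
  proof -
   have "H1_norm d M \<rho> q (S f) / ennreal K \<le> H1_norm d M \<rho> q f"
    unfolding H1_norm_def[of d M \<rho> q f]
   proof (intro INF_greatest, clarify)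
    fix c a assume D: "atomic_decomposition d M \<rho> q f c a"
    have s0: "0 \<le> (\<Sum>j. cmod (c j))" using D unfolding atomic_decomposition_def by (intro suminf_nonneg) auto
    have "HA (C * (Cq * (\<Sum>j. cmod (c j)))) (S f)" by (rule S[OF Cq(2)[OF D]])
    then have "HA (K * (\<Sum>j. cmod (c j))) (S f)"
     by (rule atomic_gauge_mono) (use Cq(1) s0 in \<open>simp add: K_def algebra_simps\<close>)
    from HA_H1(2)[OF q this] have "H1_norm d M \<rho> q (S f) \<le> ennreal K * ennreal (\<Sum>j. cmod (c j))"
     using K s0 by (simp add: ennreal_mult)
    then show "H1_norm d M \<rho> q (S f) / ennreal K \<le> ennreal (\<Sum>j. cmod (c j))"
     using K by (intro divide_le_posI_ennreal) auto
   qed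
   then have "ennreal K * (H1_norm d M \<rho> q (S f) / ennreal K) \<le> ennreal K * H1_norm d M \<rho> q f" by (rule mult_left_mono) simp
   moreover have "ennreal K * (H1_norm d M \<rho> q (S f) / ennreal K) = H1_norm d M \<rho> q (S f)"
    using K by (simp add: ennreal_times_divide mult.commute[of "ennreal K"] mult_divide_eq_ennreal)
   ultimately show ?thesis by simp
  qed
  then show "\<exists>C\<ge>0. \<forall>f\<in>H1 d M \<rho> q. H1_norm d M \<rho> q (S f) \<le> ennreal C * H1_norm d M \<rho> q f"
   using K by (intro exI[of _ K]) auto
 qed
 obtain Cd' where Cd': "0 \<le> Cd'"
  and dual: "\<And>l D. 0 \<le> D ==> (\<And>h g A A' c. HA A h ==> HA A' g ==> l (\<lambda>x. h x + c * g x) = l h + c * l g) ==>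
    (\<And>h A. HA A h ==> cmod (l h) \<le> D * A) ==> \<exists>u. bmo (Cd' * D) u \<and> (\<forall>h A. HA A h \<longrightarrow> Lp u h = l h)"
  by (rule bmo_dual) blast
 define E where "E = Cd' * (2 * dbl 4 * C)"
 have E: "0 \<le> E" unfolding E_def using Cd' C dbl_pos[of 4] by simp
 define N where "N f = enn2real (BMO_rho_norm d M \<rho> f)" for f
 have Nf: "bmo (N f) f" if "f \<in> BMO_rho d M \<rho>" for f using BMO_rho_bmo[OF that] unfolding N_def .
 \<comment> \<open>The bound is part of the relation, so every choice of representative respects
   it.\<close>
 define R where "R f u \<longleftrightarrow> bmo (E * N f) u \<and> (\<forall>h A. HA A h \<longrightarrow> Lp u h = - Lp f (S h))" for f u
 have ex: "\<exists>u. R f u" if f: "f \<in> BMO_rho d M \<rho>" for f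
 proof -
  note bf = Nf[OF f]
  have fm: "f \<in> borel_measurable M" using bf L1_loc_measurable unfolding bmo_def by blast
  have N0: "0 \<le> N f" unfolding N_def by simp
  have "\<exists>u. bmo (Cd' * (2 * dbl 4 * N f * C)) u \<and> (\<forall>h A. HA A h \<longrightarrow> Lp u h = - Lp f (S h))"
  proof (rule dual)
   show "0 \<le> 2 * dbl 4 * N f * C" using N0 C dbl_pos[of 4] by simp
   fix h g A A' c assume h: "HA A h" and g: "HA A' g"
   have hg: "HA (A + cmod c * A') (\<lambda>y. h y + c * g y)"
    by (rule atomic_gauge_add[OF L1_rho_atoms h atomic_gauge_scale[OF g]])
   have "Lp f (S (\<lambda>y. h y + c * g y)) = Lp f (\<lambda>x. S h x + c * S g x)"
    by (rule Lp_AE_cong[OF fm atomic_gauge_measurable[OF S[OF hg]] _ Slin[OF h g]])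
     (use atomic_gauge_measurable[OF S[OF h]] atomic_gauge_measurable[OF S[OF g]] in measurable)
   also have "\<dots> = Lp f (S h) + c * Lp f (S g)" by (rule Lp_add[OF bf S[OF h] S[OF g]])
   finally show "- Lp f (S (\<lambda>y. h y + c * g y)) = - Lp f (S h) + c * - Lp f (S g)" by simp
  next
   fix h A assume h: "HA A h"
   show "cmod (- Lp f (S h)) \<le> 2 * dbl 4 * N f * C * A"
    using Lp_HA(2)[OF bf S[OF h]] by (simp add: mult.assoc)
  qed
  then show ?thesis unfolding R_def E_def by (simp add: ac_simps)
 qed
 define U where "U f = (SOME u. R f u)" for f
 have RU: "R f (U f)" if "f \<in> BMO_rho d M \<rho>" for f unfolding U_def by (rule someI_ex[OF ex[OF that]])
 have Ub: "bmo (E * N f) (U f)" if "f \<in> BMO_rho d M \<rho>" for f using RU[OF that] unfolding R_def by blast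
 have UL: "Lp (U f) h = - Lp f (S h)" if "f \<in> BMO_rho d M \<rho>" "HA A h" for f h A using RU[OF that(1)] that(2) unfolding R_def by blast
 have "BMO_rho_commutator d M \<rho> q b T U"
  unfolding BMO_rho_commutator_def
 proof (intro exI[of _ S] conjI HS ballI)
  fix f assume f: "f \<in> BMO_rho d M \<rho>"
  show "U f \<in> BMO_rho d M \<rho>" by (rule bmo_BMO_rho(1)[OF Ub[OF f]])
  fix h assume h: "h \<in> H1 d M \<rho> q"
  obtain A where A: "HA A h" using H1[OF h] by blast
  show "pairing d M \<rho> q (U f) h = - pairing d M \<rho> q f (S h)"
   using pairing_eq_Lp[OF q Ub[OF f] h] pairing_eq_Lp[OF q Nf[OF f] HA_H1(1)[OF q S[OF A]]] UL[OF f A] by simp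
 qed
 moreover have "bounded_op M (BMO_rho d M \<rho>) (BMO_rho_norm d M \<rho>) U"
  unfolding bounded_op_def
 proof (intro conjI ballI allI)
  show "U f \<in> BMO_rho d M \<rho>" if "f \<in> BMO_rho d M \<rho>" for f by (rule bmo_BMO_rho(1)[OF Ub[OF that]])
  show "\<exists>C\<ge>0. \<forall>f\<in>BMO_rho d M \<rho>. BMO_rho_norm d M \<rho> (U f) \<le> ennreal C * BMO_rho_norm d M \<rho> f"
  proof (intro exI[of _ "2 * E"] conjI ballI)
   show "0 \<le> 2 * E" using E by simp
   fix f assume f: "f \<in> BMO_rho d M \<rho>"
   have "BMO_rho_norm d M \<rho> f < \<infinity>" using f unfolding BMO_rho_def by blast
   then have e: "BMO_rho_norm d M \<rho> f = ennreal (N f)" unfolding N_def by simp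
   have "BMO_rho_norm d M \<rho> (U f) \<le> ennreal (2 * (E * N f))" by (rule bmo_BMO_rho(2)[OF Ub[OF f]])
   also have "\<dots> = ennreal (2 * E) * BMO_rho_norm d M \<rho> f" unfolding e using E by (simp add: ennreal_mult[symmetric] N_def mult.assoc)
   finally show "BMO_rho_norm d M \<rho> (U f) \<le> ennreal (2 * E) * BMO_rho_norm d M \<rho> f" .
  qed
  fix f g c assume f: "f \<in> BMO_rho d M \<rho>" and g: "g \<in> BMO_rho d M \<rho>"
  obtain Ca where Ca: "\<And>f g c N N'. bmo N f ==> bmo N' g ==> bmo (Ca * (N + cmod c * N')) (\<lambda>x. f x + c * g x)"
   by (rule bmo_add) blast
  have fg: "(\<lambda>x. f x + c * g x) \<in> BMO_rho d M \<rho>" by (rule bmo_BMO_rho(1)[OF Ca[OF Nf[OF f] Nf[OF g]]])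
  have L: "U f \<in> L1_loc d M" "U g \<in> L1_loc d M" "U (\<lambda>x. f x + c * g x) \<in> L1_loc d M"
   using Ub[OF f] Ub[OF g] Ub[OF fg] unfolding bmo_def by auto
  \<comment> \<open>The representatives are chosen separately for each function, so additivity is
    recovered almost everywhere by testing: on test functions the pairing is an ordinary
    integral.\<close>
  show "AE x in M. U (\<lambda>y. f y + c * g y) x = U f x + c * U g x"
  proof (rule test_unique[OF L(3) L1_loc_add[OF L(1) L1_loc_scale[OF L(2)]]])
   fix k assume k: "k \<in> tests"
   obtain A where A: "HA A k" using test_HA[OF k] by blast
   have sum_b: "bmo (Ca * (E * N f + cmod c * (E * N g))) (\<lambda>x. U f x + c * U g x)" by (rule Ca[OF Ub[OF f] Ub[OF g]])
   have "(LINT y|M. U (\<lambda>y. f y + c * g y) y * k y) = Lp (U (\<lambda>y. f y + c * g y)) k"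
    by (rule Lp_integral[symmetric, OF Ub[OF fg] A L1_loc_test[OF L(3) k]])
   also have "\<dots> = - Lp (\<lambda>y. f y + c * g y) (S k)" by (rule UL[OF fg A])
   also have "\<dots> = - (Lp f (S k) + c * Lp g (S k))" unfolding Lp_add_left[OF Nf[OF f] Nf[OF g] S[OF A]] ..
   also have "\<dots> = Lp (U f) k + c * Lp (U g) k" using UL[OF f A] UL[OF g A] by simp
   also have "\<dots> = Lp (\<lambda>x. U f x + c * U g x) k" by (rule Lp_add_left[symmetric, OF Ub[OF f] Ub[OF g] A])
   also have "\<dots> = (LINT y|M. (U f y + c * U g y) * k y)"
    by (rule Lp_integral[OF sum_b A L1_loc_test[OF L1_loc_add[OF L(1) L1_loc_scale[OF L(2)]] k]])
   finally show "(LINT y|M. U (\<lambda>y. f y + c * g y) y * k y) = (LINT y|M. (U f y + c * U g y) * k y)" .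
  qed
 qed
 ultimately show ?thesis by blast
qed

end

theorem corollary1p3:
  fixes d :: "'a \<Rightarrow> 'a \<Rightarrow> real" and \<kappa> :: real and M :: "'a measure"
    and \<rho> :: "'a \<Rightarrow> real" and q :: ennreal and \<delta> \<theta> :: real
    and b T1 :: "'a \<Rightarrow> complex" and T :: "('a \<Rightarrow> complex) \<Rightarrow> ('a \<Rightarrow> complex)"
  assumes "homogeneous_type d \<kappa> M"
    and "admissible d \<rho>"
    and "1 < q"
    and "0 < \<delta>" and "\<delta> \<le> 1"
    and "0 \<le> \<theta>" and "\<theta> < \<delta> / (adm_index d \<rho> + 1)"
    and "b \<in> BMO_log d M \<rho> \<theta>"
    and "CZ_operator d \<kappa> M \<rho> \<delta> T"
    and "represents_T1 d M \<rho> T T1"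
    and "T1 \<in> BMO_log d M \<rho> 0"
  shows "\<exists>U. BMO_rho_commutator d M \<rho> q b T U \<and>
             bounded_op M (BMO_rho d M \<rho>) (BMO_rho_norm d M \<rho>) U"
proof -
 interpret homogeneous_type d \<kappa> M by (rule assms)
 interpret commutator_space d \<kappa> M \<rho> \<delta> T \<theta> b T1
  by unfold_locales (use assms in auto)
 show ?thesis by (rule commutator_bounded_on_BMO_rho[OF assms(3)])
qed

end
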